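(* Let $\mathcal{F}$ be a weakly idempotent complete Frobenius category with the category $\mathcal{P}$ of projective-injective objects. Then we have a decomposition \[\mathsf{K}^{-,\mathrm{b}}(\mathcal{P})=\mathsf{K}^{>0}(\mathcal{P})\perp\mathcal{F}\perp\mathsf{K}^{<0}(\mathcal{P}).\] Moreover the composition $\mathcal{F}\subset\mathsf{K}^{-,\mathrm{b}}(\mathcal{P})\to\mathsf{K}^{-,\mathrm{b}}(\mathcal{P})/\mathsf{K}^{\mathrm{b}}(\mathcal{P})$ induces a triangle equivalence \[\underline{\mathcal{F}}\xrightarrow{\simeq}\mathsf{K}^{-,\mathrm{b}}(\mathcal{P})/\mathsf{K}^{\mathrm{b}}(\mathcal{P}).\]
   Context: For full subcategories $\mathcal{X},\mathcal{Y}$ of a triangulated category $\mathcal{T}$, $\mathcal{X}*\mathcal{Y}$ is the full subcategory of objects $T\in\mathcal{T}$ for which there is a triangle $X\to T\to Y\to X[1]$ with $X\in\mathcal{X}$, $Y\in\mathcal{Y}$. When $\mathrm{Hom}_{\mathcal{T}}(\mathcal{X},\mathcal{Y})=0$, one writes $\mathcal{X}\perp\mathcal{Y}$ for $\mathcal{X}*\mathcal{Y}$; $\mathcal{X}_1\perp\cdots\perp\mathcal{X}_n$ is defined inductively. $\underline{\mathcal{F}}=\mathcal{F}/[\mathcal{P}]$ is the stable category (quotient by the ideal of morphisms factoring through objects of $\mathcal{P}$), with Happel's triangulated structure. $\mathsf{K}(\mathcal{P})$ is the homotopy category of (cochain) complexes over $\mathcal{P}$ and $\mathsf{K}^{\mathrm{b}}(\mathcal{P})$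 its full subcategory of bounded complexes. $\mathsf{K}^{-,\mathrm{b}}(\mathcal{P})$ is the full subcategory of $\mathsf{K}(\mathcal{P})$ consisting of complexes $X=(X^i,d^i:X^i\to X^{i+1})$ satisfying: (a) there exists $n_X\in\mathbb{Z}$ such that $X^i=0$ for each $i>n_X$; (b) there exist $m_X\in\mathbb{Z}$ and a conflation $0\to Y^{i-1}\xrightarrow{a^{i-1}}X^i\xrightarrow{b^i}Y^i\to0$ in $\mathcal{F}$ for each $i\le m_X$ such that $d^i=a^ib^i$ for each $i<m_X$. The category $\mathcal{F}$ is equivalent to, and is identified with, the full subcategory of $\mathsf{K}^{-,\mathrm{b}}(\mathcal{P})$ consisting of complexes isomorphic in $\mathsf{K}(\mathcal{P})$ to some $X$ satisfying (a), (b) with $n_X\le0\le m_X$ (an object of $\mathcal{F}$ corresponds to its projective resolution placed in degrees $\le0$). $\mathsf{K}^{>0}(\mathcal{P})$ (respectively, $\mathsf{K}^{<0}(\mathcal{P})$) is the full subcategory of $\mathsf{K}^{\mathrm{b}}(\mathcal{P})$ consisting of complexes $X$ with $X^i=0$ for $i\le0$ (respectively, $i\ge0$); subcategories are taken up to isomorphism in the homotopy category. *)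

theory Defs
  imports Main
begin

section \<open>Additive categories\<close>

text \<open>
  A category is given by its set of objects and its set of arrows; the fields are only meaningful
  on objects, on arrows, and on composable (for \<open>Cmp\<close>) or parallel (for \<open>Add\<close>) pairs of arrows.
\<close>

record ('o, 'm) addcat =
  Ob :: "'o set"
  Arr :: "'m set"
  Dom :: "'m \<Rightarrow> 'o"
  Cod :: "'m \<Rightarrow> 'o"
  Ident :: "'o \<Rightarrow> 'm"
  Cmp :: "'m \<Rightarrow> 'm \<Rightarrow> 'm"  (infixl "\<cdot>\<index>" 70)
  Add :: "'m \<Rightarrow> 'm \<Rightarrow> 'm"  (infixl "\<oplus>\<index>" 65)
  Zero :: "'o \<Rightarrow> 'o \<Rightarrow> 'm"

definition hom :: "('o, 'm, 'x) addcat_scheme \<Rightarrow> 'o \<Rightarrow> 'o \<Rightarrow> 'm set" where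
  "hom C X Y = {f \<in> Arr C. Dom C f = X \<and> Cod C f = Y}"

locale category =
  fixes C :: "('o, 'm, 'x) addcat_scheme" (structure)
  assumes Dom_in_Ob: "f \<in> Arr C \<Longrightarrow> Dom C f \<in> Ob C"
    and Cod_in_Ob: "f \<in> Arr C \<Longrightarrow> Cod C f \<in> Ob C"
    and Ident_in_hom: "X \<in> Ob C \<Longrightarrow> Ident C X \<in> hom C X X"
    and Cmp_in_hom: "f \<in> hom C X Y \<Longrightarrow> g \<in> hom C Y Z \<Longrightarrow> g \<cdot> f \<in> hom C X Z"
    and Cmp_assoc: "f \<in> hom C W X \<Longrightarrow> g \<in> hom C X Y \<Longrightarrow> h \<in> hom C Y Z
      \<Longrightarrow> (h \<cdot> g) \<cdot> f = h \<cdot> (g \<cdot> f)"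
    and Cmp_Ident_left: "f \<in> hom C X Y \<Longrightarrow> Ident C Y \<cdot> f = f"
    and Cmp_Ident_right: "f \<in> hom C X Y \<Longrightarrow> f \<cdot> Ident C X = f"

definition zero_object :: "('o, 'm, 'x) addcat_scheme \<Rightarrow> 'o \<Rightarrow> bool" where
  "zero_object C Z \<longleftrightarrow> Z \<in> Ob C \<and>
     (\<forall>X\<in>Ob C. (\<exists>!f. f \<in> hom C Z X) \<and> (\<exists>!f. f \<in> hom C X Z))"

definition biproduct ::
  "('o, 'm, 'x) addcat_scheme \<Rightarrow> 'o \<Rightarrow> 'o \<Rightarrow> 'o \<Rightarrow> 'm \<Rightarrow> 'm \<Rightarrow> 'm \<Rightarrow> 'm \<Rightarrow> bool" where
  "biproduct C A B W i j p q \<longleftrightarrow>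
     i \<in> hom C A W \<and> j \<in> hom C B W \<and> p \<in> hom C W A \<and> q \<in> hom C W B \<and>
     p \<cdot>\<^bsub>C\<^esub> i = Ident C A \<and> q \<cdot>\<^bsub>C\<^esub> j = Ident C B \<and>
     p \<cdot>\<^bsub>C\<^esub> j = Zero C B A \<and> q \<cdot>\<^bsub>C\<^esub> i = Zero C A B \<and>
     (i \<cdot>\<^bsub>C\<^esub> p) \<oplus>\<^bsub>C\<^esub> (j \<cdot>\<^bsub>C\<^esub> q) = Ident C W"

locale additive_category = category C for C :: "('o, 'm, 'x) addcat_scheme" (structure) +
  assumes Zero_in_hom: "X \<in> Ob C \<Longrightarrow> Y \<in> Ob C \<Longrightarrow> Zero C X Y \<in> hom C X Y"
    and Add_in_hom: "f \<in> hom C X Y \<Longrightarrow> g \<in> hom C X Y \<Longrightarrow> f \<oplus> g \<in> hom C X Y"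
    and Add_assoc: "f \<in> hom C X Y \<Longrightarrow> g \<in> hom C X Y \<Longrightarrow> h \<in> hom C X Y
      \<Longrightarrow> (f \<oplus> g) \<oplus> h = f \<oplus> (g \<oplus> h)"
    and Add_commute: "f \<in> hom C X Y \<Longrightarrow> g \<in> hom C X Y \<Longrightarrow> f \<oplus> g = g \<oplus> f"
    and Add_Zero: "f \<in> hom C X Y \<Longrightarrow> f \<oplus> Zero C X Y = f"
    and Add_inverse: "f \<in> hom C X Y \<Longrightarrow> \<exists>g\<in>hom C X Y. f \<oplus> g = Zero C X Y"
    and Cmp_Add_right: "f \<in> hom C X Y \<Longrightarrow> f' \<in> hom C X Y \<Longrightarrow> g \<in> hom C Y Z
      \<Longrightarrow> g \<cdot> (f \<oplus> f') = (g \<cdot> f) \<oplus> (g \<cdot> f')"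
    and Cmp_Add_left: "f \<in> hom C X Y \<Longrightarrow> g \<in> hom C Y Z \<Longrightarrow> g' \<in> hom C Y Z
      \<Longrightarrow> (g \<oplus> g') \<cdot> f = (g \<cdot> f) \<oplus> (g' \<cdot> f)"
    and ex_zero_object: "\<exists>Z. zero_object C Z"
    and ex_biproduct: "A \<in> Ob C \<Longrightarrow> B \<in> Ob C
      \<Longrightarrow> \<exists>W\<in>Ob C. \<exists>i j p q. biproduct C A B W i j p q"

definition Neg :: "('o, 'm, 'x) addcat_scheme \<Rightarrow> 'm \<Rightarrow> 'm" where
  "Neg C f = (THE g. g \<in> hom C (Dom C f) (Cod C f) \<and>
     f \<oplus>\<^bsub>C\<^esub> g = Zero C (Dom C f) (Cod C f))"

definition iso :: "('o, 'm, 'x) addcat_scheme \<Rightarrow> 'm \<Rightarrow> bool" where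
  "iso C f \<longleftrightarrow> f \<in> Arr C \<and>
     (\<exists>g\<in>hom C (Cod C f) (Dom C f).
        g \<cdot>\<^bsub>C\<^esub> f = Ident C (Dom C f) \<and> f \<cdot>\<^bsub>C\<^esub> g = Ident C (Cod C f))"

definition isomorphic :: "('o, 'm, 'x) addcat_scheme \<Rightarrow> 'o \<Rightarrow> 'o \<Rightarrow> bool" where
  "isomorphic C X Y \<longleftrightarrow> (\<exists>f\<in>hom C X Y. iso C f)"

definition iso_closure :: "('o, 'm, 'x) addcat_scheme \<Rightarrow> 'o set \<Rightarrow> 'o set" where
  "iso_closure C U = {X \<in> Ob C. \<exists>Y\<in>U. isomorphic C X Y}"

definition is_kernel :: "('o, 'm, 'x) addcat_scheme \<Rightarrow> 'm \<Rightarrow> 'm \<Rightarrow> bool" where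
  "is_kernel C k f \<longleftrightarrow> k \<in> Arr C \<and> f \<in> Arr C \<and> Cod C k = Dom C f \<and>
     f \<cdot>\<^bsub>C\<^esub> k = Zero C (Dom C k) (Cod C f) \<and>
     (\<forall>W\<in>Ob C. \<forall>g\<in>hom C W (Dom C f). f \<cdot>\<^bsub>C\<^esub> g = Zero C W (Cod C f) \<longrightarrow>
        (\<exists>!u. u \<in> hom C W (Dom C k) \<and> k \<cdot>\<^bsub>C\<^esub> u = g))"

definition is_cokernel :: "('o, 'm, 'x) addcat_scheme \<Rightarrow> 'm \<Rightarrow> 'm \<Rightarrow> bool" where
  "is_cokernel C c f \<longleftrightarrow> c \<in> Arr C \<and> f \<in> Arr C \<and> Dom C c = Cod C f \<and>
     c \<cdot>\<^bsub>C\<^esub> f = Zero C (Dom C f) (Cod C c) \<and>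
     (\<forall>W\<in>Ob C. \<forall>g\<in>hom C (Cod C f) W. g \<cdot>\<^bsub>C\<^esub> f = Zero C (Dom C f) W \<longrightarrow>
        (\<exists>!u. u \<in> hom C (Cod C c) W \<and> u \<cdot>\<^bsub>C\<^esub> c = g))"

text \<open>
  In \<open>is_pushout C f g f' g'\<close> the span is \<open>B \<leftarrow> A \<rightarrow> A'\<close> with legs \<open>f : A \<rightarrow> B\<close>, \<open>g : A \<rightarrow> A'\<close>, and
  \<open>f' : A' \<rightarrow> B'\<close> is opposite to \<open>f\<close>, \<open>g' : B \<rightarrow> B'\<close> is opposite to \<open>g\<close>; dually for pullbacks of
  \<open>f : B \<rightarrow> A\<close>, \<open>g : A' \<rightarrow> A\<close>.
\<close>

definition is_pushout :: "('o, 'm, 'x) addcat_scheme \<Rightarrow> 'm \<Rightarrow> 'm \<Rightarrow> 'm \<Rightarrow> 'm \<Rightarrow> bool" where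
  "is_pushout C f g f' g' \<longleftrightarrow>
     f \<in> Arr C \<and> g \<in> Arr C \<and> f' \<in> Arr C \<and> g' \<in> Arr C \<and>
     Dom C f = Dom C g \<and> Dom C f' = Cod C g \<and> Dom C g' = Cod C f \<and> Cod C f' = Cod C g' \<and>
     g' \<cdot>\<^bsub>C\<^esub> f = f' \<cdot>\<^bsub>C\<^esub> g \<and>
     (\<forall>W\<in>Ob C. \<forall>u\<in>hom C (Cod C f) W. \<forall>v\<in>hom C (Cod C g) W.
        u \<cdot>\<^bsub>C\<^esub> f = v \<cdot>\<^bsub>C\<^esub> g \<longrightarrow>
        (\<exists>!w. w \<in> hom C (Cod C f') W \<and> w \<cdot>\<^bsub>C\<^esub> g' = u \<and> w \<cdot>\<^bsub>C\<^esub> f' = v))"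

definition is_pullback :: "('o, 'm, 'x) addcat_scheme \<Rightarrow> 'm \<Rightarrow> 'm \<Rightarrow> 'm \<Rightarrow> 'm \<Rightarrow> bool" where
  "is_pullback C f g f' g' \<longleftrightarrow>
     f \<in> Arr C \<and> g \<in> Arr C \<and> f' \<in> Arr C \<and> g' \<in> Arr C \<and>
     Cod C f = Cod C g \<and> Cod C f' = Dom C g \<and> Cod C g' = Dom C f \<and> Dom C f' = Dom C g' \<and>
     f \<cdot>\<^bsub>C\<^esub> g' = g \<cdot>\<^bsub>C\<^esub> f' \<and>
     (\<forall>W\<in>Ob C. \<forall>u\<in>hom C W (Dom C f). \<forall>v\<in>hom C W (Dom C g).
        f \<cdot>\<^bsub>C\<^esub> u = g \<cdot>\<^bsub>C\<^esub> v \<longrightarrow>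
        (\<exists>!w. w \<in> hom C W (Dom C f') \<and> g' \<cdot>\<^bsub>C\<^esub> w = u \<and> f' \<cdot>\<^bsub>C\<^esub> w = v))"

definition weakly_idempotent_complete :: "('o, 'm, 'x) addcat_scheme \<Rightarrow> bool" where
  "weakly_idempotent_complete C \<longleftrightarrow>
     (\<forall>r\<in>Arr C. (\<exists>s\<in>hom C (Cod C r) (Dom C r). r \<cdot>\<^bsub>C\<^esub> s = Ident C (Cod C r)) \<longrightarrow>
        (\<exists>k. is_kernel C k r))"


section \<open>Exact and Frobenius categories\<close>

text \<open>
  An exact structure in the sense of Quillen is a set \<open>E\<close> of conflations \<open>(i, p)\<close>; the axioms are
  in Buehler's self-dual form.
\<close>

definition inflation :: "('m \<times> 'm) set \<Rightarrow> 'm \<Rightarrow> bool" where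
  "inflation E i \<longleftrightarrow> (\<exists>p. (i, p) \<in> E)"

definition deflation :: "('m \<times> 'm) set \<Rightarrow> 'm \<Rightarrow> bool" where
  "deflation E p \<longleftrightarrow> (\<exists>i. (i, p) \<in> E)"

locale exact_category = additive_category C for C :: "('o, 'm, 'x) addcat_scheme" (structure) +
  fixes E :: "('m \<times> 'm) set"
  assumes conflation_kernel_cokernel: "(i, p) \<in> E \<Longrightarrow> is_kernel C i p \<and> is_cokernel C p i"
    and conflation_iso_closed:
      "(i, p) \<in> E \<Longrightarrow> i' \<in> Arr C \<Longrightarrow> p' \<in> Arr C \<Longrightarrow> Cod C i' = Dom C p'
       \<Longrightarrow> iso C a \<Longrightarrow> iso C b \<Longrightarrow> iso C c
       \<Longrightarrow> a \<in> hom C (Dom C i) (Dom C i') \<Longrightarrow> b \<in> hom C (Cod C i) (Cod C i')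
       \<Longrightarrow> c \<in> hom C (Cod C p) (Cod C p') \<Longrightarrow> b \<cdot> i = i' \<cdot> a \<Longrightarrow> c \<cdot> p = p' \<cdot> b
       \<Longrightarrow> (i', p') \<in> E"
    and inflation_Ident: "X \<in> Ob C \<Longrightarrow> inflation E (Ident C X)"
    and deflation_Ident: "X \<in> Ob C \<Longrightarrow> deflation E (Ident C X)"
    and inflation_Cmp: "inflation E i \<Longrightarrow> inflation E j \<Longrightarrow> Cod C i = Dom C j
      \<Longrightarrow> inflation E (j \<cdot> i)"
    and deflation_Cmp: "deflation E p \<Longrightarrow> deflation E q \<Longrightarrow> Cod C p = Dom C q
      \<Longrightarrow> deflation E (q \<cdot> p)"
    and inflation_pushout: "inflation E i \<Longrightarrow> f \<in> Arr C \<Longrightarrow> Dom C f = Dom C i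
      \<Longrightarrow> \<exists>i' f'. is_pushout C i f i' f' \<and> inflation E i'"
    and deflation_pullback: "deflation E p \<Longrightarrow> f \<in> Arr C \<Longrightarrow> Cod C f = Cod C p
      \<Longrightarrow> \<exists>p' f'. is_pullback C p f p' f' \<and> deflation E p'"

definition Proj :: "('o, 'm, 'x) addcat_scheme \<Rightarrow> ('m \<times> 'm) set \<Rightarrow> 'o set" where
  "Proj C E = {P \<in> Ob C. \<forall>p. deflation E p \<longrightarrow>
     (\<forall>f\<in>hom C P (Cod C p). \<exists>g\<in>hom C P (Dom C p). p \<cdot>\<^bsub>C\<^esub> g = f)}"

definition Inj :: "('o, 'm, 'x) addcat_scheme \<Rightarrow> ('m \<times> 'm) set \<Rightarrow> 'o set" where
  "Inj C E = {I \<in> Ob C. \<forall>i. inflation E i \<longrightarrow>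
     (\<forall>f\<in>hom C (Dom C i) I. \<exists>g\<in>hom C (Cod C i) I. g \<cdot>\<^bsub>C\<^esub> i = f)}"

locale frobenius_category = exact_category C E
  for C :: "('o, 'm, 'x) addcat_scheme" (structure) and E :: "('m \<times> 'm) set" +
  assumes enough_projectives:
      "X \<in> Ob C \<Longrightarrow> \<exists>p. deflation E p \<and> Dom C p \<in> Proj C E \<and> Cod C p = X"
    and enough_injectives:
      "X \<in> Ob C \<Longrightarrow> \<exists>i. inflation E i \<and> Dom C i = X \<and> Cod C i \<in> Inj C E"
    and Proj_eq_Inj: "Proj C E = Inj C E"


section \<open>Categories with shift and distinguished triangles\<close>

text \<open>
  \<open>Tri\<close> is the set of distinguished triangles, \<open>(f, g, h)\<close> standing for
  \<open>X \<rightarrow> Y \<rightarrow> Z \<rightarrow> X[1]\<close>.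
\<close>

record ('o, 'm) tricat = "('o, 'm) addcat" +
  ShOb :: "'o \<Rightarrow> 'o"
  ShArr :: "'m \<Rightarrow> 'm"
  Tri :: "('m \<times> 'm \<times> 'm) set"

definition candidate_triangle :: "('o, 'm) tricat \<Rightarrow> 'm \<times> 'm \<times> 'm \<Rightarrow> bool" where
  "candidate_triangle T = (\<lambda>(f, g, h). f \<in> Arr T \<and> g \<in> Arr T \<and> h \<in> Arr T \<and>
     Cod T f = Dom T g \<and> Cod T g = Dom T h \<and> Cod T h = ShOb T (Dom T f))"

definition triangle_iso :: "('o, 'm) tricat \<Rightarrow> 'm \<times> 'm \<times> 'm \<Rightarrow> 'm \<times> 'm \<times> 'm \<Rightarrow> bool" where
  "triangle_iso T = (\<lambda>(f, g, h) (f', g', h').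
     candidate_triangle T (f, g, h) \<and> candidate_triangle T (f', g', h') \<and>
     (\<exists>a\<in>hom T (Dom T f) (Dom T f'). \<exists>b\<in>hom T (Dom T g) (Dom T g').
      \<exists>c\<in>hom T (Dom T h) (Dom T h').
        iso T a \<and> iso T b \<and> iso T c \<and>
        b \<cdot>\<^bsub>T\<^esub> f = f' \<cdot>\<^bsub>T\<^esub> a \<and> c \<cdot>\<^bsub>T\<^esub> g = g' \<cdot>\<^bsub>T\<^esub> b \<and>
        ShArr T a \<cdot>\<^bsub>T\<^esub> h = h' \<cdot>\<^bsub>T\<^esub> c))"

text \<open>
  The triangulated structures below are given by their standard triangles; \<open>saturate\<close> then passes
  to all triangles isomorphic to a standard one.
\<close>

definition saturate :: "('o, 'm) tricat \<Rightarrow> ('o, 'm) tricat" where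
  "saturate T = T\<lparr>Tri := {t. \<exists>t'\<in>Tri T. triangle_iso T t t'}\<rparr>"

definition full_sub :: "('o, 'm) tricat \<Rightarrow> 'o set \<Rightarrow> ('o, 'm) tricat" where
  "full_sub T U = T\<lparr>Ob := Ob T \<inter> U,
     Arr := {f \<in> Arr T. Dom T f \<in> U \<and> Cod T f \<in> U},
     Tri := {(f, g, h) \<in> Tri T. Dom T f \<in> U \<and> Dom T g \<in> U \<and> Dom T h \<in> U}\<rparr>"

definition star :: "('o, 'm) tricat \<Rightarrow> 'o set \<Rightarrow> 'o set \<Rightarrow> 'o set" where
  "star T U V = {Z \<in> Ob T. \<exists>f g h. (f, g, h) \<in> Tri T \<and>
     Dom T f \<in> U \<and> Cod T f = Z \<and> Cod T g \<in> V}"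

text \<open>\<open>is_perp T W U V\<close> expresses \<open>W = U \<bottom> V\<close>.\<close>

definition is_perp :: "('o, 'm) tricat \<Rightarrow> 'o set \<Rightarrow> 'o set \<Rightarrow> 'o set \<Rightarrow> bool" where
  "is_perp T W U V \<longleftrightarrow>
     (\<forall>X\<in>U. \<forall>Y\<in>V. hom T X Y = {Zero T X Y}) \<and> W = star T U V"


section \<open>Functors and triangle equivalences\<close>

definition is_functor ::
  "('o, 'm, 'x) addcat_scheme \<Rightarrow> ('p, 'n, 'y) addcat_scheme \<Rightarrow> ('o \<Rightarrow> 'p) \<Rightarrow> ('m \<Rightarrow> 'n) \<Rightarrow> bool"
  where
  "is_functor C D Fo Fa \<longleftrightarrow>
     (\<forall>X\<in>Ob C. Fo X \<in> Ob D) \<and>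
     (\<forall>f\<in>Arr C. Fa f \<in> hom D (Fo (Dom C f)) (Fo (Cod C f))) \<and>
     (\<forall>X\<in>Ob C. Fa (Ident C X) = Ident D (Fo X)) \<and>
     (\<forall>f\<in>Arr C. \<forall>g\<in>Arr C. Cod C f = Dom C g \<longrightarrow> Fa (g \<cdot>\<^bsub>C\<^esub> f) = Fa g \<cdot>\<^bsub>D\<^esub> Fa f)"

definition is_additive_functor ::
  "('o, 'm, 'x) addcat_scheme \<Rightarrow> ('p, 'n, 'y) addcat_scheme \<Rightarrow> ('o \<Rightarrow> 'p) \<Rightarrow> ('m \<Rightarrow> 'n) \<Rightarrow> bool"
  where
  "is_additive_functor C D Fo Fa \<longleftrightarrow> is_functor C D Fo Fa \<and>
     (\<forall>f\<in>Arr C. \<forall>g\<in>Arr C. Dom C f = Dom C g \<longrightarrow> Cod C f = Cod C g \<longrightarrow>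
        Fa (f \<oplus>\<^bsub>C\<^esub> g) = Fa f \<oplus>\<^bsub>D\<^esub> Fa g)"

definition natural_iso ::
  "('o, 'm, 'x) addcat_scheme \<Rightarrow> ('p, 'n, 'y) addcat_scheme \<Rightarrow> ('o \<Rightarrow> 'p) \<Rightarrow> ('m \<Rightarrow> 'n)
    \<Rightarrow> ('o \<Rightarrow> 'p) \<Rightarrow> ('m \<Rightarrow> 'n) \<Rightarrow> ('o \<Rightarrow> 'n) \<Rightarrow> bool"
  where
  "natural_iso C D Fo Fa Go Ga \<eta> \<longleftrightarrow>
     (\<forall>X\<in>Ob C. \<eta> X \<in> hom D (Fo X) (Go X) \<and> iso D (\<eta> X)) \<and>
     (\<forall>f\<in>Arr C. \<eta> (Cod C f) \<cdot>\<^bsub>D\<^esub> Fa f = Ga f \<cdot>\<^bsub>D\<^esub> \<eta> (Dom C f))"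

definition is_equivalence ::
  "('o, 'm, 'x) addcat_scheme \<Rightarrow> ('p, 'n, 'y) addcat_scheme \<Rightarrow> ('o \<Rightarrow> 'p) \<Rightarrow> ('m \<Rightarrow> 'n) \<Rightarrow> bool"
  where
  "is_equivalence C D Fo Fa \<longleftrightarrow> is_functor C D Fo Fa \<and>
     (\<exists>Go Ga \<eta> \<epsilon>. is_functor D C Go Ga \<and>
        natural_iso C C (\<lambda>X. X) (\<lambda>f. f) (Go \<circ> Fo) (Ga \<circ> Fa) \<eta> \<and>
        natural_iso D D (Fo \<circ> Go) (Fa \<circ> Ga) (\<lambda>X. X) (\<lambda>f. f) \<epsilon>)"

definition is_triangle_functor ::
  "('o, 'm) tricat \<Rightarrow> ('p, 'n) tricat \<Rightarrow> ('o \<Rightarrow> 'p) \<Rightarrow> ('m \<Rightarrow> 'n) \<Rightarrow> bool" where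
  "is_triangle_functor T U Fo Fa \<longleftrightarrow> is_additive_functor T U Fo Fa \<and>
     (\<exists>\<eta>. natural_iso T U (Fo \<circ> ShOb T) (Fa \<circ> ShArr T) (ShOb U \<circ> Fo) (ShArr U \<circ> Fa) \<eta> \<and>
        (\<forall>(f, g, h)\<in>Tri T. (Fa f, Fa g, \<eta> (Dom T f) \<cdot>\<^bsub>U\<^esub> Fa h) \<in> Tri U))"

definition is_triangle_equivalence ::
  "('o, 'm) tricat \<Rightarrow> ('p, 'n) tricat \<Rightarrow> ('o \<Rightarrow> 'p) \<Rightarrow> ('m \<Rightarrow> 'n) \<Rightarrow> bool" where
  "is_triangle_equivalence T U Fo Fa \<longleftrightarrow>
     is_triangle_functor T U Fo Fa \<and> is_equivalence T U Fo Fa"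


section \<open>The stable category\<close>

text \<open>
  Arrows of quotient categories are triples consisting of source, target and an equivalence class.
\<close>

definition stab_eq :: "('o, 'm, 'x) addcat_scheme \<Rightarrow> ('m \<times> 'm) set \<Rightarrow> 'm \<Rightarrow> 'm \<Rightarrow> bool" where
  "stab_eq C E f g \<longleftrightarrow> f \<in> Arr C \<and> g \<in> Arr C \<and> Dom C f = Dom C g \<and> Cod C f = Cod C g \<and>
     (\<exists>Q\<in>Proj C E. \<exists>u\<in>hom C (Dom C f) Q. \<exists>v\<in>hom C Q (Cod C f).
        g = f \<oplus>\<^bsub>C\<^esub> (v \<cdot>\<^bsub>C\<^esub> u))"

definition stab :: "('o, 'm, 'x) addcat_scheme \<Rightarrow> ('m \<times> 'm) set \<Rightarrow> 'm \<Rightarrow> 'o \<times> 'o \<times> 'm set" where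
  "stab C E f = (Dom C f, Cod C f, {g. stab_eq C E f g})"

text \<open>
  Happel's structure depends on the choice, for each object \<open>A\<close>, of a conflation
  \<open>\<sigma> A = (A \<rightarrow> I, I \<rightarrow> S)\<close> with \<open>I\<close> injective; the shift of \<open>A\<close> is then \<open>S\<close>.
\<close>

definition cosyzygy_choice ::
  "('o, 'm, 'x) addcat_scheme \<Rightarrow> ('m \<times> 'm) set \<Rightarrow> ('o \<Rightarrow> 'm \<times> 'm) \<Rightarrow> bool" where
  "cosyzygy_choice C E \<sigma> \<longleftrightarrow>
     (\<forall>A\<in>Ob C. \<sigma> A \<in> E \<and> Dom C (fst (\<sigma> A)) = A \<and> Cod C (fst (\<sigma> A)) \<in> Inj C E)"

definition cosyzygy_map ::
  "('o, 'm, 'x) addcat_scheme \<Rightarrow> ('o \<Rightarrow> 'm \<times> 'm) \<Rightarrow> 'm \<Rightarrow> 'm \<Rightarrow> bool" where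
  "cosyzygy_map C \<sigma> f g \<longleftrightarrow>
     (let i = fst (\<sigma> (Dom C f)); p = snd (\<sigma> (Dom C f));
          i' = fst (\<sigma> (Cod C f)); p' = snd (\<sigma> (Cod C f))
      in g \<in> hom C (Cod C p) (Cod C p') \<and>
         (\<exists>k\<in>hom C (Cod C i) (Cod C i'). k \<cdot>\<^bsub>C\<^esub> i = i' \<cdot>\<^bsub>C\<^esub> f \<and> g \<cdot>\<^bsub>C\<^esub> p = p' \<cdot>\<^bsub>C\<^esub> k))"

text \<open>
  The standard triangle \<open>A \<rightarrow> B \<rightarrow> D \<rightarrow> S\<close> of \<open>f : A \<rightarrow> B\<close>, where \<open>D\<close> is a pushout of
  \<open>A \<rightarrow> I\<close> along \<open>f\<close>.
\<close>

definition happel_standard ::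
  "('o, 'm, 'x) addcat_scheme \<Rightarrow> ('o \<Rightarrow> 'm \<times> 'm) \<Rightarrow> 'm \<Rightarrow> 'm \<Rightarrow> 'm \<Rightarrow> bool" where
  "happel_standard C \<sigma> f c w \<longleftrightarrow>
     (let i = fst (\<sigma> (Dom C f)); p = snd (\<sigma> (Dom C f))
      in \<exists>j. is_pushout C i f c j \<and>
           w \<in> hom C (Cod C c) (Cod C p) \<and>
           w \<cdot>\<^bsub>C\<^esub> c = Zero C (Dom C c) (Cod C p) \<and> w \<cdot>\<^bsub>C\<^esub> j = p)"

definition stable_cat ::
  "('o, 'm, 'x) addcat_scheme \<Rightarrow> ('m \<times> 'm) set \<Rightarrow> ('o \<Rightarrow> 'm \<times> 'm)
    \<Rightarrow> ('o, 'o \<times> 'o \<times> 'm set) tricat" where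
  "stable_cat C E \<sigma> = saturate \<lparr>
     Ob = Ob C,
     Arr = stab C E ` Arr C,
     Dom = (\<lambda>(X, Y, \<Phi>). X),
     Cod = (\<lambda>(X, Y, \<Phi>). Y),
     Ident = (\<lambda>X. stab C E (Ident C X)),
     Cmp = (\<lambda>(Y', Z, \<Psi>) (X, Y, \<Phi>).
       (X, Z, {\<chi>. \<exists>\<psi>\<in>\<Psi>. \<exists>\<phi>\<in>\<Phi>. stab_eq C E (\<psi> \<cdot>\<^bsub>C\<^esub> \<phi>) \<chi>})),
     Add = (\<lambda>(X, Y, \<Phi>) (X', Y', \<Psi>).
       (X, Y, {\<chi>. \<exists>\<phi>\<in>\<Phi>. \<exists>\<psi>\<in>\<Psi>. stab_eq C E (\<phi> \<oplus>\<^bsub>C\<^esub> \<psi>) \<chi>})),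
     Zero = (\<lambda>X Y. stab C E (Zero C X Y)),
     ShOb = (\<lambda>X. Cod C (snd (\<sigma> X))),
     ShArr = (\<lambda>(X, Y, \<Phi>). (Cod C (snd (\<sigma> X)), Cod C (snd (\<sigma> Y)),
       {\<chi>. \<exists>\<phi>\<in>\<Phi>. \<exists>\<psi>. cosyzygy_map C \<sigma> \<phi> \<psi> \<and> stab_eq C E \<psi> \<chi>})),
     Tri = {(stab C E f, stab C E c, stab C E w) | f c w.
       f \<in> Arr C \<and> happel_standard C \<sigma> f c w} \<rparr>"


section \<open>The homotopy category\<close>

record ('o, 'm) cpx =
  cob :: "int \<Rightarrow> 'o"
  cdiff :: "int \<Rightarrow> 'm"

definition is_complex :: "('o, 'm, 'x) addcat_scheme \<Rightarrow> 'o set \<Rightarrow> ('o, 'm) cpx \<Rightarrow> bool" where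
  "is_complex C P X \<longleftrightarrow> (\<forall>i. cob X i \<in> P \<and> cdiff X i \<in> hom C (cob X i) (cob X (i + 1)) \<and>
     cdiff X (i + 1) \<cdot>\<^bsub>C\<^esub> cdiff X i = Zero C (cob X i) (cob X (i + 2)))"

definition chain_map ::
  "('o, 'm, 'x) addcat_scheme \<Rightarrow> ('o, 'm) cpx \<Rightarrow> ('o, 'm) cpx \<Rightarrow> (int \<Rightarrow> 'm) \<Rightarrow> bool" where
  "chain_map C X Y \<phi> \<longleftrightarrow> (\<forall>i. \<phi> i \<in> hom C (cob X i) (cob Y i) \<and>
     \<phi> (i + 1) \<cdot>\<^bsub>C\<^esub> cdiff X i = cdiff Y i \<cdot>\<^bsub>C\<^esub> \<phi> i)"

definition homotopic :: "('o, 'm, 'x) addcat_scheme \<Rightarrow> ('o, 'm) cpx \<Rightarrow> ('o, 'm) cpx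
    \<Rightarrow> (int \<Rightarrow> 'm) \<Rightarrow> (int \<Rightarrow> 'm) \<Rightarrow> bool" where
  "homotopic C X Y \<phi> \<psi> \<longleftrightarrow> chain_map C X Y \<phi> \<and> chain_map C X Y \<psi> \<and>
     (\<exists>s. \<forall>i. s i \<in> hom C (cob X i) (cob Y (i - 1)) \<and>
        \<psi> i = \<phi> i \<oplus>\<^bsub>C\<^esub> ((cdiff Y (i - 1) \<cdot>\<^bsub>C\<^esub> s i) \<oplus>\<^bsub>C\<^esub> (s (i + 1) \<cdot>\<^bsub>C\<^esub> cdiff X i)))"

type_synonym ('o, 'm) karr = "('o, 'm) cpx \<times> ('o, 'm) cpx \<times> (int \<Rightarrow> 'm) set"

definition htpy :: "('o, 'm, 'x) addcat_scheme \<Rightarrow> ('o, 'm) cpx \<Rightarrow> ('o, 'm) cpx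
    \<Rightarrow> (int \<Rightarrow> 'm) \<Rightarrow> ('o, 'm) karr" where
  "htpy C X Y \<phi> = (X, Y, {\<psi>. homotopic C X Y \<phi> \<psi>})"

definition shift_cpx :: "('o, 'm, 'x) addcat_scheme \<Rightarrow> ('o, 'm) cpx \<Rightarrow> ('o, 'm) cpx" where
  "shift_cpx C X = \<lparr>cob = (\<lambda>i. cob X (i + 1)), cdiff = (\<lambda>i. Neg C (cdiff X (i + 1)))\<rparr>"

text \<open>
  \<open>Z\<close> is a mapping cone of \<open>\<phi> : X \<rightarrow> Y\<close>: in each degree it is a biproduct of \<open>X (i + 1)\<close> and
  \<open>Y i\<close>, with differential \<open>(x, y) \<mapsto> (- d x, \<phi> x + d y)\<close>; \<open>k\<close> is the inclusion of \<open>Y\<close> and \<open>p\<close> the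
  projection onto \<open>X[1]\<close>.
\<close>

definition mapping_cone :: "('o, 'm, 'x) addcat_scheme \<Rightarrow> ('o, 'm) cpx \<Rightarrow> ('o, 'm) cpx
    \<Rightarrow> (int \<Rightarrow> 'm) \<Rightarrow> ('o, 'm) cpx \<Rightarrow> (int \<Rightarrow> 'm) \<Rightarrow> (int \<Rightarrow> 'm) \<Rightarrow> bool" where
  "mapping_cone C X Y \<phi> Z k p \<longleftrightarrow> (\<exists>j q. \<forall>i.
     biproduct C (cob X (i + 1)) (cob Y i) (cob Z i) (j i) (k i) (p i) (q i) \<and>
     cdiff Z i \<cdot>\<^bsub>C\<^esub> j i =
       (j (i + 1) \<cdot>\<^bsub>C\<^esub> Neg C (cdiff X (i + 1))) \<oplus>\<^bsub>C\<^esub> (k (i + 1) \<cdot>\<^bsub>C\<^esub> \<phi> (i + 1)) \<and>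
     cdiff Z i \<cdot>\<^bsub>C\<^esub> k i = k (i + 1) \<cdot>\<^bsub>C\<^esub> cdiff Y i)"

definition homotopy_cat ::
  "('o, 'm, 'x) addcat_scheme \<Rightarrow> 'o set \<Rightarrow> (('o, 'm) cpx, ('o, 'm) karr) tricat" where
  "homotopy_cat C P = saturate \<lparr>
     Ob = {X. is_complex C P X},
     Arr = {htpy C X Y \<phi> | X Y \<phi>. is_complex C P X \<and> is_complex C P Y \<and> chain_map C X Y \<phi>},
     Dom = (\<lambda>(X, Y, \<Phi>). X),
     Cod = (\<lambda>(X, Y, \<Phi>). Y),
     Ident = (\<lambda>X. htpy C X X (\<lambda>i. Ident C (cob X i))),
     Cmp = (\<lambda>(Y', Z, \<Psi>) (X, Y, \<Phi>).
       (X, Z, {\<chi>. \<exists>\<psi>\<in>\<Psi>. \<exists>\<phi>\<in>\<Phi>. homotopic C X Z (\<lambda>i. \<psi> i \<cdot>\<^bsub>C\<^esub> \<phi> i) \<chi>})),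
     Add = (\<lambda>(X, Y, \<Phi>) (X', Y', \<Psi>).
       (X, Y, {\<chi>. \<exists>\<phi>\<in>\<Phi>. \<exists>\<psi>\<in>\<Psi>. homotopic C X Y (\<lambda>i. \<phi> i \<oplus>\<^bsub>C\<^esub> \<psi> i) \<chi>})),
     Zero = (\<lambda>X Y. htpy C X Y (\<lambda>i. Zero C (cob X i) (cob Y i))),
     ShOb = shift_cpx C,
     ShArr = (\<lambda>(X, Y, \<Phi>). (shift_cpx C X, shift_cpx C Y,
       {\<chi>. \<exists>\<phi>\<in>\<Phi>. homotopic C (shift_cpx C X) (shift_cpx C Y) (\<lambda>i. \<phi> (i + 1)) \<chi>})),
     Tri = {(htpy C X Y \<phi>, htpy C Y Z k, htpy C Z (shift_cpx C X) p) | X Y Z \<phi> k p.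
       is_complex C P X \<and> is_complex C P Y \<and> is_complex C P Z \<and> chain_map C X Y \<phi> \<and>
       mapping_cone C X Y \<phi> Z k p} \<rparr>"


section \<open>Verdier quotients\<close>

text \<open>
  \<open>T/N\<close> is built by calculus of fractions: an arrow \<open>X \<rightarrow> Y\<close> is a class of roofs
  \<open>X \<leftarrow> Z \<rightarrow> Y\<close>, written \<open>(s, f)\<close>, where the cone of \<open>s : Z \<rightarrow> X\<close> lies in \<open>N\<close>.
\<close>

definition cone_in :: "('o, 'm) tricat \<Rightarrow> 'o set \<Rightarrow> 'm set" where
  "cone_in T N = {s \<in> Arr T. \<exists>g h. (s, g, h) \<in> Tri T \<and> Cod T g \<in> N}"

definition roofs :: "('o, 'm) tricat \<Rightarrow> 'o set \<Rightarrow> 'o \<Rightarrow> 'o \<Rightarrow> ('m \<times> 'm) set" where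
  "roofs T N X Y = {(s, f). s \<in> cone_in T N \<and> f \<in> Arr T \<and> Dom T s = Dom T f \<and>
     Cod T s = X \<and> Cod T f = Y}"

definition roof_eq :: "('o, 'm) tricat \<Rightarrow> 'o set \<Rightarrow> 'o \<Rightarrow> 'o \<Rightarrow> 'm \<times> 'm \<Rightarrow> 'm \<times> 'm \<Rightarrow> bool" where
  "roof_eq T N X Y = (\<lambda>(s, f) (t, g). (s, f) \<in> roofs T N X Y \<and> (t, g) \<in> roofs T N X Y \<and>
     (\<exists>u\<in>Arr T. \<exists>v\<in>Arr T. Dom T u = Dom T v \<and> Cod T u = Dom T s \<and> Cod T v = Dom T t \<and>
        s \<cdot>\<^bsub>T\<^esub> u = t \<cdot>\<^bsub>T\<^esub> v \<and> f \<cdot>\<^bsub>T\<^esub> u = g \<cdot>\<^bsub>T\<^esub> v \<and> s \<cdot>\<^bsub>T\<^esub> u \<in> cone_in T N))"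

type_synonym ('o, 'm) varr = "'o \<times> 'o \<times> ('m \<times> 'm) set"

definition fraction ::
  "('o, 'm) tricat \<Rightarrow> 'o set \<Rightarrow> 'o \<Rightarrow> 'o \<Rightarrow> 'm \<times> 'm \<Rightarrow> ('o, 'm) varr" where
  "fraction T N X Y r = (X, Y, {r'. roof_eq T N X Y r r'})"

text \<open>The action of the quotient functor \<open>T \<rightarrow> T/N\<close> on arrows; it is the identity on objects.\<close>

definition verdier_arr :: "('o, 'm) tricat \<Rightarrow> 'o set \<Rightarrow> 'm \<Rightarrow> ('o, 'm) varr" where
  "verdier_arr T N f = fraction T N (Dom T f) (Cod T f) (Ident T (Dom T f), f)"

text \<open>
  \<open>(t, g)\<close> after \<open>(s, f)\<close> is \<open>(s u, g v)\<close> for any completion \<open>f u = t v\<close> with \<open>u\<close> inverted; two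
  classes of parallel roofs are added via representatives with a common denominator.
\<close>

definition verdier :: "('o, 'm) tricat \<Rightarrow> 'o set \<Rightarrow> ('o, ('o, 'm) varr) tricat" where
  "verdier T N = saturate \<lparr>
     Ob = Ob T,
     Arr = {fraction T N X Y r | X Y r. X \<in> Ob T \<and> Y \<in> Ob T \<and> r \<in> roofs T N X Y},
     Dom = (\<lambda>(X, Y, \<Phi>). X),
     Cod = (\<lambda>(X, Y, \<Phi>). Y),
     Ident = (\<lambda>X. verdier_arr T N (Ident T X)),
     Cmp = (\<lambda>(Y', Z, \<Psi>) (X, Y, \<Phi>). (X, Z, {r. \<exists>(t, g)\<in>\<Psi>. \<exists>(s, f)\<in>\<Phi>.
       \<exists>u\<in>cone_in T N. \<exists>v\<in>Arr T. Dom T u = Dom T v \<and> Cod T u = Dom T f \<and> Cod T v = Dom T t \<and>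
         f \<cdot>\<^bsub>T\<^esub> u = t \<cdot>\<^bsub>T\<^esub> v \<and> roof_eq T N X Z (s \<cdot>\<^bsub>T\<^esub> u, g \<cdot>\<^bsub>T\<^esub> v) r})),
     Add = (\<lambda>(X, Y, \<Phi>) (X', Y', \<Psi>). (X, Y, {r. \<exists>s f g. (s, f) \<in> \<Phi> \<and> (s, g) \<in> \<Psi> \<and>
       roof_eq T N X Y (s, f \<oplus>\<^bsub>T\<^esub> g) r})),
     Zero = (\<lambda>X Y. verdier_arr T N (Zero T X Y)),
     ShOb = ShOb T,
     ShArr = (\<lambda>(X, Y, \<Phi>). (ShOb T X, ShOb T Y, {r. \<exists>(s, f)\<in>\<Phi>.
       roof_eq T N (ShOb T X) (ShOb T Y) (ShArr T s, ShArr T f) r})),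
     Tri = {(verdier_arr T N f, verdier_arr T N g, verdier_arr T N h) | f g h.
       (f, g, h) \<in> Tri T} \<rparr>"


section \<open>Subcategories of the homotopy category of projectives\<close>

text \<open>All subcategories are taken closed under isomorphism in \<open>K(P)\<close>.\<close>

definition KP ::
  "('o, 'm, 'x) addcat_scheme \<Rightarrow> ('m \<times> 'm) set \<Rightarrow> (('o, 'm) cpx, ('o, 'm) karr) tricat" where
  "KP C E = homotopy_cat C (Proj C E)"

definition right_bounded_at :: "('o, 'm, 'x) addcat_scheme \<Rightarrow> ('o, 'm) cpx \<Rightarrow> int \<Rightarrow> bool" where
  "right_bounded_at C X n \<longleftrightarrow> (\<forall>i>n. zero_object C (cob X i))"

definition acyclic_below :: "('o, 'm, 'x) addcat_scheme \<Rightarrow> ('m \<times> 'm) set \<Rightarrow> ('o, 'm) cpx \<Rightarrow> int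
    \<Rightarrow> (int \<Rightarrow> 'o) \<Rightarrow> (int \<Rightarrow> 'm) \<Rightarrow> (int \<Rightarrow> 'm) \<Rightarrow> bool" where
  "acyclic_below C E X m Y a b \<longleftrightarrow>
     (\<forall>i\<le>m. (a (i - 1), b i) \<in> E \<and>
        a (i - 1) \<in> hom C (Y (i - 1)) (cob X i) \<and> b i \<in> hom C (cob X i) (Y i)) \<and>
     (\<forall>i<m. cdiff X i = a i \<cdot>\<^bsub>C\<^esub> b i)"

definition Kminusb :: "('o, 'm, 'x) addcat_scheme \<Rightarrow> ('m \<times> 'm) set \<Rightarrow> ('o, 'm) cpx set" where
  "Kminusb C E = iso_closure (KP C E) {X \<in> Ob (KP C E).
     (\<exists>n. right_bounded_at C X n) \<and> (\<exists>m Y a b. acyclic_below C E X m Y a b)}"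

definition KF :: "('o, 'm, 'x) addcat_scheme \<Rightarrow> ('m \<times> 'm) set \<Rightarrow> ('o, 'm) cpx set" where
  "KF C E = iso_closure (KP C E) {X \<in> Ob (KP C E).
     \<exists>n m Y a b. n \<le> 0 \<and> 0 \<le> m \<and> right_bounded_at C X n \<and> acyclic_below C E X m Y a b}"

definition bounded_cpx :: "('o, 'm, 'x) addcat_scheme \<Rightarrow> ('o, 'm) cpx \<Rightarrow> bool" where
  "bounded_cpx C X \<longleftrightarrow> (\<exists>l n. \<forall>i. i < l \<or> i > n \<longrightarrow> zero_object C (cob X i))"

definition Kb :: "('o, 'm, 'x) addcat_scheme \<Rightarrow> ('m \<times> 'm) set \<Rightarrow> ('o, 'm) cpx set" where
  "Kb C E = iso_closure (KP C E) {X \<in> Ob (KP C E). bounded_cpx C X}"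

definition Kpos :: "('o, 'm, 'x) addcat_scheme \<Rightarrow> ('m \<times> 'm) set \<Rightarrow> ('o, 'm) cpx set" where
  "Kpos C E = iso_closure (KP C E) {X \<in> Ob (KP C E). bounded_cpx C X \<and>
     (\<forall>i\<le>0. zero_object C (cob X i))}"

definition Kneg :: "('o, 'm, 'x) addcat_scheme \<Rightarrow> ('m \<times> 'm) set \<Rightarrow> ('o, 'm) cpx set" where
  "Kneg C E = iso_closure (KP C E) {X \<in> Ob (KP C E). bounded_cpx C X \<and>
     (\<forall>i\<ge>0. zero_object C (cob X i))}"

text \<open>
  The identification of the Frobenius category with the subcategory \<open>KF\<close>: an object \<open>A\<close> is sent to
  the underlying complex of a chosen projective resolution
  \<open>\<rho> A = (X, X\<^sup>0 \<rightarrow> A)\<close> with \<open>X\<close> in degrees \<open>\<le> 0\<close>, and \<open>f : A \<rightarrow> B\<close> is sent to the class of chain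
  maps lifting \<open>f\<close>, i.e. compatible with \<open>f\<close> and the augmentations.
\<close>

definition projective_resolution ::
  "('o, 'm, 'x) addcat_scheme \<Rightarrow> ('m \<times> 'm) set \<Rightarrow> 'o \<Rightarrow> ('o, 'm) cpx \<times> 'm \<Rightarrow> bool" where
  "projective_resolution C E A = (\<lambda>(X, e). is_complex C (Proj C E) X \<and> right_bounded_at C X 0 \<and>
     (\<exists>Y a b. acyclic_below C E X 0 Y a b \<and> Y 0 = A \<and> b 0 = e))"

definition resolution_choice ::
  "('o, 'm, 'x) addcat_scheme \<Rightarrow> ('m \<times> 'm) set \<Rightarrow> ('o \<Rightarrow> ('o, 'm) cpx \<times> 'm) \<Rightarrow> bool" where
  "resolution_choice C E \<rho> \<longleftrightarrow> (\<forall>A\<in>Ob C. projective_resolution C E A (\<rho> A))"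

definition resolution_ob :: "('o \<Rightarrow> ('o, 'm) cpx \<times> 'm) \<Rightarrow> 'o \<Rightarrow> ('o, 'm) cpx" where
  "resolution_ob \<rho> A = fst (\<rho> A)"

definition resolution_arr ::
  "('o, 'm, 'x) addcat_scheme \<Rightarrow> ('o \<Rightarrow> ('o, 'm) cpx \<times> 'm) \<Rightarrow> 'm \<Rightarrow> ('o, 'm) karr" where
  "resolution_arr C \<rho> f =
     (let (X, e) = \<rho> (Dom C f); (X', e') = \<rho> (Cod C f)
      in (X, X', {\<phi>. chain_map C X X' \<phi> \<and> e' \<cdot>\<^bsub>C\<^esub> \<phi> 0 = f \<cdot>\<^bsub>C\<^esub> e}))"

text \<open>The Verdier quotient of \<open>K\<^sup>-\<^sup>b(P)\<close> by \<open>K\<^sup>b(P)\<close>.\<close>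

definition KminusbTri ::
  "('o, 'm, 'x) addcat_scheme \<Rightarrow> ('m \<times> 'm) set \<Rightarrow> (('o, 'm) cpx, ('o, 'm) karr) tricat" where
  "KminusbTri C E = full_sub (KP C E) (Kminusb C E)"

definition singularity_cat :: "('o, 'm, 'x) addcat_scheme \<Rightarrow> ('m \<times> 'm) set
    \<Rightarrow> (('o, 'm) cpx, (('o, 'm) cpx, ('o, 'm) karr) varr) tricat" where
  "singularity_cat C E = verdier (KminusbTri C E) (Kb C E)"

end

theory Submission
  imports Defs
begin

text \<open>
  The triangulated structure of \<open>K(P)\<close> is built by calculations in a ring containing all graded hom
  groups, and is reused for the homotopy category of all complexes over \<open>C\<close>.

  For the decomposition, suppose that \<open>X\<close> is acyclic in degrees below some \<open>m < 0\<close>. Splicing in an injective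
  hull in degree \<open>m + 1\<close> extends the range of acyclicity by one degree and changes \<open>X\<close> only by an object
  of \<open>Kneg\<close>; once the range reaches degree \<open>0\<close>, brutal truncation leaves a part in \<open>Kpos\<close> and a
  resolution. The maps that have to vanish do so by induction on the degree, because maps into
  projective-injective objects extend along inflations.

  For the equivalence, the decomposition shows that every object becomes isomorphic to a resolution.
  A map from a resolution to a bounded complex factors through a bounded complex in degrees \<open>\<ge> 0\<close>, so
  that every roof between resolutions can be replaced by a map of complexes, and a map killed in the
  quotient comes from a map of \<open>C\<close> factoring through a projective object. Conflations give triangles, and the
  cosyzygy conflations give the isomorphism \<open>\<eta>\<close> with the shift.
\<close>

text \<open>The facts needed about triangles are collected in the locale \<open>triangulated\<close>
  and stated for standard triangles; general lemmas then move them to all isomorphic ones. The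
  octahedral axiom serves two purposes, to compose denominators and to combine the successive steps
  of the decomposition. Both concern only the cones, so it is stated without the usual
  compatibilities. Resolutions are compared in the homotopy category over all of \<open>C\<close>
  because there an augmentation is a morphism. Projectives placed in any single degree have no maps
  to its cone, so existence and uniqueness of lifts both become the vanishing of maps into that
  cone. The relation defining the stable category turns out to be equality after the functor to the
  Verdier quotient. The laws of the stable category are read off from this. Its shift is well
  defined by naturality of \<open>\<eta>\<close>, and the induced functor is faithful from the
  outset.\<close>

notation Cmp (infixl "**\<index>" 70)

section \<open>Additive categories inside rings\<close>

lemma homI: "f : Arr C ==> Dom C f = X ==> Cod C f = Y ==> f : hom C X Y"
  by (simp add: hom_def)

lemma hom_Arr: "f : hom C X Y ==> f : Arr C"
  and hom_Dom: "f : hom C X Y ==> Dom C f = X"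
  and hom_Cod: "f : hom C X Y ==> Cod C f = Y"
  by (simp_all add: hom_def)

lemma Arr_hom: "f : Arr C ==> f : hom C (Dom C f) (Cod C f)"
  by (simp add: hom_def)

context category
begin

lemma hom_Ob1: "f : hom C X Y ==> X : Ob C"
  and hom_Ob2: "f : hom C X Y ==> Y : Ob C"
  using Dom_in_Ob Cod_in_Ob by (auto simp: hom_def)

lemmas comp = Cmp_in_hom and assoc = Cmp_assoc and id_left = Cmp_Ident_left and id_right = Cmp_Ident_right
  and id_hom = Ident_in_hom

lemma Cmp_in_Arr: "f : Arr C ==> g : Arr C ==> Cod C f = Dom C g ==> g ** f : hom C (Dom C f) (Cod C g)"
  by (rule comp) (auto simp: hom_def)

lemma Arr_Cmp: "f : Arr C ==> g : Arr C ==> Cod C f = Dom C g ==> g ** f : Arr C"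
  and Dom_Cmp: "f : Arr C ==> g : Arr C ==> Cod C f = Dom C g ==> Dom C (g ** f) = Dom C f"
  and Cod_Cmp: "f : Arr C ==> g : Arr C ==> Cod C f = Dom C g ==> Cod C (g ** f) = Cod C g"
  using Cmp_in_Arr by (auto simp: hom_def)

lemma Cmp_assoc': "f : Arr C ==> g : Arr C ==> h : Arr C ==> Cod C f = Dom C g ==> Cod C g = Dom C h
    ==> (h ** g) ** f = h ** (g ** f)"
  by (rule assoc) (auto simp: hom_def)

lemma Ident_Cmp: "f : Arr C ==> Cod C f = Y ==> Ident C Y ** f = f"
  and Cmp_Ident: "f : Arr C ==> Dom C f = X ==> f ** Ident C X = f"
  using id_left id_right by (auto simp: hom_def)

lemmas cat_simps = Arr_Cmp Dom_Cmp Cod_Cmp Cmp_assoc' Ident_Cmp Cmp_Ident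

lemma isoI:
  "f : hom C X Y ==> g : hom C Y X ==> g ** f = Ident C X ==> f ** g = Ident C Y ==> iso C f"
  by (auto simp: iso_def hom_def)

lemma isoE:
  assumes "iso C f" "f : hom C X Y"
  obtains g where "g : hom C Y X" "g ** f = Ident C X" "f ** g = Ident C Y"
  using assms by (auto simp: iso_def hom_def)

lemma iso_Ident: "X : Ob C ==> iso C (Ident C X)"
  by (rule isoI[OF id_hom id_hom]) (auto intro: id_left id_hom)

lemma iso_Cmp:
  assumes "iso C f" "iso C g" "f : hom C X Y" "g : hom C Y Z"
  shows "iso C (g ** f)"
proof -
  obtain f' where f': "f' : hom C Y X" "f' ** f = Ident C X" "f ** f' = Ident C Y"
    by (rule isoE[OF assms(1,3)])
  obtain g' where g': "g' : hom C Z Y" "g' ** g = Ident C Y" "g ** g' = Ident C Z"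
    by (rule isoE[OF assms(2,4)])
  have "(f' ** g') ** (g ** f) = f' ** ((g' ** g) ** f)"
    using assms(3,4) f'(1) g'(1) by (simp add: hom_def cat_simps)
  moreover have "(g ** f) ** (f' ** g') = g ** ((f ** f') ** g')"
    using assms(3,4) f'(1) g'(1) by (simp add: hom_def cat_simps)
  ultimately show ?thesis
    using f' g' assms
    by (intro isoI[OF comp[OF assms(3,4)] comp[OF g'(1) f'(1)]])
      (auto simp: id_left[OF assms(3)] id_left[OF g'(1)])
qed

lemma iso_inverse:
  assumes "iso C f" "f : hom C X Y" "g : hom C Y X" "g ** f = Ident C X" "f ** g = Ident C Y"
  shows "iso C g"
  using assms by (intro isoI[of g Y X f])

lemma isomorphic_refl: "X : Ob C ==> isomorphic C X X"
  using iso_Ident id_hom by (auto simp: isomorphic_def)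

lemma isomorphic_sym:
  assumes "isomorphic C X Y" shows "isomorphic C Y X"
proof -
  obtain f where f: "f : hom C X Y" "iso C f"
    using assms by (auto simp: isomorphic_def)
  obtain g where "g : hom C Y X" "g ** f = Ident C X" "f ** g = Ident C Y"
    by (rule isoE[OF f(2,1)])
  with iso_inverse[OF f(2,1)] show ?thesis
    by (auto simp: isomorphic_def)
qed

lemma isomorphic_trans: "isomorphic C X Y ==> isomorphic C Y Z ==> isomorphic C X Z"
  unfolding isomorphic_def using iso_Cmp comp by metis

lemma isomorphic_Ob: "isomorphic C X Y ==> X : Ob C \<and> Y : Ob C"
  unfolding isomorphic_def using hom_Ob1 hom_Ob2 by metis

lemma zero_object_isomorphic:
  assumes "zero_object C Z" "zero_object C Z'" shows "isomorphic C Z Z'"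
proof -
  have Z: "Z : Ob C" "Z' : Ob C" using assms by (auto simp: zero_object_def)
  obtain f g where f: "f : hom C Z Z'" and g: "g : hom C Z' Z"
    using assms Z unfolding zero_object_def by metis
  have "g ** f = Ident C Z" "f ** g = Ident C Z'"
    using assms Z comp[OF f g] comp[OF g f] id_hom unfolding zero_object_def by metis+
  then show ?thesis using isoI[OF f g] f by (auto simp: isomorphic_def)
qed

end

context additive_category
begin

lemmas add_hom = Add_in_hom and zero_hom = Zero_in_hom and add_left = Cmp_Add_left and add_right = Cmp_Add_right

lemma Zero_Add: "f : hom C X Y ==> Zero C X Y \<oplus> f = f"
  using Add_Zero Add_commute zero_hom hom_Ob1 hom_Ob2 by metis

lemma Add_cancel:
  assumes "f : hom C X Y" "g : hom C X Y" "h : hom C X Y" "h \<oplus> f = h \<oplus> g"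
  shows "f = g"
proof -
  obtain k where k: "k : hom C X Y" "h \<oplus> k = Zero C X Y" using Add_inverse assms by blast
  have "k \<oplus> h = Zero C X Y" using k Add_commute assms by metis
  then have "f = (k \<oplus> h) \<oplus> f" "g = (k \<oplus> h) \<oplus> g" using Zero_Add assms by simp_all
  then show ?thesis using Add_assoc k assms by metis
qed

lemma Neg_unique:
  assumes "f : hom C X Y" "g : hom C X Y" "f \<oplus> g = Zero C X Y"
  shows "Neg C f = g"
  unfolding Neg_def
proof (rule the_equality)
  show "g : hom C (Dom C f) (Cod C f) \<and> f \<oplus> g = Zero C (Dom C f) (Cod C f)"
    using assms by (auto simp: hom_def)
next
  fix h assume h: "h : hom C (Dom C f) (Cod C f) \<and> f \<oplus> h = Zero C (Dom C f) (Cod C f)"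
  then have "h : hom C X Y" "f \<oplus> h = Zero C X Y" using assms(1) by (auto simp: hom_def)
  then show "h = g" using Add_cancel assms by metis
qed

lemma neg_hom: "f : hom C X Y ==> Neg C f : hom C X Y"
  and Add_Neg: "f : hom C X Y ==> f \<oplus> Neg C f = Zero C X Y"
  using Add_inverse Neg_unique by (metis, metis)

lemma zero_right:
  assumes "g : hom C Y Z" "X : Ob C" shows "g ** Zero C X Y = Zero C X Z"
proof -
  have z: "Zero C X Y : hom C X Y" using assms zero_hom hom_Ob1 by blast
  have "(g ** Zero C X Y) \<oplus> (g ** Zero C X Y) = (g ** Zero C X Y) \<oplus> Zero C X Z"
    using add_right[OF z z assms(1)] Add_Zero z comp[OF z assms(1)] by metis
  then show ?thesis using Add_cancel comp[OF z assms(1)] zero_hom assms hom_Ob2 by metis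
qed

lemma zero_left:
  assumes "f : hom C X Y" "Z : Ob C" shows "Zero C Y Z ** f = Zero C X Z"
proof -
  have z: "Zero C Y Z : hom C Y Z" using assms zero_hom hom_Ob2 by blast
  have "(Zero C Y Z ** f) \<oplus> (Zero C Y Z ** f) = (Zero C Y Z ** f) \<oplus> Zero C X Z"
    using add_left[OF assms(1) z z] Add_Zero z comp[OF assms(1) z] by metis
  then show ?thesis using Add_cancel comp[OF assms(1) z] zero_hom assms hom_Ob1 by metis
qed

end

text \<open>Composition is the multiplication. The instance is for \<open>ring\<close>, without a
  one: the identity of an object is represented by an idempotent (\<open>gone\<close>) and acts as a
  unit only on its own hom groups.\<close>

typedef (overloaded) ('a::ab_group_add) addend = "{h :: 'a => 'a. \<forall>x y. h (x + y) = h x + h y}"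
  by (rule exI[of _ id]) simp

setup_lifting type_definition_addend

instantiation addend :: (ab_group_add) ring
begin

lift_definition zero_addend :: "'a addend" is "\<lambda>x. 0" by simp
lift_definition plus_addend :: "'a addend => 'a addend => 'a addend" is "\<lambda>f g x. f x + g x"
  by (simp add: algebra_simps)
lift_definition uminus_addend :: "'a addend => 'a addend" is "\<lambda>f x. - f x" by simp
lift_definition minus_addend :: "'a addend => 'a addend => 'a addend" is "\<lambda>f g x. f x - g x"
  by (simp add: algebra_simps)
lift_definition times_addend :: "'a addend => 'a addend => 'a addend" is "\<lambda>f g x. f (g x)" by simp

instance
  by standard (transfer, simp add: algebra_simps)+

end

text \<open>
  The hom groups of all additive categories on given carrier types are collected in one abelian
  group, so that arrows act on it by composition. This makes arrows, and graded families of
  arrows, elements of a type of class \<open>ring\<close>, where identities between them can be checked by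
  ring normalisation.
\<close>

definition gen_hom :: "('o, 'm, 'x) addcat_scheme => 'o => 'o => 'm set" where
  "gen_hom C W Y = (if additive_category C \<and> W : Ob C \<and> Y : Ob C then hom C W Y else {undefined})"

text \<open>A type cannot depend on a category fixed by a locale, so the category is an index of the
  product like the two objects. At indices without meaning \<open>gen_hom\<close> is a trivial group
  on \<open>undefined\<close>, so the group laws hold without side conditions. The integer is a
  degree; it lets families of nonzero degree act by moving between degrees.\<close>

typedef ('o, 'm, 'x) genel =
  "{F :: ('o, 'm, 'x) addcat_scheme => 'o => 'o => int => 'm. \<forall>C W Y k. F C W Y k : gen_hom C W Y}"
  by (rule exI[of _ "\<lambda>C W Y k. if additive_category C \<and> W : Ob C \<and> Y : Ob C then Zero C W Y else undefined"])
    (simp add: gen_hom_def additive_category.zero_hom)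

setup_lifting type_definition_genel

definition gen_add :: "('o, 'm, 'x) addcat_scheme => 'o => 'o => 'm => 'm => 'm" where
  "gen_add C W Y f g = (if additive_category C \<and> W : Ob C \<and> Y : Ob C then Add C f g else undefined)"

definition gen_zero :: "('o, 'm, 'x) addcat_scheme => 'o => 'o => 'm" where
  "gen_zero C W Y = (if additive_category C \<and> W : Ob C \<and> Y : Ob C then Zero C W Y else undefined)"

definition gen_neg :: "('o, 'm, 'x) addcat_scheme => 'o => 'o => 'm => 'm" where
  "gen_neg C W Y f = (if additive_category C \<and> W : Ob C \<and> Y : Ob C then Neg C f else undefined)"

lemma gen_not_additive:
  assumes "\<not> (additive_category C \<and> W : Ob C \<and> Y : Ob C)"
  shows "gen_hom C W Y = {undefined}" "gen_add C W Y f g = undefined" "gen_zero C W Y = undefined"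
    "gen_neg C W Y f = undefined"
  using assms by (simp_all only: gen_hom_def gen_add_def gen_zero_def gen_neg_def if_False)

lemma gen_additive:
  assumes "additive_category C \<and> W : Ob C \<and> Y : Ob C"
  shows "gen_hom C W Y = hom C W Y" "gen_add C W Y f g = Add C f g" "gen_zero C W Y = Zero C W Y"
    "gen_neg C W Y f = Neg C f"
  using assms by (simp_all only: gen_hom_def gen_add_def gen_zero_def gen_neg_def if_True simp_thms)

lemma gen_add_closed:
  assumes "f : gen_hom C W Y" "g : gen_hom C W Y" shows "gen_add C W Y f g : gen_hom C W Y"
proof (cases "additive_category C \<and> W : Ob C \<and> Y : Ob C")
  case True
  with assms show ?thesis
    by (simp only: gen_additive[OF True] additive_category.add_hom)
next
  case False
  with assms show ?thesis unfolding gen_not_additive[OF False] by blast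
qed

lemma gen_zero_closed: "gen_zero C W Y : gen_hom C W Y"
proof (cases "additive_category C \<and> W : Ob C \<and> Y : Ob C")
  case True
  then show ?thesis
    by (simp only: gen_additive[OF True] additive_category.zero_hom)
next
  case False
  show ?thesis unfolding gen_not_additive[OF False] by blast
qed

lemma gen_neg_closed:
  assumes "f : gen_hom C W Y" shows "gen_neg C W Y f : gen_hom C W Y"
proof (cases "additive_category C \<and> W : Ob C \<and> Y : Ob C")
  case True
  with assms show ?thesis
    by (simp only: gen_additive[OF True] additive_category.neg_hom)
next
  case False
  with assms show ?thesis unfolding gen_not_additive[OF False] by blast
qed

lemma gen_add_assoc:
  assumes "f : gen_hom C W Y" "g : gen_hom C W Y" "h : gen_hom C W Y"
  shows "gen_add C W Y (gen_add C W Y f g) h = gen_add C W Y f (gen_add C W Y g h)"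
proof (cases "additive_category C \<and> W : Ob C \<and> Y : Ob C")
  case True
  with assms show ?thesis
    unfolding gen_additive[OF True] by (elim conjE) (rule additive_category.Add_assoc)
next
  case False
  with assms show ?thesis unfolding gen_not_additive[OF False] by blast
qed

lemma gen_add_commute:
  assumes "f : gen_hom C W Y" "g : gen_hom C W Y"
  shows "gen_add C W Y f g = gen_add C W Y g f"
proof (cases "additive_category C \<and> W : Ob C \<and> Y : Ob C")
  case True
  with assms show ?thesis
    unfolding gen_additive[OF True] by (elim conjE) (rule additive_category.Add_commute)
next
  case False
  with assms show ?thesis unfolding gen_not_additive[OF False] by blast
qed

lemma gen_zero_add:
  assumes "f : gen_hom C W Y" shows "gen_add C W Y (gen_zero C W Y) f = f"
proof (cases "additive_category C \<and> W : Ob C \<and> Y : Ob C")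
  case True
  with assms show ?thesis
    unfolding gen_additive[OF True] by (elim conjE) (rule additive_category.Zero_Add)
next
  case False
  with assms show ?thesis unfolding gen_not_additive[OF False] by blast
qed

lemma gen_neg_add:
  assumes "f : gen_hom C W Y" shows "gen_add C W Y (gen_neg C W Y f) f = gen_zero C W Y"
proof (cases "additive_category C \<and> W : Ob C \<and> Y : Ob C")
  case True
  have "gen_add C W Y f (gen_neg C W Y f) = gen_zero C W Y"
    using assms True unfolding gen_additive[OF True] by (elim conjE) (rule additive_category.Add_Neg)
  then show ?thesis
    using gen_add_commute assms gen_neg_closed by metis
next
  case False
  with assms show ?thesis unfolding gen_not_additive[OF False] by blast
qed

instantiation genel :: (type, type, type) ab_group_add
begin

lift_definition zero_genel :: "('a, 'b, 'c) genel" is "\<lambda>C W Y k. gen_zero C W Y"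
  by (rule gen_zero_closed)

lift_definition plus_genel :: "('a, 'b, 'c) genel => ('a, 'b, 'c) genel => ('a, 'b, 'c) genel"
  is "\<lambda>F G C W Y k. gen_add C W Y (F C W Y k) (G C W Y k)"
  by (simp add: gen_add_closed)

lift_definition uminus_genel :: "('a, 'b, 'c) genel => ('a, 'b, 'c) genel"
  is "\<lambda>F C W Y k. gen_neg C W Y (F C W Y k)"
  by (simp add: gen_neg_closed)

definition minus_genel :: "('a, 'b, 'c) genel => ('a, 'b, 'c) genel => ('a, 'b, 'c) genel" where
  "minus_genel F G = F + - G"

instance
proof
  fix a b c :: "('a, 'b, 'c) genel"
  show "a + b + c = a + (b + c)"
    by transfer (intro ext gen_add_assoc; simp)
  show "a + b = b + a"
    by transfer (intro ext gen_add_commute; simp)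
  show "0 + a = a"
    by transfer (intro ext gen_zero_add; simp)
  show "- a + a = 0"
    by transfer (intro ext gen_neg_add; simp)
  show "a - b = a + - b" by (rule minus_genel_def)
qed

end

definition fam :: "('o, 'm, 'x) addcat_scheme => (int => 'o) => (int => 'o) => int => (int => 'm) => bool" where
  "fam C X Y n \<phi> \<longleftrightarrow> (\<forall>i. \<phi> i : hom C (X i) (Y (i + n)))"

text \<open>Postcomposition with the family: the component into \<open>Y k\<close> in degree
  \<open>k\<close> is computed from the component into \<open>X (k - n)\<close> in degree
  \<open>k - n\<close>, and every other component becomes zero. This is the Yoneda embedding with
  all test objects \<open>W\<close> at once.\<close>

definition gr_act :: "('o, 'm, 'x) addcat_scheme => (int => 'o) => (int => 'o) => int => (int => 'm) =>
    (('o, 'm, 'x) addcat_scheme => 'o => 'o => int => 'm) => ('o, 'm, 'x) addcat_scheme => 'o => 'o => int => 'm" where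
  "gr_act C X Y n \<phi> F = (\<lambda>C' W Z k. if C' = C \<and> Z = Y k \<and> W : Ob C
     then \<phi> (k - n) **\<^bsub>C\<^esub> F C W (X (k - n)) (k - n) else gen_zero C' W Z)"

definition gr :: "('o, 'm, 'x) addcat_scheme => (int => 'o) => (int => 'o) => int => (int => 'm)
    => ('o, 'm, 'x) genel addend" where
  "gr C X Y n \<phi> = Abs_addend (\<lambda>F. Abs_genel (gr_act C X Y n \<phi> (Rep_genel F)))"

definition gH :: "('o, 'm, 'x) addcat_scheme => (int => 'o) => (int => 'o) => int => ('o, 'm, 'x) genel addend set" where
  "gH C X Y n = gr C X Y n ` {\<phi>. fam C X Y n \<phi>}"

lemma famD: "fam C X Y n \<phi> ==> \<phi> i : hom C (X i) (Y (i + n))"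
  by (simp add: fam_def)

lemma famD': "fam C X Y n \<phi> ==> \<phi> (i - n) : hom C (X (i - n)) (Y i)"
  by (metis famD diff_add_cancel)

lemma Rep_genel_hom:
  "additive_category C ==> W : Ob C ==> Y : Ob C ==> Rep_genel F C W Y k : hom C W Y"
  using Rep_genel[of F] gen_additive(1)[of C W Y] by auto

lemma Rep_genel_plus: "Rep_genel (F + G) C W Y k = gen_add C W Y (Rep_genel F C W Y k) (Rep_genel G C W Y k)"
  by transfer simp

lemma addend_eqI: "(\<And>F C W Z k. Rep_genel (Rep_addend a F) C W Z k = Rep_genel (Rep_addend b F) C W Z k) ==> a = b"
  by (subst Rep_addend_inject[symmetric], rule ext, subst Rep_genel_inject[symmetric]) (intro ext)

lemma Rep_addend_ops:
  "Rep_addend (a * b) F = Rep_addend a (Rep_addend b F)"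
  "Rep_addend (a + b) F = Rep_addend a F + Rep_addend b F"
  "Rep_addend 0 F = 0"
  by (transfer, simp)+

context additive_category
begin

lemma fam_Ob1: "fam C X Y n \<phi> ==> X i : Ob C"
  using famD hom_Ob1 by metis

lemma fam_Ob2: "fam C X Y n \<phi> ==> Y i : Ob C"
  using famD' hom_Ob2 by metis

lemma gr_act_closed:
  assumes "fam C X Y n \<phi>"
  shows "gr_act C X Y n \<phi> (Rep_genel F) C' W Z k : gen_hom C' W Z"
proof (cases "C' = C \<and> Z = Y k \<and> W : Ob C")
  case True
  have "\<phi> (k - n) ** Rep_genel F C W (X (k - n)) (k - n) : hom C W (Y k)"
    by (rule comp[OF Rep_genel_hom famD'[OF assms]]) (use additive_category_axioms True fam_Ob1[OF assms] in auto)
  moreover have "gen_hom C W (Y k) = hom C W (Y k)"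
    using gen_additive(1) additive_category_axioms True fam_Ob2[OF assms] by metis
  ultimately show ?thesis using True by (simp add: gr_act_def)
next
  case False
  then show ?thesis unfolding gr_act_def using gen_zero_closed by (simp only: if_False)
qed

text \<open>Postcomposition preserves hom groups and sums, so both abstraction functions in
  \<open>gr\<close> can be undone. The product, sum and injectivity rules for \<open>gr\<close>
  evaluate through this formula.\<close>

lemma Rep_gr:
  assumes "fam C X Y n \<phi>"
  shows "Rep_genel (Rep_addend (gr C X Y n \<phi>) F) C' W Z k =
    (if C' = C \<and> Z = Y k \<and> W : Ob C then \<phi> (k - n) ** Rep_genel F C W (X (k - n)) (k - n) else gen_zero C' W Z)"
proof -
  have R: "Rep_genel (Abs_genel (gr_act C X Y n \<phi> (Rep_genel F))) = gr_act C X Y n \<phi> (Rep_genel F)" for F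
    using gr_act_closed[OF assms] by (intro Abs_genel_inverse) blast
  have add: "gr_act C X Y n \<phi> (Rep_genel (F + G)) C' W Z k =
      gen_add C' W Z (gr_act C X Y n \<phi> (Rep_genel F) C' W Z k) (gr_act C X Y n \<phi> (Rep_genel G) C' W Z k)"
    for F G C' W Z k
  proof (cases "C' = C \<and> Z = Y k \<and> W : Ob C")
    case True
    then have ob: "additive_category C \<and> W : Ob C \<and> X (k - n) : Ob C" "additive_category C \<and> W : Ob C \<and> Y k : Ob C"
      using additive_category_axioms fam_Ob1[OF assms] fam_Ob2[OF assms] by auto
    have r: "Rep_genel H C W (X (k - n)) (k - n) : hom C W (X (k - n))" for H
      by (rule Rep_genel_hom) (use ob(1) in auto)
    show ?thesis
      using True add_right[OF r[of F] r[of G] famD'[OF assms]]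
      by (simp add: gr_act_def Rep_genel_plus gen_additive(2)[OF ob(1)] gen_additive(2)[OF ob(2)])
  next
    case False
    then show ?thesis unfolding gr_act_def
      by (simp only: if_False gen_zero_add gen_zero_closed)
  qed
  have "Rep_addend (gr C X Y n \<phi>) = (\<lambda>F. Abs_genel (gr_act C X Y n \<phi> (Rep_genel F)))"
    unfolding gr_def
  proof (rule Abs_addend_inverse, rule CollectI, intro allI)
    fix F G
    show "Abs_genel (gr_act C X Y n \<phi> (Rep_genel (F + G))) =
      Abs_genel (gr_act C X Y n \<phi> (Rep_genel F)) + Abs_genel (gr_act C X Y n \<phi> (Rep_genel G))"
      by (subst Rep_genel_inject[symmetric], intro ext) (simp only: Rep_genel_plus R add)
  qed
  then show ?thesis by (simp only: R) (simp only: gr_act_def)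
qed

lemma fam_Cmp:
  assumes "fam C X Y n \<phi>" "fam C Y Z m \<psi>" shows "fam C X Z (n + m) (\<lambda>i. \<psi> (i + n) ** \<phi> i)"
  unfolding fam_def using comp[OF famD[OF assms(1)] famD[OF assms(2)]] by (simp add: add.assoc)

lemma fam_Add: "fam C X Y n \<phi> ==> fam C X Y n \<psi> ==> fam C X Y n (\<lambda>i. \<phi> i \<oplus> \<psi> i)"
  by (simp add: fam_def add_hom)

lemma fam_Zero: "(\<And>i. X i : Ob C) ==> (\<And>i. Y i : Ob C) ==> fam C X Y n (\<lambda>i. Zero C (X i) (Y (i + n)))"
  by (simp add: fam_def zero_hom)

lemma fam_Neg: "fam C X Y n \<phi> ==> fam C X Y n (\<lambda>i. Neg C (\<phi> i))"
  by (simp add: fam_def neg_hom)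

lemma gr_mult:
  assumes "fam C X Y n \<phi>" "fam C Y Z m \<psi>"
  shows "gr C Y Z m \<psi> * gr C X Y n \<phi> = gr C X Z (n + m) (\<lambda>i. \<psi> (i + n) ** \<phi> i)"
proof (rule addend_eqI)
  fix F C' W Z' k
  show "Rep_genel (Rep_addend (gr C Y Z m \<psi> * gr C X Y n \<phi>) F) C' W Z' k =
    Rep_genel (Rep_addend (gr C X Z (n + m) (\<lambda>i. \<psi> (i + n) ** \<phi> i)) F) C' W Z' k"
  proof (cases "C' = C \<and> Z' = Z k \<and> W : Ob C")
    case True
    have "Rep_genel F C W (X (k - m - n)) (k - m - n) : hom C W (X (k - m - n))"
      by (rule Rep_genel_hom) (use additive_category_axioms True fam_Ob1[OF assms(1)] in auto)
    then have "(\<psi> (k - m) ** \<phi> (k - m - n)) ** Rep_genel F C W (X (k - m - n)) (k - m - n) =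
        \<psi> (k - m) ** (\<phi> (k - m - n) ** Rep_genel F C W (X (k - m - n)) (k - m - n))"
      using assoc famD'[OF assms(1), of "k - m"] famD'[OF assms(2), of k] by metis
    moreover have ix: "k - (n + m) + n = k - m" "k - (n + m) = k - m - n" by simp_all
    ultimately show ?thesis
      using True by (simp del: diff_diff_eq add: ix Rep_addend_ops Rep_gr[OF assms(1)] Rep_gr[OF assms(2)] Rep_gr[OF fam_Cmp[OF assms]])
  next
    case False
    show ?thesis unfolding Rep_addend_ops Rep_gr[OF assms(2)] Rep_gr[OF fam_Cmp[OF assms]] if_not_P[OF False] ..
  qed
qed

lemma gr_add:
  assumes "fam C X Y n \<phi>" "fam C X Y n \<psi>"
  shows "gr C X Y n \<phi> + gr C X Y n \<psi> = gr C X Y n (\<lambda>i. \<phi> i \<oplus> \<psi> i)"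
proof (rule addend_eqI)
  fix F C' W Z' k
  show "Rep_genel (Rep_addend (gr C X Y n \<phi> + gr C X Y n \<psi>) F) C' W Z' k =
    Rep_genel (Rep_addend (gr C X Y n (\<lambda>i. \<phi> i \<oplus> \<psi> i)) F) C' W Z' k"
  proof (cases "C' = C \<and> Z' = Y k \<and> W : Ob C")
    case True
    have r: "Rep_genel F C W (X (k - n)) (k - n) : hom C W (X (k - n))"
      by (rule Rep_genel_hom) (use additive_category_axioms True fam_Ob1[OF assms(1)] in auto)
    have ob: "additive_category C \<and> W : Ob C \<and> Y k : Ob C"
      using True additive_category_axioms fam_Ob2[OF assms(1)] by auto
    show ?thesis
      using True add_left[OF r famD'[OF assms(1)] famD'[OF assms(2)]]
      by (simp add: Rep_addend_ops Rep_genel_plus gen_additive(2)[OF ob] Rep_gr[OF assms(1)] Rep_gr[OF assms(2)] Rep_gr[OF fam_Add[OF assms]])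
  next
    case False
    show ?thesis unfolding Rep_addend_ops Rep_genel_plus Rep_gr[OF assms(1)] Rep_gr[OF assms(2)]
        Rep_gr[OF fam_Add[OF assms]] if_not_P[OF False] by (rule gen_zero_add[OF gen_zero_closed])
  qed
qed

text \<open>Adding the zero family to itself changes nothing, and an element z with z + z = z
  vanishes.\<close>

lemma gr_zero:
  assumes "\<And>i. X i : Ob C" "\<And>i. Y i : Ob C"
  shows "gr C X Y n (\<lambda>i. Zero C (X i) (Y (i + n))) = 0"
proof -
  let ?z = "gr C X Y n (\<lambda>i. Zero C (X i) (Y (i + n)))"
  have f: "fam C X Y n (\<lambda>i. Zero C (X i) (Y (i + n)))" using fam_Zero assms by blast
  have "?z + ?z = ?z"
    using gr_add[OF f f] Add_Zero[OF zero_hom] assms by simp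
  then show ?thesis by simp
qed

lemma gr_neg:
  assumes "fam C X Y n \<phi>" shows "gr C X Y n (\<lambda>i. Neg C (\<phi> i)) = - gr C X Y n \<phi>"
proof -
  have "gr C X Y n \<phi> + gr C X Y n (\<lambda>i. Neg C (\<phi> i)) = 0"
    using gr_add[OF assms fam_Neg[OF assms]] gr_zero[OF fam_Ob1[OF assms] fam_Ob2[OF assms]] Add_Neg[OF famD[OF assms]] by simp
  then show ?thesis by (simp add: eq_neg_iff_add_eq_0 add.commute)
qed

lemma gr_inj:
  assumes "fam C X Y n \<phi>" "fam C X Y n \<psi>" "gr C X Y n \<phi> = gr C X Y n \<psi>"
  shows "\<phi> = \<psi>"
proof
  fix i
  \<comment> \<open>A universal element: the identity of \<open>X i\<close> in every degree and zero
    at all other objects. Applying a family to it and reading off the component at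
    \<open>Y (i + n)\<close> returns the arrow in position \<open>i\<close>.\<close>
  define F where "F = (\<lambda>C' W Z (k::int). if C' = C \<and> W = X i \<and> Z = X i then Ident C (X i) else gen_zero C' W Z)"
  have ob: "X i : Ob C" using fam_Ob1[OF assms(1)] .
  have "F C' W Z k : gen_hom C' W Z" for C' W Z k
  proof (cases "C' = C \<and> W = X i \<and> Z = X i")
    case True
    have "gen_hom C (X i) (X i) = hom C (X i) (X i)"
      using gen_additive(1) additive_category_axioms ob by metis
    then show ?thesis using True id_hom[OF ob] by (simp add: F_def)
  next
    case False
    then show ?thesis unfolding F_def by (simp only: if_False gen_zero_closed)
  qed
  then have "Rep_genel (Abs_genel F) = F"
    by (intro Abs_genel_inverse) blast
  then have "Rep_genel (Rep_addend (gr C X Y n \<phi>) (Abs_genel F)) C (X i) (Y (i + n)) (i + n) = \<phi> i ** Ident C (X i)"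
    "Rep_genel (Rep_addend (gr C X Y n \<psi>) (Abs_genel F)) C (X i) (Y (i + n)) (i + n) = \<psi> i ** Ident C (X i)"
    using ob by (simp_all add: Rep_gr[OF assms(1)] Rep_gr[OF assms(2)] F_def)
  then show "\<phi> i = \<psi> i"
    using assms(3) id_right famD[OF assms(1)] famD[OF assms(2)] by metis
qed

subsection \<open>Graded hom groups\<close>

lemma gHE:
  assumes "a : gH C X Y n" obtains \<phi> where "fam C X Y n \<phi>" "a = gr C X Y n \<phi>"
  using assms by (auto simp: gH_def)

lemma gHI: "fam C X Y n \<phi> ==> gr C X Y n \<phi> : gH C X Y n"
  by (simp add: gH_def)

lemma gH_mult: "b : gH C Y Z m ==> a : gH C X Y n ==> k = n + m ==> b * a : gH C X Z k"
  by (elim gHE) (simp add: gr_mult gHI fam_Cmp)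

lemma gH_add: "a : gH C X Y n ==> b : gH C X Y n ==> a + b : gH C X Y n"
  by (elim gHE) (simp add: gr_add gHI fam_Add)

lemma gH_neg: "a : gH C X Y n ==> - a : gH C X Y n"
  by (elim gHE) (simp add: gr_neg[symmetric] gHI fam_Neg)

lemma gH_diff: "a : gH C X Y n ==> b : gH C X Y n ==> a - b : gH C X Y n"
  using gH_add[OF _ gH_neg] by fastforce

lemma gH_zero: "(\<And>i. X i : Ob C) ==> (\<And>i. Y i : Ob C) ==> 0 : gH C X Y n"
  using gHI[OF fam_Zero, of X Y n] gr_zero[of X Y n] by simp

definition gone :: "(int => 'o) => ('o, 'm, 'x) genel addend" where
  "gone X = gr C X X 0 (\<lambda>i. Ident C (X i))"

lemma fam_Ident: "(\<And>i. X i : Ob C) ==> fam C X X 0 (\<lambda>i. Ident C (X i))"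
  by (simp add: fam_def id_hom)

lemma gone_in_gH: "(\<And>i. X i : Ob C) ==> gone X : gH C X X 0"
  unfolding gone_def by (intro gHI fam_Ident)

lemma gone_left: "a : gH C X Y n ==> gone Y * a = a"
proof (elim gHE)
  fix \<phi> assume a: "fam C X Y n \<phi>" "a = gr C X Y n \<phi>"
  show "gone Y * a = a"
    unfolding a(2) gone_def gr_mult[OF a(1) fam_Ident[OF fam_Ob2[OF a(1)]]]
    by (simp add: id_left[OF famD[OF a(1)]])
qed

lemma gone_right: "a : gH C X Y n ==> a * gone X = a"
proof (elim gHE)
  fix \<phi> assume a: "fam C X Y n \<phi>" "a = gr C X Y n \<phi>"
  show "a * gone X = a"
    unfolding a(2) gone_def gr_mult[OF fam_Ident[OF fam_Ob1[OF a(1)]] a(1)]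
    by (simp add: id_right[OF famD[OF a(1)]])
qed

subsection \<open>Single arrows\<close>

text \<open>Identities between single arrows, in \<open>C\<close> or in any other additive category,
  can be checked by ring normalisation once the arrows are read as constant families of degree
  0.\<close>

definition emb :: "'m => ('o, 'm, 'x) genel addend" where
  "emb f = gr C (\<lambda>_. Dom C f) (\<lambda>_. Cod C f) 0 (\<lambda>_. f)"

lemma emb_Cmp: "f : hom C X Y ==> g : hom C Y Z ==> emb (g ** f) = emb g * emb f"
  using gr_mult[of "\<lambda>_. X" "\<lambda>_. Y" 0 "\<lambda>_. f" "\<lambda>_. Z" 0 "\<lambda>_. g"] comp[of f X Y g Z]
  by (simp add: emb_def fam_def hom_Dom hom_Cod)

lemma emb_Add: "f : hom C X Y ==> g : hom C X Y ==> emb (f \<oplus> g) = emb f + emb g"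
  using gr_add[of "\<lambda>_. X" "\<lambda>_. Y" 0 "\<lambda>_. f" "\<lambda>_. g"] add_hom[of f X Y g]
  by (simp add: emb_def fam_def hom_Dom hom_Cod)

lemma emb_Neg: "f : hom C X Y ==> emb (Neg C f) = - emb f"
  using gr_neg[of "\<lambda>_. X" "\<lambda>_. Y" 0 "\<lambda>_. f"] neg_hom[of f X Y]
  by (simp add: emb_def fam_def hom_Dom hom_Cod)

lemma emb_Zero: "X : Ob C ==> Y : Ob C ==> emb (Zero C X Y) = 0"
  using gr_zero[of "\<lambda>_. X" "\<lambda>_. Y" 0] zero_hom[of X Y]
  by (simp add: emb_def hom_Dom hom_Cod)

lemma emb_inj: "f : hom C X Y ==> g : hom C X Y ==> emb f = emb g ==> f = g"
  using gr_inj[of "\<lambda>_. X" "\<lambda>_. Y" 0 "\<lambda>_. f" "\<lambda>_. g"]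
  by (simp add: emb_def fam_def hom_Dom hom_Cod fun_eq_iff)

lemma emb_Ident_left: "f : hom C X Y ==> emb (Ident C Y) * emb f = emb f"
  using emb_Cmp[of f X Y "Ident C Y" Y] id_left id_hom hom_Ob2 by metis

lemma emb_Ident_right: "f : hom C X Y ==> emb f * emb (Ident C X) = emb f"
  using emb_Cmp[of "Ident C X" X X f Y] id_right id_hom hom_Ob1 by metis

end

section \<open>Complexes and chain maps\<close>

lemma saturate_simps [simp]:
  "Ob (saturate T) = Ob T" "Arr (saturate T) = Arr T" "Dom (saturate T) = Dom T" "Cod (saturate T) = Cod T"
  "Ident (saturate T) = Ident T" "Cmp (saturate T) = Cmp T" "Add (saturate T) = Add T"
  "Zero (saturate T) = Zero T" "ShOb (saturate T) = ShOb T" "ShArr (saturate T) = ShArr T"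
  by (simp_all add: saturate_def)

text \<open>Two instances are used: \<open>Proj C E\<close> for the theorem and \<open>Ob C\<close>
  for the comparison of resolutions. Closure under biproducts is what mapping cones and direct sums
  of complexes require.\<close>

locale complexes = additive_category C for C :: "('o, 'm, 'x) addcat_scheme" (structure) +
  fixes P :: "'o set"
  assumes P_Ob: "X : P ==> X : Ob C"
    and P_zero: "\<exists>Z\<in>P. zero_object C Z"
    and P_biproduct: "A : P ==> B : P ==> \<exists>W\<in>P. \<exists>i j p q. biproduct C A B W i j p q"
begin

abbreviation "cpl \<equiv> is_complex C P"
abbreviation "K \<equiv> homotopy_cat C P"
abbreviation K_Cmp_infix (infixl "**\<^sub>K" 70) where "g **\<^sub>K f \<equiv> Cmp K g f"
abbreviation "sh \<equiv> shift_cpx C"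
abbreviation "gm X Y \<equiv> gr C (cob X) (cob Y) 0"
abbreviation "fm X Y \<equiv> fam C (cob X) (cob Y) 0"
abbreviation "gh X Y \<equiv> gH C (cob X) (cob Y)"

definition df :: "('o, 'm) cpx => ('o, 'm, 'x) genel addend" where
  "df X = gr C (cob X) (cob X) 1 (cdiff X)"

definition chm :: "('o, 'm) cpx => ('o, 'm) cpx => ('o, 'm, 'x) genel addend set" where
  "chm X Y = {a \<in> gh X Y 0. a * df X = df Y * a}"

definition hty :: "('o, 'm) cpx => ('o, 'm) cpx => ('o, 'm, 'x) genel addend => ('o, 'm, 'x) genel addend => bool" where
  "hty X Y a b \<longleftrightarrow> a : chm X Y \<and> b : chm X Y \<and> (\<exists>s\<in>gh X Y (- 1). b = a + (df Y * s + s * df X))"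

text \<open>The ring counterpart of \<open>htpy\<close>: by \<open>htpy_cl\<close> both give the
  same arrow of \<open>K\<close>, so proofs about homotopy classes can stay in the ring.\<close>

definition cl :: "('o, 'm) cpx => ('o, 'm) cpx => ('o, 'm, 'x) genel addend => ('o, 'm) karr" where
  "cl X Y a = (X, Y, {\<phi>. fm X Y \<phi> \<and> hty X Y a (gm X Y \<phi>)})"

lemma cpl_Ob: "cpl X ==> cob X i : Ob C"
  and cpl_P: "cpl X ==> cob X i : P"
  using P_Ob by (auto simp: is_complex_def)

lemma cpl_fam: "cpl X ==> fam C (cob X) (cob X) 1 (cdiff X)"
  by (simp add: is_complex_def fam_def)

lemma df_in_gH: "cpl X ==> df X : gh X X 1"
  unfolding df_def by (intro gHI cpl_fam)

lemma df_df: "cpl X ==> df X * df X = 0"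
  unfolding df_def gr_mult[OF cpl_fam cpl_fam]
  using gr_zero[of "cob X" "cob X" 2] cpl_Ob[of X] by (simp add: is_complex_def)

lemma df_df_assoc: "cpl X ==> df X * (df X * a) = 0"
  by (simp add: mult.assoc[symmetric] df_df)

text \<open>Injectivity of \<open>gr\<close> turns the ring equation \<open>D * D = 0\<close> back
  into an equation of arrows, so differentials can be written down and checked as ring
  elements.\<close>

lemma cpl_eqI:
  assumes "\<And>i. W i : P" "D : gH C W W 1" "D * D = 0"
  obtains X where "cpl X" "cob X = W" "df X = D"
proof -
  obtain \<phi> where \<phi>: "fam C W W 1 \<phi>" "D = gr C W W 1 \<phi>" using assms(2) by (rule gHE)
  define X where "X = \<lparr>cob = W, cdiff = \<phi>\<rparr>"
  have "gr C W W 2 (\<lambda>i. \<phi> (i + 1) ** \<phi> i) = gr C W W 2 (\<lambda>i. Zero C (W i) (W (i + 2)))"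
    using gr_mult[OF \<phi>(1) \<phi>(1)] \<phi>(2) assms(3) gr_zero[of W W 2] P_Ob assms(1) by simp
  then have "(\<lambda>i. \<phi> (i + 1) ** \<phi> i) = (\<lambda>i. Zero C (W i) (W (i + 2)))"
    using gr_inj[of W W 2] fam_Cmp[OF \<phi>(1) \<phi>(1)] fam_Zero[of W W 2] P_Ob assms(1) by simp
  then have "cpl X"
    using \<phi>(1) assms(1) by (auto simp: is_complex_def X_def fam_def fun_eq_iff)
  then show thesis using that[of X] \<phi> by (simp add: X_def df_def)
qed

lemma chm_iff:
  assumes "cpl X" "cpl Y"
  shows "chain_map C X Y \<phi> \<longleftrightarrow> fm X Y \<phi> \<and> gm X Y \<phi> : chm X Y"
proof (cases "fm X Y \<phi>")
  case True
  have l: "gm X Y \<phi> * df X = gr C (cob X) (cob Y) 1 (\<lambda>i. \<phi> (i + 1) ** cdiff X i)"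
    unfolding df_def gr_mult[OF cpl_fam[OF assms(1)] True] by simp
  have r: "df Y * gm X Y \<phi> = gr C (cob X) (cob Y) 1 (\<lambda>i. cdiff Y i ** \<phi> i)"
    unfolding df_def gr_mult[OF True cpl_fam[OF assms(2)]] by simp
  have "gm X Y \<phi> * df X = df Y * gm X Y \<phi> \<longleftrightarrow>
      (\<lambda>i. \<phi> (i + 1) ** cdiff X i) = (\<lambda>i. cdiff Y i ** \<phi> i)"
    unfolding l r using gr_inj[of "cob X" "cob Y" 1] fam_Cmp[OF cpl_fam[OF assms(1)] True] fam_Cmp[OF True cpl_fam[OF assms(2)]]
    by auto
  then show ?thesis
    using True gHI[OF True] by (auto simp: chm_def chain_map_def fam_def fun_eq_iff)
qed (auto simp: chain_map_def fam_def)

lemma chm_gH: "a : chm X Y ==> a : gh X Y 0"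
  and chm_df: "a : chm X Y ==> a * df X = df Y * a"
  by (simp_all add: chm_def)

lemma chm_df_assoc: "a : chm X Y ==> a * (df X * b) = df Y * (a * b)"
  by (simp add: chm_def mult.assoc[symmetric])

lemma chmI: "a : gh X Y 0 ==> a * df X = df Y * a ==> a : chm X Y"
  by (simp add: chm_def)

lemma chmE:
  assumes "a : chm X Y" "cpl X" "cpl Y"
  obtains \<phi> where "chain_map C X Y \<phi>" "fm X Y \<phi>" "a = gm X Y \<phi>"
proof -
  obtain \<phi> where "fm X Y \<phi>" "a = gm X Y \<phi>"
    using chm_gH[OF assms(1)] gHE by metis
  then show thesis using that chm_iff[OF assms(2,3)] assms(1) by blast
qed

lemma chm_mult: "b : chm Y Z ==> a : chm X Y ==> b * a : chm X Z"
  by (rule chmI) (auto intro: gH_mult dest: chm_gH simp: mult.assoc chm_df chm_df_assoc)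

lemma chm_add: "b : chm X Y ==> a : chm X Y ==> b + a : chm X Y"
  by (rule chmI) (auto intro: gH_add dest: chm_gH simp: algebra_simps chm_df)

lemma chm_neg: "a : chm X Y ==> - a : chm X Y"
  by (rule chmI) (auto intro: gH_neg dest: chm_gH simp: algebra_simps chm_df)

lemma chm_zero: "cpl X ==> cpl Y ==> 0 : chm X Y"
  by (rule chmI) (auto intro: gH_zero cpl_Ob)

lemma chm_one: "cpl X ==> gone (cob X) : chm X X"
  by (rule chmI) (auto intro: gone_in_gH cpl_Ob simp: gone_left[OF df_in_gH] gone_right[OF df_in_gH])

subsection \<open>Homotopy\<close>

lemma htyI: "a : chm X Y ==> b : chm X Y ==> s : gh X Y (- 1) ==> b = a + (df Y * s + s * df X) ==> hty X Y a b"
  by (auto simp: hty_def)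

lemma hty_chm: "hty X Y a b ==> a : chm X Y" "hty X Y a b ==> b : chm X Y"
  by (simp_all add: hty_def)

lemma hty_refl: "cpl X ==> cpl Y ==> a : chm X Y ==> hty X Y a a"
  by (rule htyI[of _ _ _ _ 0]) (auto intro: gH_zero cpl_Ob)

lemma hty_sym:
  assumes "hty X Y a b" shows "hty X Y b a"
proof -
  obtain s where "s : gh X Y (- 1)" "b = a + (df Y * s + s * df X)" using assms by (auto simp: hty_def)
  then show ?thesis
    using assms by (intro htyI[of _ _ _ _ "- s"]) (auto simp: hty_def intro: gH_neg)
qed

lemma hty_trans:
  assumes "hty X Y a b" "hty X Y b c" shows "hty X Y a c"
proof -
  obtain s where s: "s : gh X Y (- 1)" "b = a + (df Y * s + s * df X)" using assms by (auto simp: hty_def)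
  obtain t where t: "t : gh X Y (- 1)" "c = b + (df Y * t + t * df X)" using assms by (auto simp: hty_def)
  show ?thesis
    using assms s t by (intro htyI[of _ _ _ _ "s + t"]) (auto simp: hty_def algebra_simps intro: gH_add)
qed

lemma hty_add:
  assumes "hty X Y a b" "hty X Y c d" shows "hty X Y (a + c) (b + d)"
proof -
  obtain s where s: "s : gh X Y (- 1)" "b = a + (df Y * s + s * df X)" using assms by (auto simp: hty_def)
  obtain t where t: "t : gh X Y (- 1)" "d = c + (df Y * t + t * df X)" using assms by (auto simp: hty_def)
  show ?thesis
    using assms s t by (intro htyI[of _ _ _ _ "s + t"] chm_add) (auto simp: hty_def algebra_simps intro: gH_add)
qed

lemma hty_mult_left:
  assumes "hty X Y a b" "c : chm Y Z" shows "hty X Z (c * a) (c * b)"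
proof -
  obtain s where s: "s : gh X Y (- 1)" "b = a + (df Y * s + s * df X)" using assms by (auto simp: hty_def)
  show ?thesis
  proof (rule htyI[of _ _ _ _ "c * s"])
    show "c * s : gh X Z (- 1)" using s(1) chm_gH[OF assms(2)] by (auto intro: gH_mult)
    show "c * b = c * a + (df Z * (c * s) + c * s * df X)"
      by (simp add: s(2) algebra_simps chm_df_assoc[OF assms(2)])
  qed (use assms in \<open>auto simp: hty_def intro: chm_mult\<close>)
qed

lemma hty_mult_right:
  assumes "hty Y Z a b" "c : chm X Y" shows "hty X Z (a * c) (b * c)"
proof -
  obtain s where s: "s : gh Y Z (- 1)" "b = a + (df Z * s + s * df Y)" using assms by (auto simp: hty_def)
  show ?thesis
  proof (rule htyI[of _ _ _ _ "s * c"])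
    show "s * c : gh X Z (- 1)" using s(1) chm_gH[OF assms(2)] by (auto intro: gH_mult)
    show "b * c = a * c + (df Z * (s * c) + s * c * df X)"
      by (simp add: s(2) algebra_simps chm_df[OF assms(2)])
  qed (use assms in \<open>auto simp: hty_def intro: chm_mult\<close>)
qed

lemma hty_mult: "hty X Y a b ==> hty Y Z c d ==> hty X Z (c * a) (d * b)"
  by (rule hty_trans[OF hty_mult_left hty_mult_right]) (auto dest: hty_chm)

lemma homotopic_iff:
  assumes "cpl X" "cpl Y"
  shows "homotopic C X Y \<phi> \<psi> \<longleftrightarrow> fm X Y \<phi> \<and> fm X Y \<psi> \<and>
    hty X Y (gm X Y \<phi>) (gm X Y \<psi>)"
proof -
  let ?G = "gm X Y"
  have key: "(\<forall>i. \<psi> i = \<phi> i \<oplus> ((cdiff Y (i - 1) ** s i) \<oplus> (s (i + 1) ** cdiff X i))) \<longleftrightarrow>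
      ?G \<psi> = ?G \<phi> + (df Y * gr C (cob X) (cob Y) (- 1) s + gr C (cob X) (cob Y) (- 1) s * df X)"
    if f: "fm X Y \<phi>" "fm X Y \<psi>" and s: "fam C (cob X) (cob Y) (- 1) s" for s
  proof -
    have 1: "df Y * gr C (cob X) (cob Y) (- 1) s = ?G (\<lambda>i. cdiff Y (i - 1) ** s i)"
      unfolding df_def gr_mult[OF s cpl_fam[OF assms(2)]] by simp
    have 2: "gr C (cob X) (cob Y) (- 1) s * df X = ?G (\<lambda>i. s (i + 1) ** cdiff X i)"
      unfolding df_def gr_mult[OF cpl_fam[OF assms(1)] s] by simp
    have f1: "fm X Y (\<lambda>i. cdiff Y (i - 1) ** s i)" "fm X Y (\<lambda>i. s (i + 1) ** cdiff X i)"
      using fam_Cmp[OF s cpl_fam[OF assms(2)]] fam_Cmp[OF cpl_fam[OF assms(1)] s] by simp_all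
    have "(\<forall>i. \<psi> i = \<phi> i \<oplus> ((cdiff Y (i - 1) ** s i) \<oplus> (s (i + 1) ** cdiff X i))) \<longleftrightarrow>
        \<psi> = (\<lambda>i. \<phi> i \<oplus> ((cdiff Y (i - 1) ** s i) \<oplus> (s (i + 1) ** cdiff X i)))"
      by (simp add: fun_eq_iff)
    then show ?thesis
      unfolding 1 2 gr_add[OF f1] gr_add[OF f(1) fam_Add[OF f1]]
      using gr_inj[OF f(2) fam_Add[OF f(1) fam_Add[OF f1]]] by blast
  qed
  have s: "(\<forall>i. s i : hom C (cob X i) (cob Y (i - 1))) \<longleftrightarrow> fam C (cob X) (cob Y) (- 1) s" for s
    by (simp add: fam_def)
  show ?thesis
  proof (cases "fm X Y \<phi> \<and> fm X Y \<psi>")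
    case True
    then have "(\<exists>s. \<forall>i. s i : hom C (cob X i) (cob Y (i - 1)) \<and>
        \<psi> i = \<phi> i \<oplus> ((cdiff Y (i - 1) ** s i) \<oplus> (s (i + 1) ** cdiff X i))) \<longleftrightarrow>
      (\<exists>s. fam C (cob X) (cob Y) (- 1) s \<and> ?G \<psi> = ?G \<phi> + (df Y * gr C (cob X) (cob Y) (- 1) s + gr C (cob X) (cob Y) (- 1) s * df X))"
      unfolding all_conj_distrib s using key by blast
    also have "\<dots> \<longleftrightarrow> (\<exists>s\<in>gh X Y (- 1). ?G \<psi> = ?G \<phi> + (df Y * s + s * df X))"
      by (auto simp: gH_def)
    finally show ?thesis
      using True by (simp add: homotopic_def hty_def chm_iff[OF assms])
  next
    case False
    then show ?thesis by (auto simp: homotopic_def chm_iff[OF assms])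
  qed
qed

lemma htpy_cl:
  assumes "cpl X" "cpl Y" "fm X Y \<phi>"
  shows "htpy C X Y \<phi> = cl X Y (gm X Y \<phi>)"
  using assms by (simp add: htpy_def cl_def homotopic_iff)

lemma cl_eq_iff:
  assumes "cpl X" "cpl Y" "a : chm X Y" "b : chm X Y"
  shows "cl X Y a = cl X Y b \<longleftrightarrow> hty X Y a b"
proof
  assume h: "hty X Y a b"
  then have "hty X Y a c \<longleftrightarrow> hty X Y b c" for c using hty_sym hty_trans by blast
  then show "cl X Y a = cl X Y b" by (simp add: cl_def)
next
  assume e: "cl X Y a = cl X Y b"
  obtain \<phi> where \<phi>: "fm X Y \<phi>" "b = gm X Y \<phi>" by (rule chmE[OF assms(4,1,2)])
  then have "\<phi> : snd (snd (cl X Y b))" using hty_refl assms by (simp add: cl_def)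
  then have "\<phi> : snd (snd (cl X Y a))" using e by simp
  then show "hty X Y a b" using \<phi>(2) by (simp add: cl_def)
qed

text \<open>Composition, sum and shift in \<open>K\<close> are defined as unions over all
  representatives. If every representative is homotopic to \<open>c\<close>, the union is the class
  of \<open>c\<close>; the set has to be nonempty, since an empty union is not a class.\<close>

lemma cl_classI:
  assumes "cpl X" "cpl Y" "c : chm X Y" "S \<noteq> {}" "\<And>\<psi>. \<psi> : S ==> fm X Y \<psi> \<and> hty X Y c (gm X Y \<psi>)"
  shows "(X, Y, {\<chi>. \<exists>\<psi>\<in>S. homotopic C X Y \<psi> \<chi>}) = cl X Y c"
proof -
  let ?G = "gm X Y"
  have "(\<exists>\<psi>\<in>S. homotopic C X Y \<psi> \<chi>) \<longleftrightarrow> fm X Y \<chi> \<and> hty X Y c (?G \<chi>)" for \<chi>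
  proof
    assume "\<exists>\<psi>\<in>S. homotopic C X Y \<psi> \<chi>"
    then obtain \<psi> where "\<psi> : S" "homotopic C X Y \<psi> \<chi>" by blast
    then show "fm X Y \<chi> \<and> hty X Y c (?G \<chi>)"
      using assms(5)[of \<psi>] hty_trans by (auto simp: homotopic_iff[OF assms(1,2)])
  next
    assume h: "fm X Y \<chi> \<and> hty X Y c (?G \<chi>)"
    obtain \<psi> where \<psi>: "\<psi> : S" using assms(4) by blast
    then have "homotopic C X Y \<psi> \<chi>"
      using assms(5)[OF \<psi>] h hty_trans[OF hty_sym, of X Y c "?G \<psi>" "?G \<chi>"] by (simp add: homotopic_iff[OF assms(1,2)])
    then show "\<exists>\<psi>\<in>S. homotopic C X Y \<psi> \<chi>" using \<psi> by blast
  qed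
  then show ?thesis by (simp add: cl_def)
qed

subsection \<open>The homotopy category\<close>

lemma K_simps [simp]:
  "Ob K = Collect cpl" "Dom K = fst" "Cod K = (\<lambda>f. fst (snd f))"
  "ShOb K = sh"
  by (auto simp: homotopy_cat_def)

lemma K_Arr: "Arr K = {cl X Y a | X Y a. cpl X \<and> cpl Y \<and> a : chm X Y}" (is "_ = ?R")
proof -
  have "Arr K = {htpy C X Y \<phi> | X Y \<phi>. cpl X \<and> cpl Y \<and> chain_map C X Y \<phi>}"
    by (simp add: homotopy_cat_def)
  also have "\<dots> = ?R"
  proof (intro equalityI subsetI)
    fix f assume "f : {htpy C X Y \<phi> | X Y \<phi>. cpl X \<and> cpl Y \<and> chain_map C X Y \<phi>}"
    then obtain X Y \<phi> where "cpl X" "cpl Y" "chain_map C X Y \<phi>" "f = htpy C X Y \<phi>" by blast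
    then have "cpl X \<and> cpl Y \<and> gm X Y \<phi> : chm X Y \<and> f = cl X Y (gm X Y \<phi>)"
      by (simp add: htpy_cl chm_iff)
    then show "f : ?R" by blast
  next
    fix f assume "f : ?R"
    then obtain X Y a where fa: "cpl X" "cpl Y" "a : chm X Y" "f = cl X Y a" by blast
    obtain \<phi> where "chain_map C X Y \<phi>" "fm X Y \<phi>" "a = gm X Y \<phi>"
      by (rule chmE[OF fa(3,1,2)])
    with fa have "cpl X \<and> cpl Y \<and> chain_map C X Y \<phi> \<and> f = htpy C X Y \<phi>" by (simp add: htpy_cl)
    then show "f : {htpy C X Y \<phi> | X Y \<phi>. cpl X \<and> cpl Y \<and> chain_map C X Y \<phi>}" by blast
  qed
  finally show ?thesis .
qed

lemma cl_Dom_Cod [simp]: "fst (cl X Y a) = X" "fst (snd (cl X Y a)) = Y"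
  by (simp_all add: cl_def)

lemma K_hom: "hom K X Y = {cl X Y a | a. cpl X \<and> cpl Y \<and> a : chm X Y}"
  by (auto simp: hom_def K_Arr)

lemma K_homI: "cpl X ==> cpl Y ==> a : chm X Y ==> cl X Y a : hom K X Y"
  by (auto simp: K_hom)

lemma K_homE:
  assumes "f : hom K X Y" obtains a where "cpl X" "cpl Y" "a : chm X Y" "f = cl X Y a"
  using assms by (auto simp: K_hom)

lemma cl_nonempty: "cpl X ==> cpl Y ==> a : chm X Y ==> \<exists>\<phi>. fm X Y \<phi> \<and> hty X Y a (gm X Y \<phi>)"
  using hty_refl chmE by metis

lemma K_Cmp:
  assumes "cpl X" "cpl Y" "cpl Z" "a : chm X Y" "b : chm Y Z"
  shows "cl Y Z b **\<^sub>K cl X Y a = cl X Z (b * a)"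
proof -
  let ?A = "{\<phi>. fm X Y \<phi> \<and> hty X Y a (gm X Y \<phi>)}"
  let ?B = "{\<phi>. fm Y Z \<phi> \<and> hty Y Z b (gm Y Z \<phi>)}"
  let ?S = "{\<lambda>i. \<psi> i ** \<phi> i | \<psi> \<phi>. \<psi> : ?B \<and> \<phi> : ?A}"
  have ne: "?A \<noteq> {}" "?B \<noteq> {}" using cl_nonempty assms by auto
  have "cl Y Z b **\<^sub>K cl X Y a = (X, Z, {\<chi>. \<exists>\<psi>\<in>?B. \<exists>\<phi>\<in>?A. homotopic C X Z (\<lambda>i. \<psi> i ** \<phi> i) \<chi>})"
    by (simp add: homotopy_cat_def cl_def)
  also have "\<dots> = (X, Z, {\<chi>. \<exists>\<psi>\<in>?S. homotopic C X Z \<psi> \<chi>})" by blast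
  also have "\<dots> = cl X Z (b * a)"
  proof (rule cl_classI)
    fix \<psi> assume "\<psi> : ?S"
    then obtain f g where fg: "g : ?B" "f : ?A" "\<psi> = (\<lambda>i. g i ** f i)" by blast
    then have "gm X Z \<psi> = gm Y Z g * gm X Y f"
      using gr_mult[of "cob X" "cob Y" 0 f "cob Z" 0 g] by simp
    then show "fm X Z \<psi> \<and> hty X Z (b * a) (gm X Z \<psi>)"
      using fg fam_Cmp[of "cob X" "cob Y" 0 f "cob Z" 0 g]
        hty_mult[of X Y a "gm X Y f" Z b "gm Y Z g"] by simp
  next
    obtain \<phi> \<psi> where "\<phi> : ?A" "\<psi> : ?B" using ne by blast
    then have "(\<lambda>i. \<psi> i ** \<phi> i) : ?S" by blast
    then show "?S \<noteq> {}" by blast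
  qed (use assms in \<open>auto intro: chm_mult\<close>)
  finally show ?thesis .
qed

lemma K_Add:
  assumes "cpl X" "cpl Y" "a : chm X Y" "b : chm X Y"
  shows "cl X Y a \<oplus>\<^bsub>K\<^esub> cl X Y b = cl X Y (a + b)"
proof -
  let ?A = "{\<phi>. fm X Y \<phi> \<and> hty X Y a (gm X Y \<phi>)}"
  let ?B = "{\<phi>. fm X Y \<phi> \<and> hty X Y b (gm X Y \<phi>)}"
  let ?S = "{\<lambda>i. \<phi> i \<oplus> \<psi> i | \<psi> \<phi>. \<psi> : ?B \<and> \<phi> : ?A}"
  have ne: "?A \<noteq> {}" "?B \<noteq> {}" using cl_nonempty assms by auto
  have "cl X Y a \<oplus>\<^bsub>K\<^esub> cl X Y b = (X, Y, {\<chi>. \<exists>\<phi>\<in>?A. \<exists>\<psi>\<in>?B. homotopic C X Y (\<lambda>i. \<phi> i \<oplus> \<psi> i) \<chi>})"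
    by (simp add: homotopy_cat_def cl_def)
  also have "\<dots> = (X, Y, {\<chi>. \<exists>\<psi>\<in>?S. homotopic C X Y \<psi> \<chi>})" by blast
  also have "\<dots> = cl X Y (a + b)"
  proof (rule cl_classI)
    fix \<psi> assume "\<psi> : ?S"
    then obtain f g where fg: "g : ?B" "f : ?A" "\<psi> = (\<lambda>i. f i \<oplus> g i)" by blast
    then have "gm X Y \<psi> = gm X Y f + gm X Y g"
      using gr_add[of "cob X" "cob Y" 0 f g] by simp
    then show "fm X Y \<psi> \<and> hty X Y (a + b) (gm X Y \<psi>)"
      using fg fam_Add[of "cob X" "cob Y" 0 f g]
        hty_add[of X Y a "gm X Y f" b "gm X Y g"] by simp
  next
    obtain \<phi> \<psi> where "\<phi> : ?A" "\<psi> : ?B" using ne by blast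
    then have "(\<lambda>i. \<phi> i \<oplus> \<psi> i) : ?S" by blast
    then show "?S \<noteq> {}" by blast
  qed (use assms in \<open>auto intro: chm_add\<close>)
  finally show ?thesis .
qed

lemma K_Ident: "cpl X ==> Ident K X = cl X X (gone (cob X))"
  by (simp add: homotopy_cat_def gone_def htpy_cl fam_Ident cpl_Ob)

lemma K_Zero: "cpl X ==> cpl Y ==> Zero K X Y = cl X Y 0"
  using gr_zero[of "cob X" "cob Y" 0] fam_Zero[of "cob X" "cob Y" 0] cpl_Ob
  by (simp add: homotopy_cat_def htpy_cl)

end

context additive_category
begin

lemma zero_object_iff: "X : Ob C ==> zero_object C X \<longleftrightarrow> Ident C X = Zero C X X"
proof
  assume X: "X : Ob C" and "zero_object C X"
  then show "Ident C X = Zero C X X"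
    unfolding zero_object_def using id_hom[OF X] zero_hom[OF X X] by metis
next
  assume X: "X : Ob C" and e: "Ident C X = Zero C X X"
  have "f = Zero C X Y" if "f : hom C X Y" for f Y
    using that e id_right zero_right X by metis
  moreover have "f = Zero C Y X" if "f : hom C Y X" for f Y
    using that e id_left zero_left X by metis
  ultimately show "zero_object C X"
    unfolding zero_object_def using X zero_hom by blast
qed

lemma zero_object_hom: "zero_object C X ==> f : hom C X Y ==> f = Zero C X Y"
  and zero_object_hom': "zero_object C X ==> g : hom C Y X ==> g = Zero C Y X"
  unfolding zero_object_def using zero_hom hom_Ob1 hom_Ob2 by metis+

lemma zero_objectI: "X : Ob C ==> Ident C X = Zero C X X ==> zero_object C X"
  by (simp add: zero_object_iff)

definition bip :: "(int => 'o) => (int => 'o) => (int => 'o) => ('o, 'm, 'x) genel addend => ('o, 'm, 'x) genel addend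
    => ('o, 'm, 'x) genel addend => ('o, 'm, 'x) genel addend => bool" where
  "bip X Y W j k p q \<longleftrightarrow> j : gH C X W 0 \<and> k : gH C Y W 0 \<and> p : gH C W X 0 \<and> q : gH C W Y 0 \<and>
     p * j = gone X \<and> q * k = gone Y \<and> p * k = 0 \<and> q * j = 0 \<and> j * p + k * q = gone W"

lemma bip_gr:
  assumes "fam C X W 0 j" "fam C Y W 0 k" "fam C W X 0 p" "fam C W Y 0 q"
  shows "bip X Y W (gr C X W 0 j) (gr C Y W 0 k) (gr C W X 0 p) (gr C W Y 0 q) \<longleftrightarrow>
    (\<forall>i. biproduct C (X i) (Y i) (W i) (j i) (k i) (p i) (q i))"
proof -
  have ob: "X i : Ob C" "Y i : Ob C" "W i : Ob C" for i
    using fam_Ob1 fam_Ob2 assms by metis+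
  note c = fam_Cmp[of _ _ 0 _ _ 0, simplified]
  note m = gr_mult[of _ _ 0 _ _ 0, simplified]
  note I = fam_Ident[OF ob(1)] fam_Ident[OF ob(2)] fam_Ident[OF ob(3)]
  have z1: "0 = gr C Y X 0 (\<lambda>i. Zero C (Y i) (X i))" and z2: "0 = gr C X Y 0 (\<lambda>i. Zero C (X i) (Y i))"
    and fz1: "fam C Y X 0 (\<lambda>i. Zero C (Y i) (X i))" and fz2: "fam C X Y 0 (\<lambda>i. Zero C (X i) (Y i))"
    using gr_zero[of Y X 0] gr_zero[of X Y 0] fam_Zero[of X Y 0] fam_Zero[of Y X 0] ob by simp_all
  have 1: "gr C W X 0 p * gr C X W 0 j = gone X \<longleftrightarrow> (\<lambda>i. p i ** j i) = (\<lambda>i. Ident C (X i))"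
    unfolding gone_def m[OF assms(1,3)] using gr_inj[OF c[OF assms(1,3)] I(1)] by auto
  have 2: "gr C W Y 0 q * gr C Y W 0 k = gone Y \<longleftrightarrow> (\<lambda>i. q i ** k i) = (\<lambda>i. Ident C (Y i))"
    unfolding gone_def m[OF assms(2,4)] using gr_inj[OF c[OF assms(2,4)] I(2)] by auto
  have 3: "gr C W X 0 p * gr C Y W 0 k = 0 \<longleftrightarrow> (\<lambda>i. p i ** k i) = (\<lambda>i. Zero C (Y i) (X i))"
    unfolding z1 m[OF assms(2,3)] using gr_inj[OF c[OF assms(2,3)] fz1] by auto
  have 4: "gr C W Y 0 q * gr C X W 0 j = 0 \<longleftrightarrow> (\<lambda>i. q i ** j i) = (\<lambda>i. Zero C (X i) (Y i))"
    unfolding z2 m[OF assms(1,4)] using gr_inj[OF c[OF assms(1,4)] fz2] by auto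
  have 5: "gr C X W 0 j * gr C W X 0 p + gr C Y W 0 k * gr C W Y 0 q = gone W \<longleftrightarrow>
      (\<lambda>i. (j i ** p i) \<oplus> (k i ** q i)) = (\<lambda>i. Ident C (W i))"
    unfolding gone_def m[OF assms(3,1)] m[OF assms(4,2)] gr_add[OF c[OF assms(3,1)] c[OF assms(4,2)]]
    using gr_inj[OF fam_Add[OF c[OF assms(3,1)] c[OF assms(4,2)]] I(3)] by auto
  show ?thesis
    unfolding bip_def 1 2 3 4 5 biproduct_def fun_eq_iff
    using assms gHI[OF assms(1)] gHI[OF assms(2)] gHI[OF assms(3)] gHI[OF assms(4)]
    by (auto simp: fam_def)
qed

lemma bipE:
  assumes "bip X Y W j k p q"
  obtains j' k' p' q' where "\<And>i. biproduct C (X i) (Y i) (W i) (j' i) (k' i) (p' i) (q' i)"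
    "fam C X W 0 j'" "fam C Y W 0 k'" "fam C W X 0 p'" "fam C W Y 0 q'"
    "j = gr C X W 0 j'" "k = gr C Y W 0 k'" "p = gr C W X 0 p'" "q = gr C W Y 0 q'"
proof -
  obtain j' k' p' q' where f: "fam C X W 0 j'" "j = gr C X W 0 j'" "fam C Y W 0 k'" "k = gr C Y W 0 k'"
    "fam C W X 0 p'" "p = gr C W X 0 p'" "fam C W Y 0 q'" "q = gr C W Y 0 q'"
    using assms by (auto simp: bip_def elim!: gHE)
  show thesis using that[OF _ f(1,3,5,7,2,4,6,8)] bip_gr[OF f(1,3,5,7)] assms f by simp
qed

text \<open>These are oriented rewrite rules. Most products come with a variant for a further factor
  on the right, because products are kept bracketed to the right in the calculations with
  cones.\<close>

lemma bip_simps: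
  assumes "bip X Y W j k p q"
  shows "j : gH C X W 0" "k : gH C Y W 0" "p : gH C W X 0" "q : gH C W Y 0"
    "p * j = gone X" "p * (j * a) = gone X * a" "q * k = gone Y" "q * (k * a) = gone Y * a"
    "p * k = 0" "p * (k * a) = 0" "q * j = 0" "q * (j * a) = 0" "j * p + k * q = gone W"
    "gone X * p = p" "gone X * (p * a) = p * a" "gone Y * q = q" "gone Y * (q * a) = q * a"
    "j * gone X = j" "j * (gone X * a) = j * a" "k * gone Y = k" "k * (gone Y * a) = k * a"
  using assms by (simp_all add: bip_def mult.assoc[symmetric] gone_left[of p W X 0] gone_left[of q W Y 0]
    gone_right[of j X W 0] gone_right[of k Y W 0])

lemma bip_ext:
  assumes "bip X Y W j k p q" "a : gH C W Z n" "b : gH C W Z n" "a * j = b * j" "a * k = b * k"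
  shows "a = b"
proof -
  have "a = a * (j * p + k * q)" "b = b * (j * p + k * q)"
    using bip_simps(13)[OF assms(1)] gone_right assms by auto
  then show ?thesis using assms(4,5) by (metis distrib_left mult.assoc)
qed

subsection \<open>Shifting families\<close>

text \<open>The identity of the underlying objects read as a map of degree -1 from \<open>X\<close>
  to its shift; \<open>tu\<close> below is its inverse of degree 1. With these two the shift of a
  family is a conjugate in the ring.\<close>

definition tt :: "(int => 'o) => ('o, 'm, 'x) genel addend" where
  "tt X = gr C X (\<lambda>i. X (i + 1)) (- 1) (\<lambda>i. Ident C (X i))"

definition tu :: "(int => 'o) => ('o, 'm, 'x) genel addend" where
  "tu X = gr C (\<lambda>i. X (i + 1)) X 1 (\<lambda>i. Ident C (X (i + 1)))"

lemma tt_fam: "(\<And>i. X i : Ob C) ==> fam C X (\<lambda>i. X (i + 1)) (- 1) (\<lambda>i. Ident C (X i))"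
  and tu_fam: "(\<And>i. X i : Ob C) ==> fam C (\<lambda>i. X (i + 1)) X 1 (\<lambda>i. Ident C (X (i + 1)))"
  by (simp_all add: fam_def id_hom)

lemma tt_gH: "(\<And>i. X i : Ob C) ==> tt X : gH C X (\<lambda>i. X (i + 1)) (- 1)"
  and tu_gH: "(\<And>i. X i : Ob C) ==> tu X : gH C (\<lambda>i. X (i + 1)) X 1"
  unfolding tt_def tu_def by (intro gHI tt_fam; simp) (intro gHI tu_fam; simp)

lemma tu_tt:
  assumes "\<And>i. X i : Ob C" shows "tu X * tt X = gone X"
  unfolding tt_def tu_def gone_def gr_mult[OF tt_fam[of X, OF assms] tu_fam[of X, OF assms]]
  by (simp add: id_left[OF id_hom[OF assms]])

lemma tt_tu:
  assumes "\<And>i. X i : Ob C" shows "tt X * tu X = gone (\<lambda>i. X (i + 1))"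
  unfolding tt_def tu_def gone_def gr_mult[OF tu_fam[of X, OF assms] tt_fam[of X, OF assms]]
  by (simp add: id_left[OF id_hom[OF assms]])

lemma gr_shift:
  assumes "fam C X Y n \<phi>"
  shows "gr C (\<lambda>i. X (i + 1)) (\<lambda>i. Y (i + 1)) n (\<lambda>i. \<phi> (i + 1)) = tt Y * gr C X Y n \<phi> * tu X"
proof -
  have f: "fam C (\<lambda>i. X (i + 1)) Y (1 + n) (\<lambda>i. \<phi> (i + 1) ** Ident C (X (i + 1)))"
    by (rule fam_Cmp[OF tu_fam[of X, OF fam_Ob1[OF assms]] assms])
  have e: "Ident C (Y (i + (1 + n))) ** (\<phi> (i + 1) ** Ident C (X (i + 1))) = \<phi> (i + 1)" for i
    using famD[OF assms, of "i + 1"] id_left id_right by (metis add.assoc)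
  show ?thesis
    unfolding tt_def tu_def mult.assoc gr_mult[OF tu_fam[of X, OF fam_Ob1[OF assms]] assms]
      gr_mult[OF f tt_fam[of Y, OF fam_Ob2[OF assms]]] e by simp
qed

lemma shift_simps:
  assumes "\<And>i. X i : Ob C"
  shows "tu X * tt X = gone X" "tu X * (tt X * a) = gone X * a"
    "tt X * tu X = gone (\<lambda>i. X (i + 1))" "tt X * (tu X * a) = gone (\<lambda>i. X (i + 1)) * a"
    "gone X * tu X = tu X" "gone X * (tu X * a) = tu X * a" "tt X * gone X = tt X" "tt X * (gone X * a) = tt X * a"
    "tu X * gone (\<lambda>i. X (i + 1)) = tu X" "tu X * (gone (\<lambda>i. X (i + 1)) * a) = tu X * a"
    "gone (\<lambda>i. X (i + 1)) * tt X = tt X" "gone (\<lambda>i. X (i + 1)) * (tt X * a) = tt X * a"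
  by (simp_all only: tu_tt[of X, OF assms] tt_tu[of X, OF assms] mult.assoc[symmetric]
    gone_left[OF tu_gH[of X, OF assms]] gone_left[OF tt_gH[of X, OF assms]]
    gone_right[OF tu_gH[of X, OF assms]] gone_right[OF tt_gH[of X, OF assms]])

lemma gone_assoc:
  assumes "a : gH C X Y n"
  shows "gone Y * a = a" "gone Y * (a * b) = a * b" "a * gone X = a" "a * (gone X * b) = a * b"
  using gone_left[OF assms] gone_right[OF assms] by (simp_all add: mult.assoc[symmetric])

end

context complexes
begin

lemma bip_ex:
  fixes X Y :: "int => 'o"
  assumes "\<And>i. X i : P" "\<And>i. Y i : P"
  obtains W j k p q where "\<And>i. W i : P" "bip X Y W j k p q"
proof -
  have "\<forall>i. \<exists>t. case t of (w, j, k, p, q) => w : P \<and> biproduct C (X i) (Y i) w j k p q"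
  proof
    fix i
    obtain w j k p q where "w : P" "biproduct C (X i) (Y i) w j k p q"
      using P_biproduct[OF assms(1)[of i] assms(2)[of i]] by blast
    then show "\<exists>t. case t of (w, j, k, p, q) => w : P \<and> biproduct C (X i) (Y i) w j k p q"
      by (intro exI[of _ "(w, j, k, p, q)"]) simp
  qed
  then obtain t where t: "\<And>i. case t i of (w, j, k, p, q) => w : P \<and> biproduct C (X i) (Y i) w j k p q"
    using choice[of "\<lambda>i t. case t of (w, j, k, p, q) => w : P \<and> biproduct C (X i) (Y i) w j k p q"] by blast
  define W where "W i = fst (t i)" for i
  define j where "j i = fst (snd (t i))" for i
  define k where "k i = fst (snd (snd (t i)))" for i
  define p where "p i = fst (snd (snd (snd (t i))))" for i
  define q where "q i = snd (snd (snd (snd (t i))))" for i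
  have b: "W i : P \<and> biproduct C (X i) (Y i) (W i) (j i) (k i) (p i) (q i)" for i
    using t[of i] by (simp add: W_def j_def k_def p_def q_def split: prod.splits)
  then have "fam C X W 0 j" "fam C Y W 0 k" "fam C W X 0 p" "fam C W Y 0 q"
    by (simp_all add: biproduct_def fam_def)
  then show thesis using that bip_gr b by blast
qed

subsection \<open>Additivity of the homotopy category\<close>

lemma zero_cpl: obtains X where "cpl X" "\<And>i. zero_object C (cob X i)" "df X = 0"
proof -
  obtain Z where Z: "Z : P" "zero_object C Z" using P_zero by blast
  obtain X where "cpl X" "cob X = (\<lambda>_. Z)" "df X = 0"
    using cpl_eqI[of "\<lambda>_. Z" 0] Z gH_zero[of "\<lambda>_. Z" "\<lambda>_. Z" 1] P_Ob by auto
  then show thesis using that Z by auto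
qed

lemma gH_zero_object1:
  assumes "\<And>i. zero_object C (X i)" "a : gH C X Y n" shows "a = 0"
proof -
  obtain \<phi> where \<phi>: "fam C X Y n \<phi>" "a = gr C X Y n \<phi>" using assms(2) by (rule gHE)
  have "\<phi> = (\<lambda>i. Zero C (X i) (Y (i + n)))"
    using zero_object_hom[OF assms(1) famD[OF \<phi>(1)]] by auto
  then show ?thesis using \<phi>(2) gr_zero[of X Y n, OF fam_Ob1[OF \<phi>(1)] fam_Ob2[OF \<phi>(1)]] by simp
qed

lemma K_category: "category K"
proof
  fix f assume "f : Arr K"
  then show "Dom K f : Ob K" "Cod K f : Ob K" by (auto simp: K_Arr)
next
  fix X assume "X : Ob K"
  then show "Ident K X : hom K X X" by (simp add: K_Ident K_homI chm_one)
next
  fix f X Y g Z assume "f : hom K X Y" "g : hom K Y Z"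
  then show "g **\<^sub>K f : hom K X Z"
    by (elim K_homE) (simp add: K_Cmp K_homI chm_mult)
next
  fix f W X g Y h Z assume "f : hom K W X" "g : hom K X Y" "h : hom K Y Z"
  then show "h **\<^sub>K g **\<^sub>K f = h **\<^sub>K (g **\<^sub>K f)"
    by (elim K_homE) (simp add: K_Cmp chm_mult mult.assoc)
next
  fix f X Y assume "f : hom K X Y"
  then show "Ident K Y **\<^sub>K f = f" "f **\<^sub>K Ident K X = f"
    by (elim K_homE; simp add: K_Cmp K_Ident chm_one gone_left[OF chm_gH] gone_right[OF chm_gH])+
qed

lemma K_biproduct:
  assumes "cpl A" "cpl B"
  shows "\<exists>W. cpl W \<and> (\<exists>i j p q. biproduct K A B W i j p q)"
proof -
  obtain W j k p q where W: "\<And>i. W i : P" and b: "bip (cob A) (cob B) W j k p q"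
    using bip_ex[of "cob A" "cob B"] cpl_P assms by metis
  note bs = bip_simps[OF b]
  note dA = df_in_gH[OF assms(1)] and dB = df_in_gH[OF assms(2)]
  \<comment> \<open>The block diagonal differential on the degreewise biproducts.\<close>
  define D where "D = j * (df A * p) + k * (df B * q)"
  have D: "D : gH C W W 1" unfolding D_def
    by (rule gH_add gH_mult[OF _ gH_mult] | rule bs dA dB | simp)+
  have DD: "D * D = 0" unfolding D_def
    by (simp add: algebra_simps bs gone_assoc[OF dA] gone_assoc[OF dB] df_df_assoc assms)
  obtain X where X: "cpl X" "cob X = W" "df X = D" by (rule cpl_eqI[OF W D DD])
  have c: "j : chm A X" "k : chm B X" "p : chm X A" "q : chm X B"
    by (rule chmI; simp add: X D_def bs algebra_simps gone_assoc[OF dA] gone_assoc[OF dB])+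
  have "biproduct K A B X (cl A X j) (cl B X k) (cl X A p) (cl X B q)"
    using assms X c unfolding biproduct_def
    by (simp add: K_homI K_Cmp K_Ident K_Zero K_Add chm_mult bs)
  then show ?thesis using X(1) by blast
qed

sublocale K: additive_category K
proof (intro additive_category.intro additive_category_axioms.intro K_category)
  fix X Y assume "X : Ob K" "Y : Ob K"
  then show "Zero K X Y : hom K X Y" by (simp add: K_Zero K_homI chm_zero)
next
  fix f X Y g assume "f : hom K X Y" "g : hom K X Y"
  then show "f \<oplus>\<^bsub>K\<^esub> g : hom K X Y" "f \<oplus>\<^bsub>K\<^esub> g = g \<oplus>\<^bsub>K\<^esub> f"
    by (auto elim!: K_homE simp: K_Add chm_add add.commute intro!: K_homI)
next
  fix f X Y g h assume "f : hom K X Y" "g : hom K X Y" "h : hom K X Y"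
  then show "f \<oplus>\<^bsub>K\<^esub> g \<oplus>\<^bsub>K\<^esub> h = f \<oplus>\<^bsub>K\<^esub> (g \<oplus>\<^bsub>K\<^esub> h)"
    by (auto elim!: K_homE simp: K_Add chm_add add.assoc)
next
  fix f X Y assume f: "f : hom K X Y"
  then show "f \<oplus>\<^bsub>K\<^esub> Zero K X Y = f" by (auto elim!: K_homE simp: K_Add K_Zero chm_zero)
  obtain a where a: "cpl X" "cpl Y" "a : chm X Y" "f = cl X Y a" using f by (rule K_homE)
  show "\<exists>g\<in>hom K X Y. f \<oplus>\<^bsub>K\<^esub> g = Zero K X Y"
    by (rule bexI[of _ "cl X Y (- a)"]) (simp_all add: a K_Add chm_neg K_Zero K_homI)
next
  fix f X Y f' g Z assume "f : hom K X Y" "f' : hom K X Y" "g : hom K Y Z"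
  then show "g **\<^sub>K (f \<oplus>\<^bsub>K\<^esub> f') = g **\<^sub>K f \<oplus>\<^bsub>K\<^esub> g **\<^sub>K f'"
    by (auto elim!: K_homE simp: K_Add K_Cmp chm_add chm_mult distrib_left)
next
  fix f X Y g Z g' assume "f : hom K X Y" "g : hom K Y Z" "g' : hom K Y Z"
  then show "(g \<oplus>\<^bsub>K\<^esub> g') **\<^sub>K f = g **\<^sub>K f \<oplus>\<^bsub>K\<^esub> g' **\<^sub>K f"
    by (auto elim!: K_homE simp: K_Add K_Cmp chm_add chm_mult distrib_right)
next
  obtain X where X: "cpl X" "\<And>i. zero_object C (cob X i)" using zero_cpl by blast
  have g0: "gone (cob X) = 0" by (rule gH_zero_object1[OF X(2) gone_in_gH[OF cpl_Ob[OF X(1)]]])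
  have z: "a = 0" if "a : chm X Y" for a Y
    using g0 gone_right[OF chm_gH[OF that]] by simp
  have z': "a = 0" if "a : chm Y X" for a Y
    using g0 gone_left[OF chm_gH[OF that]] by simp
  have "zero_object K X"
    unfolding zero_object_def
  proof (intro conjI ballI)
    fix Y assume "Y : Ob K"
    then have Y: "cpl Y" by simp
    show "\<exists>!f. f : hom K X Y"
      by (rule ex1I[of _ "cl X Y 0"]) (auto simp: K_homI chm_zero X Y elim!: K_homE dest: z)
    show "\<exists>!f. f : hom K Y X"
      by (rule ex1I[of _ "cl Y X 0"]) (auto simp: K_homI chm_zero X Y elim!: K_homE dest: z')
  qed (simp add: X)
  then show "\<exists>Z. zero_object K Z" by blast
next
  fix A B assume "A : Ob K" "B : Ob K"
  then show "\<exists>W\<in>Ob K. \<exists>i j p q. biproduct K A B W i j p q"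
    using K_biproduct by auto
qed

end

section \<open>Triangles\<close>

lemma hom_saturate [simp]: "hom (saturate T) = hom T"
  by (simp add: hom_def fun_eq_iff)

lemma iso_saturate [simp]: "iso (saturate T) = iso T"
  by (simp add: iso_def fun_eq_iff)

lemma triangle_iso_saturate [simp]: "triangle_iso (saturate T) = triangle_iso T"
  by (simp add: triangle_iso_def candidate_triangle_def fun_eq_iff)

lemma Tri_saturate: "Tri (saturate T) = {t. \<exists>t'\<in>Tri T. triangle_iso T t t'}"
  by (simp add: saturate_def)

lemma candidateD:
  fixes T :: "('o, 'm) tricat" (structure)
  assumes "candidate_triangle T (f, g, h)"
  shows "f : hom T (Dom T f) (Cod T f)" "g : hom T (Cod T f) (Cod T g)" "h : hom T (Cod T g) (ShOb T (Dom T f))"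
  using assms by (auto simp: candidate_triangle_def hom_def)

definition tri_map :: "('o, 'm) tricat => 'm \<times> 'm \<times> 'm => 'm \<times> 'm \<times> 'm => 'm => 'm => 'm => bool" where
  "tri_map T = (\<lambda>(f, g, h) (f', g', h') a b c. candidate_triangle T (f, g, h) \<and> candidate_triangle T (f', g', h') \<and>
     a : hom T (Dom T f) (Dom T f') \<and> b : hom T (Dom T g) (Dom T g') \<and> c : hom T (Dom T h) (Dom T h') \<and>
     b **\<^bsub>T\<^esub> f = f' **\<^bsub>T\<^esub> a \<and> c **\<^bsub>T\<^esub> g = g' **\<^bsub>T\<^esub> b \<and> ShArr T a **\<^bsub>T\<^esub> h = h' **\<^bsub>T\<^esub> c)"

lemma triangle_iso_iff: "triangle_iso T t t' \<longleftrightarrow> (\<exists>a b c. tri_map T t t' a b c \<and> iso T a \<and> iso T b \<and> iso T c)"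
  by (cases t; cases t') (simp add: triangle_iso_def tri_map_def, blast)

lemma tri_mapI:
  fixes T :: "('o, 'm) tricat" (structure)
  assumes "f : hom T X Y" "g : hom T Y Z" "h : hom T Z (ShOb T X)"
    "f' : hom T X' Y'" "g' : hom T Y' Z'" "h' : hom T Z' (ShOb T X')"
    "a : hom T X X'" "b : hom T Y Y'" "c : hom T Z Z'"
    "b ** f = f' ** a" "c ** g = g' ** b" "ShArr T a ** h = h' ** c"
  shows "tri_map T (f, g, h) (f', g', h') a b c"
  using assms by (auto simp: tri_map_def candidate_triangle_def hom_def)

lemma tri_mapE:
  fixes T :: "('o, 'm) tricat" (structure)
  assumes "tri_map T (f, g, h) (f', g', h') a b c"
  obtains X Y Z X' Y' Z' where
    "f : hom T X Y" "g : hom T Y Z" "h : hom T Z (ShOb T X)"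
    "f' : hom T X' Y'" "g' : hom T Y' Z'" "h' : hom T Z' (ShOb T X')"
    "a : hom T X X'" "b : hom T Y Y'" "c : hom T Z Z'"
    "b ** f = f' ** a" "c ** g = g' ** b" "ShArr T a ** h = h' ** c"
  using assms by (auto simp: tri_map_def candidate_triangle_def hom_def)

lemma triangle_isoI:
  fixes T :: "('o, 'm) tricat" (structure)
  assumes "f : hom T X Y" "g : hom T Y Z" "h : hom T Z (ShOb T X)"
    "f' : hom T X' Y'" "g' : hom T Y' Z'" "h' : hom T Z' (ShOb T X')"
    "a : hom T X X'" "b : hom T Y Y'" "c : hom T Z Z'" "iso T a" "iso T b" "iso T c"
    "b ** f = f' ** a" "c ** g = g' ** b" "ShArr T a ** h = h' ** c"
  shows "triangle_iso T (f, g, h) (f', g', h')"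
  using tri_mapI[OF assms(1-9,13-15)] assms(10-12) unfolding triangle_iso_iff by blast

text \<open>\<open>Std\<close> plays the role of the mapping cone triangles and \<open>Tri\<close>
  that of their isomorphism closure, so the axioms have to be verified for strict cones only. The
  shift is fully faithful and strictly surjective on objects. Weak kernels and cokernels are axioms
  because for cones they can be read off from null homotopies.\<close>

locale triangulated = additive_category T for T :: "('o, 'm) tricat" (structure) +
  fixes Std :: "('m \<times> 'm \<times> 'm) set"
  assumes ShArr_hom: "f : hom T X Y ==> ShArr T f : hom T (ShOb T X) (ShOb T Y)"
    and ShArr_Cmp: "f : hom T X Y ==> g : hom T Y Z ==> ShArr T (g ** f) = ShArr T g ** ShArr T f"
    and ShArr_Ident: "X : Ob T ==> ShArr T (Ident T X) = Ident T (ShOb T X)"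
    and ShArr_Add: "f : hom T X Y ==> g : hom T X Y ==> ShArr T (f \<oplus> g) = ShArr T f \<oplus> ShArr T g"
    and ShArr_inj: "f : hom T X Y ==> g : hom T X Y ==> ShArr T f = ShArr T g ==> f = g"
    and ShArr_surj: "X : Ob T ==> Y : Ob T ==> f : hom T (ShOb T X) (ShOb T Y) ==> \<exists>g\<in>hom T X Y. ShArr T g = f"
    and ShOb_surj: "X : Ob T ==> \<exists>Y\<in>Ob T. ShOb T Y = X"
    and Tri_Std: "Tri T = {t. \<exists>t'\<in>Std. triangle_iso T t t'}"
    and Std_candidate: "t : Std ==> candidate_triangle T t"
    and Std_ex: "f : hom T X Y ==> \<exists>g h. (f, g, h) : Std"
    and Std_rotate: "(f, g, h) : Std ==> (g, h, Neg T (ShArr T f)) : Tri T"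
    and Std_zero: "(f, g, h) : Std ==> g ** f = Zero T (Dom T f) (Cod T g)"
    and Std_weak_kernel: "(f, g, h) : Std ==> u : hom T W (Dom T g) ==> g ** u = Zero T W (Cod T g)
      ==> \<exists>v\<in>hom T W (Dom T f). u = f ** v"
    and Std_weak_cokernel: "(f, g, h) : Std ==> u : hom T (Dom T g) W ==> u ** f = Zero T (Dom T f) W
      ==> \<exists>v\<in>hom T (Cod T g) W. u = v ** g"
    and Std_morphism: "(f, g, h) : Std ==> (f', g', h') : Std ==> a : hom T (Dom T f) (Dom T f') ==>
      b : hom T (Dom T g) (Dom T g') ==> b ** f = f' ** a ==>
      \<exists>c\<in>hom T (Cod T g) (Cod T g'). c ** g = g' ** b \<and> ShArr T a ** h = h' ** c"
    and octahedron: "f : hom T X Y ==> g : hom T Y Z ==>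
      \<exists>f1 f2 g1 g2 h1 h2 u v w. (f, f1, f2) : Std \<and> (g, g1, g2) : Std \<and> (g ** f, h1, h2) : Std \<and>
        (u, v, w) : Tri T \<and> Dom T u = Cod T f1 \<and> Cod T u = Cod T h1 \<and> Cod T v = Cod T g1"

definition unshift_cpx :: "('o, 'm, 'x) addcat_scheme => ('o, 'm) cpx => ('o, 'm) cpx" where
  "unshift_cpx C X = \<lparr>cob = (\<lambda>i. cob X (i - 1)), cdiff = (\<lambda>i. Neg C (cdiff X (i - 1)))\<rparr>"

context additive_category
begin

lemma biproductD:
  assumes "biproduct C A B W i j p q"
  shows "i : hom C A W" "j : hom C B W" "p : hom C W A" "q : hom C W B" "p ** i = Ident C A" "q ** j = Ident C B"
    "p ** j = Zero C B A" "q ** i = Zero C A B" "(i ** p) \<oplus> (j ** q) = Ident C W"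
  using assms by (auto simp: biproduct_def)

lemma Neg_Neg: "f : hom C X Y ==> Neg C (Neg C f) = f"
  using Neg_unique[OF neg_hom] Add_Neg Add_commute neg_hom by metis

lemma Cmp_Neg_Neg:
  assumes "f : hom C X Y" "g : hom C Y Z" shows "Neg C g ** Neg C f = g ** f"
  by (rule emb_inj[OF comp[OF neg_hom neg_hom] comp])
    (use assms in \<open>simp_all add: emb_Cmp[OF neg_hom neg_hom] emb_Cmp emb_Neg\<close>)

end

section \<open>The shift of complexes and of homotopy classes\<close>

context complexes
begin

lemma cplD:
  assumes "cpl X"
  shows "cdiff X i : hom C (cob X i) (cob X (i + 1))" "cdiff X (i + 1) ** cdiff X i = Zero C (cob X i) (cob X (i + 2))"
  using assms by (auto simp: is_complex_def)

lemma cpl_shift: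
  assumes "cpl X" shows "cpl (sh X)"
  unfolding is_complex_def
proof (intro allI conjI)
  fix i
  have h: "cdiff X (i + 1) : hom C (cob X (i + 1)) (cob X (i + 2))"
    "cdiff X (i + 2) : hom C (cob X (i + 2)) (cob X (i + 3))"
    "cdiff X (i + 2) ** cdiff X (i + 1) = Zero C (cob X (i + 1)) (cob X (i + 3))"
    using cplD(1)[OF assms, of "i + 1"] cplD(1)[OF assms, of "i + 2"] cplD(2)[OF assms, of "i + 1"] by (simp_all add: add.assoc)
  show "cob (sh X) i : P" using assms by (simp add: shift_cpx_def cpl_P)
  show "cdiff (sh X) i : hom C (cob (sh X) i) (cob (sh X) (i + 1))"
    using neg_hom[OF h(1)] by (simp add: shift_cpx_def algebra_simps)
  show "cdiff (sh X) (i + 1) ** cdiff (sh X) i = Zero C (cob (sh X) i) (cob (sh X) (i + 2))"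
    using h Cmp_Neg_Neg[OF h(1,2)] by (simp add: shift_cpx_def algebra_simps)
qed

lemma cpl_unshift:
  assumes "cpl X" shows "cpl (unshift_cpx C X)"
  unfolding is_complex_def
proof (intro allI conjI)
  fix i
  have h: "cdiff X (i - 1) : hom C (cob X (i - 1)) (cob X i)" "cdiff X i : hom C (cob X i) (cob X (i + 1))"
    "cdiff X i ** cdiff X (i - 1) = Zero C (cob X (i - 1)) (cob X (i + 1))"
    using cplD(1)[OF assms, of "i - 1"] cplD(1)[OF assms, of i] cplD(2)[OF assms, of "i - 1"] by (simp_all add: algebra_simps)
  show "cob (unshift_cpx C X) i : P" using assms by (simp add: unshift_cpx_def cpl_P)
  show "cdiff (unshift_cpx C X) i : hom C (cob (unshift_cpx C X) i) (cob (unshift_cpx C X) (i + 1))"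
    using h(1) by (simp add: unshift_cpx_def neg_hom)
  show "cdiff (unshift_cpx C X) (i + 1) ** cdiff (unshift_cpx C X) i = Zero C (cob (unshift_cpx C X) i) (cob (unshift_cpx C X) (i + 2))"
    using h Cmp_Neg_Neg[OF h(1,2)] by (simp add: unshift_cpx_def add.commute)
qed

lemma shift_unshift: "cpl X ==> sh (unshift_cpx C X) = X"
  by (simp add: shift_cpx_def unshift_cpx_def Neg_Neg[OF famD[OF cpl_fam]])

lemma cob_shift: "cob (sh X) = (\<lambda>i. cob X (i + 1))"
  by (simp add: shift_cpx_def)

lemma df_shift:
  assumes "cpl X" shows "df (sh X) = - (tt (cob X) * df X * tu (cob X))"
proof -
  have f: "fam C (\<lambda>i. cob X (i + 1)) (\<lambda>i. cob X (i + 1)) 1 (\<lambda>i. cdiff X (i + 1))"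
    unfolding fam_def using cplD(1)[OF assms] by blast
  show ?thesis
    unfolding df_def shift_cpx_def using gr_shift[OF cpl_fam[OF assms]] gr_neg[OF f] by simp
qed

abbreviation sa :: "('o, 'm) cpx => ('o, 'm) cpx => ('o, 'm, 'x) genel addend => ('o, 'm, 'x) genel addend" where
  "sa X Y a \<equiv> tt (cob Y) * (a * tu (cob X))"

lemmas cpl_shift_simps = shift_simps[OF cpl_Ob]

lemma tt_cpl: "cpl X ==> tt (cob X) : gh X (sh X) (- 1)"
  and tu_cpl: "cpl X ==> tu (cob X) : gh (sh X) X 1"
  unfolding cob_shift by (intro tt_gH; simp add: cpl_Ob) (intro tu_gH; simp add: cpl_Ob)

lemma sa_gH: "cpl X ==> cpl Y ==> a : gh X Y n ==> sa X Y a : gh (sh X) (sh Y) n"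
  by (rule gH_mult[OF tt_cpl] gH_mult[OF _ tu_cpl] | assumption | simp)+

lemma sa_chm:
  assumes "cpl X" "cpl Y" "a : chm X Y" shows "sa X Y a : chm (sh X) (sh Y)"
  by (rule chmI) (simp_all add: sa_gH assms chm_gH df_shift mult.assoc cpl_shift_simps gone_assoc[OF chm_gH[OF assms(3)]]
      gone_assoc[OF df_in_gH] chm_df_assoc[OF assms(3)])

lemma sa_hty:
  assumes "cpl X" "cpl Y" "hty X Y a b" shows "hty (sh X) (sh Y) (sa X Y a) (sa X Y b)"
proof -
  obtain s where s: "s : gh X Y (- 1)" "b = a + (df Y * s + s * df X)" using assms by (auto simp: hty_def)
  show ?thesis
  \<comment> \<open>The shifted differentials carry a sign, so the shifted homotopy does as
    well.\<close>
  proof (rule htyI[of _ _ _ _ "- sa X Y s"])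
    show "- sa X Y s : gh (sh X) (sh Y) (- 1)"
      by (intro gH_neg sa_gH assms s)
    show "sa X Y b = sa X Y a + (df (sh Y) * - sa X Y s + - sa X Y s * df (sh X))"
      by (simp add: s(2) df_shift assms algebra_simps cpl_shift_simps gone_assoc[OF s(1)] gone_assoc[OF df_in_gH])
  qed (use assms hty_chm in \<open>auto intro: sa_chm\<close>)
qed

lemma sa_hty_iff:
  assumes "cpl X" "cpl Y" "a : chm X Y" "b : chm X Y"
  shows "hty (sh X) (sh Y) (sa X Y a) (sa X Y b) \<longleftrightarrow> hty X Y a b"
proof
  assume "hty (sh X) (sh Y) (sa X Y a) (sa X Y b)"
  then obtain s where s: "s : gh (sh X) (sh Y) (- 1)"
    "sa X Y b = sa X Y a + (df (sh Y) * s + s * df (sh X))" by (auto simp: hty_def)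
  have r: "tu (cob Y) * (sa X Y c * tt (cob X)) = c" if "c : chm X Y" for c
    using assms by (simp add: mult.assoc cpl_shift_simps gone_assoc[OF chm_gH[OF that]])
  have s1: "s * gone (\<lambda>i. cob X (i + 1)) = s" "gone (\<lambda>i. cob Y (i + 1)) * s = s"
    using gone_assoc[OF s(1)] by (simp_all add: cob_shift)
  define t where "t = tu (cob Y) * (s * tt (cob X))"
  have t: "t : gh X Y (- 1)" unfolding t_def
    by (rule gH_mult[OF tu_cpl] gH_mult[OF s(1)] tt_cpl assms | simp)+
  show "hty X Y a b"
  proof (rule htyI[of _ _ _ _ "- t"])
    have "b = tu (cob Y) * (sa X Y b * tt (cob X))" using r assms by simp
    also have "\<dots> = a + (df Y * (- t) + (- t) * df X)"
      unfolding s(2) distrib_right distrib_left using r[OF assms(3)] assms s1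
      by (simp add: t_def df_shift algebra_simps cpl_shift_simps gone_assoc[OF df_in_gH])
    finally show "b = a + (df Y * (- t) + (- t) * df X)" .
  qed (use assms t in \<open>auto intro: gH_neg\<close>)
qed (use assms sa_hty in auto)

lemma K_ShArr:
  assumes "cpl X" "cpl Y" "a : chm X Y"
  shows "ShArr K (cl X Y a) = cl (sh X) (sh Y) (sa X Y a)"
proof -
  let ?A = "{\<phi>. fm X Y \<phi> \<and> hty X Y a (gm X Y \<phi>)}"
  let ?S = "(\<lambda>\<phi> i. \<phi> (i + 1)) ` ?A"
  have "ShArr K (cl X Y a) = (sh X, sh Y, {\<chi>. \<exists>\<psi>\<in>?S. homotopic C (sh X) (sh Y) \<psi> \<chi>})"
    by (auto simp: homotopy_cat_def cl_def)
  also have "\<dots> = cl (sh X) (sh Y) (sa X Y a)"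
  proof (rule cl_classI)
    fix \<psi> assume "\<psi> : ?S"
    then obtain f where f: "fm X Y f" "hty X Y a (gm X Y f)" "\<psi> = (\<lambda>i. f (i + 1))" by blast
    have "fm (sh X) (sh Y) \<psi>"
      using f(1) by (simp add: fam_def cob_shift f(3))
    moreover have "gm (sh X) (sh Y) \<psi> = sa X Y (gm X Y f)"
      using gr_shift[OF f(1)] by (simp add: cob_shift f(3) mult.assoc)
    ultimately show "fm (sh X) (sh Y) \<psi> \<and>
      hty (sh X) (sh Y) (sa X Y a) (gm (sh X) (sh Y) \<psi>)"
      using sa_hty[OF assms(1,2) f(2)] by simp
  next
    show "?S \<noteq> {}" using cl_nonempty[OF assms] by blast
  qed (use assms in \<open>auto intro: cpl_shift sa_chm\<close>)
  finally show ?thesis .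
qed

lemma K_Neg: "cpl X ==> cpl Y ==> a : chm X Y ==> Neg K (cl X Y a) = cl X Y (- a)"
  by (rule K.Neg_unique[of _ X Y]) (simp_all add: K_homI chm_neg K_Add K_Zero)

end

context additive_category
begin

lemma gr_eq_iff: "fam C X Y n \<phi> ==> fam C X Y n \<psi> ==> gr C X Y n \<phi> = gr C X Y n \<psi> \<longleftrightarrow> \<phi> = \<psi>"
  using gr_inj by metis

end

section \<open>Mapping cones and standard triangles as ring identities\<close>

context complexes
begin

text \<open>\<open>mapping_cone\<close> with all four structure maps explicit and in ring form. The
  term \<open>a * tu (cob X)\<close> is \<open>a\<close> read as a map of degree 1 from the shift of
  \<open>X\<close> to \<open>Y\<close>, the off-diagonal entry of the differential.\<close>

definition rcone :: "('o, 'm) cpx => ('o, 'm) cpx => ('o, 'm, 'x) genel addend => ('o, 'm) cpx => ('o, 'm, 'x) genel addend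
    => ('o, 'm, 'x) genel addend => ('o, 'm, 'x) genel addend => ('o, 'm, 'x) genel addend => bool" where
  "rcone X Y a Z j k p q \<longleftrightarrow> cpl X \<and> cpl Y \<and> cpl Z \<and> a : chm X Y \<and>
    bip (cob (sh X)) (cob Y) (cob Z) j k p q \<and>
    df Z * j = j * df (sh X) + k * (a * tu (cob X)) \<and> df Z * k = k * df Y"

lemma mapping_cone_iff:
  assumes "cpl X" "cpl Y" "cpl Z" "fm X Y \<phi>" "gm X Y \<phi> : chm X Y"
    "fm (sh X) Z j" "fm Y Z k"
    "fm Z (sh X) p" "fm Z Y q"
  shows "rcone X Y (gm X Y \<phi>) Z (gm (sh X) Z j) (gm Y Z k)
      (gm Z (sh X) p) (gm Z Y q) \<longleftrightarrow>
    (\<forall>i. biproduct C (cob X (i + 1)) (cob Y i) (cob Z i) (j i) (k i) (p i) (q i) \<and>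
     cdiff Z i ** j i = (j (i + 1) ** Neg C (cdiff X (i + 1))) \<oplus> (k (i + 1) ** \<phi> (i + 1)) \<and>
     cdiff Z i ** k i = k (i + 1) ** cdiff Y i)"
proof -
  note tuf = tu_fam[of "cob X", OF cpl_Ob[OF assms(1)], folded cob_shift]
  have f1: "fam C (cob (sh X)) (cob Z) 1 (\<lambda>i. cdiff Z i ** j i)"
    and e1: "df Z * gm (sh X) Z j = gr C (cob (sh X)) (cob Z) 1 (\<lambda>i. cdiff Z i ** j i)"
    using fam_Cmp[OF assms(6) cpl_fam[OF assms(3)]] gr_mult[OF assms(6) cpl_fam[OF assms(3)]] by (simp_all add: df_def)
  have f2: "fam C (cob (sh X)) (cob Z) 1 (\<lambda>i. j (i + 1) ** Neg C (cdiff X (i + 1)))"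
    and e2: "gm (sh X) Z j * df (sh X) =
      gr C (cob (sh X)) (cob Z) 1 (\<lambda>i. j (i + 1) ** Neg C (cdiff X (i + 1)))"
    using fam_Cmp[OF cpl_fam[OF cpl_shift[OF assms(1)]] assms(6)] gr_mult[OF cpl_fam[OF cpl_shift[OF assms(1)]] assms(6)]
    by (simp_all add: df_def) (simp_all add: shift_cpx_def)
  have f3: "fam C (cob (sh X)) (cob Y) 1 (\<lambda>i. \<phi> (i + 1))"
    and e3: "gm X Y \<phi> * tu (cob X) = gr C (cob (sh X)) (cob Y) 1 (\<lambda>i. \<phi> (i + 1))"
    using fam_Cmp[OF tuf assms(4)] gr_mult[OF tuf assms(4)] famD[OF assms(4)]
    by (simp_all add: tu_def cob_shift id_right[of _ "cob X (i + 1)" for i])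
      (simp_all add: id_right[OF famD[OF assms(4)]])
  have f4: "fam C (cob (sh X)) (cob Z) 1 (\<lambda>i. k (i + 1) ** \<phi> (i + 1))"
    and e4: "gm Y Z k * (gm X Y \<phi> * tu (cob X)) =
      gr C (cob (sh X)) (cob Z) 1 (\<lambda>i. k (i + 1) ** \<phi> (i + 1))"
    unfolding e3 using fam_Cmp[OF f3 assms(7)] gr_mult[OF f3 assms(7)] by simp_all
  have 1: "df Z * gm (sh X) Z j = gm (sh X) Z j * df (sh X) +
      gm Y Z k * (gm X Y \<phi> * tu (cob X)) \<longleftrightarrow>
      (\<lambda>i. cdiff Z i ** j i) = (\<lambda>i. (j (i + 1) ** Neg C (cdiff X (i + 1))) \<oplus> (k (i + 1) ** \<phi> (i + 1)))"
    unfolding e1 e2 e4 gr_add[OF f2 f4] by (rule gr_eq_iff[OF f1 fam_Add[OF f2 f4]])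
  have f5: "fam C (cob Y) (cob Z) 1 (\<lambda>i. cdiff Z i ** k i)" "fam C (cob Y) (cob Z) 1 (\<lambda>i. k (i + 1) ** cdiff Y i)"
    and e5: "df Z * gm Y Z k = gr C (cob Y) (cob Z) 1 (\<lambda>i. cdiff Z i ** k i)"
      "gm Y Z k * df Y = gr C (cob Y) (cob Z) 1 (\<lambda>i. k (i + 1) ** cdiff Y i)"
    using fam_Cmp[OF assms(7) cpl_fam[OF assms(3)]] gr_mult[OF assms(7) cpl_fam[OF assms(3)]]
      fam_Cmp[OF cpl_fam[OF assms(2)] assms(7)] gr_mult[OF cpl_fam[OF assms(2)] assms(7)] by (simp_all add: df_def)
  have 2: "df Z * gm Y Z k = gm Y Z k * df Y \<longleftrightarrow>
      (\<lambda>i. cdiff Z i ** k i) = (\<lambda>i. k (i + 1) ** cdiff Y i)"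
    unfolding e5 by (rule gr_eq_iff[OF f5])
  show ?thesis
    unfolding rcone_def 1 2 bip_gr[OF assms(6-9)] fun_eq_iff using assms(1-5) by (auto simp: cob_shift)
qed

text \<open>The definition describes the differential on \<open>j\<close> and \<open>k\<close>. As
  these two are jointly epic (\<open>bip_ext\<close>), the composites of the differential with
  \<open>p\<close> and \<open>q\<close> follow. Expanding \<open>df (sh X)\<close> leaves
  \<open>tt\<close> and \<open>tu\<close> as the only traces of the shift.\<close>

lemma rcone_rules:
  assumes "rcone X Y a Z j k p q"
  shows "df Z * k = k * df Y" "df Z * (k * x) = k * (df Y * x)"
    "df Z * j = k * (a * tu (cob X)) - j * (tt (cob X) * (df X * tu (cob X)))"
    "df Z * (j * x) = k * (a * (tu (cob X) * x)) - j * (tt (cob X) * (df X * (tu (cob X) * x)))"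
    "p * df Z = - (tt (cob X) * (df X * (tu (cob X) * p)))"
    "p * (df Z * x) = - (tt (cob X) * (df X * (tu (cob X) * (p * x))))"
    "q * df Z = a * (tu (cob X) * p) + df Y * q"
    "q * (df Z * x) = a * (tu (cob X) * (p * x)) + df Y * (q * x)"
proof -
  have c: "cpl X" "cpl Y" "cpl Z" "a : chm X Y" and b: "bip (cob (sh X)) (cob Y) (cob Z) j k p q"
    and e: "df Z * j = j * df (sh X) + k * (a * tu (cob X))" "df Z * k = k * df Y"
    using assms by (auto simp: rcone_def)
  note bs = bip_simps[OF b]
  note ty = bs(1-4) chm_gH[OF c(4)] df_in_gH[OF c(1)] df_in_gH[OF c(2)] df_in_gH[OF c(3)] tt_cpl[OF c(1)] tu_cpl[OF c(1)]
    df_in_gH[OF cpl_shift[OF c(1)]]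
  show 1: "df Z * k = k * df Y" by (rule e)
  show 2: "df Z * j = k * (a * tu (cob X)) - j * (tt (cob X) * (df X * tu (cob X)))"
    by (simp add: e df_shift c mult.assoc)
  show 3: "p * df Z = - (tt (cob X) * (df X * (tu (cob X) * p)))"
    by (rule bip_ext[OF b, where n = 1 and Z = "cob (sh X)"])
      ((rule ty gH_neg gH_mult refl | simp)+, (simp_all add: mult.assoc 1 2 bs gone_assoc[OF tt_cpl[OF c(1)]] gone_assoc[OF tu_cpl[OF c(1)]] algebra_simps))
  show 4: "q * df Z = a * (tu (cob X) * p) + df Y * q"
    by (rule bip_ext[OF b, where n = 1 and Z = "cob Y"])
      ((rule ty gH_neg gH_add gH_mult refl | simp)+, (simp_all add: mult.assoc 1 2 bs gone_assoc[OF tt_cpl[OF c(1)]] gone_assoc[OF tu_cpl[OF c(1)]]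
        gone_assoc[OF df_in_gH[OF c(2)]] gone_assoc[OF chm_gH[OF c(4)]] algebra_simps))
  show "df Z * (k * x) = k * (df Y * x)" by (simp add: mult.assoc[symmetric] 1)
  show "df Z * (j * x) = k * (a * (tu (cob X) * x)) - j * (tt (cob X) * (df X * (tu (cob X) * x)))"
    by (simp add: mult.assoc[symmetric] 2 left_diff_distrib)
  show "p * (df Z * x) = - (tt (cob X) * (df X * (tu (cob X) * (p * x))))"
    by (simp add: mult.assoc[symmetric] 3)
  show "q * (df Z * x) = a * (tu (cob X) * (p * x)) + df Y * (q * x)"
    by (simp add: mult.assoc[symmetric] 4 distrib_right)
qed

lemma rconeD:
  assumes "rcone X Y a Z j k p q"
  shows "cpl X" "cpl Y" "cpl Z" "a : chm X Y" "bip (cob (sh X)) (cob Y) (cob Z) j k p q"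
    "k : chm Y Z" "p : chm Z (sh X)"
proof -
  show c: "cpl X" "cpl Y" "cpl Z" "a : chm X Y" and b: "bip (cob (sh X)) (cob Y) (cob Z) j k p q"
    using assms by (auto simp: rcone_def)
  show "k : chm Y Z" "p : chm Z (sh X)"
    using bip_simps[OF b] rcone_rules[OF assms] by (auto intro!: chmI simp: df_shift c mult.assoc)
qed

lemma rcone_ex:
  assumes "cpl X" "cpl Y" "a : chm X Y"
  obtains Z j k p q where "rcone X Y a Z j k p q"
proof -
  obtain W j k p q where W: "\<And>i. W i : P" and b: "bip (cob (sh X)) (cob Y) W j k p q"
    using bip_ex[of "cob (sh X)" "cob Y"] cpl_P assms cpl_shift by metis
  note bs = bip_simps[OF b]
  note ty = bs(1-4) chm_gH[OF assms(3)] df_in_gH[OF assms(1)] df_in_gH[OF assms(2)] tt_cpl[OF assms(1)] tu_cpl[OF assms(1)]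
    df_in_gH[OF cpl_shift[OF assms(1)]]
  \<comment> \<open>The matrix with the differentials of the shift of \<open>X\<close> and of
    \<open>Y\<close> on the diagonal and \<open>a\<close> off the diagonal. The mixed terms of its
    square cancel because \<open>a\<close> is a chain map and the shift carries a sign.\<close>
  define D where "D = j * (df (sh X) * p) + (k * (a * (tu (cob X) * p)) + k * (df Y * q))"
  have D: "D : gH C W W 1" unfolding D_def by (rule ty gH_add gH_mult refl | simp)+
  note g = gone_assoc[OF tt_cpl[OF assms(1)]] gone_assoc[OF tu_cpl[OF assms(1)]] gone_assoc[OF df_in_gH[OF assms(1)]]
        gone_assoc[OF df_in_gH[OF assms(2)]] gone_assoc[OF chm_gH[OF assms(3)]]
  have DD: "D * D = 0" unfolding D_def
    by (simp add: algebra_simps bs g df_shift assms df_df_assoc chm_df_assoc[OF assms(3)] cpl_shift_simps)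
  obtain Z where Z: "cpl Z" "cob Z = W" "df Z = D" by (rule cpl_eqI[OF W D DD])
  have "D * j = j * df (sh X) + k * (a * tu (cob X))" "D * k = k * df Y"
    unfolding D_def by (simp_all add: algebra_simps bs df_shift assms g)
  then have "rcone X Y a Z j k p q"
    unfolding rcone_def using assms Z b by simp
  then show thesis by (rule that)
qed

definition std :: "(('o, 'm) karr \<times> ('o, 'm) karr \<times> ('o, 'm) karr) set" where
  "std = {(cl X Y a, cl Y Z k, cl Z (sh X) p) | X Y a Z j k p q. rcone X Y a Z j k p q}"

lemma K_Tri: "Tri K = {t. \<exists>t'\<in>std. triangle_iso K t t'}"
proof -
  have "{(htpy C X Y \<phi>, htpy C Y Z k, htpy C Z (sh X) p) | X Y Z \<phi> k p.
       cpl X \<and> cpl Y \<and> cpl Z \<and> chain_map C X Y \<phi> \<and> mapping_cone C X Y \<phi> Z k p} = std" (is "?L = _")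
  proof (intro equalityI subsetI)
    fix t assume "t : ?L"
    then obtain X Y Z \<phi> k p where c: "cpl X" "cpl Y" "cpl Z" "chain_map C X Y \<phi>" and m: "mapping_cone C X Y \<phi> Z k p"
      and t: "t = (htpy C X Y \<phi>, htpy C Y Z k, htpy C Z (sh X) p)" by blast
    obtain j q where jq: "\<And>i. biproduct C (cob X (i + 1)) (cob Y i) (cob Z i) (j i) (k i) (p i) (q i) \<and>
     cdiff Z i ** j i = (j (i + 1) ** Neg C (cdiff X (i + 1))) \<oplus> (k (i + 1) ** \<phi> (i + 1)) \<and>
     cdiff Z i ** k i = k (i + 1) ** cdiff Y i" using m unfolding mapping_cone_def by blast
    have f: "fm (sh X) Z j" "fm Y Z k"
      "fm Z (sh X) p" "fm Z Y q"
      using jq by (simp_all add: biproduct_def fam_def cob_shift)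
    have \<phi>: "fm X Y \<phi>" "gm X Y \<phi> : chm X Y" using c chm_iff by auto
    have "rcone X Y (gm X Y \<phi>) Z (gm (sh X) Z j) (gm Y Z k)
      (gm Z (sh X) p) (gm Z Y q)"
      using mapping_cone_iff[OF c(1-3) \<phi> f] jq by blast
    moreover have "t = (cl X Y (gm X Y \<phi>), cl Y Z (gm Y Z k),
        cl Z (sh X) (gm Z (sh X) p))"
      unfolding t using htpy_cl c f \<phi> cpl_shift by metis
    ultimately show "t : std" unfolding std_def by blast
  next
    fix t assume "t : std"
    then obtain X Y a Z j k p q where r: "rcone X Y a Z j k p q" and t: "t = (cl X Y a, cl Y Z k, cl Z (sh X) p)"
      unfolding std_def by blast
    note c = rconeD[OF r]
    note bs = bip_simps[OF c(5)]
    obtain \<phi> where \<phi>: "chain_map C X Y \<phi>" "fm X Y \<phi>" "a = gm X Y \<phi>" by (rule chmE[OF c(4,1,2)])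
    obtain j' where j': "fm (sh X) Z j'" "j = gm (sh X) Z j'" by (rule gHE[OF bs(1)])
    obtain k' where k': "fm Y Z k'" "k = gm Y Z k'" by (rule gHE[OF bs(2)])
    obtain p' where p': "fm Z (sh X) p'" "p = gm Z (sh X) p'" by (rule gHE[OF bs(3)])
    obtain q' where q': "fm Z Y q'" "q = gm Z Y q'" by (rule gHE[OF bs(4)])
    have m: "mapping_cone C X Y \<phi> Z k' p'"
      unfolding mapping_cone_def
      using mapping_cone_iff[OF c(1-3) \<phi>(2) c(4)[unfolded \<phi>(3)] j'(1) k'(1) p'(1) q'(1)] r[unfolded \<phi>(3) j'(2) k'(2) p'(2) q'(2)]
      by blast
    have "t = (htpy C X Y \<phi>, htpy C Y Z k', htpy C Z (sh X) p')"
      using t \<phi> k' p' c htpy_cl cpl_shift by simp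
    then show "t : ?L" using m c \<phi>(1) by blast
  qed
  then show ?thesis by (simp add: homotopy_cat_def Tri_saturate triangle_iso_saturate)
qed

end

section \<open>Exactness, rotation and the octahedron for mapping cones\<close>

context complexes
begin

lemma hty_zeroE:
  assumes "hty X Y a 0"
  obtains s where "s : gh X Y (- 1)" "a = df Y * s + s * df X"
proof -
  obtain s where "s : gh X Y (- 1)" "a = 0 + (df Y * s + s * df X)"
    using hty_sym[OF assms] unfolding hty_def by blast
  then show thesis using that by simp
qed

lemma K_isoI:
  assumes "cpl X" "cpl Y" "\<phi> : chm X Y" "\<psi> : chm Y X" "hty X X (\<psi> * \<phi>) (gone (cob X))" "hty Y Y (\<phi> * \<psi>) (gone (cob Y))"
  shows "iso K (cl X Y \<phi>)"
  by (rule K.isoI[of _ X Y "cl Y X \<psi>"]) (use assms in \<open>simp_all add: K_homI K_Cmp K_Ident cl_eq_iff chm_mult chm_one\<close>)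

text \<open>A homotopy equivalence on the third object, with identities on the other two, is an
  isomorphism to the standard triangle. Rotation and the octahedron are both obtained by finding
  such an equivalence with a cone.\<close>

lemma K_Tri_stdI:
  assumes r: "rcone X Y a Z j k p q" and Z': "cpl Z'"
    and c: "\<phi> : chm Z' Z" "\<psi> : chm Z Z'" "hty Z' Z' (\<psi> * \<phi>) (gone (cob Z'))" "hty Z Z (\<phi> * \<psi>) (gone (cob Z))"
    and g: "k' : chm Y Z'" "hty Y Z (\<phi> * k') k" and h: "p' : chm Z' (sh X)" "hty Z' (sh X) (p * \<phi>) p'"
  shows "(cl X Y a, cl Y Z' k', cl Z' (sh X) p') : Tri K"
proof -
  note d = rconeD[OF r]
  note cs = d(1-3) Z' cpl_shift[OF d(1)]
  have std: "(cl X Y a, cl Y Z k, cl Z (sh X) p) : std" using r unfolding std_def by blast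
  note h1 = K_homI[OF cs(1,2) d(4)] and h2 = K_homI[OF cs(2,4) g(1)] and h3 = K_homI[OF cs(4,5) h(1)]
  have "ShArr K (Ident K X) = Ident K (sh X)"
    using cs by (simp add: K_Ident K_ShArr chm_one cob_shift gone_assoc[OF tu_gH[of "cob X", OF cpl_Ob]] cpl_shift_simps)
  then have "triangle_iso K (cl X Y a, cl Y Z' k', cl Z' (sh X) p') (cl X Y a, cl Y Z k, cl Z (sh X) p)"
    by (intro triangle_isoI[OF h1 h2 _ h1 K_homI[OF cs(2,3) d(6)] _ K.id_hom K.id_hom K_homI[OF cs(4,3) c(1)] K.iso_Ident K.iso_Ident K_isoI[OF cs(4,3) c]])
      (use cs d c g h K.id_left[OF h1] K.id_right[OF h1] K.id_left[OF h3] K.id_right[OF K_homI[OF cs(2,3) d(6)]] h3 K_homI[OF cs(3,5) d(7)] hty_sym in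
        \<open>simp_all add: K_Cmp cl_eq_iff chm_mult\<close>)
  then show ?thesis unfolding K_Tri using std by blast
qed

lemma std_zero:
  assumes r: "rcone X Y a Z j k p q" shows "hty X Z (k * a) 0"
proof -
  note d = rconeD[OF r] and ru = rcone_rules[OF r] and bs = bip_simps[OF rconeD(5)[OF r]]
  note ty = bs(1-4) tt_cpl[OF d(1)]
  have "hty X Z 0 (k * a)"
  \<comment> \<open>The inclusion of the shifted copy of \<open>X\<close>, read as a map of degree
    -1, is the null homotopy.\<close>
  proof (rule htyI[of _ _ _ _ "j * tt (cob X)"])
    show "j * tt (cob X) : gh X Z (- 1)" by (rule ty gH_mult refl | simp)+
    show "k * a = 0 + (df Z * (j * tt (cob X)) + j * tt (cob X) * df X)"
      by (simp add: algebra_simps ru cpl_shift_simps d gone_assoc[OF chm_gH[OF d(4)]] gone_assoc[OF df_in_gH[OF d(1)]])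
  qed (use d chm_zero chm_mult in auto)
  then show ?thesis by (rule hty_sym)
qed

text \<open>A null homotopy \<open>s\<close> of \<open>k * u\<close> is a map of degree -1 into the
  cone. Its component in the shift of \<open>X\<close> is the desired \<open>v\<close>, and its
  component in \<open>Y\<close> is the homotopy between \<open>a * v\<close> and
  \<open>u\<close>.\<close>

lemma std_weak_kernel:
  assumes r: "rcone X Y a Z j k p q" and W: "cpl W" and u: "u : chm W Y" and ku: "hty W Z (k * u) 0"
  shows "\<exists>v\<in>chm W X. hty W Y (a * v) u"
proof -
  note d = rconeD[OF r] and ru = rcone_rules[OF r] and bs = bip_simps[OF rconeD(5)[OF r]]
  obtain s where s: "s : gh W Z (- 1)" "k * u = df Z * s + s * df W"
    using ku by (rule hty_zeroE)
  note ty = bs(1-4) tt_cpl[OF d(1)] tu_cpl[OF d(1)] s(1)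
  define v where "v = tu (cob X) * (p * s)"
  have v: "v : gh W X 0" unfolding v_def by (rule ty gH_mult refl | simp)+
  have qs: "q * s : gh W Y (- 1)" by (rule ty gH_mult refl | simp)+
  have "tu (cob X) * (p * (k * u)) = tu (cob X) * (p * (df Z * s + s * df W))" using s(2) by simp
  then have "v * df W = df X * v"
    by (simp add: algebra_simps bs ru v_def cpl_shift_simps d gone_assoc[OF df_in_gH[OF d(1)]])
  then have v': "v : chm W X" using v by (intro chmI)
  have "q * (k * u) = q * (df Z * s + s * df W)" using s(2) by simp
  then have "u = a * v + (df Y * (q * s) + q * s * df W)"
    by (simp add: algebra_simps bs ru v_def gone_assoc[OF chm_gH[OF u]])
  then have "hty W Y (a * v) u"
    by (intro htyI[OF _ _ qs]) (use u v' d in \<open>auto intro: chm_mult\<close>)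
  then show ?thesis using v' by blast
qed

text \<open>A map out of the cone is a map out of \<open>Y\<close> together with a null homotopy of
  its composite with \<open>a\<close>. The factorisation is therefore strict, not only up to
  homotopy.\<close>

lemma std_weak_cokernel:
  assumes r: "rcone X Y a Z j k p q" and W: "cpl W" and u: "u : chm Y W" and ua: "hty X W (u * a) 0"
  shows "\<exists>v\<in>chm Z W. v * k = u"
proof -
  note d = rconeD[OF r] and ru = rcone_rules[OF r] and bs = bip_simps[OF rconeD(5)[OF r]]
  obtain s where s: "s : gh X W (- 1)" "u * a = df W * s + s * df X"
    using ua by (rule hty_zeroE)
  note ty = bs(1-4) tt_cpl[OF d(1)] tu_cpl[OF d(1)] s(1) chm_gH[OF u]
  define v where "v = u * q + s * (tu (cob X) * p)"
  have v: "v : gh Z W 0" unfolding v_def by (rule ty gH_add gH_mult refl | simp)+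
  have ua': "u * (a * x) = df W * (s * x) + s * (df X * x)" for x
    using s(2) by (simp add: mult.assoc[symmetric] distrib_right)
  have "v * df Z = df W * v"
    by (simp add: algebra_simps bs ru v_def cpl_shift_simps d gone_assoc[OF df_in_gH[OF d(1)]] ua' chm_df_assoc[OF u])
  then have "v : chm Z W" using v by (intro chmI)
  moreover have "v * k = u" by (simp add: v_def algebra_simps bs gone_assoc[OF chm_gH[OF u]])
  ultimately show ?thesis by blast
qed

lemma std_rotate:
  assumes r: "rcone X Y a Z j k p q"
  shows "(cl Y Z k, cl Z (sh X) p, cl (sh X) (sh Y) (- sa X Y a)) : Tri K"
proof -
  note d = rconeD[OF r] and ru = rcone_rules[OF r] and bs = bip_simps[OF rconeD(5)[OF r]]
  obtain M j' k' p' q' where r': "rcone Y Z k M j' k' p' q'" using rcone_ex[OF d(2,3,6)] by blast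
  note d' = rconeD[OF r'] and ru' = rcone_rules[OF r'] and bs' = bip_simps[OF rconeD(5)[OF r']]
  note ty = bs(1-4) bs'(1-4) tt_cpl[OF d(1)] tu_cpl[OF d(1)] tt_cpl[OF d(2)] tu_cpl[OF d(2)] chm_gH[OF d(4)]
  note ga = gone_assoc[OF df_in_gH[OF d(1)]] gone_assoc[OF df_in_gH[OF d(2)]] gone_assoc[OF chm_gH[OF d(4)]]
    gone_assoc[OF bs(4)] gone_assoc[OF bs(2)] gone_assoc[OF bs'(3)[unfolded cob_shift]]
  note ss = cpl_shift_simps[OF d(1)] cpl_shift_simps[OF d(2)]
  let ?X1 = "sh X" and ?Y1 = "sh Y"
  \<comment> \<open>The cone of \<open>k\<close> consists of the shift of \<open>Y\<close>, the
    shift of \<open>X\<close>, and \<open>Y\<close>. Up to homotopy the two copies of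
    \<open>Y\<close> cancel, and \<open>c\<close> embeds the shift of \<open>X\<close> as the graph
    of minus the shift of \<open>a\<close>.\<close>
  define c where "c = k' * j - j' * sa X Y a"
  have c: "c : chm ?X1 M"
  proof (rule chmI)
    show "c : gH C (cob ?X1) (cob M) 0" unfolding c_def by (rule ty gH_diff gH_mult refl | simp)+
    show "c * df ?X1 = df M * c"
      by (simp add: c_def algebra_simps df_shift d ru ru' ss ga chm_df_assoc[OF d(4)])
  qed
  have pq: "p * q' : chm M ?X1"
  proof (rule chmI)
    show "p * q' : gH C (cob M) (cob ?X1) 0" by (rule ty gH_mult refl | simp)+
    show "p * q' * df M = df ?X1 * (p * q')"
      by (simp add: algebra_simps df_shift d ru ru' bs)
  qed
  show ?thesis
  proof (rule K_Tri_stdI[OF r' cpl_shift[OF d(1)] c pq])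
    have "p * q' * c = gone (cob ?X1)"
      by (simp add: c_def algebra_simps bs bs' gone_assoc[OF bs(1)])
    then show "hty ?X1 ?X1 (p * q' * c) (gone (cob ?X1))"
      by (simp add: hty_refl cpl_shift d chm_one)
    \<comment> \<open>This homotopy moves the summand \<open>Y\<close> to its shifted copy and so
      contracts the two against each other.\<close>
    let ?s = "j' * (tt (cob Y) * (q * q'))"
    show "hty M M (c * (p * q')) (gone (cob M))"
    proof (rule htyI[of _ _ _ _ ?s])
      show "?s : gh M M (- 1)" by (rule ty gH_mult refl | simp)+
      have "(j * p + k * q) * q' = q'" unfolding bs(13) by (rule gone_left[OF bs'(4)])
      then have 1: "j * (p * q') = q' - k * (q * q')" by (simp add: algebra_simps)
      have "gone (cob M) = j' * p' + k' * q'" by (rule bs'(13)[symmetric])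
      then show "gone (cob M) = c * (p * q') + (df M * ?s + ?s * df M)"
        by (simp add: c_def algebra_simps ru ru' ss ga bs bs' 1)
    qed (use c pq chm_mult chm_one d' in auto)
    let ?t = "j' * (tt (cob Y) * q)"
    show "hty Z M (c * p) k'"
    proof (rule htyI[of _ _ _ _ ?t])
      show "?t : gh Z M (- 1)" by (rule ty gH_mult refl | simp)+
      have "k' * (j * p + k * q) = k'" unfolding bs(13) by (rule gone_right[OF bs'(2)])
      then have 1: "k' * (j * p) = k' - k' * (k * q)" by (simp add: algebra_simps)
      show "k' = c * p + (df M * ?t + ?t * df Z)"
        by (simp add: c_def algebra_simps ru ru' ss ga bs bs' 1)
    qed (use c d d' chm_mult in auto)
    show "- sa X Y a : chm ?X1 ?Y1" by (intro chm_neg sa_chm d)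
    have "p' * c = - sa X Y a" by (simp add: c_def algebra_simps bs' ss gone_assoc[OF tt_cpl[OF d(2)]])
    then show "hty ?X1 ?Y1 (p' * c) (- sa X Y a)"
      using \<open>- sa X Y a : chm ?X1 ?Y1\<close> by (simp add: hty_refl cpl_shift d)
  qed (use d in auto)
qed

lemma std_morphism:
  assumes r: "rcone X Y a Z j k p q" and r': "rcone X' Y' a' Z' j' k' p' q'"
    and u: "u : chm X X'" and v: "v : chm Y Y'" and e: "hty X Y' (a' * u) (v * a)"
  shows "\<exists>w\<in>chm Z Z'. w * k = k' * v \<and> sa X X' u * p = p' * w"
proof -
  note d = rconeD[OF r] and ru = rcone_rules[OF r] and bs = bip_simps[OF rconeD(5)[OF r]]
  note d' = rconeD[OF r'] and ru' = rcone_rules[OF r'] and bs' = bip_simps[OF rconeD(5)[OF r']]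
  obtain s where s: "s : gh X Y' (- 1)" "v * a = a' * u + (df Y' * s + s * df X)"
    using e by (auto simp: hty_def)
  have va: "v * (a * x) = a' * (u * x) + (df Y' * (s * x) + s * (df X * x))" for x
    using s(2) by (simp add: mult.assoc[symmetric] distrib_right)
  note ty = bs(1-4) bs'(1-4) tt_cpl[OF d(1)] tu_cpl[OF d(1)] tt_cpl[OF d'(1)] tu_cpl[OF d'(1)] chm_gH[OF u] chm_gH[OF v] s(1)
  note ga = gone_assoc[OF df_in_gH[OF d(1)]] gone_assoc[OF chm_gH[OF u]] gone_assoc[OF chm_gH[OF v]] gone_assoc[OF tt_cpl[OF d'(1)]]
  note ss = cpl_shift_simps[OF d(1)] cpl_shift_simps[OF d'(1)]
  \<comment> \<open>The matrix with the shift of \<open>u\<close> and with \<open>v\<close> on the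
    diagonal; the homotopy between \<open>a' * u\<close> and \<open>v * a\<close> is its
    off-diagonal entry. The squares with the inclusions and projections of the cones then commute
    strictly.\<close>
  define w where "w = j' * (sa X X' u * p) + (k' * (v * q) + k' * (s * (tu (cob X) * p)))"
  have "w : chm Z Z'"
  proof (rule chmI)
    show "w : gh Z Z' 0" unfolding w_def by (rule ty gH_add gH_mult refl | simp)+
    show "w * df Z = df Z' * w"
      by (simp add: w_def algebra_simps ru ru' ss ga bs va chm_df_assoc[OF u] chm_df_assoc[OF v])
  qed
  moreover have "w * k = k' * v" by (simp add: w_def algebra_simps bs ga)
  moreover have "sa X X' u * p = p' * w" by (simp add: w_def algebra_simps bs' ga)
  ultimately show ?thesis by blast
qed

lemma std_octahedron:
  assumes r1: "rcone X Y a U j1 k1 p1 q1" and r2: "rcone Y Z b W j2 k2 p2 q2" and r3: "rcone X Z (b * a) V j3 k3 p3 q3"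
  shows "\<exists>u v w. (cl U V u, cl V W v, cl W (sh U) w) : Tri K"
proof -
  note d1 = rconeD[OF r1] and ru1 = rcone_rules[OF r1] and bs1 = bip_simps[OF rconeD(5)[OF r1]]
  note d2 = rconeD[OF r2] and ru2 = rcone_rules[OF r2] and bs2 = bip_simps[OF rconeD(5)[OF r2]]
  note d3 = rconeD[OF r3] and ru3 = rcone_rules[OF r3, unfolded mult.assoc] and bs3 = bip_simps[OF rconeD(5)[OF r3]]
  note ty = bs1(1-4) bs2(1-4) bs3(1-4) tt_cpl[OF d1(1)] tu_cpl[OF d1(1)] tt_cpl[OF d1(2)] tu_cpl[OF d1(2)]
    tt_cpl[OF d1(3)] tu_cpl[OF d1(3)] chm_gH[OF d1(4)] chm_gH[OF d2(4)]
  note ga = gone_assoc[OF df_in_gH[OF d1(1)]] gone_assoc[OF df_in_gH[OF d1(2)]] gone_assoc[OF df_in_gH[OF d1(3)]]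
    gone_assoc[OF df_in_gH[OF d2(2)]] gone_assoc[OF chm_gH[OF d1(4)]] gone_assoc[OF chm_gH[OF d2(4)]]
    gone_assoc[OF bs1(1)] gone_assoc[OF bs1(2)] gone_assoc[OF bs1(3)] gone_assoc[OF bs1(4)]
  note ss = cpl_shift_simps[OF d1(1)] cpl_shift_simps[OF d1(2)] cpl_shift_simps[OF d1(3)]
  \<comment> \<open>The map of cones that is the identity on the shift of \<open>X\<close> and
    \<open>b\<close> on \<open>Y\<close>.\<close>
  define u where "u = j3 * p1 + k3 * (b * q1)"
  have u: "u : chm U V"
  proof (rule chmI)
    show "u : gh U V 0" unfolding u_def by (rule ty gH_add gH_mult refl | simp)+
    show "u * df U = df V * u"
      by (simp add: u_def algebra_simps ru1 ru3 ss ga bs1 bs3 chm_df_assoc[OF d2(4)])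
  qed
  obtain M j4 k4 p4 q4 where r4: "rcone U V u M j4 k4 p4 q4" using rcone_ex[OF d1(3) d3(3) u] by blast
  note d4 = rconeD[OF r4] and ru4 = rcone_rules[OF r4] and bs4 = bip_simps[OF rconeD(5)[OF r4]]
  have uj: "u * j1 = j3" "u * (j1 * x) = j3 * x" "u * k1 = k3 * b" "u * (k1 * x) = k3 * (b * x)"
    "p3 * u = p1" "p3 * (u * x) = p1 * x" "q3 * u = b * q1" "q3 * (u * x) = b * (q1 * x)" for x
    by (simp_all add: u_def algebra_simps bs1 bs3 ga gone_assoc[OF bs3(1)])
  note ty4 = bs4(1-4)
  \<comment> \<open>The cone of \<open>u\<close> consists of the double shift of \<open>X\<close>,
    the shifts of \<open>Y\<close> and of \<open>X\<close>, and \<open>Z\<close>. Up to homotopy the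
    copies of \<open>X\<close> cancel, which leaves the summands of the cone of \<open>b\<close>.
    The extra term with \<open>a\<close> makes \<open>\<psi>\<close> a chain map.\<close>
  define \<phi> where "\<phi> = j4 * (tt (cob U) * (k1 * (tu (cob Y) * p2))) + k4 * (k3 * q2)"
  define \<psi> where "\<psi> = j2 * (tt (cob Y) * (q1 * (tu (cob U) * p4))) + (j2 * (tt (cob Y) * (a * (tu (cob X) * (p3 * q4)))) + k2 * (q3 * q4))"
  have \<phi>: "\<phi> : chm W M"
  proof (rule chmI)
    show "\<phi> : gh W M 0" unfolding \<phi>_def by (rule ty ty4 gH_add gH_mult refl | simp)+
    show "\<phi> * df W = df M * \<phi>"
      by (simp add: \<phi>_def algebra_simps ru1 ru2 ru3 ru4 ss ga bs1 bs2 bs3 bs4 uj)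
  qed
  have \<psi>: "\<psi> : chm M W"
  proof (rule chmI)
    show "\<psi> : gh M W 0" unfolding \<psi>_def by (rule ty ty4 gH_add gH_mult refl | simp)+
    show "\<psi> * df M = df W * \<psi>"
      by (simp add: \<psi>_def algebra_simps ru1 ru2 ru3 ru4 ss ga bs1 bs2 bs3 bs4 uj chm_df_assoc[OF d1(4)] chm_df_assoc[OF d2(4)])
  qed
  have one: "\<psi> * \<phi> = gone (cob W)"
    using bs2(13) by (simp add: \<phi>_def \<psi>_def algebra_simps ss ga bs1 bs2 bs3 bs4 gone_assoc[OF bs2(3)[unfolded cob_shift]] gone_assoc[OF tu_cpl[OF d1(2)]]
      gone_assoc[OF bs3(2)] gone_assoc[OF tt_cpl[OF d1(3)]])
  \<comment> \<open>This homotopy moves the shift of \<open>X\<close> inside \<open>V\<close> to the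
    double shift of \<open>X\<close> inside the shift of \<open>U\<close>.\<close>
  let ?s = "j4 * (tt (cob U) * (j1 * (p3 * q4)))"
  have two: "hty M M (\<phi> * \<psi>) (gone (cob M))"
  proof (rule htyI[of _ _ _ _ ?s])
    show "?s : gh M M (- 1)" by (rule ty ty4 gH_mult refl | simp)+
    have "tt (cob U) * ((j1 * p1 + k1 * q1) * (tu (cob U) * p4)) = p4"
      unfolding bs1(13) by (simp add: ss gone_assoc[OF bs4(3)[unfolded cob_shift]])
    then have 1: "tt (cob U) * (j1 * (p1 * (tu (cob U) * p4))) = p4 - tt (cob U) * (k1 * (q1 * (tu (cob U) * p4)))"
      by (simp add: algebra_simps)
    have "(j3 * p3 + k3 * q3) * q4 = q4"
      unfolding bs3(13) by (simp add: gone_assoc[OF bs4(4)])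
    then have 2: "j3 * (p3 * q4) = q4 - k3 * (q3 * q4)" by (simp add: algebra_simps)
    have "gone (cob M) = j4 * p4 + k4 * q4" by (rule bs4(13)[symmetric])
    then show "gone (cob M) = \<phi> * \<psi> + (df M * ?s + ?s * df M)"
      by (simp add: \<phi>_def \<psi>_def algebra_simps ru1 ru3 ru4 ss ga bs1 bs2 bs3 bs4 uj 1 2 gone_assoc[OF tt_cpl[OF d1(2)]])
  qed (use \<phi> \<psi> chm_mult chm_one d4 in auto)
  have "(cl U V u, cl V W (\<psi> * k4), cl W (sh U) (p4 * \<phi>)) : Tri K"
  proof (rule K_Tri_stdI[OF r4 d2(3) \<phi> \<psi> _ two])
    show "hty W W (\<psi> * \<phi>) (gone (cob W))" using one by (simp add: hty_refl chm_one d2)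
    show "\<psi> * k4 : chm V W" by (rule chm_mult[OF \<psi> d4(6)])
    show "p4 * \<phi> : chm W (sh U)" by (rule chm_mult[OF d4(7) \<phi>])
    then show "hty W (sh U) (p4 * \<phi>) (p4 * \<phi>)" by (simp add: hty_refl cpl_shift d1 d2)
    show "hty V M (\<phi> * (\<psi> * k4)) k4"
      using hty_mult_right[OF two d4(6)] by (simp add: mult.assoc gone_left[OF chm_gH[OF d4(6)]])
  qed
  then show ?thesis by blast
qed

end

context complexes
begin

lemma stdE:
  assumes "(f, g, h) : std"
  obtains X Y a Z j k p q where "rcone X Y a Z j k p q" "f = cl X Y a" "g = cl Y Z k" "h = cl Z (sh X) p"
  using assms unfolding std_def by blast

sublocale K: triangulated K std
proof (intro triangulated.intro K.additive_category_axioms triangulated_axioms.intro)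
  fix f X Y assume "f : hom K X Y"
  then show "ShArr K f : hom K (ShOb K X) (ShOb K Y)"
    by (auto elim!: K_homE simp: K_ShArr intro!: K_homI cpl_shift sa_chm)
next
  fix f X Y g Z assume "f : hom K X Y" "g : hom K Y Z"
  then obtain a b where "cpl X" "cpl Y" "cpl Z" "a : chm X Y" "b : chm Y Z" "f = cl X Y a" "g = cl Y Z b"
    by (elim K_homE) blast
  then show "ShArr K (g **\<^sub>K f) = ShArr K g **\<^sub>K ShArr K f"
    by (simp add: K_Cmp K_ShArr chm_mult cpl_shift sa_chm mult.assoc cpl_shift_simps gone_assoc[OF chm_gH])
next
  fix X assume "X : Ob K"
  then show "ShArr K (Ident K X) = Ident K (ShOb K X)"
    by (simp add: K_Ident K_ShArr chm_one cpl_shift cob_shift cpl_shift_simps)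
next
  fix f X Y g assume "f : hom K X Y" "g : hom K X Y"
  then obtain a b where "cpl X" "cpl Y" "a : chm X Y" "b : chm X Y" "f = cl X Y a" "g = cl X Y b"
    by (elim K_homE) blast
  then show "ShArr K (f \<oplus>\<^bsub>K\<^esub> g) = ShArr K f \<oplus>\<^bsub>K\<^esub> ShArr K g"
    "ShArr K f = ShArr K g ==> f = g"
    by (simp_all add: K_Add K_ShArr chm_add cpl_shift sa_chm cl_eq_iff sa_hty_iff) (simp add: algebra_simps hty_refl cpl_shift chm_add sa_chm)
next
  fix X Y f assume "X : Ob K" "Y : Ob K" "f : hom K (ShOb K X) (ShOb K Y)"
  then obtain b where c: "cpl X" "cpl Y" and b: "b : chm (sh X) (sh Y)" "f = cl (sh X) (sh Y) b"
    by (auto elim!: K_homE)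
  note ty = tt_cpl[OF c(1)] tu_cpl[OF c(1)] tt_cpl[OF c(2)] tu_cpl[OF c(2)] chm_gH[OF b(1)]
  note ga = gone_assoc[OF df_in_gH[OF c(1)]] gone_assoc[OF df_in_gH[OF c(2)]] gone_assoc[OF chm_gH[OF b(1), unfolded cob_shift]]
  define a where "a = tu (cob Y) * (b * tt (cob X))"
  have "a : chm X Y"
  proof (rule chmI)
    show "a : gh X Y 0" unfolding a_def by (rule ty gH_mult refl | simp)+
    have "tu (cob Y) * (b * df (sh X) * tt (cob X)) = tu (cob Y) * (df (sh Y) * b * tt (cob X))"
      using chm_df[OF b(1)] by simp
    then show "a * df X = df Y * a"
      by (simp add: a_def mult.assoc df_shift c cpl_shift_simps ga)
  qed
  moreover have "sa X Y a = b" by (simp add: a_def mult.assoc cpl_shift_simps c ga)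
  ultimately show "\<exists>g\<in>hom K X Y. ShArr K g = f"
    using c b by (intro bexI[of _ "cl X Y a"]) (simp_all add: K_ShArr K_homI)
next
  fix X assume "X : Ob K"
  then show "\<exists>Y\<in>Ob K. ShOb K Y = X"
    by (intro bexI[of _ "unshift_cpx C X"]) (simp_all add: cpl_unshift shift_unshift)
next
  show "Tri K = {t. \<exists>t'\<in>std. triangle_iso K t t'}" by (rule K_Tri)
next
  fix t assume "t : std"
  then obtain X Y a Z j k p q where r: "rcone X Y a Z j k p q" and t: "t = (cl X Y a, cl Y Z k, cl Z (sh X) p)"
    unfolding std_def by blast
  then show "candidate_triangle K t"
    using rconeD[OF r] cpl_shift by (auto simp: candidate_triangle_def K_Arr)
next
  fix f X Y assume "f : hom K X Y"
  then obtain a where a: "cpl X" "cpl Y" "a : chm X Y" "f = cl X Y a" by (rule K_homE)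
  obtain Z j k p q where "rcone X Y a Z j k p q" by (rule rcone_ex[OF a(1-3)])
  then show "\<exists>g h. (f, g, h) : std" unfolding std_def a(4) by blast
next
  fix f g h assume "(f, g, h) : std"
  then obtain X Y a Z j k p q where r: "rcone X Y a Z j k p q" and e: "f = cl X Y a" "g = cl Y Z k" "h = cl Z (sh X) p"
    by (rule stdE)
  note d = rconeD[OF r]
  show "(g, h, Neg K (ShArr K f)) : Tri K"
    using std_rotate[OF r] d by (simp add: e K_ShArr K_Neg cpl_shift sa_chm)
  show "g **\<^sub>K f = Zero K (Dom K f) (Cod K g)"
    using std_zero[OF r] d by (simp add: e K_Cmp K_Zero cl_eq_iff chm_mult chm_zero)
  {
    fix u W assume u: "u : hom K W (Dom K g)" and z: "g **\<^sub>K u = Zero K W (Cod K g)"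
    obtain b where b: "cpl W" "b : chm W Y" "u = cl W Y b" using u by (auto simp: e elim!: K_homE)
    have "hty W Z (k * b) 0" using z b d by (simp add: e K_Cmp K_Zero cl_eq_iff chm_mult chm_zero)
    then obtain v where "v : chm W X" "hty W Y (a * v) b" using std_weak_kernel[OF r b(1,2)] by blast
    then show "\<exists>v\<in>hom K W (Dom K f). u = f **\<^sub>K v"
      using b d by (intro bexI[of _ "cl W X v"]) (simp_all add: e K_Cmp cl_eq_iff chm_mult K_homI hty_sym)
  }
  {
    fix u W assume u: "u : hom K (Dom K g) W" and z: "u **\<^sub>K f = Zero K (Dom K f) W"
    obtain b where b: "cpl W" "b : chm Y W" "u = cl Y W b" using u by (auto simp: e elim!: K_homE)
    have "hty X W (b * a) 0" using z b d by (simp add: e K_Cmp K_Zero cl_eq_iff chm_mult chm_zero)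
    then obtain v where "v : chm Z W" "v * k = b" using std_weak_cokernel[OF r b(1,2)] by blast
    then show "\<exists>v\<in>hom K (Cod K g) W. u = v **\<^sub>K g"
      using b d by (intro bexI[of _ "cl Z W v"]) (simp_all add: e K_Cmp K_homI)
  }
next
  fix f g h f' g' h' u v
  assume "(f, g, h) : std" "(f', g', h') : std" and u: "u : hom K (Dom K f) (Dom K f')"
    and v: "v : hom K (Dom K g) (Dom K g')" and c: "v **\<^sub>K f = f' **\<^sub>K u"
  then obtain X Y a Z j k p q X' Y' a' Z' j' k' p' q' where r: "rcone X Y a Z j k p q"
    and e: "f = cl X Y a" "g = cl Y Z k" "h = cl Z (sh X) p"
    and r': "rcone X' Y' a' Z' j' k' p' q'"
    and e': "f' = cl X' Y' a'" "g' = cl Y' Z' k'" "h' = cl Z' (sh X') p'"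
    by (elim stdE) blast
  note d = rconeD[OF r] and d' = rconeD[OF r']
  obtain b where b: "b : chm X X'" "u = cl X X' b" using u by (auto simp: e e' elim!: K_homE)
  obtain b' where b': "b' : chm Y Y'" "v = cl Y Y' b'" using v by (auto simp: e e' elim!: K_homE)
  have "hty X Y' (a' * b) (b' * a)"
    using c[symmetric] b b' d d' by (simp add: e e' K_Cmp cl_eq_iff chm_mult)
  then obtain w where "w : chm Z Z'" "w * k = k' * b'" "sa X X' b * p = p' * w"
    using std_morphism[OF r r' b(1) b'(1)] by blast
  then show "\<exists>c\<in>hom K (Cod K g) (Cod K g'). c **\<^sub>K g = g' **\<^sub>K v \<and> ShArr K u **\<^sub>K h = h' **\<^sub>K c"
    using b b' d d' by (intro bexI[of _ "cl Z Z' w"]) (simp_all add: e e' K_Cmp K_ShArr cpl_shift sa_chm K_homI)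
next
  fix f X Y g Z assume f: "f : hom K X Y" and g: "g : hom K Y Z"
  obtain a where a: "cpl X" "cpl Y" "a : chm X Y" "f = cl X Y a" using f by (rule K_homE)
  obtain b where b: "cpl Z" "b : chm Y Z" "g = cl Y Z b" using g by (auto elim: K_homE)
  obtain U j1 k1 p1 q1 where r1: "rcone X Y a U j1 k1 p1 q1" by (rule rcone_ex[OF a(1-3)])
  obtain W j2 k2 p2 q2 where r2: "rcone Y Z b W j2 k2 p2 q2" by (rule rcone_ex[OF a(2) b(1,2)])
  obtain V j3 k3 p3 q3 where r3: "rcone X Z (b * a) V j3 k3 p3 q3" by (rule rcone_ex[OF a(1) b(1) chm_mult[OF b(2) a(3)]])
  obtain u v w where t: "(cl U V u, cl V W v, cl W (sh U) w) : Tri K"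
    using std_octahedron[OF r1 r2 r3] by blast
  have "g **\<^sub>K f = cl X Z (b * a)" using a b by (simp add: K_Cmp)
  then have s: "(f, cl Y U k1, cl U (sh X) p1) : std" "(g, cl Z W k2, cl W (sh Y) p2) : std"
      "(g **\<^sub>K f, cl Z V k3, cl V (sh X) p3) : std"
    using r1 r2 r3 a(4) b(3) unfolding std_def by blast+
  have e: "Dom K (cl U V u) = Cod K (cl Y U k1)" "Cod K (cl U V u) = Cod K (cl Z V k3)" "Cod K (cl V W v) = Cod K (cl Z W k2)"
    by simp_all
  show "\<exists>f1 f2 g1 g2 h1 h2 u v w. (f, f1, f2) : std \<and> (g, g1, g2) : std \<and> (g **\<^sub>K f, h1, h2) : std \<and>
        (u, v, w) : Tri K \<and> Dom K u = Cod K f1 \<and> Cod K u = Cod K h1 \<and> Cod K v = Cod K g1"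
    by (intro exI conjI) (rule s t e)+
qed

end

section \<open>Isomorphisms and signs, and consequences of the triangulated axioms\<close>

context category
begin

lemma iso_square:
  assumes "f : hom C X Y" "f' : hom C X' Y'" "a : hom C X X'" "b : hom C Y Y'" "b ** f = f' ** a"
    "a' : hom C X' X" "b' : hom C Y' Y" "b' ** b = Ident C Y" "a ** a' = Ident C X'"
  shows "b' ** f' = f ** a'"
proof -
  have "b' ** f' = b' ** (f' ** (a ** a'))" using assms id_right by simp
  also have "\<dots> = b' ** ((b ** f) ** a')" unfolding assms(5) using assoc[OF assms(6,3,2)] by simp
  also have "\<dots> = (b' ** b) ** (f ** a')"
    using assms(1,4,6,7) by (simp add: hom_def cat_simps)
  also have "\<dots> = f ** a'" using assms id_left comp by metis
  finally show ?thesis .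
qed

lemma square_comp:
  assumes "q ** r = r' ** p" "q' ** r' = r'' ** p'" "p : hom C A A'" "p' : hom C A' A''" "q : hom C B B'" "q' : hom C B' B''"
    "r : hom C A B" "r' : hom C A' B'" "r'' : hom C A'' B''"
  shows "(q' ** q) ** r = r'' ** (p' ** p)"
  using assoc[OF assms(7,5,6)] assoc[OF assms(3,8,6)] assoc[OF assms(3,4,9)] assms(1,2) by simp

lemma conjugate_cancel:
  assumes "x : hom C A B" "x' : hom C B A" "x' ** x = Ident C A" "y : hom C D A" "z : hom C D F" "z' : hom C F D" "z' ** z = Ident C D"
  shows "x' ** ((x ** (y ** z')) ** z) = y"
  using assoc[OF assms(5) comp[OF assms(6,4)] assms(1)] assoc[OF assms(5,6,4)] assoc[OF comp[OF assms(5) comp[OF assms(6,4)]] assms(1,2)]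
    assms(3,7) id_right[OF assms(4)] id_left[OF assms(4)] by simp

lemma iso_of_composites:
  assumes c: "c : hom C X Y" and d: "d : hom C Y X" and i: "iso C (d ** c)" "iso C (c ** d)"
  shows "iso C c"
proof -
  obtain p where p: "p : hom C X X" "p ** (d ** c) = Ident C X" by (rule isoE[OF i(1) comp[OF c d]])
  obtain q where q: "q : hom C Y Y" "(c ** d) ** q = Ident C Y" by (rule isoE[OF i(2) comp[OF d c]])
  note l = comp[OF d p(1)] and r = comp[OF q(1) d]
  have lc: "(p ** d) ** c = Ident C X" and cr: "c ** (d ** q) = Ident C Y" using assoc[OF c d p(1)] p(2) assoc[OF q(1) d c] q(2) by simp_all
  have "p ** d = d ** q" using assoc[OF r c l] lc cr id_left[OF r] id_right[OF l] by simp
  then show ?thesis using isoI[OF c l lc] cr by simp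
qed

lemma Ident_pair: "X : Ob C ==> Ident C X ** Ident C X = Ident C X"
  using id_left id_hom by blast

end

context additive_category
begin

lemma neg_left: "f : hom C X Y ==> g : hom C Y Z ==> Neg C g ** f = Neg C (g ** f)"
  by (rule emb_inj[OF comp[OF _ neg_hom] neg_hom[OF comp]])
    (simp_all add: emb_Cmp emb_Neg[OF comp] emb_Neg emb_Cmp[OF _ neg_hom])

lemma neg_right: "f : hom C X Y ==> g : hom C Y Z ==> g ** Neg C f = Neg C (g ** f)"
  by (rule emb_inj[OF comp[OF neg_hom] neg_hom[OF comp]])
    (simp_all add: emb_Cmp emb_Neg[OF comp] emb_Neg emb_Cmp[OF neg_hom])

lemma Neg_Zero: "X : Ob C ==> Y : Ob C ==> Neg C (Zero C X Y) = Zero C X Y"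
  using Neg_unique Add_Zero zero_hom by metis

lemma Neg_eq_Zero: "f : hom C X Y ==> Neg C f = Zero C X Y ==> f = Zero C X Y"
  using Neg_Neg Neg_Zero hom_Ob1 hom_Ob2 by metis

lemma diff_Zero:
  assumes "f : hom C X Y" "g : hom C X Y" shows "f \<oplus> Neg C g = Zero C X Y \<longleftrightarrow> f = g"
  using Add_Neg[OF assms(2)] Add_cancel[OF assms neg_hom[OF assms(2)]] Add_commute neg_hom assms by metis

lemma Cmp_diff:
  assumes "f : hom C X Y" "g : hom C X Y" "t : hom C Y Z" "u : hom C W X"
  shows "t ** (f \<oplus> Neg C g) = (t ** f) \<oplus> Neg C (t ** g)" "(f \<oplus> Neg C g) ** u = (f ** u) \<oplus> Neg C (g ** u)"
  using add_right[OF assms(1) neg_hom[OF assms(2)] assms(3)] neg_right[OF assms(2,3)]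
    add_left[OF assms(4,1) neg_hom[OF assms(2)]] neg_left[OF assms(4,2)] by simp_all

text \<open>The inverse is the identity minus \<open>n\<close>.\<close>

lemma iso_one_plus_square_zero:
  assumes n: "n : hom C X X" "n ** n = Zero C X X" shows "iso C (Ident C X \<oplus> n)"
proof -
  note X = hom_Ob1[OF n(1)]
  note I = id_hom[OF X]
  note p = add_hom[OF I n(1)] and m = add_hom[OF I neg_hom[OF n(1)]]
  note e = emb_Add[OF I n(1)] emb_Add[OF I neg_hom[OF n(1)]] emb_Neg[OF n(1)] emb_Ident_left[OF n(1)] emb_Ident_right[OF n(1)] emb_Ident_left[OF I]
  have "emb n * emb n = 0" using emb_Cmp[OF n(1,1)] n(2) emb_Zero[OF X X] by simp
  then show ?thesis
    by (intro isoI[OF p m] emb_inj[OF comp[OF p m] I] emb_inj[OF comp[OF m p] I]) (simp_all add: emb_Cmp[OF p m] emb_Cmp[OF m p] e algebra_simps)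
qed

end

context triangulated
begin

lemma iso_ShArr:
  assumes "iso T a" "a : hom T X X'" shows "iso T (ShArr T a)"
proof -
  obtain b where b: "b : hom T X' X" "b ** a = Ident T X" "a ** b = Ident T X'" by (rule isoE[OF assms])
  show ?thesis
    by (rule isoI[OF ShArr_hom[OF assms(2)] ShArr_hom[OF b(1)]])
      (use ShArr_Cmp[OF assms(2) b(1)] ShArr_Cmp[OF b(1) assms(2)] b ShArr_Ident hom_Ob1 hom_Ob2 assms in auto)
qed

lemma tri_map_comp:
  assumes "tri_map T t t' a b c" "tri_map T t' t'' a' b' c'" shows "tri_map T t t'' (a' ** a) (b' ** b) (c' ** c)"
proof -
  obtain f g h f' g' h' f'' g'' h'' where t: "t = (f, g, h)" "t' = (f', g', h')" "t'' = (f'', g'', h'')" by (metis prod_cases3)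
  obtain X Y Z X' Y' Z' where 1:
    "f : hom T X Y" "g : hom T Y Z" "h : hom T Z (ShOb T X)"
    "f' : hom T X' Y'" "g' : hom T Y' Z'" "h' : hom T Z' (ShOb T X')" "a : hom T X X'" "b : hom T Y Y'" "c : hom T Z Z'"
    "b ** f = f' ** a" "c ** g = g' ** b" "ShArr T a ** h = h' ** c" using assms(1) unfolding t by (rule tri_mapE)
  obtain X0 Y0 Z0 X'' Y'' Z'' where 2:
    "f' : hom T X0 Y0" "g' : hom T Y0 Z0" "h' : hom T Z0 (ShOb T X0)"
    "f'' : hom T X'' Y''" "g'' : hom T Y'' Z''" "h'' : hom T Z'' (ShOb T X'')" "a' : hom T X0 X''" "b' : hom T Y0 Y''" "c' : hom T Z0 Z''"
    "b' ** f' = f'' ** a'" "c' ** g' = g'' ** b'" "ShArr T a' ** h' = h'' ** c'" using assms(2) unfolding t by (rule tri_mapE)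
  have [simp]: "X0 = X'" "Y0 = Y'" "Z0 = Z'" using 1(4,5) 2(1,2) by (auto simp: hom_def)
  note 2 = 2[simplified]
  show ?thesis unfolding t
    by (rule tri_mapI[OF 1(1-3) 2(4-6) comp[OF 1(7) 2(7)] comp[OF 1(8) 2(8)] comp[OF 1(9) 2(9)]
        square_comp[OF 1(10) 2(10) 1(7) 2(7) 1(8) 2(8) 1(1,4) 2(4)] square_comp[OF 1(11) 2(11) 1(8) 2(8) 1(9) 2(9) 1(2,5) 2(5)]])
      (use square_comp[OF 1(12) 2(12) 1(9) 2(9) ShArr_hom[OF 1(7)] ShArr_hom[OF 2(7)] 1(3,6) 2(6)] ShArr_Cmp[OF 1(7) 2(7)] in simp)
qed

lemma triangle_iso_trans:
  assumes "triangle_iso T t t'" "triangle_iso T t' t''" shows "triangle_iso T t t''"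
proof -
  obtain a b c a' b' c' where m: "tri_map T t t' a b c" "tri_map T t' t'' a' b' c'" and i: "iso T a" "iso T b" "iso T c" "iso T a'" "iso T b'" "iso T c'"
    using assms unfolding triangle_iso_iff by blast
  have "iso T (y ** x)" if "iso T x" "iso T y" "Cod T x = Dom T y" for x y
    by (rule iso_Cmp[OF that(1,2), of "Dom T x" "Cod T x" "Cod T y"]) (use that in \<open>auto simp: iso_def hom_def\<close>)
  moreover have "Cod T a = Dom T a' \<and> Cod T b = Dom T b' \<and> Cod T c = Dom T c'"
    using m by (cases t; cases t'; cases t'') (auto simp: tri_map_def hom_def)
  ultimately have "iso T (a' ** a)" "iso T (b' ** b)" "iso T (c' ** c)" using i by blast+
  then show ?thesis using tri_map_comp[OF m] unfolding triangle_iso_iff by blast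
qed

lemma Tri_iso: "t' : Tri T ==> triangle_iso T t t' ==> t : Tri T"
  unfolding Tri_Std using triangle_iso_trans by blast

lemma triangle_iso_refl:
  assumes "candidate_triangle T t" shows "triangle_iso T t t"
proof -
  obtain f g h where t: "t = (f, g, h)" by (cases t)
  note c = candidateD[OF assms[unfolded t]]
  have ob: "Dom T f : Ob T" "Cod T f : Ob T" "Cod T g : Ob T"
    using hom_Ob1[OF c(1)] hom_Ob1[OF c(2)] hom_Ob1[OF c(3)] by auto
  show ?thesis unfolding t
    by (rule triangle_isoI[OF c c id_hom[OF ob(1)] id_hom[OF ob(2)] id_hom[OF ob(3)]
        iso_Ident[OF ob(1)] iso_Ident[OF ob(2)] iso_Ident[OF ob(3)]])
      (use id_left[OF c(1)] id_right[OF c(1)] id_left[OF c(2)] id_right[OF c(2)]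
        id_left[OF c(3)] id_right[OF c(3)] ShArr_Ident[OF ob(1)] in auto)
qed

lemma Std_Tri: "t : Std ==> t : Tri T"
  unfolding Tri_Std using triangle_iso_refl Std_candidate by blast

lemma Tri_StdE:
  assumes "(f, g, h) : Tri T"
  obtains f' g' h' X Y Z X' Y' Z' a b c a' b' c' where "(f', g', h') : Std"
    "f : hom T X Y" "g : hom T Y Z" "h : hom T Z (ShOb T X)"
    "f' : hom T X' Y'" "g' : hom T Y' Z'" "h' : hom T Z' (ShOb T X')"
    "a : hom T X X'" "b : hom T Y Y'" "c : hom T Z Z'" "iso T a" "iso T b" "iso T c"
    "b ** f = f' ** a" "c ** g = g' ** b" "ShArr T a ** h = h' ** c"
    "a' : hom T X' X" "b' : hom T Y' Y" "c' : hom T Z' Z"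
    "a' ** a = Ident T X" "b' ** b = Ident T Y" "c' ** c = Ident T Z"
    "a ** a' = Ident T X'" "b ** b' = Ident T Y'" "c ** c' = Ident T Z'"
proof -
  obtain f' g' h' where s: "(f', g', h') : Std" "triangle_iso T (f, g, h) (f', g', h')"
    using assms unfolding Tri_Std by auto
  obtain a b c where m: "tri_map T (f, g, h) (f', g', h') a b c" and i: "iso T a" "iso T b" "iso T c" using s(2) unfolding triangle_iso_iff by blast
  obtain X Y Z X' Y' Z' where 1:
    "f : hom T X Y" "g : hom T Y Z" "h : hom T Z (ShOb T X)"
    "f' : hom T X' Y'" "g' : hom T Y' Z'" "h' : hom T Z' (ShOb T X')"
    "a : hom T X X'" "b : hom T Y Y'" "c : hom T Z Z'"
    "b ** f = f' ** a" "c ** g = g' ** b" "ShArr T a ** h = h' ** c"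
    by (rule tri_mapE[OF m])
  obtain a' where a': "a' : hom T X' X" "a' ** a = Ident T X" "a ** a' = Ident T X'" by (rule isoE[OF i(1) 1(7)])
  obtain b' where b': "b' : hom T Y' Y" "b' ** b = Ident T Y" "b ** b' = Ident T Y'" by (rule isoE[OF i(2) 1(8)])
  obtain c' where c': "c' : hom T Z' Z" "c' ** c = Ident T Z" "c ** c' = Ident T Z'" by (rule isoE[OF i(3) 1(9)])
  show thesis
    by (rule that[OF s(1) 1(1-9) i 1(10-12) a'(1) b'(1) c'(1) a'(2) b'(2) c'(2) a'(3) b'(3) c'(3)])
qed

lemma TriE:
  assumes "(f, g, h) : Tri T"
  obtains X Y Z where "f : hom T X Y" "g : hom T Y Z" "h : hom T Z (ShOb T X)"
  using assms by (rule Tri_StdE)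

lemma Tri_hom:
  assumes "(f, g, h) : Tri T"
  shows "f : hom T (Dom T f) (Cod T f)" "g : hom T (Cod T f) (Cod T g)" "h : hom T (Cod T g) (ShOb T (Dom T f))"
  using assms by (rule TriE; auto simp: hom_def)+

lemma ShArr_Zero:
  assumes "X : Ob T" "Y : Ob T" shows "ShArr T (Zero T X Y) = Zero T (ShOb T X) (ShOb T Y)"
proof -
  have z: "Zero T X Y : hom T X Y" using assms zero_hom by blast
  note s = ShArr_hom[OF z]
  have "ShArr T (Zero T X Y) \<oplus> ShArr T (Zero T X Y) = ShArr T (Zero T X Y) \<oplus> Zero T (ShOb T X) (ShOb T Y)"
    using ShArr_Add[OF z z] Add_Zero z s by metis
  then show ?thesis using Add_cancel[OF s _ s] zero_hom hom_Ob1[OF s] hom_Ob2[OF s] by blast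
qed

lemma ShArr_Neg: "f : hom T X Y ==> ShArr T (Neg T f) = Neg T (ShArr T f)"
  using Neg_unique[OF ShArr_hom ShArr_hom[OF neg_hom], of f X Y f] ShArr_Add[OF _ neg_hom, of f X Y f] Add_Neg[of f X Y]
    ShArr_Zero hom_Ob1 hom_Ob2 by metis

lemma Tri_rotate:
  assumes "(f, g, h) : Tri T" shows "(g, h, Neg T (ShArr T f)) : Tri T"
proof -
  obtain f' g' h' X Y Z X' Y' Z' a b c a' b' c' where s: "(f', g', h') : Std"
    and f: "f : hom T X Y" and g: "g : hom T Y Z" and h: "h : hom T Z (ShOb T X)"
    and f': "f' : hom T X' Y'" and g': "g' : hom T Y' Z'" and h': "h' : hom T Z' (ShOb T X')"
    and a: "a : hom T X X'" and b: "b : hom T Y Y'" and c: "c : hom T Z Z'" and i: "iso T a" "iso T b" "iso T c"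
    and e: "b ** f = f' ** a" "c ** g = g' ** b" "ShArr T a ** h = h' ** c"
    by (rule Tri_StdE[OF assms])
  have "ShArr T b ** Neg T (ShArr T f) = Neg T (ShArr T (f' ** a))"
    using neg_right[OF ShArr_hom[OF f] ShArr_hom[OF b]] ShArr_Cmp[OF f b] e by simp
  also have "\<dots> = Neg T (ShArr T f') ** ShArr T a"
    using neg_left[OF ShArr_hom[OF a] ShArr_hom[OF f']] ShArr_Cmp[OF a f'] by simp
  finally have "triangle_iso T (g, h, Neg T (ShArr T f)) (g', h', Neg T (ShArr T f'))"
    by (intro triangle_isoI[OF g h neg_hom[OF ShArr_hom[OF f]] g' h' neg_hom[OF ShArr_hom[OF f']] b c ShArr_hom[OF a] i(2,3) iso_ShArr[OF i(1) a] e(2,3)])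
  then show ?thesis using Tri_iso[OF Std_rotate[OF s]] by blast
qed

lemma Tri_zero:
  assumes "(f, g, h) : Tri T" shows "g ** f = Zero T (Dom T f) (Cod T g)"
proof -
  obtain f' g' h' X Y Z X' Y' Z' a b c a' b' c' where s: "(f', g', h') : Std"
    and f: "f : hom T X Y" and g: "g : hom T Y Z"
    and f': "f' : hom T X' Y'" and g': "g' : hom T Y' Z'"
    and a: "a : hom T X X'" and b: "b : hom T Y Y'" and c: "c : hom T Z Z'"
    and e: "b ** f = f' ** a" "c ** g = g' ** b" and c': "c' : hom T Z' Z" "c' ** c = Ident T Z"
    by (rule Tri_StdE[OF assms])
  have z: "g' ** f' = Zero T X' Z'" using Std_zero[OF s] f' g' by (simp add: hom_def)
  have "c ** (g ** f) = (g' ** f') ** a"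
    using assoc[OF f g c] e assoc[OF f b g'] assoc[OF a f' g'] by simp
  then have "c ** (g ** f) = Zero T X Z'" using z zero_left a hom_Ob2[OF g'] by simp
  then have "c' ** (c ** (g ** f)) = Zero T X Z" using zero_right[OF c'(1)] hom_Ob1[OF f] by simp
  then have "g ** f = Zero T X Z"
    using assoc[OF comp[OF f g] c c'(1)] c'(2) id_left[OF comp[OF f g]] by simp
  then show ?thesis using f g by (simp add: hom_def)
qed

lemma Tri_weak_kernel:
  assumes "(f, g, h) : Tri T" "u : hom T W (Dom T g)" "g ** u = Zero T W (Cod T g)"
  shows "\<exists>v\<in>hom T W (Dom T f). u = f ** v"
proof -
  obtain f' g' h' X Y Z X' Y' Z' a b c a' b' c' where s: "(f', g', h') : Std"
    and f: "f : hom T X Y" and g: "g : hom T Y Z"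
    and f': "f' : hom T X' Y'" and g': "g' : hom T Y' Z'"
    and a: "a : hom T X X'" and b: "b : hom T Y Y'" and c: "c : hom T Z Z'"
    and e: "b ** f = f' ** a" "c ** g = g' ** b"
    and inv: "a' : hom T X' X" "b' : hom T Y' Y" "b' ** b = Ident T Y" "a ** a' = Ident T X'"
    by (rule Tri_StdE[OF assms(1)])
  have u: "u : hom T W Y" and z: "g ** u = Zero T W Z" using assms f g by (auto simp: hom_def)
  have "g' ** (b ** u) = c ** (g ** u)" using assoc[OF u b g'] assoc[OF u g c] e(2) by simp
  then have "g' ** (b ** u) = Zero T W Z'" using z zero_right[OF c] hom_Ob1[OF u] by simp
  then obtain v where v: "v : hom T W X'" "b ** u = f' ** v"
    using Std_weak_kernel[OF s, of "b ** u" W] comp[OF u b] f' g' by (auto simp: hom_def)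
  have "u = b' ** (b ** u)" using assoc[OF u b inv(2)] inv(3) id_left[OF u] by simp
  also have "\<dots> = (b' ** f') ** v" unfolding v(2) using assoc[OF v(1) f' inv(2)] by simp
  also have "\<dots> = f ** (a' ** v)"
    unfolding iso_square[OF f f' a b e(1) inv] by (rule assoc[OF v(1) inv(1) f])
  finally show ?thesis using comp[OF v(1) inv(1)] f by (auto simp: hom_Dom)
qed

lemma Tri_weak_cokernel:
  assumes "(f, g, h) : Tri T" "u : hom T (Dom T g) W" "u ** f = Zero T (Dom T f) W"
  shows "\<exists>v\<in>hom T (Cod T g) W. u = v ** g"
proof -
  obtain f' g' h' X Y Z X' Y' Z' a b c a' b' c' where s: "(f', g', h') : Std"
    and f: "f : hom T X Y" and g: "g : hom T Y Z"
    and f': "f' : hom T X' Y'" and g': "g' : hom T Y' Z'"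
    and a: "a : hom T X X'" and b: "b : hom T Y Y'" and c: "c : hom T Z Z'"
    and e: "b ** f = f' ** a" "c ** g = g' ** b"
    and inv: "a' : hom T X' X" "b' : hom T Y' Y" "b' ** b = Ident T Y" "a ** a' = Ident T X'"
    by (rule Tri_StdE[OF assms(1)])
  have u: "u : hom T Y W" and z: "u ** f = Zero T X W" using assms f g by (auto simp: hom_def)
  have ub: "u ** b' : hom T Y' W" using comp[OF inv(2) u] .
  have "(u ** b') ** f' = (u ** f) ** a'"
    unfolding assoc[OF f' inv(2) u] assoc[OF inv(1) f u] iso_square[OF f f' a b e(1) inv] ..
  then have "(u ** b') ** f' = Zero T X' W" using z zero_left[OF inv(1)] hom_Ob2[OF u] by simp
  then obtain v where v: "v : hom T Z' W" "u ** b' = v ** g'"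
    using Std_weak_cokernel[OF s, of "u ** b'" W] ub f' g' by (auto simp: hom_def)
  have "u = (u ** b') ** b" using assoc[OF b inv(2) u] inv(3) id_right[OF u] by simp
  also have "\<dots> = v ** (c ** g)" unfolding v(2) e(2) by (rule assoc[OF b g' v(1)])
  also have "\<dots> = (v ** c) ** g" using assoc[OF g c v(1)] by simp
  finally show ?thesis using comp[OF c v(1)] g by (auto simp: hom_Cod)
qed

lemma Tri_Std_maps:
  assumes "(f, g, h) : Tri T"
  obtains f' g' h' a b c a' b' c' where "(f', g', h') : Std" "tri_map T (f, g, h) (f', g', h') a b c" "tri_map T (f', g', h') (f, g, h) a' b' c'"
    "a' ** a = Ident T (Dom T f)" "b' ** b = Ident T (Dom T g)"
proof -
  obtain f' g' h' X Y Z X' Y' Z' a b c a' b' c' where s: "(f', g', h') : Std"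
    and h: "f : hom T X Y" "g : hom T Y Z" "h : hom T Z (ShOb T X)" "f' : hom T X' Y'" "g' : hom T Y' Z'" "h' : hom T Z' (ShOb T X')"
    and a: "a : hom T X X'" "b : hom T Y Y'" "c : hom T Z Z'"
    and e: "b ** f = f' ** a" "c ** g = g' ** b" "ShArr T a ** h = h' ** c"
    and a': "a' : hom T X' X" "b' : hom T Y' Y" "c' : hom T Z' Z" "a' ** a = Ident T X" "b' ** b = Ident T Y" "c' ** c = Ident T Z"
      "a ** a' = Ident T X'" "b ** b' = Ident T Y'" "c ** c' = Ident T Z'" by (rule Tri_StdE[OF assms])
  note Sa = ShArr_hom[OF a(1)] ShArr_hom[OF a'(1)]
  have "ShArr T a' ** ShArr T a = Ident T (ShOb T X)" using ShArr_Cmp[OF a(1) a'(1)] a'(4) ShArr_Ident hom_Ob1[OF h(1)] by simp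
  then have "tri_map T (f', g', h') (f, g, h) a' b' c'"
    by (intro tri_mapI[OF h(4-6,1-3) a'(1-3) iso_square[OF h(1,4) a(1,2) e(1) a'(1,2,5,7)] iso_square[OF h(2,5) a(2,3) e(2) a'(2,3,6,8)]]
      iso_square[OF h(3,6) a(3) Sa(1) e(3) a'(3) Sa(2) _ a'(9)])
  then show thesis using that[OF s tri_mapI[OF h a e]] a'(4,5) h(1,2) by (simp add: hom_Dom)
qed

lemma Tri_morphism:
  assumes "(f, g, h) : Tri T" "(f1, g1, h1) : Tri T" "u : hom T (Dom T f) (Dom T f1)" "v : hom T (Dom T g) (Dom T g1)"
    "v ** f = f1 ** u"
  shows "\<exists>w\<in>hom T (Cod T g) (Cod T g1). w ** g = g1 ** v \<and> ShArr T u ** h = h1 ** w"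
proof -
  obtain f' g' h' a b c a' b' c' where s: "(f', g', h') : Std" and m: "tri_map T (f, g, h) (f', g', h') a b c" "tri_map T (f', g', h') (f, g, h) a' b' c'"
    and inv: "a' ** a = Ident T (Dom T f)" "b' ** b = Ident T (Dom T g)" by (rule Tri_Std_maps[OF assms(1)])
  obtain f1' g1' h1' a1 b1 c1 a1' b1' c1' where s1: "(f1', g1', h1') : Std"
    and m1: "tri_map T (f1, g1, h1) (f1', g1', h1') a1 b1 c1" "tri_map T (f1', g1', h1') (f1, g1, h1) a1' b1' c1'"
    and inv1: "a1' ** a1 = Ident T (Dom T f1)" "b1' ** b1 = Ident T (Dom T g1)" by (rule Tri_Std_maps[OF assms(2)])
  let ?u = "a1 ** (u ** a')" and ?v = "b1 ** (v ** b')"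
  have h: "f : hom T (Dom T f) (Dom T g)" "f' : hom T (Dom T f') (Dom T g')" "f1 : hom T (Dom T f1) (Dom T g1)" "f1' : hom T (Dom T f1') (Dom T g1')"
    and ab: "a : hom T (Dom T f) (Dom T f')" "b : hom T (Dom T g) (Dom T g')" "a' : hom T (Dom T f') (Dom T f)" "b' : hom T (Dom T g') (Dom T g)"
      "a1 : hom T (Dom T f1) (Dom T f1')" "b1 : hom T (Dom T g1) (Dom T g1')" "a1' : hom T (Dom T f1') (Dom T f1)" "b1' : hom T (Dom T g1') (Dom T g1)"
    and e: "b' ** f' = f ** a'" "b1 ** f1 = f1' ** a1"
    using m m1 by (auto simp: tri_map_def candidate_triangle_def hom_def)
  note uh = comp[OF comp[OF ab(3) assms(3)] ab(5)] and vh = comp[OF comp[OF ab(4) assms(4)] ab(6)]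
  have "?v ** f' = f1' ** ?u"
    by (rule square_comp[OF square_comp[OF e(1) assms(5) ab(3) assms(3) ab(4) assms(4) h(2,1,3)] e(2) comp[OF ab(3) assms(3)] ab(5)
      comp[OF ab(4) assms(4)] ab(6) h(2,3,4)])
  then obtain w where w: "w : hom T (Cod T g') (Cod T g1')" "w ** g' = g1' ** ?v" "ShArr T ?u ** h' = h1' ** w"
    using Std_morphism[OF s s1 uh vh] by blast
  have n: "tri_map T (f', g', h') (f1', g1', h1') ?u ?v w"
    using m m1 uh vh w \<open>?v ** f' = f1' ** ?u\<close> by (simp add: tri_map_def candidate_triangle_def hom_def)
  have "tri_map T (f, g, h) (f1, g1, h1) u v (c1' ** (w ** c))"
    using tri_map_comp[OF tri_map_comp[OF m(1) n] m1(2)] conjugate_cancel[OF ab(5,7) inv1(1) assms(3) ab(1,3) inv(1)]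
      conjugate_cancel[OF ab(6,8) inv1(2) assms(4) ab(2,4) inv(2)] by simp
  then show ?thesis by (auto simp: tri_map_def candidate_triangle_def)
qed

lemma cone_exists: "f : hom T X Y ==> \<exists>Z g h. (f, g, h) : Tri T \<and> g : hom T Y Z \<and> h : hom T Z (ShOb T X)"
  using Std_ex Std_Tri Tri_hom by (metis hom_Cod hom_Dom)

text \<open>The difference \<open>n\<close> of \<open>c\<close> and the identity vanishes on
  \<open>g\<close>, hence factors through \<open>h\<close>, and \<open>h\<close> kills
  \<open>n\<close>; so \<open>n\<close> has square zero. This takes the place of the five
  lemma.\<close>

lemma cone_endo_iso:
  assumes t: "(f, g, h) : Tri T" and c: "c : hom T (Cod T g) (Cod T g)" "c ** g = g" "h ** c = h"
  shows "iso T c"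
proof -
  let ?Z = "Cod T g" and ?X = "ShOb T (Dom T f)"
  note hs = Tri_hom[OF t]
  have Z: "?Z : Ob T" using hom_Ob2[OF hs(2)] .
  note I = id_hom[OF Z]
  define n where "n = c \<oplus> Neg T (Ident T ?Z)"
  have n: "n : hom T ?Z ?Z" unfolding n_def by (intro add_hom c neg_hom I)
  have en: "emb n = emb c - emb (Ident T ?Z)"
    unfolding n_def by (simp add: emb_Add[OF c(1) neg_hom[OF I]] emb_Neg[OF I])
  have "n ** g = Zero T (Cod T f) ?Z"
    by (rule emb_inj[OF comp[OF hs(2) n]])
      (use emb_Cmp[OF hs(2) c(1)] c(2) hom_Ob1[OF hs(2)] Z in \<open>simp_all add: zero_hom emb_Cmp[OF hs(2) n] en left_diff_distrib emb_Ident_left[OF hs(2)] emb_Zero\<close>)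
  then obtain m where m: "m : hom T ?X ?Z" "n = m ** h"
    using Tri_weak_cokernel[OF Tri_rotate[OF t], of n ?Z] n hs by (auto simp: hom_def)
  have hn: "emb h * emb n = 0"
    using emb_Cmp[OF c(1) hs(3)] c(3) by (simp add: en right_diff_distrib emb_Ident_right[OF hs(3)])
  have "n ** n = Zero T ?Z ?Z"
  proof (rule emb_inj[OF comp[OF n n] zero_hom[OF Z Z]])
    have "emb (n ** n) = emb n * emb n" by (rule emb_Cmp[OF n n])
    also have "\<dots> = emb m * (emb h * emb n)" using m(2) emb_Cmp[OF hs(3) m(1)] by (simp add: mult.assoc)
    finally show "emb (n ** n) = emb (Zero T ?Z ?Z)" using hn emb_Zero[OF Z Z] by simp
  qed
  moreover have "c = Ident T ?Z \<oplus> n"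
    by (rule emb_inj[OF c(1) add_hom[OF I n]]) (simp add: emb_Add[OF I n] en)
  ultimately show ?thesis using iso_one_plus_square_zero[OF n] by simp
qed

lemma cone_unique:
  assumes t: "(f, g, h) : Tri T" and t': "(f, g', h') : Tri T"
  shows "\<exists>c\<in>hom T (Cod T g) (Cod T g'). iso T c \<and> c ** g = g' \<and> h = h' ** c"
proof -
  note hs = Tri_hom[OF t] and hs' = Tri_hom[OF t']
  have ob: "Dom T f : Ob T" "Cod T f : Ob T" "Cod T g : Ob T" "Cod T g' : Ob T"
    using hom_Ob1[OF hs(1)] hom_Ob2[OF hs(1)] hom_Ob2[OF hs(2)] hom_Ob2[OF hs'(2)] by auto
  have D: "Dom T g = Cod T f" "Dom T g' = Cod T f" using hs hs' by (auto simp: hom_def)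
  have I: "Ident T (Cod T f) ** f = f ** Ident T (Dom T f)"
    using id_left[OF hs(1)] id_right[OF hs(1)] by simp
  obtain c where c: "c : hom T (Cod T g) (Cod T g')" "c ** g = g'" "h = h' ** c"
    using Tri_morphism[OF t t' id_hom[OF ob(1)] _ I] id_hom[OF ob(2)] D
      id_right[OF hs'(2)] ShArr_Ident[OF ob(1)] id_left[OF hs(3)] by auto
  obtain d where d: "d : hom T (Cod T g') (Cod T g)" "d ** g' = g" "h' = h ** d"
    using Tri_morphism[OF t' t id_hom[OF ob(1)] _ I] id_hom[OF ob(2)] D
      id_right[OF hs(2)] ShArr_Ident[OF ob(1)] id_left[OF hs'(3)] by auto
  note cd = c(2) d(2) c(3)[symmetric] d(3)[symmetric]
  have "(d ** c) ** g = g" "h ** (d ** c) = h"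
    using assoc[OF hs(2) c(1) d(1)] assoc[OF c(1) d(1) hs(3), symmetric] cd by simp_all
  then have i: "iso T (d ** c)" using cone_endo_iso[OF t comp[OF c(1) d(1)]] by blast
  have "(c ** d) ** g' = g'" "h' ** (c ** d) = h'"
    using assoc[OF hs'(2) d(1) c(1)] assoc[OF d(1) c(1) hs'(3), symmetric] cd by simp_all
  then have "iso T (c ** d)" using cone_endo_iso[OF t' comp[OF d(1) c(1)]] by blast
  then have "iso T c" using iso_of_composites[OF c(1) d(1) i] by blast
  then show ?thesis using c by blast
qed

text \<open>Rotation backwards: the cone triangle of a desuspension of minus \<open>h\<close> is
  rotated once. The sign cancels the one that rotation puts on the shifted arrow.\<close>

lemma Tri_third:
  assumes "X : Ob T" "h : hom T Z (ShOb T X)"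
  shows "\<exists>Y f g. (f, g, h) : Tri T \<and> f : hom T X Y \<and> g : hom T Y Z"
proof -
  obtain Z0 where Z0: "Z0 : Ob T" "ShOb T Z0 = Z" using ShOb_surj hom_Ob1[OF assms(2)] by blast
  then obtain h0 where h0: "h0 : hom T Z0 X" "ShArr T h0 = Neg T h"
    using ShArr_surj[OF Z0(1) assms(1)] neg_hom[OF assms(2)] by blast
  obtain Y k p where "(h0, k, p) : Tri T" "k : hom T X Y" "p : hom T Y (ShOb T Z0)" using cone_exists[OF h0(1)] by blast
  then show ?thesis using Tri_rotate h0(2) Neg_Neg[OF assms(2)] Z0(2) by metis
qed

lemma octahedron_objects:
  assumes "(f, f1, f2) : Tri T" "(g, g1, g2) : Tri T" "(g ** f, h1, h2) : Tri T" "Cod T f = Dom T g"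
  shows "\<exists>u v w. (u, v, w) : Tri T \<and> isomorphic T (Cod T f1) (Dom T u) \<and> isomorphic T (Cod T h1) (Cod T u) \<and> isomorphic T (Cod T g1) (Cod T v)"
proof -
  obtain f1' f2' g1' g2' h1' h2' u v w where o: "(f, f1', f2') : Std" "(g, g1', g2') : Std" "(g ** f, h1', h2') : Std"
    "(u, v, w) : Tri T" "Dom T u = Cod T f1'" "Cod T u = Cod T h1'" "Cod T v = Cod T g1'"
    using octahedron[OF Tri_hom(1)[OF assms(1)], of g "Cod T g"] Tri_hom(1)[OF assms(2)] assms(4) by auto
  have "isomorphic T (Cod T f1) (Cod T f1')" "isomorphic T (Cod T g1) (Cod T g1')" "isomorphic T (Cod T h1) (Cod T h1')"
    using cone_unique[OF assms(1) Std_Tri[OF o(1)]] cone_unique[OF assms(2) Std_Tri[OF o(2)]] cone_unique[OF assms(3) Std_Tri[OF o(3)]]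
    unfolding isomorphic_def by blast+
  then show ?thesis using o by metis
qed

end

section \<open>Right fractions\<close>

text \<open>The conditions of a right calculus of fractions, matching roofs whose first leg is
  inverted: squares are completed at the source, and two arrows that agree after a denominator
  already agree on a refinement of their source.\<close>

locale right_fractions = category T for T :: "('o, 'm) tricat" (structure) +
  fixes N :: "'o set"
  assumes frac_Ident: "X : Ob T ==> Ident T X : cone_in T N"
    and frac_Cmp: "s : hom T X Y ==> t : hom T Y Z ==> s : cone_in T N ==> t : cone_in T N ==> t ** s : cone_in T N"
    and frac_ore: "f : hom T X Y ==> t : hom T Z Y ==> t : cone_in T N ==>
      \<exists>W u v. u : hom T W X \<and> u : cone_in T N \<and> v : hom T W Z \<and> f ** u = t ** v"
    and frac_cancel: "f : hom T X Z ==> g : hom T X Z ==> t : hom T Z Y ==> t : cone_in T N ==> t ** f = t ** g ==>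
      \<exists>W u. u : hom T W X \<and> u : cone_in T N \<and> f ** u = g ** u"
begin

abbreviation "S \<equiv> cone_in T N"
abbreviation "D \<equiv> verdier T N"
abbreviation D_Cmp_infix (infixl "**\<^sub>D" 70) where "g **\<^sub>D f \<equiv> Cmp D g f"

lemma roofI: "s : hom T Z X ==> s : S ==> f : hom T Z Y ==> (s, f) : roofs T N X Y"
  by (auto simp: roofs_def hom_def)

lemma roofE:
  assumes "(s, f) : roofs T N X Y"
  obtains Z where "s : hom T Z X" "s : S" "f : hom T Z Y"
  using assms by (auto simp: roofs_def hom_def cone_in_def)

lemma roof_eqI:
  assumes "s : hom T Z X" "s : S" "f : hom T Z Y" "t : hom T Z' X" "t : S" "g : hom T Z' Y"
    "u : hom T W Z" "v : hom T W Z'" "s ** u = t ** v" "f ** u = g ** v" "s ** u : S"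
  shows "roof_eq T N X Y (s, f) (t, g)"
  unfolding roof_eq_def split_conv
proof (intro conjI)
  show "(s, f) : roofs T N X Y" "(t, g) : roofs T N X Y" using roofI assms by blast+
  have "u : Arr T" "v : Arr T" "Dom T u = Dom T v" "Cod T u = Dom T s" "Cod T v = Dom T t"
    using assms by (auto simp: hom_def)
  then show "\<exists>u\<in>Arr T. \<exists>v\<in>Arr T. Dom T u = Dom T v \<and> Cod T u = Dom T s \<and> Cod T v = Dom T t \<and>
      s ** u = t ** v \<and> f ** u = g ** v \<and> s ** u : S"
    using assms(9-11) by blast
qed

lemma roof_eqE:
  assumes "roof_eq T N X Y (s, f) (t, g)"
  obtains Z Z' W u v where "s : hom T Z X" "s : S" "f : hom T Z Y" "t : hom T Z' X" "t : S" "g : hom T Z' Y"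
    "u : hom T W Z" "v : hom T W Z'" "s ** u = t ** v" "f ** u = g ** v" "s ** u : S"
proof -
  from assms obtain u v where *: "(s, f) : roofs T N X Y" "(t, g) : roofs T N X Y" "u : Arr T" "v : Arr T"
    "Dom T u = Dom T v" "Cod T u = Dom T s" "Cod T v = Dom T t" "s ** u = t ** v" "f ** u = g ** v" "s ** u : S"
    unfolding roof_eq_def by auto
  obtain Z where Z: "s : hom T Z X" "s : S" "f : hom T Z Y" using *(1) by (rule roofE)
  obtain Z' where Z': "t : hom T Z' X" "t : S" "g : hom T Z' Y" using *(2) by (rule roofE)
  show thesis
    by (rule that[OF Z Z', of u "Dom T u" v]) (use * Z Z' in \<open>auto simp: hom_def\<close>)
qed

lemma roof_eq_refl:
  assumes "(s, f) : roofs T N X Y" shows "roof_eq T N X Y (s, f) (s, f)"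
proof -
  obtain Z where Z: "s : hom T Z X" "s : S" "f : hom T Z Y" using assms by (rule roofE)
  have I: "Ident T Z : hom T Z Z" using id_hom hom_Ob1[OF Z(1)] by blast
  show ?thesis
    by (rule roof_eqI[OF Z Z I I]) (use id_right[OF Z(1)] Z(2) in simp_all)
qed

lemma roof_eq_sym: "roof_eq T N X Y r r' ==> roof_eq T N X Y r' r"
  by (cases r, cases r') (auto elim!: roof_eqE intro!: roof_eqI)

text \<open>An Ore square joins the two refinements, but it commutes only over \<open>X\<close>,
  that is, after composing with \<open>t\<close>. A further denominator \<open>x\<close> cancels
  \<open>t\<close>; then denominators and numerators agree along the whole chain.\<close>

lemma roof_eq_trans:
  assumes "roof_eq T N X Y (s, f) (t, g)" "roof_eq T N X Y (t, g) (r, h)"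
  shows "roof_eq T N X Y (s, f) (r, h)"
proof -
  obtain Z Z' W u v where s: "s : hom T Z X" "s : S" "f : hom T Z Y" and t: "t : hom T Z' X" "t : S" "g : hom T Z' Y"
    and u: "u : hom T W Z" and v: "v : hom T W Z'" and e: "s ** u = t ** v" "f ** u = g ** v" "s ** u : S"
    using assms(1) by (rule roof_eqE)
  obtain Y' Z'' W' u' v' where t': "t : hom T Y' X" and r: "r : hom T Z'' X" "r : S" "h : hom T Z'' Y"
    and u': "u' : hom T W' Y'" and v': "v' : hom T W' Z''" and e': "t ** u' = r ** v'" "g ** u' = h ** v'" "t ** u' : S"
    using assms(2) by (rule roof_eqE)
  have [simp]: "Y' = Z'" using t(1) t' by (auto simp: hom_def)
  note u' = u'[simplified]
  have tv: "t ** v : hom T W X" using comp[OF v t(1)] .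
  obtain V w w' where w: "w : hom T V W" "w : S" "w' : hom T V W'" "(t ** v) ** w = (t ** u') ** w'"
    using frac_ore[OF tv comp[OF u' t(1)] e'(3)] by blast
  have vw: "v ** w : hom T V Z'" and uw': "u' ** w' : hom T V Z'" using comp[OF w(1) v] comp[OF w(3) u'] .
  have "t ** (v ** w) = t ** (u' ** w')" using w(4) assoc[OF w(1) v t(1)] assoc[OF w(3) u' t(1)] by simp
  then obtain V' x where x: "x : hom T V' V" "x : S" "(v ** w) ** x = (u' ** w') ** x"
    using frac_cancel[OF vw uw' t(1,2)] by blast
  have wx: "w ** x : hom T V' W" and wx': "w' ** x : hom T V' W'" using comp[OF x(1) w(1)] comp[OF x(1) w(3)] .
  have y: "v ** (w ** x) = u' ** (w' ** x)"
    using x(3) assoc[OF x(1) w(1) v] assoc[OF x(1) w(3) u'] by simp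
  have swap: "a ** (u ** (w ** x)) = c ** (v' ** (w' ** x))"
    if "a ** u = b ** v" "b ** u' = c ** v'" "a : hom T Z A" "b : hom T Z' A" "c : hom T Z'' A" for a b c A
  proof -
    have "a ** (u ** (w ** x)) = b ** (v ** (w ** x))"
      using assoc[OF wx u that(3)] assoc[OF wx v that(4)] that(1) by simp
    also have "\<dots> = c ** (v' ** (w' ** x))"
      unfolding y using assoc[OF wx' u' that(4)] assoc[OF wx' v' that(5)] that(2) by simp
    finally show ?thesis .
  qed
  show ?thesis
  proof (rule roof_eqI[OF s r comp[OF wx u] comp[OF wx' v'] swap[OF e(1) e'(1) s(1) t(1) r(1)] swap[OF e(2) e'(2) s(3) t(3) r(3)]])
    have "(s ** u) ** (w ** x) : S"
      by (rule frac_Cmp[OF wx comp[OF u s(1)] frac_Cmp[OF x(1) w(1) x(2) w(2)] e(3)])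
    then show "s ** (u ** (w ** x)) : S" using assoc[OF wx u s(1)] by simp
  qed
qed

lemma roof_refine:
  assumes "s : hom T Z X" "s : S" "f : hom T Z Y" "w : hom T W Z" "s ** w : S"
  shows "roof_eq T N X Y (s, f) (s ** w, f ** w)"
proof -
  have I: "Ident T W : hom T W W" using id_hom hom_Ob1[OF assms(4)] by blast
  show ?thesis
    by (rule roof_eqI[OF assms(1-3) comp[OF assms(4,1)] assms(5) comp[OF assms(4,3)] assms(4) I])
      (use assms id_right[OF comp[OF assms(4,1)]] id_right[OF comp[OF assms(4,3)]] in simp_all)
qed

lemma roof_eq_trans': "roof_eq T N X Y r r' ==> roof_eq T N X Y r' r'' ==> roof_eq T N X Y r r''"
  by (cases r; cases r'; cases r'') (simp only: roof_eq_trans)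

lemma fraction_eqI:
  assumes "roof_eq T N X Y r r'" shows "fraction T N X Y r = fraction T N X Y r'"
proof -
  have "roof_eq T N X Y r q \<longleftrightarrow> roof_eq T N X Y r' q" for q
    using roof_eq_trans' roof_eq_sym assms by blast
  then show ?thesis by (simp add: fraction_def)
qed

lemma fraction_eqD:
  assumes "fraction T N X Y r = fraction T N X Y r'" "r' : roofs T N X Y" shows "roof_eq T N X Y r r'"
proof -
  have "roof_eq T N X Y r' r'" using roof_eq_refl assms(2) by (cases r') auto
  then show ?thesis using assms(1) by (auto simp: fraction_def)
qed

text \<open>
  The middle square need only satisfy \<open>s u \<in> S\<close>, rather than \<open>u \<in> S\<close>. With this slack, replacing a
  factor by an equivalent roof is the same as choosing another square.
\<close>

lemma completion_unique:
  assumes s: "s : hom T A X" "s : S" and f: "f : hom T A Y" and t: "t : hom T B Y" "t : S" and g: "g : hom T B Z"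
    and u: "u : hom T W A" "v : hom T W B" "f ** u = t ** v" "s ** u : S"
    and u': "u' : hom T W' A" "v' : hom T W' B" "f ** u' = t ** v'" "s ** u' : S"
  shows "roof_eq T N X Z (s ** u, g ** v) (s ** u', g ** v')"
proof -
  have su: "s ** u : hom T W X" "s ** u' : hom T W' X" using comp u u' s by blast+
  have gv: "g ** v : hom T W Z" "g ** v' : hom T W' Z" using comp u u' g by blast+
  obtain V w w' where w: "w : hom T V W" "w : S" "w' : hom T V W'" "(s ** u) ** w = (s ** u') ** w'"
    using frac_ore[OF su u'(4)] by blast
  have "s ** (u ** w) = s ** (u' ** w')" using w(4) assoc[OF w(1) u(1) s(1)] assoc[OF w(3) u'(1) s(1)] by simp
  then obtain V1 z where z: "z : hom T V1 V" "z : S" "(u ** w) ** z = (u' ** w') ** z"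
    using frac_cancel[OF comp[OF w(1) u(1)] comp[OF w(3) u'(1)] s] by blast
  define x where "x = w ** z"
  define x' where "x' = w' ** z"
  have x: "x : hom T V1 W" "x' : hom T V1 W'" unfolding x_def x'_def using comp z(1) w(1,3) by blast+
  have xS: "x : S" unfolding x_def by (rule frac_Cmp[OF z(1) w(1) z(2) w(2)])
  have ux: "u ** x = u' ** x'"
    unfolding x_def x'_def using z(3) assoc[OF z(1) w(1) u(1)] assoc[OF z(1) w(3) u'(1)] by simp
  \<comment> \<open>The first legs already agree over \<open>A\<close>. The second legs agree only
    after \<open>t\<close>, which one more cancellation removes.\<close>
  have "t ** (v ** x) = f ** (u ** x)" using assoc[OF x(1) u(2) t(1)] assoc[OF x(1) u(1) f] u(3) by simp
  also have "\<dots> = t ** (v' ** x')"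
    unfolding ux using assoc[OF x(2) u'(2) t(1)] assoc[OF x(2) u'(1) f] u'(3) by simp
  finally obtain V2 y where y: "y : hom T V2 V1" "y : S" "(v ** x) ** y = (v' ** x') ** y"
    using frac_cancel[OF comp[OF x(1) u(2)] comp[OF x(2) u'(2)] t] by blast
  have xy: "x ** y : hom T V2 W" "x' ** y : hom T V2 W'" using comp y(1) x by blast+
  show ?thesis
  proof (rule roof_eqI[OF su(1) u(4) gv(1) su(2) u'(4) gv(2) xy])
    have "(s ** u) ** (x ** y) = s ** ((u ** x) ** y)"
      using assoc[OF xy(1) u(1) s(1)] assoc[OF y(1) x(1) u(1)] by simp
    also have "\<dots> = (s ** u') ** (x' ** y)"
      unfolding ux using assoc[OF xy(2) u'(1) s(1)] assoc[OF y(1) x(2) u'(1)] by simp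
    finally show "(s ** u) ** (x ** y) = (s ** u') ** (x' ** y)" .
    have "(g ** v) ** (x ** y) = g ** ((v ** x) ** y)"
      using assoc[OF xy(1) u(2) g] assoc[OF y(1) x(1) u(2)] by simp
    also have "\<dots> = (g ** v') ** (x' ** y)"
      unfolding y(3) using assoc[OF xy(2) u'(2) g] assoc[OF y(1) x(2) u'(2)] by simp
    finally show "(g ** v) ** (x ** y) = (g ** v') ** (x' ** y)" .
    show "(s ** u) ** (x ** y) : S" by (rule frac_Cmp[OF xy(1) su(1) frac_Cmp[OF y(1) x(1) y(2) xS] u(4)])
  qed
qed

text \<open>A square formed over the common refinements of both pairs of roofs is a completion for
  either pair, so \<open>completion_unique\<close> compares it with each of the two given
  ones.\<close>

lemma completion_well_defined:
  assumes sf: "roof_eq T N X Y (s, f) (s', f')" and tg: "roof_eq T N Y Z (t, g) (t', g')"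
    and u: "u : Arr T" "v : Arr T" "Dom T u = Dom T v" "Cod T u = Dom T f" "Cod T v = Dom T t" "f ** u = t ** v" "s ** u : S"
    and u': "u' : Arr T" "v' : Arr T" "Dom T u' = Dom T v'" "Cod T u' = Dom T f'" "Cod T v' = Dom T t'" "f' ** u' = t' ** v'" "s' ** u' : S"
  shows "roof_eq T N X Z (s ** u, g ** v) (s' ** u', g' ** v')"
proof -
  obtain A A' W x x' where s: "s : hom T A X" "s : S" and f: "f : hom T A Y" and s': "s' : hom T A' X" "s' : S" and f': "f' : hom T A' Y"
    and x: "x : hom T W A" "x' : hom T W A'" "s ** x = s' ** x'" "f ** x = f' ** x'" "s ** x : S"
    using sf by (rule roof_eqE)
  obtain B B' V y y' where t: "t : hom T B Y" "t : S" and g: "g : hom T B Z" and t': "t' : hom T B' Y" "t' : S" and g': "g' : hom T B' Z"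
    and y: "y : hom T V B" "y' : hom T V B'" "t ** y = t' ** y'" "g ** y = g' ** y'" "t ** y : S"
    using tg by (rule roof_eqE)
  have uh: "u : hom T (Dom T u) A" "v : hom T (Dom T u) B" "u' : hom T (Dom T u') A'" "v' : hom T (Dom T u') B'"
    using u(1-5) u'(1-5) f f' t t' by (auto simp: hom_def)
  obtain R z w where z: "z : hom T R W" "z : S" "w : hom T R V" "(f ** x) ** z = (t ** y) ** w"
    using frac_ore[OF comp[OF x(1) f] comp[OF y(1) t(1)] y(5)] by blast
  have h: "x ** z : hom T R A" "x' ** z : hom T R A'" "y ** w : hom T R B" "y' ** w : hom T R B'"
    using comp x y z by blast+
  have e: "f ** (x ** z) = t ** (y ** w)" using z(4) assoc[OF z(1) x(1) f] assoc[OF z(3) y(1) t(1)] by simp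
  have e': "f' ** (x' ** z) = t' ** (y' ** w)"
    using z(4) unfolding x(4) y(3) using assoc[OF z(1) x(2) f'] assoc[OF z(3) y(2) t'(1)] by simp
  have sx: "s ** (x ** z) = s' ** (x' ** z)"
    using assoc[OF z(1) x(1) s(1)] assoc[OF z(1) x(2) s'(1)] x(3) by simp
  have gy: "g ** (y ** w) = g' ** (y' ** w)"
    using assoc[OF z(3) y(1) g] assoc[OF z(3) y(2) g'] y(4) by simp
  have sxz: "s ** (x ** z) : S"
    using frac_Cmp[OF z(1) comp[OF x(1) s(1)] z(2) x(5)] assoc[OF z(1) x(1) s(1)] by simp
  have "roof_eq T N X Z (s ** u, g ** v) (s ** (x ** z), g ** (y ** w))"
    by (rule completion_unique[OF s f t g uh(1,2) u(6,7) h(1,3) e sxz])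
  moreover have "roof_eq T N X Z (s' ** (x' ** z), g' ** (y' ** w)) (s' ** u', g' ** v')"
    by (rule completion_unique[OF s' f' t' g' h(2,4) e' sxz[unfolded sx] uh(3,4) u'(6,7)])
  ultimately show ?thesis unfolding sx gy by (rule roof_eq_trans)
qed

lemma D_simps [simp]:
  "Ob D = Ob T" "Dom D = fst" "Cod D = (\<lambda>f. fst (snd f))" "ShOb D = ShOb T" "Ident D X = verdier_arr T N (Ident T X)"
  "Arr D = {fraction T N X Y r | X Y r. X : Ob T \<and> Y : Ob T \<and> r : roofs T N X Y}"
  by (auto simp: verdier_def fun_eq_iff)

lemma fraction_Dom_Cod [simp]: "fst (fraction T N X Y r) = X" "fst (snd (fraction T N X Y r)) = Y"
  by (simp_all add: fraction_def)

lemma D_hom: "hom D X Y = {fraction T N X Y r | r. r : roofs T N X Y}"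
proof -
  have "X : Ob T \<and> Y : Ob T" if "r : roofs T N X Y" for r
    using that roofE[of "fst r" "snd r"] hom_Ob2 by (metis prod.collapse)
  note ob = this
  have "fraction T N X Y r : hom D X Y" if "r : roofs T N X Y" for r
  proof (rule homI)
    show "fraction T N X Y r : Arr D" unfolding D_simps(6) using that ob by blast
  qed simp_all
  moreover have "\<exists>r. \<alpha> = fraction T N X Y r \<and> r : roofs T N X Y" if "\<alpha> : hom D X Y" for \<alpha>
  proof -
    have \<alpha>: "\<alpha> : Arr D" "Dom D \<alpha> = X" "Cod D \<alpha> = Y" using that by (simp_all only: hom_Arr hom_Dom hom_Cod)
    obtain X' Y' r where "\<alpha> = fraction T N X' Y' r" "r : roofs T N X' Y'"
      using \<alpha>(1) unfolding D_simps(6) by blast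
    moreover from this have "X' = X" "Y' = Y" using \<alpha>(2,3) by simp_all
    ultimately show ?thesis by blast
  qed
  ultimately show ?thesis by blast
qed

lemma D_homE:
  assumes "\<alpha> : hom D X Y"
  obtains Z s f where "s : hom T Z X" "s : S" "f : hom T Z Y" "\<alpha> = fraction T N X Y (s, f)"
  using assms unfolding D_hom by (auto elim: roofE)

lemma D_homI: "s : hom T Z X ==> s : S ==> f : hom T Z Y ==> fraction T N X Y (s, f) : hom D X Y"
  unfolding D_hom using roofI by blast

text \<open>The definition of composition admits all representatives and all squares with
  \<open>u\<close> inverted. Well-definedness makes their union a single class and allows computing
  it from one square in which only \<open>s ** u\<close> is inverted.\<close>

lemma D_Cmp:
  assumes s: "s : hom T A X" "s : S" and f: "f : hom T A Y" and t: "t : hom T B Y" "t : S" and g: "g : hom T B Z"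
    and u: "u : hom T W A" "v : hom T W B" "f ** u = t ** v" "s ** u : S"
  shows "fraction T N Y Z (t, g) **\<^sub>D fraction T N X Y (s, f) = fraction T N X Z (s ** u, g ** v)"
proof -
  have "fraction T N Y Z (t, g) **\<^sub>D fraction T N X Y (s, f) =
    (X, Z, {r. \<exists>t' g' s' f'. roof_eq T N Y Z (t, g) (t', g') \<and> roof_eq T N X Y (s, f) (s', f') \<and>
      (\<exists>u'\<in>S. \<exists>v'\<in>Arr T. Dom T u' = Dom T v' \<and> Cod T u' = Dom T f' \<and> Cod T v' = Dom T t' \<and>
         f' ** u' = t' ** v' \<and> roof_eq T N X Z (s' ** u', g' ** v') r)})"
    by (auto simp: verdier_def fraction_def)
  moreover have "(\<exists>t' g' s' f'. roof_eq T N Y Z (t, g) (t', g') \<and> roof_eq T N X Y (s, f) (s', f') \<and>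
      (\<exists>u'\<in>S. \<exists>v'\<in>Arr T. Dom T u' = Dom T v' \<and> Cod T u' = Dom T f' \<and> Cod T v' = Dom T t' \<and>
         f' ** u' = t' ** v' \<and> roof_eq T N X Z (s' ** u', g' ** v') r)) \<longleftrightarrow> roof_eq T N X Z (s ** u, g ** v) r" (is "?L \<longleftrightarrow> ?R") for r
  proof
    assume ?L
    then obtain t' g' s' f' u' v' where h: "roof_eq T N Y Z (t, g) (t', g')" "roof_eq T N X Y (s, f) (s', f')"
      "u' : S" "v' : Arr T" "Dom T u' = Dom T v'" "Cod T u' = Dom T f'" "Cod T v' = Dom T t'"
      "f' ** u' = t' ** v'" "roof_eq T N X Z (s' ** u', g' ** v') r" by blast
    obtain A' where s': "s' : hom T A' X" "s' : S" "f' : hom T A' Y" using h(2) by (rule roof_eqE)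
    have u'A: "u' : Arr T" using h(3) by (simp add: cone_in_def)
    have "u' : hom T (Dom T u') A'" using u'A h(6) s' by (auto simp: hom_def)
    then have "s' ** u' : S" using frac_Cmp s' h(3) by blast
    then have "roof_eq T N X Z (s ** u, g ** v) (s' ** u', g' ** v')"
      by (intro completion_well_defined[OF h(2,1) _ _ _ _ _ u(3,4) u'A h(4-8)]) (use u f t in \<open>auto simp: hom_def\<close>)
    then show ?R using h(9) roof_eq_trans' by blast
  next
    assume R: ?R
    obtain W' u' v' where u': "u' : hom T W' A" "u' : S" "v' : hom T W' B" "f ** u' = t ** v'"
      using frac_ore[OF f t] by blast
    have "roof_eq T N X Z (s ** u', g ** v') (s ** u, g ** v)"
      by (rule completion_unique[OF s f t g u'(1,3,4) frac_Cmp[OF u'(1) s(1) u'(2) s(2)] u])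
    then have "roof_eq T N X Z (s ** u', g ** v') r" using R roof_eq_trans' by blast
    moreover have "roof_eq T N Y Z (t, g) (t, g)" "roof_eq T N X Y (s, f) (s, f)"
      using roof_eq_refl roofI s f t g by blast+
    moreover have "v' : Arr T" "Dom T u' = Dom T v'" "Cod T u' = Dom T f" "Cod T v' = Dom T t"
      using u' f t by (auto simp: hom_def)
    ultimately show ?L using u'(2,4) by blast
  qed
  ultimately show ?thesis by (simp add: fraction_def)
qed

lemma D_CmpE:
  assumes "\<alpha> : hom D X Y" "\<beta> : hom D Y Z"
  obtains A B W s f t g u v where "s : hom T A X" "s : S" "f : hom T A Y" "t : hom T B Y" "t : S" "g : hom T B Z"
    "u : hom T W A" "u : S" "v : hom T W B" "f ** u = t ** v" "s ** u : S"
    "\<alpha> = fraction T N X Y (s, f)" "\<beta> = fraction T N Y Z (t, g)" "\<beta> **\<^sub>D \<alpha> = fraction T N X Z (s ** u, g ** v)"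
proof -
  obtain A s f where s: "s : hom T A X" "s : S" "f : hom T A Y" "\<alpha> = fraction T N X Y (s, f)" using assms(1) by (rule D_homE)
  obtain B t g where t: "t : hom T B Y" "t : S" "g : hom T B Z" "\<beta> = fraction T N Y Z (t, g)" using assms(2) by (rule D_homE)
  obtain W u v where u: "u : hom T W A" "u : S" "v : hom T W B" "f ** u = t ** v"
    using frac_ore[OF s(3) t(1,2)] by blast
  have su: "s ** u : S" using frac_Cmp u s by blast
  show thesis
    by (rule that[OF s(1-3) t(1-3) u su s(4) t(4)]) (use D_Cmp[OF s(1-3) t(1-3) u(1,3,4) su] s(4) t(4) in simp)
qed

abbreviation "Q f \<equiv> verdier_arr T N f"

lemma Q_def: "f : hom T X Y ==> Q f = fraction T N X Y (Ident T X, f)"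
  by (auto simp: verdier_arr_def hom_def)

lemma Q_hom: "f : hom T X Y ==> Q f : hom D X Y"
  using D_homI[OF id_hom frac_Ident] hom_Ob1 by (metis Q_def)

lemma Q_Cmp:
  assumes "f : hom T X Y" "g : hom T Y Z" shows "Q (g ** f) = Q g **\<^sub>D Q f"
proof -
  have X: "X : Ob T" "Y : Ob T" using hom_Ob1 hom_Ob2 assms by auto
  note I = id_hom[OF X(1)] frac_Ident[OF X(1)] id_hom[OF X(2)] frac_Ident[OF X(2)]
  have "Q g **\<^sub>D Q f = fraction T N X Z (Ident T X ** Ident T X, g ** f)"
    unfolding Q_def[OF assms(1)] Q_def[OF assms(2)]
    by (rule D_Cmp[OF I(1,2) assms(1) I(3,4) assms(2) I(1) assms(1)])
      (use id_left[OF assms(1)] id_right[OF assms(1)] Ident_pair[OF X(1)] I in simp_all)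
  then show ?thesis using Ident_pair[OF X(1)] Q_def[OF comp[OF assms]] by simp
qed

sublocale D: category D
proof
  fix f assume "f : Arr D"
  then show "Dom D f : Ob D" "Cod D f : Ob D" by auto
next
  fix X assume "X : Ob D"
  then show "Ident D X : hom D X X" using Q_hom[OF id_hom] by simp
next
  fix f X Y g Z assume "f : hom D X Y" "g : hom D Y Z"
  then obtain A B W s f' t g' u v where h: "s : hom T A X" "s : S" "f' : hom T A Y" "t : hom T B Y" "t : S" "g' : hom T B Z"
    "u : hom T W A" "u : S" "v : hom T W B" "f' ** u = t ** v" "s ** u : S"
    "f = fraction T N X Y (s, f')" "g = fraction T N Y Z (t, g')" "g **\<^sub>D f = fraction T N X Z (s ** u, g' ** v)"
    by (rule D_CmpE)
  then show "g **\<^sub>D f : hom D X Z"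
    using D_homI[OF comp[OF h(7,1)] h(11) comp[OF h(9,6)]] by simp
next
  fix f W X g Y h Z assume f: "f : hom D W X" and g: "g : hom D X Y" and h: "h : hom D Y Z"
  obtain B C V t g' r h' u v where g': "t : hom T B X" "t : S" "g' : hom T B Y" and r: "r : hom T C Y" "r : S" "h' : hom T C Z"
    and u: "u : hom T V B" "u : S" "v : hom T V C" "g' ** u = r ** v" "t ** u : S"
    and e: "g = fraction T N X Y (t, g')" "h = fraction T N Y Z (r, h')" "h **\<^sub>D g = fraction T N X Z (t ** u, h' ** v)"
    using g h by (rule D_CmpE)
  obtain A s f' where s: "s : hom T A W" "s : S" "f' : hom T A X" "f = fraction T N W X (s, f')" using f by (rule D_homE)
  \<comment> \<open>One Ore square over the composite denominator \<open>t ** u\<close> computes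
    both bracketings: \<open>u ** y\<close> completes the square for \<open>g\<close> after
    \<open>f\<close>, and the remaining square for \<open>h\<close> can be taken with an identity as
    its first leg.\<close>
  obtain R x y where x: "x : hom T R A" "x : S" "y : hom T R V" "f' ** x = (t ** u) ** y"
    using frac_ore[OF s(3) comp[OF u(1) g'(1)] u(5)] by blast
  have sx: "s ** x : S" using frac_Cmp[OF x(1) s(1) x(2) s(2)] .
  have uy: "u ** y : hom T R B" and vy: "v ** y : hom T R C" using comp x(3) u by blast+
  have 1: "h **\<^sub>D g **\<^sub>D f = fraction T N W Z (s ** x, (h' ** v) ** y)"
    unfolding e(3) s(4) by (rule D_Cmp[OF s(1-3) comp[OF u(1) g'(1)] u(5) comp[OF u(3) r(3)] x(1,3,4) sx])
  have 2: "g **\<^sub>D f = fraction T N W Y (s ** x, g' ** (u ** y))"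
    unfolding e(1) s(4) by (rule D_Cmp[OF s(1-3) g' x(1) uy _ sx]) (use x(4) assoc[OF x(3) u(1) g'(1)] in simp)
  have R: "Ident T R : hom T R R" using id_hom hom_Ob1[OF x(1)] by blast
  have sxR: "s ** x : hom T R W" using comp x(1) s(1) by blast
  have gu: "g' ** (u ** y) : hom T R Y" using comp uy g'(3) by blast
  have q: "g' ** (u ** y) = r ** (v ** y)"
    using assoc[OF x(3) u(1) g'(3)] assoc[OF x(3) u(3) r(1)] u(4) by simp
  have "h **\<^sub>D (g **\<^sub>D f) = fraction T N W Z ((s ** x) ** Ident T R, h' ** (v ** y))"
    unfolding 2 e(2)
    by (rule D_Cmp[OF sxR sx gu r R vy]) (use q id_right[OF gu] id_right[OF sxR] sx in simp_all)
  then show "h **\<^sub>D g **\<^sub>D f = h **\<^sub>D (g **\<^sub>D f)"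
    unfolding 1 using assoc[OF x(3) u(3) r(3)] id_right[OF sxR] by simp
next
  fix f X Y assume "f : hom D X Y"
  then obtain A s f' where s: "s : hom T A X" "s : S" "f' : hom T A Y" "f = fraction T N X Y (s, f')" by (rule D_homE)
  have X: "X : Ob T" "Y : Ob T" "A : Ob T" using hom_Ob1 hom_Ob2 s by auto
  note I = id_hom[OF X(1)] frac_Ident[OF X(1)] id_hom[OF X(2)] frac_Ident[OF X(2)] id_hom[OF X(3)]
  have "Ident D Y **\<^sub>D f = fraction T N X Y (s ** Ident T A, Ident T Y ** f')"
    unfolding D_simps Q_def[OF I(3)] s(4)
    by (rule D_Cmp[OF s(1-3) I(3,4,3,5) s(3)]) (use id_right[OF s(1)] id_right[OF s(3)] id_left[OF s(3)] s in simp_all)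
  then show "Ident D Y **\<^sub>D f = f" using id_right[OF s(1)] id_left[OF s(3)] s(4) by simp
  have "f **\<^sub>D Ident D X = fraction T N X Y (Ident T X ** s, f' ** Ident T A)"
    unfolding D_simps Q_def[OF I(1)] s(4)
    by (rule D_Cmp[OF I(1,2,1) s(1-3) s(1) I(5)]) (use id_right[OF s(1)] id_left[OF s(1)] s in simp_all)
  then show "f **\<^sub>D Ident D X = f" using id_left[OF s(1)] id_right[OF s(3)] s(4) by simp
qed

lemma Q_iso:
  assumes "s : hom T Z X" "s : S"
  shows "fraction T N X Z (s, Ident T Z) : hom D X Z" "fraction T N X Z (s, Ident T Z) **\<^sub>D Q s = Ident D Z"
    "Q s **\<^sub>D fraction T N X Z (s, Ident T Z) = Ident D X" "iso D (Q s)"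
proof -
  have Z: "Z : Ob T" "X : Ob T" using hom_Ob1 hom_Ob2 assms by auto
  note I = id_hom[OF Z(1)] frac_Ident[OF Z(1)] id_hom[OF Z(2)] frac_Ident[OF Z(2)]
  show 1: "fraction T N X Z (s, Ident T Z) : hom D X Z" by (rule D_homI[OF assms I(1)])
  have "fraction T N X Z (s, Ident T Z) **\<^sub>D Q s = fraction T N Z Z (Ident T Z ** Ident T Z, Ident T Z ** Ident T Z)"
    unfolding Q_def[OF assms(1)]
    by (rule D_Cmp[OF I(1,2) assms(1) assms I(1,1,1)]) (use Ident_pair[OF Z(1)] I in simp_all)
  then show 2: "fraction T N X Z (s, Ident T Z) **\<^sub>D Q s = Ident D Z" using Ident_pair[OF Z(1)] Q_def[OF I(1)] by simp
  have "Q s **\<^sub>D fraction T N X Z (s, Ident T Z) = fraction T N X X (s ** Ident T Z, s ** Ident T Z)"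
    unfolding Q_def[OF assms(1)]
    by (rule D_Cmp[OF assms I(1,1,2) assms(1) I(1,1)]) (use id_right[OF assms(1)] assms in simp_all)
  also have "\<dots> = fraction T N X X (Ident T X, Ident T X)"
    using fraction_eqI[OF roof_refine[OF I(3,4,3) assms(1)]] id_right[OF assms(1)] id_left[OF assms(1)] assms(2) by simp
  finally show 3: "Q s **\<^sub>D fraction T N X Z (s, Ident T Z) = Ident D X" using Q_def[OF I(3)] by simp
  show "iso D (Q s)" by (rule D.isoI[OF Q_hom[OF assms(1)] 1 2 3])
qed

lemma Q_eqD:
  assumes "f : hom T X Y" "g : hom T X Y" "Q f = Q g"
  shows "\<exists>W u. u : hom T W X \<and> u : S \<and> f ** u = g ** u"
proof -
  have X: "X : Ob T" using hom_Ob1 assms by auto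
  have "roof_eq T N X Y (Ident T X, f) (Ident T X, g)"
    by (rule fraction_eqD) (use assms(3) Q_def[OF assms(1)] Q_def[OF assms(2)] roofI[OF id_hom[OF X] frac_Ident[OF X] assms(2)] in simp_all)
  then obtain A B W u v where "Ident T X : hom T A X" "Ident T X : hom T B X" "u : hom T W A" "v : hom T W B"
    "Ident T X ** u = Ident T X ** v" "f ** u = g ** v" "Ident T X ** u : S"
    by (rule roof_eqE)
  moreover from this have "A = X" "B = X" using id_hom[OF X] by (auto simp: hom_def)
  ultimately show ?thesis using id_left by metis
qed

lemma Q_eqI:
  assumes "f : hom T X Y" "g : hom T X Y" "u : hom T W X" "u : S" "f ** u = g ** u"
  shows "Q f = Q g"
proof -
  have X: "X : Ob T" using hom_Ob1 assms by auto
  note I = id_hom[OF X] frac_Ident[OF X]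
  show ?thesis unfolding Q_def[OF assms(1)] Q_def[OF assms(2)]
    by (rule fraction_eqI[OF roof_eqI[OF I assms(1) I assms(2,3,3)]]) (use assms id_left[OF assms(3)] in simp_all)
qed

text \<open>Shift and sum in the quotient range over all representatives of a class. Each
  representative of \<open>Q f\<close> is brought to a form in which its numerator is
  \<open>f\<close> after its denominator, by a refinement \<open>x\<close> that is itself
  inverted.\<close>

lemma roof_eqD:
  assumes r: "roof_eq T N X Y (Ident T X, f) (s, f')" and f: "f : hom T X Y"
  shows "\<exists>B V x. s : hom T B X \<and> s : S \<and> f' : hom T B Y \<and> x : hom T V B \<and> x : S \<and> f ** (s ** x) = f' ** x"
proof -
  obtain B where s: "s : hom T B X" "s : S" "f' : hom T B Y" by (rule roof_eqE[OF r])
  note B = hom_Ob1[OF s(1)]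
  note I = id_hom[OF B] frac_Ident[OF B]
  have "Q (f ** s) = fraction T N X Y (s, f') **\<^sub>D Q s"
    unfolding Q_Cmp[OF s(1) f] using Q_def[OF f] fraction_eqI[OF r] by simp
  also have "\<dots> = fraction T N B Y (Ident T B ** Ident T B, f' ** Ident T B)"
    unfolding Q_def[OF s(1)] by (rule D_Cmp[OF I s(1) s I(1,1)]) (use Ident_pair[OF B] I in simp_all)
  also have "\<dots> = Q f'" using Q_def[OF s(3)] Ident_pair[OF B] id_right[OF s(3)] by simp
  finally obtain V x where x: "x : hom T V B" "x : S" "(f ** s) ** x = f' ** x" using Q_eqD[OF comp[OF s(1) f] s(3)] by blast
  then show ?thesis using s assoc[OF x(1) s(1) f] by metis
qed

end

section \<open>Exactness of hom groups along a triangle\<close>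

context triangulated
begin

lemma Tri_zero':
  assumes "(f, g, h) : Tri T" "f : hom T X Y" "g : hom T Y Z" shows "g ** f = Zero T X Z"
  using Tri_zero[OF assms(1)] hom_Dom[OF assms(2)] hom_Cod[OF assms(3)] by simp

lemma Tri_kernel:
  assumes "(f, g, h) : Tri T" "f : hom T X Y" "g : hom T Y Z" "u : hom T W Y" "g ** u = Zero T W Z"
  shows "\<exists>v\<in>hom T W X. u = f ** v"
  using Tri_weak_kernel[OF assms(1), of u W] assms(4,5) hom_Dom[OF assms(2)] hom_Dom[OF assms(3)] hom_Cod[OF assms(3)] by simp

lemma Tri_cokernel:
  assumes "(f, g, h) : Tri T" "f : hom T X Y" "g : hom T Y Z" "u : hom T Y W" "u ** f = Zero T X W"
  shows "\<exists>v\<in>hom T Z W. u = v ** g"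
  using Tri_weak_cokernel[OF assms(1), of u W] assms(4,5) hom_Dom[OF assms(2)] hom_Dom[OF assms(3)] hom_Cod[OF assms(3)] by simp

lemma Tri_kernel_first:
  assumes t: "(f, g, h) : Tri T" "f : hom T X Y" "g : hom T Y Z" and u: "u : hom T W X" "f ** u = Zero T W Y"
  shows "\<exists>w. w : hom T (ShOb T W) Z \<and> ShArr T u = h ** w"
proof -
  have h: "h : hom T Z (ShOb T X)" using Tri_hom(3)[OF t(1)] t(2,3) by (simp add: hom_def)
  note Sf = ShArr_hom[OF t(2)] and Su = ShArr_hom[OF u(1)]
  have "Neg T (ShArr T f) ** ShArr T u = Zero T (ShOb T W) (ShOb T Y)"
    using neg_left[OF Su Sf] ShArr_Cmp[OF u(1) t(2), symmetric] u(2) ShArr_Zero[OF hom_Ob1[OF u(1)] hom_Ob2[OF t(2)]]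
      Neg_Zero[OF hom_Ob1[OF Su] hom_Ob2[OF Sf]] by simp
  then show ?thesis using Tri_kernel[OF Tri_rotate[OF Tri_rotate[OF t(1)]] h neg_hom[OF Sf] Su] by blast
qed

text \<open>The difference of \<open>u\<close> and \<open>v\<close> is killed by \<open>f\<close>,
  so its shift factors through \<open>h\<close> by a map from the shift of \<open>W\<close> to
  \<open>Z\<close>, and every such map is zero.\<close>

lemma Tri_injective:
  assumes t: "(f, g, h) : Tri T" "f : hom T X Y" "g : hom T Y Z" and z: "hom T (ShOb T W) Z = {Zero T (ShOb T W) Z}"
    and u: "u : hom T W X" "v : hom T W X" "f ** u = f ** v"
  shows "u = v"
proof -
  let ?d = "u \<oplus> Neg T v"
  have ob: "W : Ob T" "X : Ob T" "Y : Ob T" using hom_Ob1 hom_Ob2 u(1) t(2) by blast+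
  have h: "h : hom T Z (ShOb T X)" using Tri_hom(3)[OF t(1)] t(2,3) by (simp add: hom_def)
  have d: "?d : hom T W X" using add_hom[OF u(1) neg_hom[OF u(2)]] .
  have "f ** ?d = Zero T W Y" using Cmp_diff(1)[OF u(1,2) t(2) id_hom[OF ob(1)]] Add_Neg[OF comp[OF u(2) t(2)]] u(3) by simp
  then obtain w where w: "w : hom T (ShOb T W) Z" "ShArr T ?d = h ** w" using Tri_kernel_first[OF t d] by blast
  then have "w = Zero T (ShOb T W) Z" using z by blast
  then have "ShArr T ?d = ShArr T (Zero T W X)" using w(2) zero_right[OF h hom_Ob1[OF w(1)]] ShArr_Zero[OF ob(1,2)] by simp
  then have "?d = Zero T W X" using ShArr_inj[OF d zero_hom[OF ob(1,2)]] by blast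
  then show ?thesis using diff_Zero[OF u(1,2)] by blast
qed

text \<open>An arrow from \<open>W\<close> into \<open>Z\<close> has zero image in the shift of
  \<open>X\<close> by injectivity. So it comes from \<open>Y\<close>, hence by surjectivity from
  \<open>X\<close>, and consecutive arrows of a triangle compose to zero.\<close>

lemma Tri_cone_zero:
  assumes t: "(f, g, h) : Tri T" "f : hom T X Y" "g : hom T Y Z" and W: "W : Ob T"
    and surj: "\<And>v. v : hom T W Y ==> \<exists>w\<in>hom T W X. f ** w = v"
    and inj: "\<And>u. u : hom T W (ShOb T X) ==> ShArr T f ** u = Zero T W (ShOb T Y) ==> u = Zero T W (ShOb T X)"
  shows "hom T W Z = {Zero T W Z}"
proof -
  have h: "h : hom T Z (ShOb T X)" using Tri_hom(3)[OF t(1)] t(2,3) by (simp add: hom_def)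
  note Sf = ShArr_hom[OF t(2)] and Z = hom_Ob1[OF h]
  have "u = Zero T W Z" if u: "u : hom T W Z" for u
  proof -
    have hu: "h ** u : hom T W (ShOb T X)" using comp[OF u h] .
    have "Neg T (ShArr T f) ** h = Zero T Z (ShOb T Y)" using Tri_zero'[OF Tri_rotate[OF Tri_rotate[OF t(1)]] h neg_hom[OF Sf]] .
    then have "ShArr T f ** h = Zero T Z (ShOb T Y)" using neg_left[OF h Sf] Neg_eq_Zero[OF comp[OF h Sf]] by simp
    then have "h ** u = Zero T W (ShOb T X)" using inj[OF hu] assoc[OF u h Sf] zero_left[OF u hom_Ob2[OF Sf]] by simp
    then obtain v where v: "v : hom T W Y" "u = g ** v" using Tri_kernel[OF Tri_rotate[OF t(1)] t(3) h u] by blast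
    obtain w where w: "w : hom T W X" "f ** w = v" using surj[OF v(1)] by blast
    show ?thesis using v(2) w assoc[OF w(1) t(2,3)] Tri_zero'[OF t] zero_left[OF w(1) Z] by simp
  qed
  then show ?thesis using zero_hom[OF W Z] by blast
qed

end

section \<open>The Verdier quotient of a subcategory\<close>

text \<open>Triangles are formed in the ambient category \<open>T\<close>. Whenever a new object is
  an extension of an object of \<open>U\<close> by one of \<open>N\<close>, \<open>U_ext\<close>
  puts it back into \<open>U\<close>; this keeps the fractions inside the full subcategory.\<close>

locale verdier_setting = triangulated T Std for T :: "('o, 'm) tricat" (structure) and Std +
  fixes U N :: "'o set"
  assumes N_sub: "N \<subseteq> U" and U_sub: "U \<subseteq> Ob T"
    and U_shift: "X : U ==> ShOb T X : U"
    and N_iso: "isomorphic T X Y ==> Y : N ==> X : N"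
    and N_zero: "zero_object T X ==> X : N"
    and N_shift: "X : N ==> ShOb T X : N"
    and N_unshift: "X : Ob T ==> ShOb T X : N ==> X : N"
    and N_ext: "(f, g, h) : Tri T ==> Dom T f : N ==> Cod T g : N ==> Cod T f : N"
    and U_ext: "(f, g, h) : Tri T ==> Dom T f : N ==> Cod T g : U ==> Cod T f : U"
begin

abbreviation "T' \<equiv> full_sub T U"

lemma sub_simps [simp]:
  "Ob T' = U" "Dom T' = Dom T" "Cod T' = Cod T" "Ident T' = Ident T" "Cmp T' = Cmp T" "Add T' = Add T"
  "Zero T' = Zero T" "ShOb T' = ShOb T" "ShArr T' = ShArr T"
  using U_sub by (auto simp: full_sub_def)

lemma sub_hom: "f : hom T' X Y \<longleftrightarrow> f : hom T X Y \<and> X : U \<and> Y : U"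
  by (auto simp: hom_def full_sub_def)

lemma sub_Tri: "(f, g, h) : Tri T' \<longleftrightarrow> (f, g, h) : Tri T \<and> Dom T f : U \<and> Dom T g : U \<and> Dom T h : U"
  by (auto simp: full_sub_def)

lemma Tri_Dom: "(f, g, h) : Tri T ==> Dom T g = Cod T f" "(f, g, h) : Tri T ==> Dom T h = Cod T g"
  "(f, g, h) : Tri T ==> Cod T h = ShOb T (Dom T f)"
  using Tri_hom by (metis hom_Dom, metis hom_Dom, metis hom_Cod)

lemma sub_category: "category T'"
proof
  fix f assume "f : Arr T'"
  then show "Dom T' f : Ob T'" "Cod T' f : Ob T'" using Dom_in_Ob Cod_in_Ob U_sub by (auto simp: full_sub_def)
qed (use U_sub id_hom comp assoc id_left id_right in \<open>auto simp: sub_hom\<close>)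

lemma S_iff: "s : cone_in T' N \<longleftrightarrow> Dom T s : U \<and> Cod T s : U \<and> (\<exists>g h. (s, g, h) : Tri T \<and> Cod T g : N)"
proof
  assume "s : cone_in T' N"
  then show "Dom T s : U \<and> Cod T s : U \<and> (\<exists>g h. (s, g, h) : Tri T \<and> Cod T g : N)"
    by (auto simp: cone_in_def full_sub_def)
next
  assume a: "Dom T s : U \<and> Cod T s : U \<and> (\<exists>g h. (s, g, h) : Tri T \<and> Cod T g : N)"
  then obtain g h where t: "(s, g, h) : Tri T" "Cod T g : N" by blast
  have "s : Arr T" using Tri_hom(1)[OF t(1)] by (rule hom_Arr)
  then have "s : Arr T'" using a by (auto simp: full_sub_def)
  moreover have "(s, g, h) : Tri T'" using a t Tri_Dom[OF t(1)] N_sub by (auto simp: sub_Tri)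
  ultimately show "s : cone_in T' N" using t(2) unfolding cone_in_def sub_simps by blast
qed

lemma S_I: "(s, g, h) : Tri T ==> Dom T s : U ==> Cod T s : U ==> Cod T g : N ==> s : cone_in T' N"
  using S_iff by blast

lemma S_U: "s : cone_in T' N ==> s : hom T X Y ==> X : U \<and> Y : U"
  by (auto simp: S_iff hom_def)

text \<open>Both \<open>g\<close> and \<open>h\<close> vanish, and the identity of the cone factors
  through \<open>h\<close> because it kills \<open>g\<close>.\<close>

lemma cone_Ident:
  assumes t: "(Ident T X, g, h) : Tri T" and X: "X : Ob T" shows "zero_object T (Cod T g)"
proof -
  note I = id_hom[OF X]
  note hs = Tri_hom[OF t, unfolded hom_Dom[OF I] hom_Cod[OF I]]
  have Z: "Cod T g : Ob T" using hom_Ob2[OF hs(2)] .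
  have g: "g = Zero T X (Cod T g)"
    using Tri_zero'[OF t I hs(2)] id_right[OF hs(2)] by simp
  have 1: "Ident T (Cod T g) ** g = Zero T X (Cod T g)" using g id_left[OF hs(2)] by simp
  obtain v where v: "v : hom T (ShOb T X) (Cod T g)" "Ident T (Cod T g) = v ** h"
    using Tri_cokernel[OF Tri_rotate[OF t] hs(2,3) id_hom[OF Z] 1] by blast
  have "Neg T (Ident T (ShOb T X)) ** h = Zero T (Cod T g) (ShOb T X)"
    using Tri_zero'[OF Tri_rotate[OF Tri_rotate[OF t]] hs(3) neg_hom[OF ShArr_hom[OF I]]] ShArr_Ident[OF X] by simp
  then have "h = Zero T (Cod T g) (ShOb T X)"
    using neg_left[OF hs(3) id_hom[OF hom_Ob2[OF hs(3)]]] id_left[OF hs(3)] Neg_eq_Zero[OF hs(3)] by simp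
  then show ?thesis using v zero_right[OF v(1) Z] zero_objectI[OF Z] by simp
qed

text \<open>Rotation exhibits the shift of \<open>Dom T x\<close> as the cone of \<open>s\<close>.
  The denominators in \<open>S_ore\<close> and \<open>S_annihilator\<close> are fibres of arrows
  into objects of \<open>N\<close> and arise in this way.\<close>

lemma S_of_third:
  assumes "(x, s, g) : Tri T" "Dom T x : N" "Cod T s : U" shows "s : cone_in T' N"
proof (rule S_I[OF Tri_rotate[OF assms(1)]])
  show "Dom T s : U" using Tri_Dom[OF assms(1)] U_ext[OF assms] by simp
  show "Cod T g : N" using Tri_Dom[OF assms(1)] N_shift[OF assms(2)] by simp
qed (rule assms)

text \<open>\<open>u\<close> is the fibre of \<open>g ** f\<close>, where \<open>g\<close> is the
  map to the cone of \<open>t\<close>. Then \<open>f ** u\<close> dies in that cone and therefore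
  lifts through \<open>t\<close>.\<close>

lemma S_ore:
  assumes f: "f : hom T X Y" "X : U" and t: "t : hom T Z Y" "t : cone_in T' N"
  shows "\<exists>W u v. u : hom T W X \<and> u : cone_in T' N \<and> v : hom T W Z \<and> f ** u = t ** v"
proof -
  obtain g h where g: "(t, g, h) : Tri T" "Cod T g : N" using t(2) S_iff by blast
  have gh: "g : hom T Y (Cod T g)" using Tri_hom[OF g(1)] t(1) by (simp add: hom_def)
  obtain B where B: "B : Ob T" "ShOb T B = Cod T g" using ShOb_surj hom_Ob2[OF gh] by blast
  have gf: "g ** f : hom T X (ShOb T B)" using comp[OF f(1) gh] B by simp
  obtain W x u where x: "(x, u, g ** f) : Tri T" "x : hom T B W" "u : hom T W X" using Tri_third[OF B(1) gf] by blast
  have BN: "B : N" using N_unshift B g(2) by simp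
  have "u : cone_in T' N" by (rule S_of_third[OF x(1)]) (use x BN f in \<open>simp_all add: hom_def\<close>)
  moreover have "(g ** f) ** u = Zero T W (Cod T g)"
    using Tri_zero'[OF Tri_rotate[OF x(1)] x(3) gf] B by simp
  then have "g ** (f ** u) = Zero T W (Cod T g)" using assoc[OF x(3) f(1) gh] by simp
  then obtain v where "v : hom T W Z" "f ** u = t ** v"
    using Tri_kernel[OF g(1) t(1) gh comp[OF x(3) f(1)]] by blast
  ultimately show ?thesis using x by blast
qed

text \<open>Since \<open>t\<close> kills \<open>f\<close>, the shift of \<open>f\<close> factors
  through the cone of \<open>t\<close>, an object of \<open>N\<close>. Desuspending this factor
  gives \<open>w0\<close>; its fibre \<open>u\<close> kills \<open>f\<close> because the shift is
  faithful.\<close>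

lemma S_annihilator:
  assumes f: "f : hom T X Z" "X : U" and t: "t : hom T Z Y" "t : cone_in T' N" and e: "t ** f = Zero T X Y"
  shows "\<exists>W u. u : hom T W X \<and> u : cone_in T' N \<and> f ** u = Zero T W Z"
proof -
  obtain g h where g: "(t, g, h) : Tri T" "Cod T g : N" using t(2) S_iff by blast
  note hs = Tri_hom[OF g(1), unfolded hom_Dom[OF t(1)] hom_Cod[OF t(1)]]
  have X: "X : Ob T" "Z : Ob T" "Y : Ob T" using hom_Ob1 hom_Ob2 f t by blast+
  obtain w where w: "w : hom T (ShOb T X) (Cod T g)" "ShArr T f = h ** w" using Tri_kernel_first[OF g(1) t(1) hs(2) f(1) e] by blast
  obtain B where B: "B : Ob T" "ShOb T B = Cod T g" using ShOb_surj hom_Ob1[OF hs(3)] by blast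
  have BN: "B : N" using N_unshift B g(2) by simp
  obtain w0 where w0: "w0 : hom T X B" "ShArr T w0 = w" using ShArr_surj[OF X(1) B(1)] w(1) B(2) by auto
  obtain B' where B': "B' : Ob T" "ShOb T B' = B" using ShOb_surj B by blast
  have B'N: "B' : N" using N_unshift B' BN by simp
  obtain W x u where x: "(x, u, w0) : Tri T" "x : hom T B' W" "u : hom T W X" using Tri_third[OF B'(1), of w0 X] w0 B' by blast
  have "u : cone_in T' N" by (rule S_of_third[OF x(1)]) (use x B'N f in \<open>simp_all add: hom_def\<close>)
  moreover have "f ** u = Zero T W Z"
  proof (rule ShArr_inj[OF comp[OF x(3) f(1)] zero_hom[OF hom_Ob1[OF x(3)] X(2)]])
    have z: "w0 ** u = Zero T W B" using Tri_zero'[OF Tri_rotate[OF x(1)] x(3) w0(1)] .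
    have "ShArr T (f ** u) = h ** (ShArr T w0 ** ShArr T u)"
      unfolding ShArr_Cmp[OF x(3) f(1)] w(2) w0(2) by (rule assoc[OF ShArr_hom[OF x(3)] w(1) hs(3)])
    also have "\<dots> = h ** Zero T (ShOb T W) (Cod T g)"
      unfolding ShArr_Cmp[OF x(3) w0(1), symmetric] z using ShArr_Zero[OF hom_Ob1[OF x(3)] B(1)] B(2) by simp
    also have "\<dots> = ShArr T (Zero T W Z)"
      using zero_right[OF hs(3)] hom_Ob1[OF ShArr_hom[OF x(3)]] ShArr_Zero[OF hom_Ob1[OF x(3)] X(2)] by simp
    finally show "ShArr T (f ** u) = ShArr T (Zero T W Z)" .
  qed
  ultimately show ?thesis using x by blast
qed

sublocale F: right_fractions T' N
proof (intro right_fractions.intro sub_category right_fractions_axioms.intro)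
  fix X assume "X : Ob T'"
  then have X: "X : U" "X : Ob T" using U_sub by auto
  obtain Z g h where t: "(Ident T X, g, h) : Tri T" using cone_exists[OF id_hom[OF X(2)]] by blast
  then have "Cod T g : N" using cone_Ident X N_zero by blast
  then show "Ident T' X : cone_in T' N"
    using S_I[OF t] X id_hom[OF X(2)] by (simp add: hom_def)
next
  fix s X Y t Z assume s: "s : hom T' X Y" "s : cone_in T' N" and t: "t : hom T' Y Z" "t : cone_in T' N"
  then have st: "s : hom T X Y" "t : hom T Y Z" "X : U" "Y : U" "Z : U" by (auto simp: sub_hom)
  obtain s1 s2 where s1: "(s, s1, s2) : Tri T" "Cod T s1 : N" using s S_iff by blast
  obtain t1 t2 where t1: "(t, t1, t2) : Tri T" "Cod T t1 : N" using t S_iff by blast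
  obtain r1 r2 where r1: "(t ** s, r1, r2) : Tri T" using cone_exists[OF comp[OF st(1,2)]] by blast
  obtain u v w where o: "(u, v, w) : Tri T" "isomorphic T (Cod T s1) (Dom T u)" "isomorphic T (Cod T r1) (Cod T u)"
    "isomorphic T (Cod T t1) (Cod T v)"
    using octahedron_objects[OF s1(1) t1(1) r1] hom_Cod[OF st(1)] hom_Dom[OF st(2)] by auto
  have "Cod T r1 : N"
    using N_iso[OF o(3)] N_ext[OF o(1)] N_iso[OF isomorphic_sym[OF o(2)] s1(2)] N_iso[OF isomorphic_sym[OF o(4)] t1(2)] by blast
  then show "t **\<^bsub>T'\<^esub> s : cone_in T' N"
    using S_I[OF r1] hom_Dom[OF comp[OF st(1,2)]] hom_Cod[OF comp[OF st(1,2)]] st by simp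
next
  fix f X Y t Z assume "f : hom T' X Y" "t : hom T' Z Y" "t : cone_in T' N"
  then show "\<exists>W u v. u : hom T' W X \<and> u : cone_in T' N \<and> v : hom T' W Z \<and> f **\<^bsub>T'\<^esub> u = t **\<^bsub>T'\<^esub> v"
    using S_ore[of f X Y t Z] S_U unfolding sub_hom sub_simps by blast
next
  fix f X Z g t Y assume h: "f : hom T' X Z" "g : hom T' X Z" "t : hom T' Z Y" "t : cone_in T' N" "t **\<^bsub>T'\<^esub> f = t **\<^bsub>T'\<^esub> g"
  then have h': "f : hom T X Z" "g : hom T X Z" "t : hom T Z Y" "X : U" "t ** f = t ** g" by (auto simp: sub_hom)
  have fg: "f \<oplus> Neg T g : hom T X Z" using add_hom neg_hom h' by blast
  have "t ** (f \<oplus> Neg T g) = Zero T X Y"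
    using Cmp_diff(1)[OF h'(1,2,3) id_hom[OF hom_Ob1[OF h'(1)]]] Add_Neg[OF comp[OF h'(2,3)]] h'(5) by simp
  then obtain W u where u: "u : hom T W X" "u : cone_in T' N" "(f \<oplus> Neg T g) ** u = Zero T W Z"
    using S_annihilator[OF fg h'(4,3) h(4)] by blast
  then have "f ** u = g ** u"
    using Cmp_diff(2)[OF h'(1,2) _ u(1), of "Ident T Z" Z] id_hom[OF hom_Ob2[OF h'(1)]]
      diff_Zero[OF comp[OF u(1) h'(1)] comp[OF u(1) h'(2)]] by simp
  moreover have "W : U" using u S_U by blast
  ultimately show "\<exists>W u. u : hom T' W X \<and> u : cone_in T' N \<and> f **\<^bsub>T'\<^esub> u = g **\<^bsub>T'\<^esub> u"
    using u h' unfolding sub_hom sub_simps by blast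
qed

notation F.D_Cmp_infix (infixl "**\<^sub>D" 70)

lemma S_shift:
  assumes "s : cone_in T' N" shows "ShArr T s : cone_in T' N"
proof -
  obtain g h where g: "(s, g, h) : Tri T" "Cod T g : N" using assms S_iff by blast
  note hs = Tri_hom[OF g(1)]
  note r = Tri_rotate[OF Tri_rotate[OF Tri_rotate[OF g(1)]]]
  let ?X = "ShOb T (Dom T s)" and ?Y = "ShOb T (Cod T s)" and ?Z = "ShOb T (Cod T g)"
  note Sh = ShArr_hom[OF hs(1)] ShArr_hom[OF hs(2)] ShArr_hom[OF hs(3)]
  have ob: "?X : Ob T" "?Y : Ob T" "?Z : Ob T" using hom_Ob1 hom_Ob2 Sh by blast+
  note I = id_hom[OF ob(1)] id_hom[OF ob(2)] id_hom[OF ob(3)]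
  let ?i = "Neg T (Ident T ?X)"
  have i: "?i : hom T ?X ?X" using I neg_hom by blast
  have ii: "?i ** ?i = Ident T ?X" using Cmp_Neg_Neg[OF I(1,1)] id_left[OF I(1)] by simp
  have iso: "iso T ?i" by (rule isoI[OF i i ii ii])
  have e: "ShArr T ?i ** Neg T (ShArr T h) = ShArr T h"
    using Cmp_Neg_Neg[OF Sh(3) id_hom[OF hom_Ob2[OF Sh(3)]]] ShArr_Neg[OF I(1)] ShArr_Ident[OF ob(1)] id_left[OF Sh(3)] by simp
  have e': "ShArr T ?i ** ShArr T h = Neg T (ShArr T h)"
    using neg_left[OF Sh(3) id_hom[OF hom_Ob2[OF Sh(3)]]] ShArr_Neg[OF I(1)] ShArr_Ident[OF ob(1)] id_left[OF Sh(3)] by simp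
  text \<open>The threefold rotation differs from the shift of the triangle by the sign \<open>-1\<close> on all three arrows.\<close>
  have "triangle_iso T (ShArr T s, Neg T (ShArr T g), ShArr T h) (Neg T (ShArr T s), Neg T (ShArr T g), Neg T (ShArr T h))"
    by (rule triangle_isoI[OF Sh(1) neg_hom[OF Sh(2)] Sh(3) neg_hom[OF Sh(1)] neg_hom[OF Sh(2)] neg_hom[OF Sh(3)]
        i I(2,3) iso iso_Ident[OF ob(2)] iso_Ident[OF ob(3)]])
      (use Cmp_Neg_Neg[OF I(1) Sh(1)] id_right[OF Sh(1)] id_left[OF Sh(1)] id_left[OF neg_hom[OF Sh(2)]]
        id_right[OF neg_hom[OF Sh(2)]] id_right[OF neg_hom[OF Sh(3)]] e' in simp_all)
  then have t: "(ShArr T s, Neg T (ShArr T g), ShArr T h) \<in> Tri T" using Tri_iso[OF r] by blast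
  show ?thesis
    by (rule S_I[OF t]) (use Sh neg_hom[OF Sh(2)] assms S_iff U_shift N_shift g in \<open>auto simp: hom_def\<close>)
qed

lemma sub_ShArr: "f \<in> hom T' X Y \<Longrightarrow> ShArr T f \<in> hom T' (ShOb T X) (ShOb T Y)"
  using ShArr_hom U_shift by (auto simp: sub_hom)

lemma Q_ShArr:
  assumes "f \<in> hom T' X Y" shows "ShArr F.D (F.Q f) = F.Q (ShArr T f)"
proof -
  have X: "X \<in> U" "Y \<in> U" "X \<in> Ob T" and f: "f \<in> hom T X Y" using assms hom_Ob1 by (auto simp: sub_hom)
  have I: "Ident T X \<in> hom T' X X" "Ident T X \<in> cone_in T' N" using id_hom X F.frac_Ident[of X] by (auto simp: sub_hom)
  note SI = sub_ShArr[OF I(1)] S_shift[OF I(2)]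
  have SIe: "ShArr T (Ident T X) = Ident T (ShOb T X)" using ShArr_Ident X by blast
  have key: "roof_eq T' N (ShOb T X) (ShOb T Y) (ShArr T (Ident T X), ShArr T f) (ShArr T s, ShArr T f')"
    if roof: "roof_eq T' N X Y (Ident T X, f) (s, f')" for s f'
  proof -
    obtain B V x where h: "s \<in> hom T' B X" "s \<in> F.S" "f' \<in> hom T' B Y" "x \<in> hom T' V B" "x \<in> F.S" "f \<cdot> (s \<cdot> x) = f' \<cdot> x"
      using F.roof_eqD[OF _ assms, of s f'] roof by auto
    have sx: "s \<cdot> x \<in> hom T' V X" "s \<cdot> x \<in> F.S" using F.comp[OF h(4,1)] F.frac_Cmp[OF h(4,1,5,2)] by simp_all
    have h': "s \<in> hom T B X" "f' \<in> hom T B Y" "x \<in> hom T V B" "s \<cdot> x \<in> hom T V X" using h sx by (auto simp: sub_hom)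
    show ?thesis
      by (rule F.roof_eqI[OF SI sub_ShArr[OF assms] sub_ShArr[OF h(1)] S_shift[OF h(2)] sub_ShArr[OF h(3)] sub_ShArr[OF sx(1)] sub_ShArr[OF h(4)]])
        (use h(6) S_shift[OF sx(2)] ShArr_Cmp[OF h'(3,1)] ShArr_Cmp[OF h'(4) f] ShArr_Cmp[OF h'(3,2)] id_left[OF ShArr_hom[OF h'(4)]] SIe in simp_all)
  qed
  have "(\<exists>(s, f')\<in>{r'. roof_eq T' N X Y (Ident T X, f) r'}. roof_eq T' N (ShOb T X) (ShOb T Y) (ShArr T s, ShArr T f') r) \<longleftrightarrow>
    roof_eq T' N (ShOb T X) (ShOb T Y) (ShArr T (Ident T X), ShArr T f) r" for r
  proof
    assume "\<exists>(s, f')\<in>{r'. roof_eq T' N X Y (Ident T X, f) r'}. roof_eq T' N (ShOb T X) (ShOb T Y) (ShArr T s, ShArr T f') r"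
    then show "roof_eq T' N (ShOb T X) (ShOb T Y) (ShArr T (Ident T X), ShArr T f) r"
      using key F.roof_eq_trans' by blast
  next
    assume "roof_eq T' N (ShOb T X) (ShOb T Y) (ShArr T (Ident T X), ShArr T f) r"
    moreover have "roof_eq T' N X Y (Ident T X, f) (Ident T X, f)" using F.roof_eq_refl F.roofI I assms by blast
    ultimately show "\<exists>(s, f')\<in>{r'. roof_eq T' N X Y (Ident T X, f) r'}. roof_eq T' N (ShOb T X) (ShOb T Y) (ShArr T s, ShArr T f') r"
      by blast
  qed
  then have "ShArr F.D (fraction T' N X Y (Ident T X, f)) = fraction T' N (ShOb T X) (ShOb T Y) (ShArr T (Ident T X), ShArr T f)"
    by (simp add: verdier_def fraction_def)
  then show ?thesis using F.Q_def[OF assms] F.Q_def[OF sub_ShArr[OF assms]] SIe by simp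
qed

text \<open>For two representatives with the same denominator the refinements from
  \<open>roof_eqD\<close> may differ. An Ore square makes them equal, and on the common refinement
  the numerators add.\<close>

lemma Q_Add:
  assumes "f \<in> hom T' X Y" "g \<in> hom T' X Y" shows "F.Q f \<oplus>\<^bsub>F.D\<^esub> F.Q g = F.Q (f \<oplus> g)"
proof -
  have X: "X \<in> U" "Y \<in> U" "X \<in> Ob T" and f: "f \<in> hom T X Y" "g \<in> hom T X Y" using assms hom_Ob1 by (auto simp: sub_hom)
  have I: "Ident T X \<in> hom T' X X" "Ident T X \<in> cone_in T' N" using id_hom X F.frac_Ident[of X] by (auto simp: sub_hom)
  have fg: "f \<oplus> g \<in> hom T' X Y" using add_hom assms by (auto simp: sub_hom)
  have key: "roof_eq T' N X Y (Ident T X, f \<oplus> g) (s, f' \<oplus> g')"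
    if roofs: "roof_eq T' N X Y (Ident T X, f) (s, f')" "roof_eq T' N X Y (Ident T X, g) (s, g')" for s f' g'
  proof -
    obtain B V x where x: "s \<in> hom T' B X" "s \<in> F.S" "f' \<in> hom T' B Y" "x \<in> hom T' V B" "x \<in> F.S" "f \<cdot> (s \<cdot> x) = f' \<cdot> x"
      using F.roof_eqD[OF _ assms(1), of s f'] roofs(1) by auto
    obtain B' V' x' where x'': "s \<in> hom T' B' X" "g' \<in> hom T' B' Y" "x' \<in> hom T' V' B'" "x' \<in> F.S" "g \<cdot> (s \<cdot> x') = g' \<cdot> x'"
      using F.roof_eqD[OF _ assms(2), of s g'] roofs(2) by auto
    have "B' = B" using x x'' by (auto simp: hom_def)
    note x' = x''[unfolded this]
    obtain R w w' where w: "w \<in> hom T' R V" "w \<in> F.S" "w' \<in> hom T' R V'" "x \<cdot> w = x' \<cdot> w'" using F.frac_ore[OF x(4) x'(3,4)] by auto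
    have h: "s \<in> hom T B X" "f' \<in> hom T B Y" "g' \<in> hom T B Y" "x \<in> hom T V B" "x' \<in> hom T V' B" "w \<in> hom T R V" "w' \<in> hom T R V'"
      using x x' w by (auto simp: sub_hom)
    define y where "y = x \<cdot> w"
    have y: "y \<in> hom T' R B" "y \<in> F.S" unfolding y_def using F.comp[OF w(1) x(4)] F.frac_Cmp[OF w(1) x(4) w(2) x(5)] by simp_all
    have sy: "s \<cdot> y \<in> hom T' R X" "s \<cdot> y \<in> F.S" using F.comp[OF y(1) x(1)] F.frac_Cmp[OF y(1) x(1) y(2) x(2)] by simp_all
    have y': "y \<in> hom T R B" and sy': "s \<cdot> y \<in> hom T R X" using y sy by (auto simp: sub_hom)
    have fy: "f \<cdot> (s \<cdot> y) = f' \<cdot> y"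
      unfolding y_def using assoc[OF h(6,4,1)] assoc[OF h(6) comp[OF h(4,1)] f(1)] assoc[OF h(6,4,2)] x(6) by simp
    have gy: "g \<cdot> (s \<cdot> y) = g' \<cdot> y"
      unfolding y_def w(4) using assoc[OF h(7,5,1)] assoc[OF h(7) comp[OF h(5,1)] f(2)] assoc[OF h(7,5,3)] x'(5) by simp
    have fg': "f' \<oplus> g' \<in> hom T' B Y" using add_hom[OF h(2,3)] x(3) by (simp add: sub_hom)
    show ?thesis
      by (rule F.roof_eqI[OF I fg x(1,2) fg' sy(1) y(1)])
        (use id_left[OF sy'] sy(2) add_left[OF sy' f] add_left[OF y' h(2,3)] fy gy in simp_all)
  qed
  have "(\<exists>s f' g'. roof_eq T' N X Y (Ident T X, f) (s, f') \<and> roof_eq T' N X Y (Ident T X, g) (s, g') \<and> roof_eq T' N X Y (s, f' \<oplus> g') r) \<longleftrightarrow>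
    roof_eq T' N X Y (Ident T X, f \<oplus> g) r" for r
  proof
    assume "\<exists>s f' g'. roof_eq T' N X Y (Ident T X, f) (s, f') \<and> roof_eq T' N X Y (Ident T X, g) (s, g') \<and> roof_eq T' N X Y (s, f' \<oplus> g') r"
    then show "roof_eq T' N X Y (Ident T X, f \<oplus> g) r" using key F.roof_eq_trans' by blast
  next
    assume "roof_eq T' N X Y (Ident T X, f \<oplus> g) r"
    moreover have "roof_eq T' N X Y (Ident T X, f) (Ident T X, f)" "roof_eq T' N X Y (Ident T X, g) (Ident T X, g)"
      using F.roof_eq_refl F.roofI I assms by blast+
    ultimately show "\<exists>s f' g'. roof_eq T' N X Y (Ident T X, f) (s, f') \<and> roof_eq T' N X Y (Ident T X, g) (s, g') \<and> roof_eq T' N X Y (s, f' \<oplus> g') r"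
      by blast
  qed
  then have "fraction T' N X Y (Ident T X, f) \<oplus>\<^bsub>F.D\<^esub> fraction T' N X Y (Ident T X, g) = fraction T' N X Y (Ident T X, f \<oplus> g)"
    by (simp add: verdier_def fraction_def)
  then show ?thesis using F.Q_def[OF assms(1)] F.Q_def[OF assms(2)] F.Q_def[OF fg] by simp
qed

lemma D_Tri: "Tri F.D = {t. \<exists>f g h. (f, g, h) \<in> Tri T' \<and> triangle_iso F.D t (F.Q f, F.Q g, F.Q h)}"
proof -
  obtain R where R: "F.D = saturate R" "Tri R = {(F.Q f, F.Q g, F.Q h) | f g h. (f, g, h) \<in> Tri T'}"
    unfolding verdier_def by simp
  then have "Tri F.D = {t. \<exists>t'\<in>Tri R. triangle_iso F.D t t'}" by (simp only: Tri_saturate triangle_iso_saturate)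
  then show ?thesis unfolding R(2) by blast
qed

end

section \<open>Extensions and truncations of complexes\<close>

context triangulated
begin

lemma isomorphic_unshift:
  assumes "isomorphic T (ShOb T X) (ShOb T Y)" "X : Ob T" "Y : Ob T" shows "isomorphic T X Y"
proof -
  obtain f where f: "f : hom T (ShOb T X) (ShOb T Y)" "iso T f" using assms by (auto simp: isomorphic_def)
  obtain g where g: "g : hom T (ShOb T Y) (ShOb T X)" "g ** f = Ident T (ShOb T X)" "f ** g = Ident T (ShOb T Y)"
    by (rule isoE[OF f(2,1)])
  obtain f' where f': "f' : hom T X Y" "ShArr T f' = f" using ShArr_surj f assms by blast
  obtain g' where g': "g' : hom T Y X" "ShArr T g' = g" using ShArr_surj g assms by blast
  have "iso T f'"
  proof (rule isoI[OF f'(1) g'(1)])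
    show "g' ** f' = Ident T X"
      by (rule ShArr_inj[OF comp[OF f'(1) g'(1)] id_hom[OF assms(2)]])
        (simp add: ShArr_Cmp[OF f'(1) g'(1)] f' g' g ShArr_Ident assms)
    show "f' ** g' = Ident T Y"
      by (rule ShArr_inj[OF comp[OF g'(1) f'(1)] id_hom[OF assms(3)]])
        (simp add: ShArr_Cmp[OF g'(1) f'(1)] f' g' g ShArr_Ident assms)
  qed
  then show ?thesis using f'(1) by (auto simp: isomorphic_def)
qed

lemma Tri_replace_first:
  assumes t: "(f', g', h') : Tri T" and h: "f' : hom T X' Y'" "g' : hom T Y' Z'" "h' : hom T Z' (ShOb T X')"
    and f: "f : hom T X Y" and a: "a : hom T X X'" "iso T a" and b: "b : hom T Y Y'" "iso T b" and e: "b ** f = f' ** a"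
  shows "\<exists>h. (f, g' ** b, h) : Tri T"
proof -
  obtain a' where a': "a' : hom T X' X" "a' ** a = Ident T X" "a ** a' = Ident T X'" by (rule isoE[OF a(2,1)])
  note Sa' = ShArr_hom[OF a'(1)] and Sa = ShArr_hom[OF a(1)]
  have Z: "Z' : Ob T" using hom_Ob2[OF h(2)] .
  have "ShArr T a ** ShArr T a' = Ident T (ShOb T X')"
    using ShArr_Cmp[OF a'(1) a(1)] a'(3) ShArr_Ident hom_Ob1[OF h(1)] by simp
  then have "ShArr T a ** (ShArr T a' ** h') = h' ** Ident T Z'"
    using assoc[OF h(3) Sa' Sa, symmetric] id_left[OF h(3)] id_right[OF h(3)] by simp
  then have "triangle_iso T (f, g' ** b, ShArr T a' ** h') (f', g', h')"
    by (intro triangle_isoI[OF f comp[OF b(1) h(2)] comp[OF h(3) Sa'] h a(1) b(1) id_hom[OF Z] a(2) b(2) iso_Ident[OF Z] e])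
      (use id_left[OF comp[OF b(1) h(2)]] in simp_all)
  then show ?thesis using Tri_iso[OF t] by blast
qed

lemma cone_isomorphic:
  assumes t: "(f, g, h) : Tri T" and t': "(f', g', h') : Tri T"
    and a: "a : hom T (Dom T f) (Dom T f')" "iso T a" and b: "b : hom T (Cod T f) (Cod T f')" "iso T b" and e: "b ** f = f' ** a"
  shows "isomorphic T (Cod T g) (Cod T g')"
proof -
  obtain h'' where t'': "(f, g' ** b, h'') : Tri T"
    using Tri_replace_first[OF t' Tri_hom[OF t'] Tri_hom(1)[OF t] a b e] by blast
  then show ?thesis
    using cone_unique[OF t t''] hom_Cod[OF comp[OF b(1) Tri_hom(2)[OF t']]] unfolding isomorphic_def by auto
qed

text \<open>Two rotations turn the middle object, up to a shift, into the cone of the third arrow,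
  and cones of isomorphic arrows are isomorphic.\<close>

lemma middle_isomorphic:
  assumes t: "(f, g, h) : Tri T" and t': "(f', g', h') : Tri T"
    and a: "a : hom T (Dom T f) (Dom T f')" "iso T a" and c: "c : hom T (Cod T g) (Cod T g')" "iso T c" and e: "ShArr T a ** h = h' ** c"
  shows "isomorphic T (Cod T f) (Cod T f')"
proof -
  note hs = Tri_hom[OF t] and hs' = Tri_hom[OF t']
  note r = Tri_rotate[OF Tri_rotate[OF t]] and r' = Tri_rotate[OF Tri_rotate[OF t']]
  have "isomorphic T (Cod T (Neg T (ShArr T f))) (Cod T (Neg T (ShArr T f')))"
    by (rule cone_isomorphic[OF r r', of c "ShArr T a"])
      (use ShArr_hom[OF a(1)] iso_ShArr[OF a(2,1)] c e hom_Dom[OF hs(3)] hom_Cod[OF hs(3)] hom_Dom[OF hs'(3)] hom_Cod[OF hs'(3)] in simp_all)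
  then have "isomorphic T (ShOb T (Cod T f)) (ShOb T (Cod T f'))"
    using hom_Cod[OF neg_hom[OF ShArr_hom[OF hs(1)]]] hom_Cod[OF neg_hom[OF ShArr_hom[OF hs'(1)]]] by simp
  then show ?thesis using isomorphic_unshift hom_Ob2[OF hs(1)] hom_Ob2[OF hs'(1)] by blast
qed

end

context additive_category
begin

lemma biproduct_zero_object:
  assumes "biproduct C A B W i j p q" "zero_object C A" "zero_object C B" shows "zero_object C W"
proof -
  note h = biproductD(1-4,9)[OF assms(1)]
  have W: "W : Ob C" using hom_Ob2[OF h(1)] .
  have "i = Zero C A W" "j = Zero C B W" using zero_object_hom assms h by auto
  then have "i ** p = Zero C W W" "j ** q = Zero C W W" using zero_left h W by auto
  then show ?thesis using h(5) Add_Zero[OF zero_hom[OF W W]] zero_objectI[OF W] by simp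
qed

lemma biproduct_zero_left:
  assumes "zero_object C Z" "X : Ob C"
  shows "biproduct C Z X X (Zero C Z X) (Ident C X) (Zero C X Z) (Ident C X)"
proof -
  have Z: "Z : Ob C" using assms by (simp add: zero_object_def)
  have z: "Ident C Z = Zero C Z Z" using zero_object_iff Z assms by blast
  note I = id_hom[OF assms(2)] and zz = zero_hom[OF Z assms(2)] zero_hom[OF assms(2) Z]
  show ?thesis unfolding biproduct_def
    using I zz z zero_right[OF zz(1) assms(2)] zero_right[OF zz(2) Z] id_left[OF I] id_right[OF zz(2)] id_left[OF zz(1)]
      Zero_Add[OF I] by simp
qed

lemma biproduct_zero_right:
  assumes "zero_object C Z" "X : Ob C"
  shows "biproduct C X Z X (Ident C X) (Zero C Z X) (Ident C X) (Zero C X Z)"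
proof -
  have Z: "Z : Ob C" using assms by (simp add: zero_object_def)
  have z: "Ident C Z = Zero C Z Z" using zero_object_iff Z assms by blast
  note I = id_hom[OF assms(2)] and zz = zero_hom[OF Z assms(2)] zero_hom[OF assms(2) Z]
  show ?thesis unfolding biproduct_def
    using I zz z zero_right[OF zz(1) assms(2)] zero_right[OF zz(2) Z] id_left[OF I] id_right[OF zz(2)] id_left[OF zz(1)]
      Add_Zero[OF I] by simp
qed

end

context complexes
begin

lemma stdI: "rcone X Y a Z j k p q ==> (cl X Y a, cl Y Z k, cl Z (sh X) p) : std"
  unfolding std_def by blast

text \<open>Boundedness and acyclicity in low degrees are properties of a complex, not of its
  isomorphism class. An extension is therefore replaced by a strict mapping cone over chosen
  representatives of its ends, whose terms are biproducts of theirs.\<close>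

lemma K_extension:
  assumes t: "(f, g, h) : Tri K" and X: "isomorphic K (Dom K f) X" and Z: "isomorphic K (Cod K g) Z"
  shows "\<exists>Y a j k p q. rcone (unshift_cpx C Z) X a Y j k p q \<and> isomorphic K (Cod K f) Y"
proof -
  note hs = K.Tri_hom[OF t]
  obtain \<alpha> where \<alpha>: "\<alpha> : hom K (Dom K f) X" "iso K \<alpha>" using X by (auto simp: isomorphic_def)
  obtain \<gamma> where \<gamma>: "\<gamma> : hom K (Cod K g) Z" "iso K \<gamma>" using Z by (auto simp: isomorphic_def)
  obtain \<gamma>' where \<gamma>': "\<gamma>' : hom K Z (Cod K g)" "\<gamma>' **\<^sub>K \<gamma> = Ident K (Cod K g)" "\<gamma> **\<^sub>K \<gamma>' = Ident K Z"
    by (rule K.isoE[OF \<gamma>(2,1)])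
  let ?V = "unshift_cpx C Z"
  have ob: "cpl X" "cpl Z" using K.hom_Ob2[OF \<alpha>(1)] K.hom_Ob2[OF \<gamma>(1)] by auto
  then have V: "cpl ?V" "sh ?V = Z" using cpl_unshift shift_unshift by auto
  define h0 where "h0 = (ShArr K \<alpha> **\<^sub>K h) **\<^sub>K \<gamma>'"
  note Sh = K.comp[OF hs(3) K.ShArr_hom[OF \<alpha>(1)]]
  have h0: "h0 : hom K Z (sh X)"
    unfolding h0_def using K.comp[OF \<gamma>'(1) Sh] by simp
  obtain w where w: "w : hom K ?V X" "ShArr K w = Neg K h0"
    using K.ShArr_surj[of ?V X "Neg K h0"] K.neg_hom[OF h0] V ob by auto
  obtain b where b: "b : chm ?V X" "w = cl ?V X b" using w(1) by (auto elim: K_homE)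
  obtain Y j k p q where r: "rcone ?V X b Y j k p q" by (rule rcone_ex[OF V(1) ob(1) b(1)])
  have "(w, cl X Y k, cl Y Z p) : std" using stdI[OF r] V b by simp
  then have t': "(cl X Y k, cl Y Z p, h0) : Tri K"
    using K.Std_rotate w K.Neg_Neg[OF h0] by metis
  have "h0 **\<^sub>K \<gamma> = ShArr K \<alpha> **\<^sub>K h"
    unfolding h0_def using K.assoc[OF \<gamma>(1) \<gamma>'(1) Sh] \<gamma>'(2) K.id_right[OF Sh] by simp
  then have "isomorphic K (Cod K f) (Cod K (cl X Y k))"
    using K.middle_isomorphic[OF t t', of \<alpha> \<gamma>] \<alpha> \<gamma> by simp
  then have "isomorphic K (Cod K f) Y" by simp
  then show ?thesis using r by blast
qed

text \<open>By the relational definition of mapping cones, a degreewise split sequence is itself a rotated standard triangle.\<close>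

lemma split_triangle:
  assumes c: "cpl X" "cpl Y" "cpl Z" and b: "bip (cob Z) (cob X) (cob Y) j k p q"
    and k: "df Y * k = k * df X" and p: "p * df Y = df Z * p"
  shows "\<exists>h. (cl X Y k, cl Y Z p, h) : Tri K"
proof -
  let ?V = "unshift_cpx C Z"
  have V: "cpl ?V" "sh ?V = Z" using cpl_unshift shift_unshift c by auto
  note bs = bip_simps[OF b]
  have ttV: "tt (cob ?V) : gH C (cob ?V) (cob Z) (- 1)" "tu (cob ?V) : gH C (cob Z) (cob ?V) 1"
    using tt_cpl[OF V(1)] tu_cpl[OF V(1)] V(2) by simp_all
  note ty = bs(1-4) df_in_gH[OF c(1)] df_in_gH[OF c(2)] df_in_gH[OF c(3)] ttV
  have cobZ: "(\<lambda>i. cob ?V (i + 1)) = cob Z" using cob_shift[of ?V] V(2) by simp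
  note ss = cpl_shift_simps[OF V(1), unfolded cobZ]
  have dZ: "df Z = - (tt (cob ?V) * df ?V * tu (cob ?V))" using df_shift[OF V(1)] V(2) by simp
  have ttd: "tt (cob ?V) * df ?V = - (df Z * tt (cob ?V))"
    unfolding dZ by (simp add: mult.assoc ss gone_assoc[OF df_in_gH[OF V(1)]])
  have kp: "k * x = df Y * (k * y) ==> x = df X * y" if "gone (cob X) * x = x" "gone (cob X) * y = y" for x y
  proof -
    assume "k * x = df Y * (k * y)"
    then have "q * (k * x) = q * (k * (df X * y))" using k by (simp add: mult.assoc[symmetric])
    then show "x = df X * y" using that by (simp add: bs gone_assoc[OF df_in_gH[OF c(1)]])
  qed
  have kq: "k * (q * x) = x - j * (p * x)" if "gone (cob Y) * x = x" for x
  proof -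
    have "(j * p + k * q) * x = x" using that bs(13) by simp
    then show ?thesis by (simp add: algebra_simps)
  qed
  have pp: "p * (df Y * x) = df Z * (p * x)" for x using p by (simp add: mult.assoc[symmetric])
  have kk: "k * (df X * x) = df Y * (k * x)" for x using k by (simp add: mult.assoc[symmetric])
  note ga = gone_assoc[OF df_in_gH[OF c(2)]] gone_assoc[OF df_in_gH[OF c(3)]] gone_assoc[OF bs(1)] gone_assoc[OF bs(3)]
  \<comment> \<open>The off-diagonal entry of the differential of \<open>Y\<close>, read on the
    desuspension of \<open>Z\<close>; with it the given sequence satisfies the equations of a
    cone.\<close>
  define a where "a = q * (df Y * (j * tt (cob ?V)))"
  have a: "a : chm ?V X"
  proof (rule chmI)
    show "a : gH C (cob ?V) (cob X) 0" unfolding a_def by (rule ty gH_mult refl | simp)+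
    have 1: "k * a = df Y * (j * tt (cob ?V)) - j * (df Z * tt (cob ?V))"
      unfolding a_def by (subst kq) (simp_all add: ga pp bs)
    have "df Y * (k * a) = - (df Y * (j * (df Z * tt (cob ?V))))"
      unfolding 1 by (simp add: algebra_simps df_df_assoc c)
    moreover have "k * (a * df ?V) = - (df Y * (j * (df Z * tt (cob ?V))))"
      using arg_cong[OF 1, of "\<lambda>z. z * df ?V"] by (simp add: algebra_simps ttd df_df_assoc c)
    ultimately show "a * df ?V = df X * a"
      by (intro kp) (simp_all add: a_def bs mult.assoc)
  qed
  have "k * (a * tu (cob ?V)) = df Y * j - j * df Z"
    unfolding a_def mult.assoc by (subst kq) (simp_all add: ga pp bs ss cobZ)
  then have "rcone ?V X a Y j k p q"
    unfolding rcone_def using V c a b k by simp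
  then have "(cl ?V X a, cl X Y k, cl Y Z p) : std" using stdI V(2) by metis
  then show ?thesis using K.Std_rotate by blast
qed

subsection \<open>Supports\<close>

definition supp :: "('o, 'm) cpx => int set => bool" where
  "supp X I \<longleftrightarrow> (\<forall>i. i \<notin> I \<longrightarrow> zero_object C (cob X i))"

lemma chm_disjoint_supp:
  assumes "cpl X" "cpl Y" "supp X I" "supp Y J" "I \<inter> J = {}" "a : chm X Y" shows "a = 0"
proof -
  obtain \<phi> where \<phi>: "fm X Y \<phi>" "a = gm X Y \<phi>" using chm_gH[OF assms(6)] by (rule gHE)
  have "\<phi> i = Zero C (cob X i) (cob Y i)" for i
  proof (cases "i : I")
    case True
    then have "zero_object C (cob Y i)" using assms by (auto simp: supp_def)
    then show ?thesis using zero_object_hom' famD[OF \<phi>(1), of i] by simp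
  next
    case False
    then have "zero_object C (cob X i)" using assms by (auto simp: supp_def)
    then show ?thesis using zero_object_hom famD[OF \<phi>(1), of i] by simp
  qed
  then have "\<phi> = (\<lambda>i. Zero C (cob X i) (cob Y (i + 0)))" by auto
  then show ?thesis using \<phi>(2) gr_zero[of "cob X" "cob Y" 0] cpl_Ob assms by simp
qed

lemma hom_disjoint_supp:
  assumes "cpl X" "cpl Y" "supp X I" "supp Y J" "I \<inter> J = {}" shows "hom K X Y = {Zero K X Y}"
  using assms chm_disjoint_supp[OF assms] by (auto simp: K_hom K_Zero chm_zero)

lemma supp_extension:
  assumes "rcone (unshift_cpx C Z) X a Y j k p q" "cpl Z" "supp X I" "supp Z I" shows "supp Y I"
  unfolding supp_def
proof (intro allI impI)
  fix i assume i: "i \<notin> I"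
  have b: "bip (cob Z) (cob X) (cob Y) j k p q" using rconeD(5)[OF assms(1)] shift_unshift[OF assms(2)] by simp
  obtain j' k' p' q' where "\<And>i. biproduct C (cob Z i) (cob X i) (cob Y i) (j' i) (k' i) (p' i) (q' i)" using bipE[OF b] by metis
  then show "zero_object C (cob Y i)" using biproduct_zero_object assms(3,4) i unfolding supp_def by blast
qed

lemma supp_shift: "supp X I ==> supp (sh X) {i. i + 1 : I}"
  by (auto simp: supp_def shift_cpx_def)

lemma supp_unshift: "supp X I ==> supp (unshift_cpx C X) {i. i - 1 : I}"
  by (auto simp: supp_def unshift_cpx_def)

lemma supp_mono: "supp X I ==> I \<subseteq> J ==> supp X J"
  by (auto simp: supp_def)

lemma bounded_iff: "bounded_cpx C X \<longleftrightarrow> (\<exists>l n. supp X {l..n})"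
  unfolding bounded_cpx_def supp_def by (auto simp: not_le)

definition isoc :: "('o, 'm) cpx set => ('o, 'm) cpx set" where
  "isoc A = iso_closure K {X. cpl X \<and> X : A}"

lemma isoc_iff: "X : isoc A \<longleftrightarrow> (\<exists>Y. isomorphic K X Y \<and> cpl Y \<and> Y : A)"
  unfolding isoc_def iso_closure_def using K.isomorphic_Ob by auto

lemma isoc_base: "cpl X ==> X : A ==> X : isoc A"
  unfolding isoc_iff using K.isomorphic_refl by auto

lemma isoc_closed: "X : isoc A ==> isomorphic K Y X ==> Y : isoc A"
  unfolding isoc_iff using K.isomorphic_trans by blast

lemma isoc_cpl: "X : isoc A ==> cpl X"
  unfolding isoc_iff using K.isomorphic_Ob by auto

lemma isoc_mono: "A \<subseteq> B ==> isoc A \<subseteq> isoc B"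
  unfolding isoc_iff subset_iff by blast

lemma isoc_extension:
  assumes "(f, g, h) : Tri K" "Dom K f : isoc A" "Cod K g : isoc B"
    and "\<And>X Z a Y j k p q. X : A ==> Z : B ==> cpl Z ==> rcone (unshift_cpx C Z) X a Y j k p q ==> Y : D"
  shows "Cod K f : isoc D"
proof -
  obtain X Z where X: "isomorphic K (Dom K f) X" "X : A" and Z: "isomorphic K (Cod K g) Z" "cpl Z" "Z : B"
    using assms(2,3) by (auto simp: isoc_iff)
  obtain Y a j k p q where Y: "rcone (unshift_cpx C Z) X a Y j k p q" "isomorphic K (Cod K f) Y"
    using K_extension[OF assms(1) X(1) Z(1)] by blast
  then show ?thesis using assms(4)[OF X(2) Z(3,2) Y(1)] rconeD(3)[OF Y(1)] by (auto simp: isoc_iff)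
qed

lemma isomorphic_shift: "isomorphic K X Y ==> isomorphic K (sh X) (sh Y)"
  unfolding isomorphic_def using K.iso_ShArr K.ShArr_hom by auto blast

lemma isoc_shift:
  assumes "X : isoc A" "\<And>Y. Y : A ==> cpl Y ==> sh Y : B" shows "sh X : isoc B"
  using assms isomorphic_shift cpl_shift unfolding isoc_iff by blast

lemma isoc_unshift:
  assumes "cpl X" "sh X : isoc A" "\<And>Y. Y : A ==> cpl Y ==> unshift_cpx C Y : B" shows "X : isoc B"
proof -
  obtain Y where Y: "isomorphic K (sh X) Y" "cpl Y" "Y : A" using assms(2) by (auto simp: isoc_iff)
  then have "isomorphic K (ShOb K X) (ShOb K (unshift_cpx C Y))" by (simp add: shift_unshift)
  then have "isomorphic K X (unshift_cpx C Y)" using K.isomorphic_unshift assms(1) cpl_unshift[OF Y(2)] by simp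
  then show ?thesis using assms(3)[OF Y(3,2)] cpl_unshift[OF Y(2)] by (auto simp: isoc_iff)
qed

lemma isoc_hom_zero:
  assumes "X : isoc A" "Y : isoc B" "\<And>X Y. X : A ==> Y : B ==> cpl X ==> cpl Y ==> hom K X Y = {Zero K X Y}"
  shows "hom K X Y = {Zero K X Y}"
proof -
  obtain X' f where X': "cpl X'" "X' : A" "f : hom K X X'" "iso K f" using assms(1) by (auto simp: isoc_iff isomorphic_def)
  obtain Y' g where Y': "cpl Y'" "Y' : B" "g : hom K Y Y'" "iso K g" using assms(2) by (auto simp: isoc_iff isomorphic_def)
  obtain f' where f': "f' : hom K X' X" "f' **\<^sub>K f = Ident K X" by (rule K.isoE[OF X'(4,3)])
  obtain g' where g': "g' : hom K Y' Y" "g' **\<^sub>K g = Ident K Y" by (rule K.isoE[OF Y'(4,3)])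
  have XY: "X : Ob K" "Y : Ob K" using isoc_cpl assms by auto
  have "u = Zero K X Y" if u: "u : hom K X Y" for u
  proof -
    have gu: "g **\<^sub>K u **\<^sub>K f' : hom K X' Y'" using K.comp u f' Y' by blast
    then have z: "g **\<^sub>K u **\<^sub>K f' = Zero K X' Y'" using assms(3)[OF X'(2) Y'(2) X'(1) Y'(1)] by blast
    note A = X'(3) Y'(3) f'(1) g'(1) u
    have "g' **\<^sub>K ((g **\<^sub>K u **\<^sub>K f') **\<^sub>K f) = (g' **\<^sub>K g) **\<^sub>K (u **\<^sub>K (f' **\<^sub>K f))"
      using A by (simp add: hom_def K.cat_simps del: K_simps)
    also have "\<dots> = u" unfolding f' g' using K.id_left[OF u] K.id_right[OF u] by simp
    finally show ?thesis
      using z K.zero_left[OF X'(3)] K.zero_right[OF g'(1)] XY Y'(1) by simp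
  qed
  then show ?thesis using K.zero_hom[OF XY] by blast
qed

end

section \<open>Conflations and projective objects\<close>

context exact_category
begin

lemma conflationD:
  assumes "(i, p) : E"
  shows "i : hom C (Dom C i) (Cod C i)" "p : hom C (Cod C i) (Cod C p)" "p ** i = Zero C (Dom C i) (Cod C p)"
  using conflation_kernel_cokernel[OF assms] by (auto simp: is_kernel_def hom_def)

lemma inflation_mono:
  assumes "(i, p) : E" "i : hom C A B" "u : hom C W A" "v : hom C W A" "i ** u = i ** v" shows "u = v"
proof -
  have k: "is_kernel C i p" using conflation_kernel_cokernel assms(1) by blast
  note c = conflationD[OF assms(1), unfolded hom_Dom[OF assms(2)] hom_Cod[OF assms(2)]]
  have D: "Dom C p = B" using hom_Dom[OF c(2)] .
  have iu: "i ** u : hom C W B" using comp[OF assms(3,2)] .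
  have "p ** (i ** u) = Zero C W (Cod C p)"
    using assoc[OF assms(3,2) c(2)] c(3) zero_left[OF assms(3) hom_Ob2[OF c(2)]] by simp
  then have "\<exists>!w. w : hom C W A \<and> i ** w = i ** u"
    using k iu hom_Ob1[OF assms(3)] unfolding is_kernel_def D hom_Dom[OF assms(2)] by blast
  then show ?thesis using assms by metis
qed

lemma deflation_epi:
  assumes "(i, p) : E" "p : hom C B D" "u : hom C D W" "v : hom C D W" "u ** p = v ** p" shows "u = v"
proof -
  have k: "is_cokernel C p i" using conflation_kernel_cokernel assms(1) by blast
  note c = conflationD[OF assms(1)]
  have D: "Cod C i = B" using hom_Dom[OF c(2)] hom_Dom[OF assms(2)] by simp
  note c = c[unfolded D hom_Cod[OF assms(2)]]
  have up: "u ** p : hom C B W" using comp[OF assms(2,3)] .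
  have "(u ** p) ** i = Zero C (Dom C i) W"
    using assoc[OF c(1,2) assms(3)] c(3) zero_right[OF assms(3) hom_Ob1[OF c(1)]] by simp
  then have "\<exists>!w. w : hom C D W \<and> w ** p = u ** p"
    using k up hom_Ob2[OF assms(3)] unfolding is_cokernel_def D hom_Cod[OF assms(2)] by blast
  then show ?thesis using assms by metis
qed

lemma conflation_kernel:
  assumes "(i, p) : E" "i : hom C A B" "p : hom C B D" "g : hom C W B" "p ** g = Zero C W D"
  shows "\<exists>u\<in>hom C W A. i ** u = g"
proof -
  have k: "is_kernel C i p" using conflation_kernel_cokernel assms(1) by blast
  then show ?thesis
    using assms hom_Ob1[OF assms(4)] unfolding is_kernel_def hom_Dom[OF assms(2)] hom_Dom[OF assms(3)] hom_Cod[OF assms(3)] by blast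
qed

lemma conflation_cokernel:
  assumes "(i, p) : E" "i : hom C A B" "p : hom C B D" "g : hom C B W" "g ** i = Zero C A W"
  shows "\<exists>u\<in>hom C D W. u ** p = g"
proof -
  have k: "is_cokernel C p i" using conflation_kernel_cokernel assms(1) by blast
  then show ?thesis
    using assms hom_Ob2[OF assms(4)] unfolding is_cokernel_def hom_Dom[OF assms(2)] hom_Cod[OF assms(2)] hom_Cod[OF assms(3)] by blast
qed

lemma conflation_iso:
  assumes "(i, p) : E" "i : hom C A B" "p : hom C B D" "i' : hom C A' B'" "p' : hom C B' D'"
    "a : hom C A A'" "b : hom C B B'" "c : hom C D D'" "iso C a" "iso C b" "iso C c" "b ** i = i' ** a" "c ** p = p' ** b"
  shows "(i', p') : E"
  using conflation_iso_closed[OF assms(1), of i' p' a b c] assms(2-) by (simp add: hom_def)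

text \<open>The cokernel of the identity of a zero object is zero, since its projection is both epic
  and zero. The given pair is isomorphic to this conflation because zero objects are
  isomorphic.\<close>

lemma zero_conflation:
  assumes "zero_object C A" "zero_object C B" "zero_object C D" "i : hom C A B" "p : hom C B D"
  shows "(i, p) : E"
proof -
  have ob: "A : Ob C" "B : Ob C" "D : Ob C" using assms by (auto simp: zero_object_def)
  note I = id_hom[OF ob(1)]
  obtain p0 where p0: "(Ident C A, p0) : E" using inflation_Ident[OF ob(1)] by (auto simp: inflation_def)
  note c = conflationD[OF p0, unfolded hom_Dom[OF I] hom_Cod[OF I]]
  let ?Z = "Cod C p0"
  have Z: "?Z : Ob C" using hom_Ob2[OF c(2)] .
  have "p0 = Zero C A ?Z" using c(3) id_right[OF c(2)] by simp
  then have "Ident C ?Z ** p0 = Zero C ?Z ?Z ** p0"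
    using id_left[OF c(2)] zero_left[OF c(2) Z] by simp
  then have "Ident C ?Z = Zero C ?Z ?Z" using deflation_epi[OF p0 c(2) id_hom[OF Z] zero_hom[OF Z Z]] by blast
  then have zZ: "zero_object C ?Z" using zero_objectI Z by blast
  obtain b where b: "b : hom C A B" "iso C b" using zero_object_isomorphic assms(1,2) unfolding isomorphic_def by blast
  obtain d where d: "d : hom C ?Z D" "iso C d" using zero_object_isomorphic zZ assms(3) unfolding isomorphic_def by blast
  show ?thesis
    by (rule conflation_iso[OF p0 I c(2) assms(4,5) I b(1) d(1) iso_Ident[OF ob(1)] b(2) d(2)])
      (use zero_object_hom[OF assms(1) comp[OF I b(1)]] zero_object_hom[OF assms(1) comp[OF I assms(4)]]
        zero_object_hom[OF assms(1) comp[OF c(2) d(1)]] zero_object_hom[OF assms(1) comp[OF b(1) assms(5)]] in simp_all)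
qed

lemma Proj_lift:
  assumes "P : Proj C E" "(i, p) : E" "p : hom C B D" "f : hom C P D"
  shows "\<exists>g\<in>hom C P B. p ** g = f"
proof -
  have "deflation E p" using assms(2) by (auto simp: deflation_def)
  then show ?thesis using assms(1,4) hom_Dom[OF assms(3)] hom_Cod[OF assms(3)] unfolding Proj_def by auto
qed

lemma Inj_extend:
  assumes "I : Inj C E" "(i, p) : E" "i : hom C A B" "f : hom C A I"
  shows "\<exists>g\<in>hom C B I. g ** i = f"
proof -
  have "inflation E i" using assms(2) by (auto simp: inflation_def)
  then show ?thesis using assms(1,4) hom_Dom[OF assms(3)] hom_Cod[OF assms(3)] unfolding Inj_def by auto
qed

lemma Proj_Ob: "P : Proj C E ==> P : Ob C"
  by (simp add: Proj_def)

lemma Proj_zero_object: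
  assumes "zero_object C Z" shows "Z : Proj C E"
  unfolding Proj_def
proof (intro CollectI conjI allI impI ballI)
  show Z: "Z : Ob C" using assms by (simp add: zero_object_def)
  fix p f assume p: "deflation E p" and f: "f : hom C Z (Cod C p)"
  obtain i where "(i, p) : E" using p by (auto simp: deflation_def)
  then have ph: "p : hom C (Dom C p) (Cod C p)" using conflationD[of i p] by (auto simp: hom_def)
  have "p ** Zero C Z (Dom C p) = f"
    using zero_object_hom[OF assms f] zero_right[OF ph Z] by simp
  then show "\<exists>g\<in>hom C Z (Dom C p). p ** g = f" using zero_hom[OF Z hom_Ob1[OF ph]] by blast
qed

lemma Proj_biproduct:
  assumes "A : Proj C E" "B : Proj C E" "biproduct C A B W i j p q" shows "W : Proj C E"
  unfolding Proj_def
proof (intro CollectI conjI allI impI ballI)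
  note h = biproductD(1-4,9)[OF assms(3)]
  show "W : Ob C" using hom_Ob2[OF h(1)] .
  fix r f assume r: "deflation E r" and f: "f : hom C W (Cod C r)"
  obtain k where k: "(k, r) : E" using r by (auto simp: deflation_def)
  then have rh: "r : hom C (Dom C r) (Cod C r)" using conflationD[of k r] by (auto simp: hom_def)
  obtain g where g: "g : hom C A (Dom C r)" "r ** g = f ** i" using Proj_lift[OF assms(1) k rh comp[OF h(1) f]] by blast
  obtain g' where g': "g' : hom C B (Dom C r)" "r ** g' = f ** j" using Proj_lift[OF assms(2) k rh comp[OF h(2) f]] by blast
  have gp: "g ** p : hom C W (Dom C r)" "g' ** q : hom C W (Dom C r)" using comp h g g' by blast+
  have "r ** ((g ** p) \<oplus> (g' ** q)) = ((r ** g) ** p) \<oplus> ((r ** g') ** q)"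
    using add_right[OF gp rh] assoc[OF h(3) g(1) rh] assoc[OF h(4) g'(1) rh] by simp
  also have "\<dots> = f ** ((i ** p) \<oplus> (j ** q))"
    unfolding g(2) g'(2) using add_right[OF comp[OF h(3,1)] comp[OF h(4,2)] f]
      assoc[OF h(3,1) f] assoc[OF h(4,2) f] by simp
  also have "\<dots> = f" unfolding h(5) using id_right[OF f] .
  finally show "\<exists>g\<in>hom C W (Dom C r). r ** g = f" using add_hom[OF gp] by blast
qed

end

sublocale exact_category \<subseteq> complexes C "Proj C E"
proof
  show "X : Proj C E ==> X : Ob C" for X by (rule Proj_Ob)
  show "\<exists>Z\<in>Proj C E. zero_object C Z" using ex_zero_object Proj_zero_object by blast
  fix A B assume "A : Proj C E" "B : Proj C E"
  then show "\<exists>W\<in>Proj C E. \<exists>i j p q. biproduct C A B W i j p q"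
    using ex_biproduct Proj_Ob Proj_biproduct by meson
qed

section \<open>Arrows concentrated in one degree\<close>

context complexes
begin

definition conc :: "('o, 'm) cpx => ('o, 'm) cpx => int => 'm => int => 'm" where
  "conc X Y n u i = (if i = n then u else Zero C (cob X i) (cob Y i))"

abbreviation carr :: "('o, 'm) cpx => ('o, 'm) cpx => int => 'm => ('o, 'm) karr" where
  "carr X Y n u \<equiv> cl X Y (gm X Y (conc X Y n u))"

definition cocycle :: "('o, 'm) cpx => ('o, 'm) cpx => int => 'm => bool" where
  "cocycle X Y n u \<longleftrightarrow> u : hom C (cob X n) (cob Y n) \<and>
  u ** cdiff X (n - 1) = Zero C (cob X (n - 1)) (cob Y n) \<and> cdiff Y n ** u = Zero C (cob X n) (cob Y (n + 1))"

text \<open>Away from degree \<open>n\<close> only zero components are possible, so chain maps and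
  the homotopy relation are governed by what happens in degree \<open>n\<close>.\<close>

definition meets :: "('o, 'm) cpx => ('o, 'm) cpx => int => bool" where
  "meets X Y n \<longleftrightarrow> (\<forall>i. i \<noteq> n \<longrightarrow> zero_object C (cob X i) \<or> zero_object C (cob Y i))"

lemma meets_zero: "meets X Y n ==> i \<noteq> n ==> f : hom C (cob X i) (cob Y i) ==> f = Zero C (cob X i) (cob Y i)"
  unfolding meets_def using zero_object_hom zero_object_hom' by blast

lemma chain_map_hom: "chain_map C X Y \<phi> ==> \<phi> i : hom C (cob X i) (cob Y i)"
  by (simp add: chain_map_def)

lemma chain_map_arr: "cpl X ==> cpl Y ==> chain_map C X Y \<phi> ==> cl X Y (gm X Y \<phi>) : hom K X Y"
  using K_homI chm_iff by blast

lemma chain_map_arrE: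
  assumes "f : hom K X Y" obtains \<phi> where "chain_map C X Y \<phi>" "f = cl X Y (gm X Y \<phi>)"
  by (rule K_homE[OF assms]) (metis chmE that)

lemma cl_comp:
  assumes c: "cpl X" "cpl Y" "cpl Z" and \<phi>: "chain_map C X Y \<phi>" and \<psi>: "chain_map C Y Z \<psi>"
  shows "cl Y Z (gm Y Z \<psi>) **\<^sub>K cl X Y (gm X Y \<phi>) = cl X Z (gm X Z (\<lambda>i. \<psi> i ** \<phi> i))"
  using K_Cmp[OF c] chm_iff[OF c(1,2)] chm_iff[OF c(2,3)] \<phi> \<psi> gr_mult[of "cob X" "cob Y" 0 \<phi> "cob Z" 0 \<psi>] by simp

lemma homotopic_cl:
  assumes c: "cpl X" "cpl Y" and \<phi>: "chain_map C X Y \<phi>" and \<psi>: "chain_map C X Y \<psi>"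
  shows "cl X Y (gm X Y \<phi>) = cl X Y (gm X Y \<psi>) \<longleftrightarrow> homotopic C X Y \<phi> \<psi>"
  using homotopic_iff[OF c] cl_eq_iff[OF c] chm_iff[OF c] \<phi> \<psi> by blast

lemma conc_chain:
  assumes X: "cpl X" and Y: "cpl Y" and u: "cocycle X Y n u" shows "chain_map C X Y (conc X Y n u)"
  unfolding chain_map_def
proof (intro allI conjI)
  fix i
  show "conc X Y n u i : hom C (cob X i) (cob Y i)" using u zero_hom cpl_Ob X Y by (auto simp: conc_def cocycle_def)
  show "conc X Y n u (i + 1) ** cdiff X i = cdiff Y i ** conc X Y n u i"
    using u zero_left[OF cplD(1)[OF X] cpl_Ob[OF Y]] zero_right[OF cplD(1)[OF Y] cpl_Ob[OF X]] by (auto simp: conc_def cocycle_def)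
qed

lemma zero_cocycle: "cpl X ==> cpl Y ==> cocycle X Y n (Zero C (cob X n) (cob Y n))"
  using zero_left[OF cplD(1)[of X "n - 1"] cpl_Ob[of Y n]] zero_right[OF cplD(1)[of Y n] cpl_Ob[of X n]] cpl_Ob zero_hom by (simp add: cocycle_def)

lemma conc_zero: "cpl X ==> cpl Y ==> carr X Y n (Zero C (cob X n) (cob Y n)) = Zero K X Y"
  using arg_cong[of "conc X Y n (Zero C (cob X n) (cob Y n))" "\<lambda>i. Zero C (cob X i) (cob Y i)" "\<lambda>f. cl X Y (gm X Y f)"]
    gr_zero[of "cob X" "cob Y" 0] cpl_Ob by (simp add: K_Zero conc_def fun_eq_iff)

lemma conc_eq:
  assumes c: "cpl X" "cpl Y" and m: "meets X Y n" and \<phi>: "chain_map C X Y \<phi>"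
  shows "cocycle X Y n (\<phi> n)" "\<phi> = conc X Y n (\<phi> n)"
proof -
  have z: "\<phi> i = Zero C (cob X i) (cob Y i)" if "i \<noteq> n" for i using meets_zero[OF m that chain_map_hom[OF \<phi>]] .
  then show "\<phi> = conc X Y n (\<phi> n)" by (auto simp: conc_def)
  have e: "\<phi> (i + 1) ** cdiff X i = cdiff Y i ** \<phi> i" for i using \<phi> by (simp add: chain_map_def)
  show "cocycle X Y n (\<phi> n)"
    using e[of "n - 1"] e[of n] z[of "n - 1"] z[of "n + 1"] chain_map_hom[OF \<phi>] zero_left[OF cplD(1)[OF c(1)] cpl_Ob[OF c(2)], of n "n + 1"]
      zero_right[OF cplD(1)[OF c(2)] cpl_Ob[OF c(1)], of "n - 1" "n - 1"] by (simp add: cocycle_def)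
qed

lemma conc_ex:
  assumes c: "cpl X" "cpl Y" and m: "meets X Y n" and f: "f : hom K X Y"
  shows "\<exists>u. cocycle X Y n u \<and> f = carr X Y n u"
  by (rule chain_map_arrE[OF f]) (use conc_eq[OF c m] in metis)

lemma conc_eq_iff:
  assumes c: "cpl X" "cpl Y" and m: "meets X Y n" and u: "cocycle X Y n u" "cocycle X Y n v"
  shows "carr X Y n u = carr X Y n v \<longleftrightarrow>
    (\<exists>s\<in>hom C (cob X n) (cob Y (n - 1)). \<exists>t\<in>hom C (cob X (n + 1)) (cob Y n). v = u \<oplus> ((cdiff Y (n - 1) ** s) \<oplus> (t ** cdiff X n)))"
    (is "_ \<longleftrightarrow> ?R")
proof -
  note h = conc_chain[OF c u(1)] conc_chain[OF c u(2)]
  have "homotopic C X Y (conc X Y n u) (conc X Y n v) \<longleftrightarrow> ?R"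
  proof
    assume "homotopic C X Y (conc X Y n u) (conc X Y n v)"
    then obtain s where s: "\<And>i. s i : hom C (cob X i) (cob Y (i - 1))"
      "\<And>i. conc X Y n v i = conc X Y n u i \<oplus> ((cdiff Y (i - 1) ** s i) \<oplus> (s (i + 1) ** cdiff X i))" by (auto simp: homotopic_def)
    have "s (n + 1) : hom C (cob X (n + 1)) (cob Y n)" using s(1)[of "n + 1"] by simp
    then show ?R using s(1)[of n] s(2)[of n] by (auto simp: conc_def)
  next
    assume ?R
    then obtain s t where st: "s : hom C (cob X n) (cob Y (n - 1))" "t : hom C (cob X (n + 1)) (cob Y n)"
      "v = u \<oplus> ((cdiff Y (n - 1) ** s) \<oplus> (t ** cdiff X n))" by blast
    \<comment> \<open>Two components of a homotopy enter the equation in degree \<open>n\<close>,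
      the one out of degree \<open>n\<close> and the one out of degree \<open>n + 1\<close>. In
      every other degree the equation holds in a zero hom group.\<close>
    define S where "S i = (if i = n then s else if i = n + 1 then t else Zero C (cob X i) (cob Y (i - 1)))" for i
    have Sh: "S i : hom C (cob X i) (cob Y (i - 1))" for i using st zero_hom cpl_Ob c by (auto simp: S_def)
    have "conc X Y n v i = conc X Y n u i \<oplus> ((cdiff Y (i - 1) ** S i) \<oplus> (S (i + 1) ** cdiff X i))" for i
    proof (cases "i = n")
      case True
      then show ?thesis using st(3) by (simp add: conc_def S_def)
    next
      case False
      have "(cdiff Y (i - 1) ** S i) \<oplus> (S (i + 1) ** cdiff X i) : hom C (cob X i) (cob Y i)"
        using add_hom[OF comp[OF Sh cplD(1)[OF c(2), of "i - 1"]]] comp[OF cplD(1)[OF c(1)] Sh[of "i + 1"]] by simp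
      then show ?thesis using False meets_zero[OF m False] add_hom[OF chain_map_hom[OF h(1)]] chain_map_hom[OF h(2)] by metis
    qed
    then show "homotopic C X Y (conc X Y n u) (conc X Y n v)" unfolding homotopic_def using h Sh by blast
  qed
  then show ?thesis using homotopic_cl[OF c h] by blast
qed

lemma conc_left:
  assumes c: "cpl X" "cpl Y" "cpl Z" and u: "cocycle X Y n u" and \<psi>: "chain_map C Y Z \<psi>"
  shows "cl Y Z (gm Y Z \<psi>) **\<^sub>K carr X Y n u = carr X Z n (\<psi> n ** u)"
proof -
  have "(\<lambda>i. \<psi> i ** conc X Y n u i) = conc X Z n (\<psi> n ** u)"
    using zero_right[OF chain_map_hom[OF \<psi>] cpl_Ob[OF c(1)]] by (auto simp: conc_def)
  then show ?thesis using cl_comp[OF c conc_chain[OF c(1,2) u] \<psi>] by simp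
qed

lemma conc_right:
  assumes c: "cpl X" "cpl Y" "cpl Z" and u: "cocycle Y Z n u" and \<phi>: "chain_map C X Y \<phi>"
  shows "carr Y Z n u **\<^sub>K cl X Y (gm X Y \<phi>) = carr X Z n (u ** \<phi> n)"
proof -
  have "(\<lambda>i. conc Y Z n u i ** \<phi> i) = conc X Z n (u ** \<phi> n)"
    using zero_left[OF chain_map_hom[OF \<phi>] cpl_Ob[OF c(3)]] by (auto simp: conc_def)
  then show ?thesis using cl_comp[OF c \<phi> conc_chain[OF c(2,3) u]] by simp
qed

end

section \<open>The comparison theorem\<close>

text \<open>
  Resolutions are compared inside the homotopy category of all complexes over \<open>C\<close>, where an object is
  a complex concentrated in one degree.
\<close>

context exact_category
begin

sublocale B: complexes C "Ob C"
  using ex_zero_object ex_biproduct by unfold_locales (auto simp: zero_object_def)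

notation K_Cmp_infix (infixl "**\<^sub>K" 70) and B.K_Cmp_infix (infixl "**\<^sub>B" 70)

lemma B_cpl: "cpl X ==> B.cpl X"
  using P_Ob unfolding is_complex_def by blast

text \<open>The set \<open>P\<close> enters a homotopy category only through its objects, arrows and
  triangles, so composites and sums may be computed in either of the two categories.\<close>

lemma B_ops: "Cmp K = Cmp B.K" "Add K = Add B.K" "Zero K = Zero B.K" "Ident K = Ident B.K" "ShArr K = ShArr B.K"
  by (simp_all add: homotopy_cat_def)

lemma B_hom: "cpl X ==> cpl Y ==> hom K X Y = hom B.K X Y"
  by (simp add: K_hom B.K_hom B_cpl)

definition "zob = (SOME Z. zero_object C Z)"

lemma zob: "zero_object C zob" "zob : Ob C" "zob : Proj C E"
  using someI_ex[OF ex_zero_object] Proj_zero_object by (auto simp: zob_def zero_object_def)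

definition stalk :: "'o => int => ('o, 'm) cpx" where
  "stalk A n = \<lparr>cob = (\<lambda>i. if i = n then A else zob),
    cdiff = (\<lambda>i. Zero C (if i = n then A else zob) (if i + 1 = n then A else zob))\<rparr>"

lemma cob_stalk: "cob (stalk A n) i = (if i = n then A else zob)"
  and cdiff_stalk: "cdiff (stalk A n) i = Zero C (cob (stalk A n) i) (cob (stalk A n) (i + 1))"
  by (simp_all add: stalk_def)

lemma stalk_cpl: "A : Ob C ==> B.cpl (stalk A n)" "A : Proj C E ==> cpl (stalk A n)"
  using zob Proj_Ob zero_left zero_hom by (auto simp: is_complex_def stalk_def)

lemma sh_stalk: "A : Ob C ==> sh (stalk A n) = stalk A (n - 1)"
  using Neg_Zero zob(2) by (auto simp: shift_cpx_def stalk_def fun_eq_iff)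

lemma right_bounded_stalk: "right_bounded_at C (stalk A n) n"
  using zob by (simp add: right_bounded_at_def cob_stalk)

lemma meets_stalk: "B.meets X (stalk A n) n" "B.meets (stalk A n) X n"
  using zob by (simp_all add: B.meets_def cob_stalk)

lemma cocycle_stalk:
  assumes "B.cpl X" "A : Ob C"
  shows "B.cocycle X (stalk A n) n u \<longleftrightarrow> u : hom C (cob X n) A \<and> u ** cdiff X (n - 1) = Zero C (cob X (n - 1)) A"
    "B.cocycle (stalk A n) X n u \<longleftrightarrow> u : hom C A (cob X n) \<and> cdiff X n ** u = Zero C A (cob X (n + 1))"
  using zero_left[of u "cob X n" A zob] zero_right[of u A "cob X n" zob] zob by (auto simp: B.cocycle_def cob_stalk cdiff_stalk)

text \<open>A homotopy contributes through one component out of the zero object in degree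
  \<open>n + 1\<close> and one into the zero object below the stalk; both contributions
  vanish.\<close>

lemma carr_to_stalk_inj:
  assumes X: "B.cpl X" "zero_object C (cob X (n + 1))" and A: "A : Ob C"
    and u: "B.cocycle X (stalk A n) n u" "B.cocycle X (stalk A n) n v" and e: "B.carr X (stalk A n) n u = B.carr X (stalk A n) n v"
  shows "u = v"
proof -
  note S = stalk_cpl(1)[OF A, of n]
  have uh: "u : hom C (cob X n) (cob (stalk A n) n)" using u(1) by (simp add: B.cocycle_def)
  obtain s t where st: "s : hom C (cob X n) (cob (stalk A n) (n - 1))" "t : hom C (cob X (n + 1)) (cob (stalk A n) n)"
    "v = u \<oplus> ((cdiff (stalk A n) (n - 1) ** s) \<oplus> (t ** cdiff X n))"
    using B.conc_eq_iff[OF X(1) S meets_stalk(1) u] e by blast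
  have "cdiff (stalk A n) (n - 1) ** s = Zero C (cob X n) A"
    using zero_left[OF st(1)] A by (simp add: cdiff_stalk cob_stalk)
  moreover have "t ** cdiff X n = Zero C (cob X n) A"
    using zero_object_hom[OF X(2) st(2)] zero_left[OF B.cplD(1)[OF X(1)]] A by (simp add: cob_stalk)
  ultimately show ?thesis using st(3) Add_Zero zero_hom[OF hom_Ob1[OF uh] A] uh by (simp add: cob_stalk)
qed

lemma carr_from_stalk_zero:
  assumes X: "B.cpl X" and Q: "Q : Ob C" and u: "B.cocycle (stalk Q n) X n u"
  shows "B.carr (stalk Q n) X n u = Zero B.K (stalk Q n) X \<longleftrightarrow> (\<exists>v\<in>hom C Q (cob X (n - 1)). cdiff X (n - 1) ** v = u)"
proof -
  note S = stalk_cpl(1)[OF Q, of n]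
  have o: "cob X n : Ob C" using B.cpl_Ob[OF X] .
  note d = B.cplD(1)[OF X, of "n - 1", simplified]
  have "Zero C Q (cob X n) \<oplus> ((cdiff X (n - 1) ** s) \<oplus> (t ** cdiff (stalk Q n) n)) = cdiff X (n - 1) ** s"
    if "s : hom C Q (cob X (n - 1))" "t : hom C zob (cob X n)" for s t
    using zero_right[OF that(2) Q] Add_Zero[OF comp[OF that(1) d]] Zero_Add[OF comp[OF that(1) d]] by (simp add: cdiff_stalk cob_stalk)
  moreover have "Zero C zob (cob X n) : hom C zob (cob X n)" using zero_hom zob(2) o .
  ultimately show ?thesis
    using B.conc_eq_iff[OF S X meets_stalk(2) B.zero_cocycle[OF S X] u] B.conc_zero[OF S X, of n] by (auto simp: cob_stalk)
qed

text \<open>Exactness of the complexes of homs from all projectives into \<open>T\<close>. The cone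
  of an augmentation has this property, and it suffices to kill maps from right bounded complexes of
  projectives.\<close>

definition pex :: "('o, 'm) cpx => bool" where
  "pex T \<longleftrightarrow> B.cpl T \<and> (\<forall>Q\<in>Proj C E. \<forall>i. \<forall>u\<in>hom C Q (cob T i). cdiff T i ** u = Zero C Q (cob T (i + 1)) \<longrightarrow>
     (\<exists>v\<in>hom C Q (cob T (i - 1)). cdiff T (i - 1) ** v = u))"

lemma pexI:
  assumes T: "B.cpl T" and z: "\<And>Q n. Q : Proj C E ==> hom B.K (stalk Q n) T = {Zero B.K (stalk Q n) T}"
  shows "pex T"
  unfolding pex_def
proof (intro conjI ballI allI impI T)
  fix Q i u assume Q: "Q : Proj C E" and u: "u : hom C Q (cob T i)" "cdiff T i ** u = Zero C Q (cob T (i + 1))"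
  have c: "B.cocycle (stalk Q i) T i u" using cocycle_stalk(2)[OF T Proj_Ob[OF Q]] u by blast
  have "B.carr (stalk Q i) T i u = Zero B.K (stalk Q i) T"
    using z[OF Q] B.chain_map_arr[OF stalk_cpl(1)[OF Proj_Ob[OF Q]] T B.conc_chain[OF stalk_cpl(1)[OF Proj_Ob[OF Q]] T c]] by blast
  then show "\<exists>v\<in>hom C Q (cob T (i - 1)). cdiff T (i - 1) ** v = u" using carr_from_stalk_zero[OF T Proj_Ob[OF Q] c] by blast
qed

text \<open>The homotopy is constructed by descending induction on the degree.\<close>

lemma hom_pex:
  assumes X: "cpl X" "right_bounded_at C X n" and T: "pex T" shows "hom B.K X T = {Zero B.K X T}"
proof -
  note XB = B_cpl[OF X(1)]
  have TB: "B.cpl T" and ex: "\<And>Q i u. Q : Proj C E ==> u : hom C Q (cob T i) ==> cdiff T i ** u = Zero C Q (cob T (i + 1)) ==>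
     \<exists>v\<in>hom C Q (cob T (i - 1)). cdiff T (i - 1) ** v = u" using T unfolding pex_def by blast+
  note dX = cplD(1)[OF X(1)] and dT = B.cplD(1)[OF TB] and o = cpl_Ob[OF X(1)] B.cpl_Ob[OF TB]
  have "f = Zero B.K X T" if f: "f : hom B.K X T" for f
  proof -
    obtain \<phi> where \<phi>: "chain_map C X T \<phi>" "f = cl X T (gm X T \<phi>)" by (rule B.chain_map_arrE[OF f])
    note h = chain_map_hom[OF \<phi>(1)]
    have c: "\<phi> (i + 1) ** cdiff X i = cdiff T i ** \<phi> i" for i using \<phi>(1) by (simp add: chain_map_def)
    \<comment> \<open>What remains of \<open>\<phi>\<close> in degree \<open>i\<close> once the
      homotopy component \<open>y\<close> out of degree \<open>i + 1\<close> has been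
      chosen.\<close>
    define r where "r i y = \<phi> i \<oplus> Neg C (y ** cdiff X i)" for i y
    have rh: "r i y : hom C (cob X i) (cob T i)" if "y : hom C (cob X (i + 1)) (cob T i)" for i y
      unfolding r_def using add_hom[OF h neg_hom[OF comp[OF dX that]]] .
    have r_hom: "y : hom C (cob X (i + 1)) (cob T i) ==> v : hom C (cob X i) (cob T (i - 1)) ==> cdiff T (i - 1) ** v = r i y ==>
        cdiff T (i - 1) ** r (i - 1) v = Zero C (cob X (i - 1)) (cob T i)" for i y v
    proof -
      assume y: "y : hom C (cob X (i + 1)) (cob T i)" and v: "v : hom C (cob X i) (cob T (i - 1))" and e: "cdiff T (i - 1) ** v = r i y"
      note d = dX[of "i - 1", simplified] and d' = dT[of "i - 1", simplified]
      have "(y ** cdiff X i) ** cdiff X (i - 1) = Zero C (cob X (i - 1)) (cob T i)"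
        using assoc[OF d dX y] cplD(2)[OF X(1), of "i - 1"] zero_right[OF y o(1)] by (simp add: algebra_simps)
      then have "r i y ** cdiff X (i - 1) = \<phi> i ** cdiff X (i - 1)"
        unfolding r_def using Cmp_diff(2)[OF h comp[OF dX y] id_hom[OF o(2)] d] Neg_Zero[OF o] Add_Zero[OF comp[OF d h]] by simp
      then have "cdiff T (i - 1) ** (v ** cdiff X (i - 1)) = cdiff T (i - 1) ** \<phi> (i - 1)"
        using assoc[OF d v d'] e c[of "i - 1"] by simp
      then show ?thesis
        unfolding r_def using Cmp_diff(1)[OF h comp[OF d v[simplified]] d' id_hom[OF o(1)]] Add_Neg[OF comp[OF h d']] by simp
    qed
    \<comment> \<open>Index \<open>k\<close> stands for degree \<open>n - k\<close>, so that
      descending induction becomes recursion on natural numbers. \<open>y\<close> is the homotopy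
      component out of degree \<open>n - k + 1\<close>, and the remainder it leaves is a
      cocycle.\<close>
    define R where "R k y \<longleftrightarrow> y : hom C (cob X (n - int k + 1)) (cob T (n - int k)) \<and>
      cdiff T (n - int k) ** r (n - int k) y = Zero C (cob X (n - int k)) (cob T (n - int k + 1))" for k y
    have "\<exists>y. \<forall>k. R k (y k) \<and> cdiff T (n - int k - 1) ** y (Suc k) = r (n - int k) (y k)"
    proof (rule dependent_nat_choice[of R "\<lambda>k y v. cdiff T (n - int k - 1) ** v = r (n - int k) y"])
      let ?z = "Zero C (cob X (n + 1)) (cob T n)"
      have z: "?z : hom C (cob X (n + 1)) (cob T n)" using zero_hom o by blast
      have "zero_object C (cob X (n + 1))" using X(2) by (simp add: right_bounded_at_def)
      then have "cdiff T n ** \<phi> n = Zero C (cob X n) (cob T (n + 1))"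
        using c[of n] zero_object_hom[OF _ h[of "n + 1"]] zero_left[OF dX o(2)] by metis
      moreover have "r n ?z = \<phi> n" unfolding r_def using zero_left[OF dX o(2)] Neg_Zero[OF o] Add_Zero[OF h] by simp
      ultimately show "\<exists>y. R 0 y" using z by (auto simp: R_def)
    next
      fix y k assume R: "R k y"
      let ?i = "n - int k"
      have y: "y : hom C (cob X (?i + 1)) (cob T ?i)" "cdiff T ?i ** r ?i y = Zero C (cob X ?i) (cob T (?i + 1))" using R by (auto simp: R_def)
      obtain v where v: "v : hom C (cob X ?i) (cob T (?i - 1))" "cdiff T (?i - 1) ** v = r ?i y"
        using ex[OF cpl_P[OF X(1)] rh[OF y(1)] y(2)] by blast
      have k: "n - int (Suc k) = ?i - 1" by simp
      have "R (Suc k) v" unfolding R_def k using v(1) r_hom[OF y(1) v] by simp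
      then show "\<exists>v. R (Suc k) v \<and> cdiff T (?i - 1) ** v = r ?i y" using v(2) by blast
    qed
    then obtain y where y: "\<And>k. R k (y k)" "\<And>k. cdiff T (n - int k - 1) ** y (Suc k) = r (n - int k) (y k)" by blast
    \<comment> \<open>Above degree \<open>n + 1\<close> the source is a zero object, so the zero
      component is the only choice.\<close>
    define s where "s i = (if i \<le> n + 1 then y (nat (n + 1 - i)) else Zero C (cob X i) (cob T (i - 1)))" for i
    have sh: "s i : hom C (cob X i) (cob T (i - 1))" for i
    proof (cases "i \<le> n + 1")
      case True
      then have "n - int (nat (n + 1 - i)) = i - 1" by simp
      then show ?thesis using y(1)[of "nat (n + 1 - i)"] True by (simp add: R_def s_def)
    qed (use zero_hom o in \<open>simp add: s_def\<close>)
    have e: "\<phi> i = Zero C (cob X i) (cob T i) \<oplus> ((cdiff T (i - 1) ** s i) \<oplus> (s (i + 1) ** cdiff X i))" for i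
    proof -
      have s1: "s (i + 1) : hom C (cob X (i + 1)) (cob T i)" using sh[of "i + 1"] by simp
      note t1 = comp[OF sh[of i] dT[of "i - 1", simplified]] and t2 = comp[OF dX[of i] s1]
      have "\<phi> i = (cdiff T (i - 1) ** s i) \<oplus> (s (i + 1) ** cdiff X i)"
      proof (cases "i \<le> n")
        case True
        define k where "k = nat (n - i)"
        have k: "n - int k = i" "nat (n + 1 - i) = Suc k" "nat (n - i) = k" using True by (auto simp: k_def)
        have "cdiff T (i - 1) ** s i = r i (s (i + 1))" using y(2)[of k] True by (simp add: s_def k)
        then have "emb (cdiff T (i - 1) ** s i) = emb (\<phi> i) - emb (s (i + 1) ** cdiff X i)"
          unfolding r_def using emb_Add[OF h neg_hom[OF t2]] emb_Neg[OF t2] by simp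
        then show ?thesis using emb_inj[OF h add_hom[OF t1 t2]] emb_Add[OF t1 t2] by simp
      next
        case False
        then have "zero_object C (cob X i)" using X(2) by (simp add: right_bounded_at_def)
        then show ?thesis using zero_object_hom h add_hom[OF t1 t2] by metis
      qed
      then show ?thesis using Zero_Add[OF h[of i]] by simp
    qed
    have z: "chain_map C X T (\<lambda>i. Zero C (cob X i) (cob T i))"
      using zero_left[OF dX o(2)] zero_right[OF dT o(1)] zero_hom o by (simp add: chain_map_def)
    have "homotopic C X T (\<lambda>i. Zero C (cob X i) (cob T i)) \<phi>"
      unfolding homotopic_def by (intro conjI exI[of _ s] allI) (rule z \<phi>(1) sh e)+
    then show ?thesis using B.homotopic_cl[OF XB TB z \<phi>(1)] \<phi>(2) gr_zero[of "cob X" "cob T" 0] o by (simp add: B.K_Zero XB TB)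
  qed
  moreover have "Zero B.K X T : hom B.K X T" using B.K.zero_hom XB TB by simp
  ultimately show ?thesis by blast
qed

abbreviation "sarr A A' f \<equiv> B.carr (stalk A 0) (stalk A' 0) 0 f"

lemma cocycle_stalks: "f : hom C A A' ==> B.cocycle (stalk A 0) (stalk A' 0) 0 f"
  using cocycle_stalk(2)[of "stalk A' 0" A 0 f] stalk_cpl(1) hom_Ob1 hom_Ob2 zero_left[of f A A' zob] zob by (auto simp: cob_stalk cdiff_stalk)

lemma sarr_hom: "f : hom C A A' ==> sarr A A' f : hom B.K (stalk A 0) (stalk A' 0)"
  using B.chain_map_arr B.conc_chain cocycle_stalks stalk_cpl hom_Ob1 hom_Ob2 by metis

lemma sarr_comp:
  assumes X: "B.cpl X" and u: "B.cocycle X (stalk A 0) 0 u" and f: "f : hom C A A'"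
  shows "sarr A A' f **\<^sub>B B.carr X (stalk A 0) 0 u = B.carr X (stalk A' 0) 0 (f ** u)"
proof -
  note o = stalk_cpl(1)[OF hom_Ob1[OF f], of 0] stalk_cpl(1)[OF hom_Ob2[OF f], of 0]
  show ?thesis using B.conc_left[OF X o(1,2) u B.conc_chain[OF o cocycle_stalks[OF f]]] by (simp add: B.conc_def)
qed

lemma sarr_Cmp: "f : hom C A A' ==> g : hom C A' D ==> sarr A' D g **\<^sub>B sarr A A' f = sarr A D (g ** f)"
  using sarr_comp[OF stalk_cpl(1) cocycle_stalks] hom_Ob1 by blast

lemma sarr_Add:
  assumes f: "f : hom C A A'" and g: "g : hom C A A'"
  shows "sarr A A' (f \<oplus> g) = sarr A A' f \<oplus>\<^bsub>B.K\<^esub> sarr A A' g"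
proof -
  have ob: "A : Ob C" "A' : Ob C" using hom_Ob1[OF f] hom_Ob2[OF f] .
  note c = stalk_cpl(1)[OF ob(1), of 0] stalk_cpl(1)[OF ob(2), of 0]
  have m: "fm (stalk A 0) (stalk A' 0) (B.conc (stalk A 0) (stalk A' 0) 0 u)" "gm (stalk A 0) (stalk A' 0) (B.conc (stalk A 0) (stalk A' 0) 0 u) : chm (stalk A 0) (stalk A' 0)"
    if "u : hom C A A'" for u using B.conc_chain[OF c cocycle_stalks[OF that]] B.chm_iff[OF c] by blast+
  have "(\<lambda>i. B.conc (stalk A 0) (stalk A' 0) 0 f i \<oplus> B.conc (stalk A 0) (stalk A' 0) 0 g i) = B.conc (stalk A 0) (stalk A' 0) 0 (f \<oplus> g)"
    using Add_Zero[OF zero_hom[OF B.cpl_Ob[OF c(1)] B.cpl_Ob[OF c(2)]]] by (auto simp: B.conc_def)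
  then show ?thesis using B.K_Add[OF c m(2)[OF f] m(2)[OF g]] gr_add[OF m(1)[OF f] m(1)[OF g]] by simp
qed

lemma sarr_zero: "A : Ob C ==> A' : Ob C ==> sarr A A' (Zero C A A') = Zero B.K (stalk A 0) (stalk A' 0)"
  using B.conc_zero[OF stalk_cpl(1)[of A 0] stalk_cpl(1)[of A' 0], of 0] by (simp add: cob_stalk)

lemma sarr_ex:
  assumes "A : Ob C" "A' : Ob C" "x : hom B.K (stalk A 0) (stalk A' 0)"
  shows "\<exists>f\<in>hom C A A'. x = sarr A A' f"
  using B.conc_ex[OF stalk_cpl(1)[OF assms(1)] stalk_cpl(1)[OF assms(2)] meets_stalk(1) assms(3)] by (auto simp: B.cocycle_def cob_stalk)

lemma sarr_inj:
  assumes "f : hom C A A'" "g : hom C A A'" "sarr A A' f = sarr A A' g" shows "f = g"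
  using carr_to_stalk_inj[OF stalk_cpl(1)[OF hom_Ob1[OF assms(1)]] _ hom_Ob2[OF assms(1)] cocycle_stalks[OF assms(1)] cocycle_stalks[OF assms(2)] assms(3)]
    zob by (simp add: cob_stalk)

lemma stalks_zero:
  assumes "A : Ob C" "A' : Ob C" "n \<noteq> 0" "x : hom B.K (stalk A n) (stalk A' 0)" shows "x = Zero B.K (stalk A n) (stalk A' 0)"
  using B.hom_disjoint_supp[of "stalk A n" "stalk A' 0" "{n}" "{0}"] stalk_cpl assms zob by (auto simp: B.supp_def cob_stalk)

text \<open>\<open>pres X \<epsilon> A\<close>: seen from projective objects, \<open>\<epsilon>\<close> is a quasi-isomorphism from \<open>X\<close> to \<open>A\<close> in degree \<open>0\<close>.\<close>

definition pres :: "('o, 'm) cpx => ('o, 'm) karr => 'o => bool" where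
  "pres X \<epsilon> A \<longleftrightarrow> cpl X \<and> right_bounded_at C X 0 \<and> A : Ob C \<and> \<epsilon> : hom B.K X (stalk A 0) \<and>
     (\<forall>Q\<in>Proj C E. \<forall>f\<in>hom C Q A. \<exists>x\<in>hom B.K (stalk Q 0) X. \<epsilon> **\<^sub>B x = sarr Q A f) \<and> (\<forall>Q\<in>Proj C E. \<forall>n.
     (\<forall>x\<in>hom B.K (stalk Q n) X. \<epsilon> **\<^sub>B x = Zero B.K (stalk Q n) (stalk A 0) \<longrightarrow> x = Zero B.K (stalk Q n) X))"

lemma presD:
  assumes p: "pres X \<epsilon> A"
  shows "cpl X" "right_bounded_at C X 0" "A : Ob C" "\<epsilon> : hom B.K X (stalk A 0)"
    "Q : Proj C E ==> f : hom C Q A ==> \<exists>x\<in>hom B.K (stalk Q 0) X. \<epsilon> **\<^sub>B x = sarr Q A f"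
    "Q : Proj C E ==> x : hom B.K (stalk Q n) X ==> \<epsilon> **\<^sub>B x = Zero B.K (stalk Q n) (stalk A 0) ==> x = Zero B.K (stalk Q n) X"
  using p unfolding pres_def by blast+

lemma pres_lift:
  assumes p: "pres X \<epsilon> A" and Q: "Q : Proj C E" and f: "f : hom B.K (stalk Q n) (stalk A 0)"
  shows "\<exists>x\<in>hom B.K (stalk Q n) X. \<epsilon> **\<^sub>B x = f"
proof (cases "n = 0")
  case True
  then show ?thesis using sarr_ex[OF Proj_Ob[OF Q] presD(3)[OF p]] f presD(5)[OF p Q] by blast
next
  case False
  note D = presD[OF p] and S = stalk_cpl(1)[OF Proj_Ob[OF Q], of n]
  have "Zero B.K (stalk Q n) X : hom B.K (stalk Q n) X" using B.K.zero_hom S B_cpl[OF D(1)] by simp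
  then show ?thesis using stalks_zero[OF Proj_Ob[OF Q] D(3) False f] B.K.zero_right[OF D(4), of "stalk Q n"] S by auto
qed

text \<open>Seen from every \<open>stalk Q n\<close>, \<open>\<epsilon>\<close> is bijective, so the
  long exact sequence annihilates the maps into its cone. Injectivity on the shifted term is that
  for \<open>stalk Q (n + 1)\<close>, transported by the shift.\<close>

lemma pres_cone:
  assumes p: "pres X \<epsilon> A" and t: "(\<epsilon>, g, h) : Tri B.K" "g : hom B.K (stalk A 0) Z" shows "pex Z"
proof (rule pexI)
  note D = presD[OF p]
  show "B.cpl Z" using B.K.hom_Ob2[OF t(2)] by simp
  fix Q n assume Q: "Q : Proj C E"
  note S = stalk_cpl(1)[OF Proj_Ob[OF Q]]
  have sh: "sh (stalk Q (n + 1)) = stalk Q n" using sh_stalk[OF Proj_Ob[OF Q], of "n + 1"] by simp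
  show "hom B.K (stalk Q n) Z = {Zero B.K (stalk Q n) Z}"
  proof (rule B.K.Tri_cone_zero[OF t(1) D(4) t(2)])
    show "stalk Q n : Ob B.K" using S by simp
    show "\<exists>w\<in>hom B.K (stalk Q n) X. \<epsilon> **\<^sub>B w = v" if "v : hom B.K (stalk Q n) (stalk A 0)" for v using pres_lift[OF p Q that] .
    fix u assume u: "u : hom B.K (stalk Q n) (ShOb B.K X)" and z: "ShArr B.K \<epsilon> **\<^sub>B u = Zero B.K (stalk Q n) (ShOb B.K (stalk A 0))"
    obtain x where x: "x : hom B.K (stalk Q (n + 1)) X" "ShArr B.K x = u"
      using B.K.ShArr_surj[of "stalk Q (n + 1)" X u] u S B_cpl[OF D(1)] sh by auto
    have ob: "stalk Q (n + 1) : Ob B.K" "stalk A 0 : Ob B.K" "X : Ob B.K" using S stalk_cpl D(3) B_cpl[OF D(1)] by simp_all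
    have "ShArr B.K (\<epsilon> **\<^sub>B x) = ShArr B.K (Zero B.K (stalk Q (n + 1)) (stalk A 0))"
      using B.K.ShArr_Cmp[OF x(1) D(4)] x(2) z B.K.ShArr_Zero[OF ob(1,2)] sh by simp
    then have "\<epsilon> **\<^sub>B x = Zero B.K (stalk Q (n + 1)) (stalk A 0)"
      by (rule B.K.ShArr_inj[OF B.K.comp[OF x(1) D(4)] B.K.zero_hom[OF ob(1,2)]])
    then have "x = Zero B.K (stalk Q (n + 1)) X" using D(6)[OF Q x(1)] by blast
    then show "u = Zero B.K (stalk Q n) (ShOb B.K X)" using x(2) B.K.ShArr_Zero[OF ob(1,3)] sh by simp
  qed
qed

text \<open>Existence and uniqueness of the lift come from the vanishing of maps into the cone of
  \<open>\<epsilon>\<close>: from \<open>X\<close> for the first, from the shift of \<open>X\<close>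
  for the second.\<close>

lemma comparison:
  assumes p: "pres Y \<epsilon> A" and X: "cpl X" "right_bounded_at C X n"
  shows "f : hom B.K X (stalk A 0) ==> \<exists>x\<in>hom B.K X Y. \<epsilon> **\<^sub>B x = f"
    "x : hom B.K X Y ==> y : hom B.K X Y ==> \<epsilon> **\<^sub>B x = \<epsilon> **\<^sub>B y ==> x = y"
proof -
  note D = presD[OF p]
  obtain Z g h where t: "(\<epsilon>, g, h) : Tri B.K" "g : hom B.K (stalk A 0) Z" using B.K.cone_exists[OF D(4)] by blast
  note Z = pres_cone[OF p t]
  have s: "right_bounded_at C (sh X) (n - 1)" using X(2) by (simp add: right_bounded_at_def cob_shift)
  show "\<exists>x\<in>hom B.K X Y. \<epsilon> **\<^sub>B x = f" if f: "f : hom B.K X (stalk A 0)"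
  proof -
    have "g **\<^sub>B f = Zero B.K X Z" using B.K.comp[OF f t(2)] hom_pex[OF X Z] by blast
    then show ?thesis using B.K.Tri_kernel[OF t(1) D(4) t(2) f] by metis
  qed
  show "x : hom B.K X Y ==> y : hom B.K X Y ==> \<epsilon> **\<^sub>B x = \<epsilon> **\<^sub>B y ==> x = y"
    by (rule B.K.Tri_injective[OF t(1) D(4) t(2)]) (use hom_pex[OF cpl_shift[OF X(1)] s Z] in simp_all)
qed

lemma pres_isomorphism:
  assumes X: "pres X \<epsilon> A" and Y: "pres Y \<epsilon>' A"
  obtains x y where "x : hom K X Y" "y : hom K Y X" "y **\<^sub>K x = Ident K X" "x **\<^sub>K y = Ident K Y" "\<epsilon>' **\<^sub>B x = \<epsilon>" "\<epsilon> **\<^sub>B y = \<epsilon>'"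
proof -
  note D = presD[OF X] and D' = presD[OF Y]
  obtain x where x: "x : hom B.K X Y" "\<epsilon>' **\<^sub>B x = \<epsilon>" using comparison(1)[OF Y D(1,2,4)] by blast
  obtain y where y: "y : hom B.K Y X" "\<epsilon> **\<^sub>B y = \<epsilon>'" using comparison(1)[OF X D'(1,2,4)] by blast
  have o: "X : Ob B.K" "Y : Ob B.K" using B_cpl D(1) D'(1) by simp_all
  have "y **\<^sub>B x = Ident B.K X"
    by (rule comparison(2)[OF X D(1,2) B.K.comp[OF x(1) y(1)] B.K.id_hom[OF o(1)]])
      (use B.K.assoc[OF x(1) y(1) D(4)] x(2) y(2) B.K.id_right[OF D(4)] in simp)
  moreover have "x **\<^sub>B y = Ident B.K Y"
    by (rule comparison(2)[OF Y D'(1,2) B.K.comp[OF y(1) x(1)] B.K.id_hom[OF o(2)]])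
      (use B.K.assoc[OF y(1) x(1) D'(4)] x(2) y(2) B.K.id_right[OF D'(4)] in simp)
  ultimately show thesis using that x y unfolding B_ops B_hom[OF D(1) D'(1)] B_hom[OF D'(1) D(1)] by blast
qed

lemma pres_isomorphic:
  assumes "pres X \<epsilon> A" "pres Y \<epsilon>' A" shows "isomorphic K X Y"
  by (rule pres_isomorphism[OF assms]) (use K.isoI in \<open>unfold isomorphic_def, blast\<close>)

text \<open>The composite of \<open>\<epsilon>'\<close> with \<open>p\<close> kills \<open>a\<close>
  and so extends to the cone \<open>Z\<close> of \<open>a\<close>. A chase with stalks of
  projectives yields \<open>pres Z \<zeta> D\<close>, and comparing \<open>Z\<close> with
  \<open>W\<close> transports the cone triangle.\<close>

lemma conflation_triangle:
  assumes X: "pres X \<epsilon> A" and Y: "pres Y \<epsilon>' A'" and W: "pres W \<epsilon>'' D"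
    and E: "(i, p) : E" "i : hom C A A'" "p : hom C A' D"
    and a: "a : hom K X Y" "\<epsilon>' **\<^sub>B a = sarr A A' i **\<^sub>B \<epsilon>" and b: "b : hom K Y W" "\<epsilon>'' **\<^sub>B b = sarr A' D p **\<^sub>B \<epsilon>'"
  shows "\<exists>c\<in>hom K W (sh X). (a, b, c) : Tri K"
proof -
  note DX = presD[OF X] and DY = presD[OF Y] and DW = presD[OF W]
  obtain \<alpha> where \<alpha>: "\<alpha> : chm X Y" "a = cl X Y \<alpha>" using a(1) by (rule K_homE)
  obtain Z j k0 c0 q where r: "rcone X Y \<alpha> Z j k0 c0 q" by (rule rcone_ex[OF DX(1) DY(1) \<alpha>(1)])
  note R = rconeD[OF r]
  let ?k = "cl Y Z k0" and ?c = "cl Z (sh X) c0"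
  have "B.rcone X Y \<alpha> Z j k0 c0 q" using r R B_cpl unfolding rcone_def B.rcone_def by blast
  then have tB: "(a, ?k, ?c) : Tri B.K" and tK: "(a, ?k, ?c) : Tri K" using stdI[OF r] B.stdI \<alpha>(2) K.Std_Tri B.K.Std_Tri by blast+
  have sX: "cpl (sh X)" using cpl_shift[OF DX(1)] .
  have kK: "?k : hom K Y Z" and cK: "?c : hom K Z (sh X)" using K_homI R DY(1) sX by blast+
  have kB: "?k : hom B.K Y Z" and cB: "?c : hom B.K Z (sh X)" and aB: "a : hom B.K X Y" and bB: "b : hom B.K Y W"
    using kK cK a(1) b(1) B_hom[OF DY(1) R(3)] B_hom[OF R(3) sX] B_hom[OF DX(1) DY(1)] B_hom[OF DY(1) DW(1)] by simp_all
  note si = sarr_hom[OF E(2)] and sp = sarr_hom[OF E(3)]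
  have oA: "B.cpl (stalk A 0)" "B.cpl (stalk A' 0)" "B.cpl (stalk D 0)" and oX: "B.cpl X" "B.cpl Y" "B.cpl Z"
    using stalk_cpl(1) DX(3) DY(3) DW(3) B_cpl DX(1) DY(1) R(3) by auto
  have pi: "sarr A' D p **\<^sub>B sarr A A' i = Zero B.K (stalk A 0) (stalk D 0)"
    using sarr_Cmp[OF E(2,3)] conflationD(3)[OF E(1)] hom_Dom[OF E(2)] hom_Cod[OF E(3)] sarr_zero[OF DX(3) DW(3)] by simp
  have spe: "sarr A' D p **\<^sub>B \<epsilon>' : hom B.K Y (stalk D 0)" using B.K.comp[OF DY(4) sp] .
  have "(sarr A' D p **\<^sub>B \<epsilon>') **\<^sub>B a = Zero B.K X (stalk D 0)"
    using B.K.assoc[OF aB DY(4) sp] a(2) B.K.assoc[OF DX(4) si sp] pi B.K.zero_left[OF DX(4)] oA(3) by simp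
  then obtain \<zeta> where \<zeta>: "\<zeta> : hom B.K Z (stalk D 0)" "sarr A' D p **\<^sub>B \<epsilon>' = \<zeta> **\<^sub>B ?k" using B.K.Tri_cokernel[OF tB aB kB spe] by blast
  have Z: "pres Z \<zeta> D"
    unfolding pres_def
  proof (intro conjI ballI allI impI R(3) \<zeta>(1) DW(3))
    show "right_bounded_at C Z 0"
      using R(5) DX(2) DY(2) biproduct_zero_object unfolding right_bounded_at_def cob_shift by (elim bipE) (auto, smt (verit))
    fix Q assume Q: "Q : Proj C E"
    note QO = Proj_Ob[OF Q] and S = stalk_cpl(1)[OF Proj_Ob[OF Q]]
    show "\<exists>x\<in>hom B.K (stalk Q 0) Z. \<zeta> **\<^sub>B x = sarr Q D f" if f: "f : hom C Q D" for f
    proof -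
      obtain g where g: "g : hom C Q A'" "p ** g = f" using Proj_lift[OF Q E(1,3) f] by blast
      obtain y where y: "y : hom B.K (stalk Q 0) Y" "\<epsilon>' **\<^sub>B y = sarr Q A' g" using DY(5)[OF Q g(1)] by blast
      have "\<zeta> **\<^sub>B (?k **\<^sub>B y) = sarr Q D f"
        using B.K.assoc[OF y(1) kB \<zeta>(1)] \<zeta>(2) B.K.assoc[OF y(1) DY(4) sp] y(2) sarr_Cmp[OF g(1) E(3)] g(2) by simp
      then show ?thesis using B.K.comp[OF y(1) kB] by blast
    qed
    fix n z assume z: "z : hom B.K (stalk Q n) Z" "\<zeta> **\<^sub>B z = Zero B.K (stalk Q n) (stalk D 0)"
    have sh: "sh (stalk Q (n + 1)) = stalk Q n" using sh_stalk[OF QO, of "n + 1"] by simp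
    have cz: "?c **\<^sub>B z : hom B.K (stalk Q n) (sh X)" using B.K.comp[OF z(1) cB] .
    \<comment> \<open>First half of the chase: the image of \<open>z\<close> in the shift of
      \<open>X\<close> is desuspended to \<open>x\<close> and shown to vanish.\<close>
    obtain x where x: "x : hom B.K (stalk Q (n + 1)) X" "ShArr B.K x = ?c **\<^sub>B z"
      using B.K.ShArr_surj[of "stalk Q (n + 1)" X "?c **\<^sub>B z"] cz S oX(1) sh by auto
    have Sa: "ShArr B.K a : hom B.K (sh X) (sh Y)" using B.K.ShArr_hom[OF aB] by simp
    have "Neg B.K (ShArr B.K a) **\<^sub>B ?c = Zero B.K Z (sh Y)"
      using B.K.Tri_zero'[OF B.K.Tri_rotate[OF B.K.Tri_rotate[OF tB]] cB B.K.neg_hom[OF Sa]] .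
    then have "ShArr B.K a **\<^sub>B ?c = Zero B.K Z (sh Y)" using B.K.neg_left[OF cB Sa] B.K.Neg_eq_Zero[OF B.K.comp[OF cB Sa]] by simp
    then have "ShArr B.K (a **\<^sub>B x) = ShArr B.K (Zero B.K (stalk Q (n + 1)) Y)"
      using B.K.ShArr_Cmp[OF x(1) aB] x(2) B.K.assoc[OF z(1) cB Sa] B.K.zero_left[OF z(1)] B.K.hom_Ob2[OF Sa] B.K.ShArr_Zero[of "stalk Q (n + 1)" Y] S oX(2) sh by simp
    moreover have "Zero B.K (stalk Q (n + 1)) Y : hom B.K (stalk Q (n + 1)) Y" using B.K.zero_hom S oX(2) by simp
    ultimately have ax: "a **\<^sub>B x = Zero B.K (stalk Q (n + 1)) Y" using B.K.ShArr_inj[OF B.K.comp[OF x(1) aB]] by blast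
    have ex: "\<epsilon> **\<^sub>B x : hom B.K (stalk Q (n + 1)) (stalk A 0)" using B.K.comp[OF x(1) DX(4)] .
    have iex: "sarr A A' i **\<^sub>B (\<epsilon> **\<^sub>B x) = Zero B.K (stalk Q (n + 1)) (stalk A' 0)"
      using B.K.assoc[OF x(1) DX(4) si] a(2) B.K.assoc[OF x(1) aB DY(4)] ax B.K.zero_right[OF DY(4)] S by simp
    have "\<epsilon> **\<^sub>B x = Zero B.K (stalk Q (n + 1)) (stalk A 0)"
    \<comment> \<open>Maps between stalks in different degrees vanish, so only equal degrees carry
      content; there \<open>i\<close> is monic.\<close>
    proof (cases "n + 1 = 0")
      case True
      obtain w where w: "w : hom C Q A" "\<epsilon> **\<^sub>B x = sarr Q A w" using sarr_ex[OF QO DX(3) ex[unfolded True]] by blast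
      have "sarr Q A' (i ** w) = sarr Q A' (Zero C Q A')"
        using sarr_Cmp[OF w(1) E(2)] w(2) iex True sarr_zero[OF QO DY(3)] by simp
      then have "i ** w = i ** Zero C Q A" using sarr_inj[OF comp[OF w(1) E(2)] zero_hom[OF QO DY(3)]] zero_right[OF E(2) QO] by simp
      then have "w = Zero C Q A" by (rule inflation_mono[OF E(1,2) w(1) zero_hom[OF QO DX(3)]])
      then show ?thesis using w(2) sarr_zero[OF QO DX(3)] True by simp
    next
      case False
      then show ?thesis using stalks_zero[OF QO DX(3) _ ex] by blast
    qed
    then have "x = Zero B.K (stalk Q (n + 1)) X" using DX(6)[OF Q x(1)] by blast
    then have "?c **\<^sub>B z = Zero B.K (stalk Q n) (sh X)" using x(2) B.K.ShArr_Zero[of "stalk Q (n + 1)" X] S oX(1) sh by simp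
    \<comment> \<open>Second half: \<open>z\<close> comes from a map \<open>y\<close> into
      \<open>Y\<close>, which is then shown to come from \<open>X\<close>.\<close>
    then obtain y where y: "y : hom B.K (stalk Q n) Y" "z = ?k **\<^sub>B y" using B.K.Tri_kernel[OF B.K.Tri_rotate[OF tB] kB cB z(1)] by blast
    have ey: "\<epsilon>' **\<^sub>B y : hom B.K (stalk Q n) (stalk A' 0)" using B.K.comp[OF y(1) DY(4)] .
    have pey: "sarr A' D p **\<^sub>B (\<epsilon>' **\<^sub>B y) = Zero B.K (stalk Q n) (stalk D 0)"
      using B.K.assoc[OF y(1) DY(4) sp] \<zeta>(2) B.K.assoc[OF y(1) kB \<zeta>(1)] y(2) z(2) by simp
    have "\<exists>x\<in>hom B.K (stalk Q n) X. y = a **\<^sub>B x"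
    proof (cases "n = 0")
      case True
      obtain g where g: "g : hom C Q A'" "\<epsilon>' **\<^sub>B y = sarr Q A' g" using sarr_ex[OF QO DY(3) ey[unfolded True]] by blast
      have "sarr Q D (p ** g) = sarr Q D (Zero C Q D)"
        using sarr_Cmp[OF g(1) E(3)] g(2) pey True sarr_zero[OF QO DW(3)] by simp
      then have "p ** g = Zero C Q D" by (rule sarr_inj[OF comp[OF g(1) E(3)] zero_hom[OF QO DW(3)]])
      then obtain w where w: "w : hom C Q A" "i ** w = g" using conflation_kernel[OF E g(1)] by blast
      obtain x where x: "x : hom B.K (stalk Q 0) X" "\<epsilon> **\<^sub>B x = sarr Q A w" using DX(5)[OF Q w(1)] by blast
      have "\<epsilon>' **\<^sub>B (a **\<^sub>B x) = \<epsilon>' **\<^sub>B y"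
        using B.K.assoc[OF x(1) aB DY(4)] a(2) B.K.assoc[OF x(1) DX(4) si] x(2) sarr_Cmp[OF w(1) E(2)] w(2) g(2) by simp
      then have "a **\<^sub>B x = y" using comparison(2)[OF Y stalk_cpl(2)[OF Q] right_bounded_stalk B.K.comp[OF x(1) aB]] y(1) True by blast
      then show ?thesis using x(1) True by blast
    next
      case False
      then have "y = Zero B.K (stalk Q n) Y" using stalks_zero[OF QO DY(3) False ey] DY(6)[OF Q y(1)] by blast
      then show ?thesis using B.K.zero_right[OF aB] B.K.zero_hom S oX(1) by (intro bexI[of _ "Zero B.K (stalk Q n) X"]) simp_all
    qed
    then obtain x' where x': "x' : hom B.K (stalk Q n) X" "y = a **\<^sub>B x'" by blast
    show "z = Zero B.K (stalk Q n) Z"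
      using y(2) x' B.K.assoc[OF x'(1) aB kB] B.K.Tri_zero'[OF tB aB kB] B.K.zero_left[OF x'(1)] oX(3) by simp
  qed
  obtain x y where xy: "x : hom K Z W" "y : hom K W Z" "y **\<^sub>K x = Ident K Z" "x **\<^sub>K y = Ident K W" "\<epsilon>'' **\<^sub>B x = \<zeta>" "\<zeta> **\<^sub>B y = \<epsilon>''"
    by (rule pres_isomorphism[OF Z W])
  have yB: "y : hom B.K W Z" using xy(2) B_hom[OF DW(1) R(3)] by simp
  have "y **\<^sub>B b = ?k"
    by (rule comparison(2)[OF Z DY(1,2) B.K.comp[OF bB yB] kB]) (use B.K.assoc[OF bB yB \<zeta>(1)] xy(6) b(2) \<zeta>(2) in simp)
  then have yb: "y **\<^sub>K b = ?k" unfolding B_ops .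
  have cy: "?c **\<^sub>K y : hom K W (sh X)" using K.comp[OF xy(2) cK] .
  have o: "X : Ob K" "Y : Ob K" "sh X : Ob K" using DX(1) DY(1) sX by simp_all
  have "triangle_iso K (a, b, ?c **\<^sub>K y) (a, ?k, ?c)"
    by (rule triangle_isoI[OF a(1) b(1) _ a(1) kK _ K.id_hom[OF o(1)] K.id_hom[OF o(2)] xy(2) K.iso_Ident[OF o(1)] K.iso_Ident[OF o(2)] K.isoI[OF xy(2,1,4,3)]])
      (use cy cK K.id_left[OF a(1)] K.id_right[OF a(1)] yb K.id_right[OF kK] K.ShArr_Ident[OF o(1)] K.id_left[OF cy] in simp_all)
  then show ?thesis using K.Tri_iso[OF tK] cy by blast
qed

text \<open>The shift of \<open>X\<close> lives in negative degrees and has no maps to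
  \<open>A\<close> placed in degree 0, so \<open>comparison\<close> leaves no maps to
  \<open>Y\<close>. This rigidity makes the third arrow of a triangle of resolutions
  natural.\<close>

lemma hom_shift_zero:
  assumes X: "cpl X" "right_bounded_at C X 0" and Y: "pres Y \<epsilon> A" shows "hom K (sh X) Y = {Zero K (sh X) Y}"
proof -
  note D = presD[OF Y] and sX = cpl_shift[OF X(1)]
  have s: "right_bounded_at C (sh X) (- 1)" using X(2) by (simp add: right_bounded_at_def cob_shift)
  have s': "supp (sh X) {..- 1}" "B.supp (stalk A 0) {0}" using s zob by (auto simp: supp_def B.supp_def right_bounded_at_def cob_stalk)
  have z: "hom B.K (sh X) (stalk A 0) = {Zero B.K (sh X) (stalk A 0)}"
    using B.hom_disjoint_supp[OF B_cpl[OF sX] stalk_cpl(1)[OF D(3)] _ s'(2), of "{..- 1}"] s' by (simp add: supp_def B.supp_def)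
  have o: "Zero B.K (sh X) Y : hom B.K (sh X) Y" using B.K.zero_hom B_cpl[OF sX] B_cpl[OF D(1)] by simp
  have "x = Zero B.K (sh X) Y" if "x : hom B.K (sh X) Y" for x
    by (rule comparison(2)[OF Y sX s that o]) (use B.K.comp[OF that D(4)] B.K.comp[OF o D(4)] in \<open>simp add: z\<close>)
  then show ?thesis unfolding B_hom[OF sX D(1)] B_ops using o by blast
qed

end

context additive_category
begin

lemma biproduct_pair:
  assumes "biproduct C A B W i j p q" "x : hom C X A" "y : hom C X B"
  shows "(i ** x) \<oplus> (j ** y) : hom C X W" "p ** ((i ** x) \<oplus> (j ** y)) = x" "q ** ((i ** x) \<oplus> (j ** y)) = y"
proof -
  note h = biproductD[OF assms(1)]
  note ix = comp[OF assms(2) h(1)] and jy = comp[OF assms(3) h(2)]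
  show "(i ** x) \<oplus> (j ** y) : hom C X W" using add_hom[OF ix jy] .
  show "p ** ((i ** x) \<oplus> (j ** y)) = x"
    using add_right[OF ix jy h(3)] assoc[OF assms(2) h(1,3)] assoc[OF assms(3) h(2,3)] h
      id_left[OF assms(2)] zero_left[OF assms(3) hom_Ob1[OF h(1)]] Add_Zero[OF assms(2)] by simp
  show "q ** ((i ** x) \<oplus> (j ** y)) = y"
    using add_right[OF ix jy h(4)] assoc[OF assms(2) h(1,4)] assoc[OF assms(3) h(2,4)] h
      id_left[OF assms(3)] zero_left[OF assms(2) hom_Ob1[OF h(2)]] Zero_Add[OF assms(3)] by simp
qed

end

section \<open>Acyclic complexes\<close>

context exact_category
begin

lemma acyclicD:
  assumes "acyclic_below C E X m Y a b"
  shows "i \<le> m ==> (a (i - 1), b i) : E" "i \<le> m ==> a (i - 1) : hom C (Y (i - 1)) (cob X i)"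
    "i \<le> m ==> b i : hom C (cob X i) (Y i)" "i < m ==> cdiff X i = a i ** b i"
    "i < m ==> (a i, b (i + 1)) : E" "i < m ==> a i : hom C (Y i) (cob X (i + 1))"
proof -
  show "i \<le> m ==> (a (i - 1), b i) : E" "i \<le> m ==> a (i - 1) : hom C (Y (i - 1)) (cob X i)"
    "i \<le> m ==> b i : hom C (cob X i) (Y i)" "i < m ==> cdiff X i = a i ** b i" for i
    using assms by (auto simp: acyclic_below_def)
  from this(1,2)[of "i + 1"] show "i < m ==> (a i, b (i + 1)) : E" "i < m ==> a i : hom C (Y i) (cob X (i + 1))"
    by simp_all
qed

lemma acyclic_mono: "acyclic_below C E X m Y a b ==> m' \<le> m ==> acyclic_below C E X m' Y a b"
  by (auto simp: acyclic_below_def)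

lemma resolution_pres:
  assumes "projective_resolution C E A (X, e)"
  shows "B.cocycle X (stalk A 0) 0 e" "pres X (B.carr X (stalk A 0) 0 e) A"
proof -
  from assms obtain Y a b where X: "cpl X" "right_bounded_at C X 0" and ac: "acyclic_below C E X 0 Y a b" and Y: "Y 0 = A" "b 0 = e"
    unfolding projective_resolution_def by auto
  note D = acyclicD[OF ac]
  have e: "e : hom C (cob X 0) A" using D(3)[of 0] Y by simp
  \<comment> \<open>A map from a projective that is killed by \<open>b i\<close> factors through the
    kernel \<open>a (i - 1)\<close> and then lifts, by projectivity, along the deflation
    \<open>b (i - 1)\<close>. This is exactness of \<open>X\<close> as seen from
    \<open>Q\<close>.\<close>
  have lift: "\<exists>v\<in>hom C Q (cob X (i - 1)). cdiff X (i - 1) ** v = u"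
    if Q: "Q : Proj C E" and i: "i \<le> 0" and u: "u : hom C Q (cob X i)" "b i ** u = Zero C Q (Y i)" for Q i u
  proof -
    obtain u' where u': "u' : hom C Q (Y (i - 1))" "a (i - 1) ** u' = u"
      using conflation_kernel[OF D(1)[OF i] D(2)[OF i] D(3)[OF i] u] by blast
    have i1: "i - 1 \<le> 0" "i - 1 < 0" using i by auto
    obtain v where v: "v : hom C Q (cob X (i - 1))" "b (i - 1) ** v = u'"
      using Proj_lift[OF Q D(1)[OF i1(1)] D(3)[OF i1(1)] u'(1)] by blast
    have "cdiff X (i - 1) ** v = u"
      unfolding D(4)[OF i1(2)] using assoc[OF v(1) D(3)[OF i1(1)] D(2)[OF i]] v u' by simp
    then show ?thesis using v(1) by blast
  qed
  have d: "a (- 1) : hom C (Y (- 1)) (cob X 0)" "b (- 1) : hom C (cob X (- 1)) (Y (- 1))" "(a (- 1), e) : E"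
    using D(2)[of 0] D(3)[of "- 1"] D(1)[of 0] Y by simp_all
  have "e ** (a (- 1) ** b (- 1)) = Zero C (cob X (- 1)) A"
    using assoc[OF d(2,1) e] conflationD(3)[OF d(3)] hom_Dom[OF d(1)] hom_Cod[OF e] zero_left[OF d(2) hom_Ob2[OF e]] by simp
  note A = hom_Ob2[OF e] and XB = B_cpl[OF X(1)]
  note SA = stalk_cpl(1)[OF A, of 0]
  show c: "B.cocycle X (stalk A 0) 0 e" using cocycle_stalk(1)[OF XB A, of 0 e] e \<open>e ** _ = _\<close> D(4)[of "- 1"] by simp
  let ?e = "B.carr X (stalk A 0) 0 e"
  have eh: "?e : hom B.K X (stalk A 0)" using B.chain_map_arr[OF XB SA B.conc_chain[OF XB SA c]] .
  have ec: "?e **\<^sub>B B.carr (stalk Q 0) X 0 u = sarr Q A (e ** u)" if "Q : Ob C" "B.cocycle (stalk Q 0) X 0 u" for Q u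
    using B.conc_left[OF stalk_cpl(1)[OF that(1)] XB SA that(2) B.conc_chain[OF XB SA c]] by (simp add: B.conc_def)
  show "pres X ?e A"
    unfolding pres_def
  proof (intro conjI ballI allI impI X A eh)
    fix Q assume Q: "Q : Proj C E"
    note QO = Proj_Ob[OF Q] and S = stalk_cpl(1)[OF Proj_Ob[OF Q]]
    show "\<exists>x\<in>hom B.K (stalk Q 0) X. ?e **\<^sub>B x = sarr Q A f" if f: "f : hom C Q A" for f
    proof -
      obtain v where v: "v : hom C Q (cob X 0)" "e ** v = f" using Proj_lift[OF Q d(3) e f] by blast
      have "zero_object C (cob X 1)" using X(2) by (simp add: right_bounded_at_def)
      then have "B.cocycle (stalk Q 0) X 0 v"
        using cocycle_stalk(2)[OF XB QO, of 0 v] v(1) zero_object_hom' comp[OF v(1) cplD(1)[OF X(1), of 0]] by simp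
      then show ?thesis using ec[OF QO] v(2) B.chain_map_arr[OF S XB B.conc_chain[OF S XB]] by blast
    qed
    fix n x assume x: "x : hom B.K (stalk Q n) X" "?e **\<^sub>B x = Zero B.K (stalk Q n) (stalk A 0)"
    obtain u where u: "B.cocycle (stalk Q n) X n u" "x = B.carr (stalk Q n) X n u" using B.conc_ex[OF S XB meets_stalk(2) x(1)] by blast
    have uh: "u : hom C Q (cob X n)" "cdiff X n ** u = Zero C Q (cob X (n + 1))" using u(1) cocycle_stalk(2)[OF XB QO] by blast+
    show "x = Zero B.K (stalk Q n) X"
    proof (cases "n \<le> 0")
      case False
      then have "u = Zero C (cob (stalk Q n) n) (cob X n)"
        using zero_object_hom'[OF _ uh(1)] X(2) by (simp add: right_bounded_at_def cob_stalk)
      then show ?thesis using u(2) B.conc_zero[OF S XB] by simp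
    next
      case True
      note Dn = D(3)[OF True]
      have "b n ** u = Zero C Q (Y n)"
      proof (cases "n = 0")
        case True
        have "sarr Q A (e ** u) = sarr Q A (Zero C Q A)" using ec[OF QO] u x(2) True sarr_zero[OF QO A] by simp
        then show ?thesis using sarr_inj[OF comp[OF uh(1) Dn] zero_hom[OF QO]] A True Y by simp
      next
        case False
        then have n: "n < 0" using True by simp
        have "a n ** (b n ** u) = a n ** Zero C Q (Y n)"
          using assoc[OF uh(1) Dn D(6)[OF n]] uh(2) D(4)[OF n] zero_right[OF D(6)[OF n] QO] by simp
        then show ?thesis
          using inflation_mono[OF D(5)[OF n] D(6)[OF n] comp[OF uh(1) Dn] zero_hom[OF QO hom_Ob2[OF Dn]]] by blast
      qed
      then show ?thesis using lift[OF Q True uh(1)] carr_from_stalk_zero[OF XB QO u(1)] u(2) by blast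
    qed
  qed
qed

lemma acyclic_below_0_resolution:
  assumes "cpl X" "right_bounded_at C X 0" "acyclic_below C E X 0 Y a b"
  shows "projective_resolution C E (Y 0) (X, b 0)"
  using assms unfolding projective_resolution_def by auto

lemma resolution_exists:
  assumes enough: "\<And>A. A : Ob C ==> \<exists>p. deflation E p \<and> Dom C p : Proj C E \<and> Cod C p = A" and A: "A : Ob C"
  shows "\<exists>r. projective_resolution C E A r"
proof -
  obtain Z where Z: "Z : Proj C E" "zero_object C Z" using P_zero by blast
  have ZO: "Z : Ob C" using Z(1) Proj_Ob by blast
  \<comment> \<open>Entry \<open>n\<close> of the sequence is the conflation whose middle term will
    sit in degree \<open>- n\<close>; the deflation of the next entry ends at its kernel
    term.\<close>
  define R where "R n t \<longleftrightarrow> t : E \<and> Dom C (snd t) : Proj C E \<and> (n = 0 \<longrightarrow> Cod C (snd t) = A)" for n :: nat and t :: "'m \<times> 'm"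
  have step: "\<exists>t. t : E \<and> Dom C (snd t) : Proj C E \<and> Cod C (snd t) = B" if B: "B : Ob C" for B
  proof -
    obtain p where "deflation E p" "Dom C p : Proj C E" "Cod C p = B" using enough[OF B] by blast
    moreover from this obtain i where "(i, p) : E" by (auto simp: deflation_def)
    ultimately show ?thesis by force
  qed
  have "\<exists>t. \<forall>n. R n (t n) \<and> Cod C (snd (t (Suc n))) = Dom C (fst (t n))"
  proof (rule dependent_nat_choice)
    show "\<exists>t. R 0 t" using step[OF A] by (auto simp: R_def)
  next
    fix t n assume "R n t"
    then have "Dom C (fst t) : Ob C" using hom_Ob1[OF conflationD(1)[of "fst t" "snd t"]] by (simp add: R_def)
    then show "\<exists>t'. R (Suc n) t' \<and> Cod C (snd t') = Dom C (fst t)" using step by (auto simp: R_def)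
  qed
  then obtain t where t: "\<And>n. R n (t n)" "\<And>n. Cod C (snd (t (Suc n))) = Dom C (fst (t n))" by blast
  define k where "k n = fst (t n)" for n
  define p where "p n = snd (t n)" for n
  have kp: "(k n, p n) : E" "Dom C (p n) : Proj C E" "Cod C (p (Suc n)) = Dom C (k n)" "Cod C (p 0) = A" for n
    using t(1)[of n] t(1)[of 0] t(2)[of n] by (simp_all add: R_def k_def p_def)
  have kh: "k n : hom C (Cod C (p (Suc n))) (Dom C (p n))" and ph: "p n : hom C (Dom C (p n)) (Cod C (p n))" for n
    using conflationD(1,2)[OF kp(1)] kp(3) hom_Dom[OF conflationD(2)[OF kp(1)], of n] by (auto simp: hom_def)
  define X where "X = \<lparr>cob = (\<lambda>i. if i \<le> 0 then Dom C (p (nat (- i))) else Z),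
    cdiff = (\<lambda>i. if i < 0 then k (nat (- i - 1)) ** p (nat (- i)) else Zero C (if i \<le> 0 then Dom C (p (nat (- i))) else Z) Z)\<rparr>"
  define Y where "Y i = Cod C (p (nat (- i)))" for i :: int
  define a where "a i = k (nat (- i - 1))" for i :: int
  define b where "b i = p (nat (- i))" for i :: int
  have nt: "nat (- i) = Suc (nat (- i - 1))" if "i < 0" for i using that by auto
  have nt': "nat (- (i + 1)) = nat (- i - 1)" for i :: int by simp
  have ah: "a i : hom C (Y i) (cob X (i + 1))" if "i < 0" for i
    using kh[of "nat (- i - 1)"] nt[OF that] that by (simp add: a_def Y_def X_def)
  have bh: "b i : hom C (cob X i) (Y i)" if "i \<le> 0" for i
    using ph that by (simp add: b_def Y_def X_def)
  have cX: "cob X i : Proj C E" for i using kp(2) Z(1) by (simp add: X_def)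
  have dX: "cdiff X i = a i ** b i" if "i < 0" for i using that by (simp add: X_def a_def b_def)
  have dh: "cdiff X i : hom C (cob X i) (cob X (i + 1))" for i
  proof (cases "i < 0")
    case True
    then show ?thesis unfolding dX[OF True] using comp[OF bh ah] by simp
  next
    case False
    then show ?thesis using zero_hom[OF Proj_Ob[OF cX[of i]] ZO] by (auto simp: X_def)
  qed
  have abE: "(a (i - 1), b i) : E" if "i \<le> 0" for i
    using kp(1)[of "nat (- i)"] by (simp add: a_def b_def)
  have "cpl X"
    unfolding is_complex_def
  proof (intro allI conjI)
    fix i
    show "cdiff X (i + 1) ** cdiff X i = Zero C (cob X i) (cob X (i + 2))"
    proof (cases "i + 1 < 0")
      case True
      have "(a i, b (i + 1)) : E" using abE[of "i + 1"] True by simp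
      then have z: "b (i + 1) ** a i = Zero C (Y i) (Y (i + 1))"
        using conflationD(3) hom_Dom[OF ah[of i]] hom_Cod[OF bh[of "i + 1"]] True by simp
      have h: "b i : hom C (cob X i) (Y i)" "a i : hom C (Y i) (cob X (i + 1))" "b (i + 1) : hom C (cob X (i + 1)) (Y (i + 1))"
        "a (i + 1) : hom C (Y (i + 1)) (cob X (i + 2))" using ah[of i] ah[of "i + 1"] bh[of i] bh[of "i + 1"] True by (simp_all add: add.assoc)
      have "(a (i + 1) ** b (i + 1)) ** (a i ** b i) = a (i + 1) ** ((b (i + 1) ** a i) ** b i)"
        using assoc[OF comp[OF h(1,2)] h(3,4)] assoc[OF h(1,2,3)] by simp
      also have "\<dots> = Zero C (cob X i) (cob X (i + 2))"
        unfolding z using zero_left[OF h(1) hom_Ob2[OF h(3)]] zero_right[OF h(4) hom_Ob1[OF h(1)]] by simp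
      finally show ?thesis using dX[of i] dX[of "i + 1"] True by simp
    next
      case False
      then have "zero_object C (cob X (i + 2))" using Z(2) by (simp add: X_def)
      then show ?thesis using zero_object_hom'[OF _ comp[OF dh[of i] dh[of "i + 1"]]] by (simp add: add.assoc)
    qed
  qed (use cX dh in auto)
  moreover have "right_bounded_at C X 0" using Z(2) by (simp add: right_bounded_at_def X_def)
  moreover have "acyclic_below C E X 0 Y a b"
    unfolding acyclic_below_def
  proof (intro conjI allI impI)
    fix i :: int assume i: "i \<le> 0"
    show "(a (i - 1), b i) : E" "a (i - 1) : hom C (Y (i - 1)) (cob X i)" "b i : hom C (cob X i) (Y i)"
      using abE[OF i] bh[OF i] ah[of "i - 1"] i by simp_all
  qed (use dX in simp)
  moreover have "Y 0 = A" using kp(4) by (simp add: Y_def)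
  ultimately have "projective_resolution C E A (X, b 0)" unfolding projective_resolution_def by auto
  then show ?thesis by blast
qed

text \<open>Conflations are closed under isomorphism. The comparison maps are required only in
  degrees up to \<open>m\<close>, so the lemma applies to complexes that resemble each other in low
  degrees only.\<close>

lemma acyclic_transfer:
  assumes X: "cpl X" "cpl X'" and ac: "acyclic_below C E X m Y a b"
    and \<theta>: "\<And>i. i \<le> m ==> \<theta> i : hom C (cob X i) (cob X' i)" "\<And>i. i \<le> m ==> \<theta>' i : hom C (cob X' i) (cob X i)"
      "\<And>i. i \<le> m ==> \<theta>' i ** \<theta> i = Ident C (cob X i)" "\<And>i. i \<le> m ==> \<theta> i ** \<theta>' i = Ident C (cob X' i)"
      "\<And>i. i < m ==> \<theta> (i + 1) ** cdiff X i = cdiff X' i ** \<theta> i"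
  shows "acyclic_below C E X' m Y (\<lambda>i. \<theta> (i + 1) ** a i) (\<lambda>i. b i ** \<theta>' i)"
  unfolding acyclic_below_def
proof (intro conjI allI impI)
  note D = acyclicD[OF ac]
  fix i
  {
    assume i: "i \<le> m"
    have ob: "Y (i - 1) : Ob C" "Y i : Ob C" using hom_Ob1[OF D(2)[OF i]] hom_Ob2[OF D(3)[OF i]] by auto
    show 1: "\<theta> (i - 1 + 1) ** a (i - 1) : hom C (Y (i - 1)) (cob X' i)" using comp[OF D(2)[OF i] \<theta>(1)[OF i]] by simp
    show 2: "b i ** \<theta>' i : hom C (cob X' i) (Y i)" using comp[OF \<theta>(2)[OF i] D(3)[OF i]] .
    show "(\<theta> (i - 1 + 1) ** a (i - 1), b i ** \<theta>' i) : E"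
      by (rule conflation_iso[OF D(1)[OF i] D(2)[OF i] D(3)[OF i] 1 2 id_hom[OF ob(1)] \<theta>(1)[OF i] id_hom[OF ob(2)]
          iso_Ident[OF ob(1)] isoI[OF \<theta>(1)[OF i] \<theta>(2)[OF i] \<theta>(3)[OF i] \<theta>(4)[OF i]] iso_Ident[OF ob(2)]])
        (use id_right[OF comp[OF D(2)[OF i] \<theta>(1)[OF i]]] id_left[OF D(3)[OF i]] id_right[OF D(3)[OF i]]
          assoc[OF \<theta>(1)[OF i] \<theta>(2)[OF i] D(3)[OF i]] \<theta>(3)[OF i] in simp_all)
  }
  assume i: "i < m"
  then have i': "i \<le> m" "i + 1 \<le> m" by auto
  have d: "cdiff X' i : hom C (cob X' i) (cob X' (i + 1))" using cplD(1)[OF X(2)] .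
  have "cdiff X' i = (cdiff X' i ** \<theta> i) ** \<theta>' i"
    using assoc[OF \<theta>(2)[OF i'(1)] \<theta>(1)[OF i'(1)] d] \<theta>(4)[OF i'(1)] id_right[OF d] by simp
  also have "\<dots> = (\<theta> (i + 1) ** (a i ** b i)) ** \<theta>' i" using \<theta>(5)[OF i] D(4)[OF i] by simp
  also have "\<dots> = (\<theta> (i + 1) ** a i) ** (b i ** \<theta>' i)"
    using assoc[OF \<theta>(2)[OF i'(1)] comp[OF D(3)[OF i'(1)] D(6)[OF i]] \<theta>(1)[OF i'(2)]]
      assoc[OF \<theta>(2)[OF i'(1)] D(3)[OF i'(1)] D(6)[OF i]] assoc[OF comp[OF \<theta>(2)[OF i'(1)] D(3)[OF i'(1)]] D(6)[OF i] \<theta>(1)[OF i'(2)]] by simp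
  finally show "cdiff X' i = (\<theta> (i + 1) ** a i) ** (b i ** \<theta>' i)" .
qed

text \<open>The sign of the shifted differential is placed on the inflations; minus the identity on
  the kernel term shows that the new pairs are conflations again.\<close>

lemma acyclic_shift:
  assumes X: "cpl X" and ac: "acyclic_below C E X m Y a b"
  shows "acyclic_below C E (sh X) (m - 1) (\<lambda>i. Y (i + 1)) (\<lambda>i. Neg C (a (i + 1))) (\<lambda>i. b (i + 1))"
  unfolding acyclic_below_def
proof (intro conjI allI impI)
  note D = acyclicD[OF ac]
  fix i
  {
    assume "i \<le> m - 1"
    then have i: "i + 1 \<le> m" by simp
    have ix: "i - 1 + 1 = i" "i + 1 - 1 = i" by auto
    note D1 = D(1)[OF i, unfolded ix] and D2 = D(2)[OF i, unfolded ix] and D3 = D(3)[OF i]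
    have ob: "Y i : Ob C" "cob X (i + 1) : Ob C" "Y (i + 1) : Ob C" using hom_Ob1[OF D2] hom_Ob2[OF D2] hom_Ob2[OF D3] by auto
    note I = id_hom[OF ob(1)] id_hom[OF ob(2)] id_hom[OF ob(3)]
    show 1: "Neg C (a (i - 1 + 1)) : hom C (Y (i - 1 + 1)) (cob (sh X) i)" using neg_hom[OF D2] by (simp add: cob_shift)
    show 2: "b (i + 1) : hom C (cob (sh X) i) (Y (i + 1))" using D3 by (simp add: cob_shift)
    have ii: "Neg C (Ident C (Y i)) ** Neg C (Ident C (Y i)) = Ident C (Y i)" using Cmp_Neg_Neg[OF I(1,1)] Ident_pair[OF ob(1)] by simp
    have "(Neg C (a i), b (i + 1)) : E"
      by (rule conflation_iso[OF D1 D2 D3 neg_hom[OF D2] D3 neg_hom[OF I(1)] I(2,3) isoI[OF neg_hom[OF I(1)] neg_hom[OF I(1)] ii ii] iso_Ident[OF ob(2)] iso_Ident[OF ob(3)]])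
        (use Cmp_Neg_Neg[OF I(1) D2] id_left[OF D2] id_right[OF D2] id_left[OF D3] id_right[OF D3] in simp_all)
    then show "(Neg C (a (i - 1 + 1)), b (i + 1)) : E" unfolding ix .
  }
  assume "i < m - 1"
  then have i: "i + 1 < m" "i + 1 \<le> m" by auto
  show "cdiff (sh X) i = Neg C (a (i + 1)) ** b (i + 1)"
    using D(4)[OF i(1)] neg_left[OF D(3)[OF i(2)] D(6)[OF i(1)]] by (simp add: shift_cpx_def)
qed

lemma acyclic_zero:
  assumes X: "cpl X" and z: "\<And>i. i \<le> m ==> zero_object C (cob X i)"
  shows "\<exists>Y a b. acyclic_below C E X m Y a b"
proof -
  obtain Z where Z: "Z : Proj C E" "zero_object C Z" using P_zero by blast
  have ob: "Z : Ob C" "cob X i : Ob C" for i using Z Proj_Ob cpl_Ob[OF X] by auto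
  have "acyclic_below C E X m (\<lambda>_. Z) (\<lambda>i. Zero C Z (cob X (i + 1))) (\<lambda>i. Zero C (cob X i) Z)"
    unfolding acyclic_below_def
  proof (intro conjI allI impI)
    fix i assume i: "i \<le> m"
    show 1: "Zero C Z (cob X (i - 1 + 1)) : hom C Z (cob X i)" "Zero C (cob X i) Z : hom C (cob X i) Z"
      using zero_hom ob by auto
    show "(Zero C Z (cob X (i - 1 + 1)), Zero C (cob X i) Z) : E" by (rule zero_conflation[OF Z(2) z[OF i] Z(2) 1])
  next
    fix i assume i: "i < m"
    show "cdiff X i = Zero C Z (cob X (i + 1)) ** Zero C (cob X i) Z"
      using zero_object_hom[OF z cplD(1)[OF X]] i zero_left[OF zero_hom[OF ob(2) ob(1)] ob(2)] by simp
  qed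
  then show ?thesis by blast
qed

section \<open>Inflations and pushouts\<close>

lemma inflation_iso:
  assumes "inflation E i" "i : hom C A B" "b : hom C B B'" "iso C b" shows "inflation E (b ** i)"
proof -
  obtain p where p: "(i, p) : E" using assms(1) by (auto simp: inflation_def)
  note c = conflationD[OF p, unfolded hom_Dom[OF assms(2)] hom_Cod[OF assms(2)]]
  obtain b' where b': "b' : hom C B' B" "b' ** b = Ident C B" "b ** b' = Ident C B'" by (rule isoE[OF assms(4,3)])
  have ob: "A : Ob C" "Cod C p : Ob C" using hom_Ob1[OF assms(2)] hom_Ob2[OF c(2)] by auto
  have "(b ** i, p ** b') : E"
    by (rule conflation_iso[OF p assms(2) c(2) comp[OF assms(2,3)] comp[OF b'(1) c(2)] id_hom[OF ob(1)] assms(3) id_hom[OF ob(2)]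
        iso_Ident[OF ob(1)] assms(4) iso_Ident[OF ob(2)]])
      (use id_right[OF comp[OF assms(2,3)]] id_left[OF c(2)] assoc[OF assms(3) b'(1) c(2)] b' id_right[OF c(2)] in simp_all)
  then show ?thesis by (auto simp: inflation_def)
qed

lemma pushoutD:
  assumes po: "is_pushout C f g f' g'" and f: "f : hom C A B" and g: "g : hom C A B'"
  obtains W where "f' : hom C B' W" "g' : hom C B W" "g' ** f = f' ** g"
    "\<forall>V. \<forall>u\<in>hom C B V. \<forall>v\<in>hom C B' V. u ** f = v ** g \<longrightarrow> (\<exists>!w. w : hom C W V \<and> w ** g' = u \<and> w ** f' = v)"
proof (rule that[of "Cod C f'"])
  have d: "Cod C f = B" "Cod C g = B'" using f g by (simp_all add: hom_def)
  note po = po[unfolded is_pushout_def d]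
  show "f' : hom C B' (Cod C f')" "g' : hom C B (Cod C f')" "g' ** f = f' ** g" using po by (simp_all add: hom_def)
  show "\<forall>V. \<forall>u\<in>hom C B V. \<forall>v\<in>hom C B' V. u ** f = v ** g \<longrightarrow> (\<exists>!w. w : hom C (Cod C f') V \<and> w ** g' = u \<and> w ** f' = v)"
  proof (intro allI ballI impI)
    fix V u v assume u: "u : hom C B V" and v: "v : hom C B' V" and e: "u ** f = v ** g"
    have "\<forall>W\<in>Ob C. \<forall>u\<in>hom C B W. \<forall>v\<in>hom C B' W. u ** f = v ** g \<longrightarrow> (\<exists>!w. w : hom C (Cod C f') W \<and> w ** g' = u \<and> w ** f' = v)"
      using po by (elim conjE) assumption
    from this[THEN bspec, OF hom_Ob2[OF u], THEN bspec, OF u, THEN bspec, OF v] e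
    show "\<exists>!w. w : hom C (Cod C f') V \<and> w ** g' = u \<and> w ** f' = v" by (rule mp)
  qed
qed

lemma pushoutI:
  assumes "f : hom C A B" "g : hom C A B'" "f' : hom C B' W" "g' : hom C B W" "g' ** f = f' ** g"
    "\<And>V u v. u : hom C B V ==> v : hom C B' V ==> u ** f = v ** g ==> \<exists>w. w : hom C W V \<and> w ** g' = u \<and> w ** f' = v"
    "\<And>V w w'. w : hom C W V ==> w' : hom C W V ==> w ** g' = w' ** g' ==> w ** f' = w' ** f' ==> w = w'"
  shows "is_pushout C f g f' g'"
proof -
  have u: "\<exists>!w. w : hom C W V \<and> w ** g' = u \<and> w ** f' = v" if "u : hom C B V" "v : hom C B' V" "u ** f = v ** g" for V u v
  proof (rule ex_ex1I)
    show "\<exists>w. w : hom C W V \<and> w ** g' = u \<and> w ** f' = v" using assms(6)[OF that] .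
    fix w w' assume "w : hom C W V \<and> w ** g' = u \<and> w ** f' = v" "w' : hom C W V \<and> w' ** g' = u \<and> w' ** f' = v"
    then show "w = w'" using assms(7)[of w V w'] by simp
  qed
  have d: "Dom C f = A" "Cod C f = B" "Dom C g = A" "Cod C g = B'" "Dom C f' = B'" "Cod C f' = W" "Dom C g' = B" "Cod C g' = W"
    "f : Arr C" "g : Arr C" "f' : Arr C" "g' : Arr C"
    using assms(1-4) by (simp_all add: hom_def)
  show ?thesis unfolding is_pushout_def d by (intro conjI ballI impI refl d(9-12) assms(5) u)
qed

text \<open>The axiom provides one pushout along an inflation whose opposite leg is an inflation.
  Every other pushout is isomorphic to it, and inflations are stable under isomorphisms of the
  target.\<close>

lemma pushout_inflation:
  assumes po: "is_pushout C i f i' f'" and i: "inflation E i" shows "inflation E i'"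
proof -
  from po have fi: "f : Arr C" "Dom C f = Dom C i" by (simp_all add: is_pushout_def)
  obtain i1 f1 where p1: "is_pushout C i f i1 f1" "inflation E i1" using inflation_pushout[OF i fi] by blast
  have io: "i : hom C (Dom C i) (Cod C i)" "f : hom C (Dom C i) (Cod C f)" using po by (simp_all add: is_pushout_def hom_def)
  obtain W where h: "i' : hom C (Cod C f) W" "f' : hom C (Cod C i) W" "f' ** i = i' ** f"
    and u: "\<forall>V. \<forall>u\<in>hom C (Cod C i) V. \<forall>v\<in>hom C (Cod C f) V. u ** i = v ** f \<longrightarrow> (\<exists>!w. w : hom C W V \<and> w ** f' = u \<and> w ** i' = v)"
    by (rule pushoutD[OF po io])
  obtain W1 where h1: "i1 : hom C (Cod C f) W1" "f1 : hom C (Cod C i) W1" "f1 ** i = i1 ** f"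
    and u1: "\<forall>V. \<forall>u\<in>hom C (Cod C i) V. \<forall>v\<in>hom C (Cod C f) V. u ** i = v ** f \<longrightarrow> (\<exists>!w. w : hom C W1 V \<and> w ** f1 = u \<and> w ** i1 = v)"
    by (rule pushoutD[OF p1(1) io])
  note u = u[rule_format] and u1 = u1[rule_format]
  obtain w where w: "w : hom C W1 W" "w ** f1 = f'" "w ** i1 = i'" using u1[OF h(2,1,3)] by blast
  obtain v where v: "v : hom C W W1" "v ** f' = f1" "v ** i' = i1" using u[OF h1(2,1,3)] by blast
  have W: "W : Ob C" "W1 : Ob C" using hom_Ob1[OF v(1)] hom_Ob2[OF v(1)] by auto
  have "v ** w = Ident C W1"
  proof -
    have "v ** w : hom C W1 W1 \<and> (v ** w) ** f1 = f1 \<and> (v ** w) ** i1 = i1"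
      using comp[OF w(1) v(1)] assoc[OF h1(2) w(1) v(1)] assoc[OF h1(1) w(1) v(1)] w v by simp
    moreover have "Ident C W1 : hom C W1 W1 \<and> Ident C W1 ** f1 = f1 \<and> Ident C W1 ** i1 = i1"
      using id_hom[OF W(2)] id_left h1 by blast
    ultimately show ?thesis using u1[OF h1(2,1,3)] by blast
  qed
  moreover have "w ** v = Ident C W"
  proof -
    have "w ** v : hom C W W \<and> (w ** v) ** f' = f' \<and> (w ** v) ** i' = i'"
      using comp[OF v(1) w(1)] assoc[OF h(2) v(1) w(1)] assoc[OF h(1) v(1) w(1)] w v by simp
    moreover have "Ident C W : hom C W W \<and> Ident C W ** f' = f' \<and> Ident C W ** i' = i'"
      using id_hom[OF W(1)] id_left h by blast
    ultimately show ?thesis using u[OF h(2,1,3)] by blast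
  qed
  ultimately have "iso C w" using isoI[OF w(1) v(1)] by blast
  then show ?thesis using inflation_iso[OF p1(2) h1(1) w(1)] w(3) by simp
qed

lemma biproduct_copair:
  assumes "biproduct C A B W i j p q" "x : hom C A X" "y : hom C B X"
  shows "(x ** p) \<oplus> (y ** q) : hom C W X" "((x ** p) \<oplus> (y ** q)) ** i = x" "((x ** p) \<oplus> (y ** q)) ** j = y"
proof -
  note h = biproductD[OF assms(1)]
  note xp = comp[OF h(3) assms(2)] and yq = comp[OF h(4) assms(3)]
  show "(x ** p) \<oplus> (y ** q) : hom C W X" using add_hom[OF xp yq] .
  show "((x ** p) \<oplus> (y ** q)) ** i = x"
    using add_left[OF h(1) xp yq] assoc[OF h(1,3) assms(2)] assoc[OF h(1,4) assms(3)] h(5,8)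
      id_right[OF assms(2)] zero_right[OF assms(3) hom_Ob1[OF h(1)]] Add_Zero[OF assms(2)] by simp
  show "((x ** p) \<oplus> (y ** q)) ** j = y"
    using add_left[OF h(2) xp yq] assoc[OF h(2,3) assms(2)] assoc[OF h(2,4) assms(3)] h(6,7)
      id_right[OF assms(3)] zero_right[OF assms(2) hom_Ob1[OF h(2)]] Zero_Add[OF assms(3)] by simp
qed

lemma biproduct_coext:
  assumes "biproduct C A B W i j p q" "u : hom C W X" "v : hom C W X" "u ** i = v ** i" "u ** j = v ** j"
  shows "u = v"
proof -
  note h = biproductD[OF assms(1)]
  have *: "w = ((w ** i) ** p) \<oplus> ((w ** j) ** q)" if "w : hom C W X" for w
    using add_right[OF comp[OF h(3,1)] comp[OF h(4,2)] that] h(9) id_right[OF that]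
      assoc[OF h(3,1) that] assoc[OF h(4,2) that] by simp
  show ?thesis using *[OF assms(2)] *[OF assms(3)] assms(4,5) by simp
qed

text \<open>The identity of \<open>B\<close> is a deflation, and its kernel is a zero object; so the
  map from zero to \<open>B\<close> is an inflation. The inclusion \<open>i\<close> is its pushout
  along the map from zero to \<open>A\<close>.\<close>

lemma split_inflation:
  assumes b: "biproduct C A B W i j p q" shows "inflation E i"
proof -
  note h = biproductD[OF b]
  have B: "B : Ob C" "A : Ob C" using hom_Ob1[OF h(1)] hom_Ob1[OF h(2)] by auto
  note I = id_hom[OF B(1)]
  obtain z where z: "(z, Ident C B) : E" using deflation_Ident[OF B(1)] by (auto simp: deflation_def)
  note c = conflationD[OF z]
  have zB: "z : hom C (Dom C z) B" using c(1,2) I by (auto simp: hom_def)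
  let ?Z = "Dom C z"
  have Z: "?Z : Ob C" using hom_Ob1[OF zB] .
  have "z = Zero C ?Z B" using c(3) id_left[OF zB] hom_Cod[OF I] by simp
  then have "z ** Ident C ?Z = z ** Zero C ?Z ?Z" using id_right[OF zB] zero_right[OF zB Z] by simp
  then have "Ident C ?Z = Zero C ?Z ?Z" using inflation_mono[OF z zB id_hom[OF Z] zero_hom[OF Z Z]] by blast
  then have zo: "zero_object C ?Z" using zero_objectI[OF Z] by blast
  have zA: "Zero C ?Z A : hom C ?Z A" using zero_hom[OF Z B(2)] .
  have "is_pushout C z (Zero C ?Z A) i j"
  proof (rule pushoutI[OF zB zA h(1,2)])
    show "j ** z = i ** Zero C ?Z A"
      using zero_object_hom[OF zo comp[OF zB h(2)]] zero_object_hom[OF zo comp[OF zA h(1)]] by simp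
    fix V u v assume uv: "u : hom C B V" "v : hom C A V"
    show "\<exists>w. w : hom C W V \<and> w ** j = u \<and> w ** i = v"
      using biproduct_copair[OF b uv(2,1)] by blast
  next
    fix V w w' assume "w : hom C W V" "w' : hom C W V" "w ** j = w' ** j" "w ** i = w' ** i"
    then show "w = w'" using biproduct_coext[OF b] by blast
  qed
  then show ?thesis by (rule pushout_inflation) (use z in \<open>auto simp: inflation_def\<close>)
qed

text \<open>
  The map with components \<open>c\<close> and \<open>\<iota>\<close> is the composite of the split inflation \<open>A \<rightarrow> A \<oplus> B\<close>, a shear
  of \<open>A \<oplus> B\<close>, and \<open>\<iota> \<oplus> 1\<close>, which is a pushout of \<open>\<iota>\<close>.
\<close>

lemma inflation_pair:
  assumes \<iota>: "inflation E \<iota>" "\<iota> : hom C A I" and c: "c : hom C A B" and b: "biproduct C B I W j k p q"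
  shows "inflation E ((j ** c) \<oplus> (k ** \<iota>))"
proof -
  note h = biproductD[OF b]
  have ob: "A : Ob C" "B : Ob C" using hom_Ob1[OF c] hom_Ob2[OF c] by auto
  obtain V ka jb qa pb where bV: "biproduct C A B V ka jb qa pb" using ex_biproduct[OF ob] by blast
  note g = biproductD[OF bV]
  have V: "V : Ob C" using hom_Ob2[OF g(1)] .
  let ?n = "jb ** (c ** qa)"
  have cq: "c ** qa : hom C V B" and n: "?n : hom C V V" using comp[OF g(3) c] comp[OF comp[OF g(3) c] g(2)] .
  note I = id_hom[OF V]
  note sh = add_hom[OF I n]
  have "?n ** ?n = jb ** (c ** ((qa ** jb) ** (c ** qa)))"
    using assoc[OF cq g(2,3)] assoc[OF n cq g(2)] assoc[OF n g(3) c] by simp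
  then have "?n ** ?n = Zero C V V"
    using g(7) zero_left[OF cq ob(1)] zero_right[OF c V] zero_right[OF g(2) V] by simp
  then have "iso C (Ident C V \<oplus> ?n)" by (rule iso_one_plus_square_zero[OF n])
  then have 1: "inflation E ((Ident C V \<oplus> ?n) ** ka)" using inflation_iso[OF split_inflation[OF bV] g(1) sh] by blast
  have nk: "(Ident C V \<oplus> ?n) ** ka : hom C A V" using comp[OF g(1) sh] .
  have k\<iota>: "k ** \<iota> : hom C A W" using comp[OF \<iota>(2) h(2)] .
  note t = biproduct_copair[OF bV k\<iota> h(1)]
  let ?t = "(k ** \<iota> ** qa) \<oplus> (j ** pb)"
  have "is_pushout C \<iota> ka ?t k"
  proof (rule pushoutI[OF \<iota>(2) g(1) t(1) h(2) t(2)[symmetric]])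
    fix X u v assume u: "u : hom C I X" and v: "v : hom C V X" and e: "u ** \<iota> = v ** ka"
    have vj: "v ** jb : hom C B X" using comp[OF g(2) v] .
    let ?w = "((v ** jb) ** p) \<oplus> (u ** q)"
    note w = biproduct_copair[OF b vj u]
    have "?w ** ?t = v"
    proof (rule biproduct_coext[OF bV comp[OF t(1) w(1)] v])
      show "?w ** ?t ** ka = v ** ka"
        using assoc[OF g(1) t(1) w(1)] t(2) assoc[OF \<iota>(2) h(2) w(1)] w(3) e by simp
      show "?w ** ?t ** jb = v ** jb" using assoc[OF g(2) t(1) w(1)] t(3) w(2) by simp
    qed
    then show "\<exists>w. w : hom C W X \<and> w ** k = u \<and> w ** ?t = v" using w by blast
  next
    fix X w w' assume w: "w : hom C W X" "w' : hom C W X" "w ** k = w' ** k" "w ** ?t = w' ** ?t"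
    have "w ** j = w' ** j" using w(4) assoc[OF g(2) t(1) w(1)] assoc[OF g(2) t(1) w(2)] t(3) by simp
    then show "w = w'" using biproduct_coext[OF b w(1,2)] w(3) by blast
  qed
  then have 2: "inflation E ?t" using pushout_inflation \<iota>(1) by blast
  have "inflation E (?t ** ((Ident C V \<oplus> ?n) ** ka))"
    using inflation_Cmp[OF 1 2] hom_Cod[OF nk] hom_Dom[OF t(1)] by simp
  moreover have "?t ** ((Ident C V \<oplus> ?n) ** ka) = (j ** c) \<oplus> (k ** \<iota>)"
  proof -
    have nka: "?n ** ka = jb ** c"
      using assoc[OF g(1) cq g(2)] assoc[OF g(1,3) c] g(5) id_right[OF c] by simp
    have jc: "jb ** c : hom C A V" using comp[OF c g(2)] .
    have "(Ident C V \<oplus> ?n) ** ka = ka \<oplus> (jb ** c)"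
      using add_left[OF g(1) I n] nka id_left[OF g(1)] by simp
    then show ?thesis
      using add_right[OF g(1) jc t(1)] t(2) assoc[OF c g(2) t(1)] t(3) Add_commute[OF k\<iota> comp[OF c h(1)]] by simp
  qed
  ultimately show ?thesis by simp
qed

text \<open>A cokernel of \<open>i\<close> is isomorphic to the deflation paired with
  \<open>i\<close>, and conflations are closed under isomorphism.\<close>

lemma inflation_cokernel:
  assumes i: "inflation E i" "i : hom C A B" and c: "c : hom C B D" "c ** i = Zero C A D"
    and u: "\<And>V g. g : hom C B V ==> g ** i = Zero C A V ==> \<exists>u\<in>hom C D V. u ** c = g"
    and epi: "\<And>V u v. u : hom C D V ==> v : hom C D V ==> u ** c = v ** c ==> u = v"
  shows "(i, c) : E"
proof -
  obtain p where p: "(i, p) : E" using i by (auto simp: inflation_def)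
  note d = conflationD[OF p, unfolded hom_Dom[OF i(2)] hom_Cod[OF i(2)]]
  obtain v where v: "v : hom C (Cod C p) D" "v ** p = c" using conflation_cokernel[OF p i(2) d(2) c] by blast
  obtain w where w: "w : hom C D (Cod C p)" "w ** c = p" using u[OF d(2,3)] by blast
  have ob: "A : Ob C" "B : Ob C" "D : Ob C" "Cod C p : Ob C" using hom_Ob1 hom_Ob2 i(2) c(1) d(2) by blast+
  have "w ** v = Ident C (Cod C p)"
    by (rule deflation_epi[OF p d(2) comp[OF v(1) w(1)] id_hom[OF ob(4)]])
      (use assoc[OF d(2) v(1) w(1)] v w id_left[OF d(2)] in simp)
  moreover have "v ** w = Ident C D"
    by (rule epi[OF comp[OF w(1) v(1)] id_hom[OF ob(3)]])
      (use assoc[OF c(1) w(1) v(1)] v w id_left[OF c(1)] in simp)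
  ultimately have "iso C v" using isoI[OF v(1) w(1)] by blast
  then show ?thesis
    by (intro conflation_iso[OF p i(2) d(2) i(2) c(1) id_hom[OF ob(1)] id_hom[OF ob(2)] v(1) iso_Ident[OF ob(1)] iso_Ident[OF ob(2)]])
      (use id_left[OF i(2)] id_right[OF i(2)] v id_right[OF c(1)] in simp_all)
qed

end

section \<open>The decomposition\<close>

context triangulated
begin

lemma hom_zero_middle:
  assumes t: "(f, g, h) : Tri T" "f : hom T X Y" "g : hom T Y Z" and W: "W : Ob T"
    and z: "hom T W X = {Zero T W X}" "hom T W Z = {Zero T W Z}"
  shows "hom T W Y = {Zero T W Y}"
proof -
  have "u = Zero T W Y" if u: "u : hom T W Y" for u
  proof -
    have "g ** u = Zero T W Z" using comp[OF u t(3)] z(2) by blast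
    then obtain v where v: "v : hom T W X" "u = f ** v" using Tri_kernel[OF t u] by blast
    then have "v = Zero T W X" using z(1) by blast
    then show ?thesis using v zero_right[OF t(2) W] by simp
  qed
  then show ?thesis using zero_hom[OF W hom_Ob2[OF t(2)]] by blast
qed

lemma hom_zero_middle':
  assumes t: "(f, g, h) : Tri T" "f : hom T X Y" "g : hom T Y Z" and W: "W : Ob T"
    and z: "hom T X W = {Zero T X W}" "hom T Z W = {Zero T Z W}"
  shows "hom T Y W = {Zero T Y W}"
proof -
  have "u = Zero T Y W" if u: "u : hom T Y W" for u
  proof -
    have "u ** f = Zero T X W" using comp[OF t(2) u] z(1) by blast
    then obtain v where v: "v : hom T Z W" "u = v ** g" using Tri_cokernel[OF t u] by blast
    then have "v = Zero T Z W" using z(2) by blast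
    then show ?thesis using v zero_left[OF t(3) W] by simp
  qed
  then show ?thesis using zero_hom[OF hom_Ob1[OF t(3)] W] hom_Ob2[OF t(2)] zero_hom[OF hom_Ob2[OF t(2)] W] by blast
qed

end

context complexes
begin

lemma split_triangle_chain:
  assumes c: "cpl X" "cpl Y" "cpl Z" and k: "chain_map C X Y k" and p: "chain_map C Y Z p"
    and b: "\<And>i. biproduct C (cob Z i) (cob X i) (cob Y i) (j i) (k i) (p i) (q i)"
  shows "\<exists>h. (cl X Y (gm X Y k), cl Y Z (gm Y Z p), h) : Tri K"
proof -
  have f: "fm Z Y j" "fm X Y k" "fm Y Z p" "fm Y X q"
    using b by (simp_all add: fam_def biproduct_def)
  have "bip (cob Z) (cob X) (cob Y) (gm Z Y j) (gm X Y k) (gm Y Z p) (gm Y X q)"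
    using bip_gr[OF f] b by blast
  then show ?thesis
    using split_triangle[OF c] chm_df[of "gm X Y k" X Y] chm_df[of "gm Y Z p" Y Z]
      chm_iff[OF c(1,2), of k] chm_iff[OF c(2,3), of p] k p by simp
qed

text \<open>Brutal truncation: the terms in degrees \<open>\<ge> n\<close> form a subcomplex
  \<open>V\<close>, the others the quotient \<open>W\<close>, and the sequence splits in each
  degree. The terms of both parts are recorded as equalities, so that the conflations of
  \<open>X\<close> serve for \<open>W\<close> unchanged.\<close>

lemma truncation_triangle:
  assumes X: "cpl X"
  shows "\<exists>V W k p h. cpl V \<and> cpl W \<and> supp V {n..} \<and> supp W {..<n} \<and> (\<forall>i\<ge>n. cob V i = cob X i) \<and> (\<forall>i<n. cob W i = cob X i) \<and>
    (\<forall>i. i + 1 < n \<longrightarrow> cdiff W i = cdiff X i) \<and> k : hom K V X \<and> p : hom K X W \<and> (k, p, h) : Tri K"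
proof -
  obtain Z where Z: "Z : P" "zero_object C Z" using P_zero by blast
  have ZO: "Z : Ob C" using Z P_Ob by blast
  note O = cpl_Ob[OF X] and d = cplD[OF X]
  define V where "V = \<lparr>cob = (\<lambda>i. if n \<le> i then cob X i else Z),
    cdiff = (\<lambda>i. if n \<le> i then cdiff X i else Zero C Z (if n \<le> i + 1 then cob X (i + 1) else Z))\<rparr>"
  \<comment> \<open>The differential out of degree \<open>n - 1\<close> leaves the range of
    \<open>W\<close> and is cut off, hence the condition \<open>i + 1 < n\<close>.\<close>
  define W where "W = \<lparr>cob = (\<lambda>i. if n \<le> i then Z else cob X i),
    cdiff = (\<lambda>i. if i + 1 < n then cdiff X i else Zero C (if n \<le> i then Z else cob X i) Z)\<rparr>"
  define k where "k i = (if n \<le> i then Ident C (cob X i) else Zero C Z (cob X i))" for i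
  define q where "q i = (if n \<le> i then Ident C (cob X i) else Zero C (cob X i) Z)" for i
  define j where "j i = (if n \<le> i then Zero C Z (cob X i) else Ident C (cob X i))" for i
  define p where "p i = (if n \<le> i then Zero C (cob X i) Z else Ident C (cob X i))" for i
  note z = zero_hom zero_left[OF zero_hom[OF _ ZO]] zero_right[OF zero_hom[OF ZO] ZO] zero_left[OF d(1)] zero_right[OF d(1)] zero_left[OF d(1)[of "i + 1" for i], unfolded add.assoc one_add_one]
     zero_right[OF d(1)[of "i + 1" for i], unfolded add.assoc one_add_one] O ZO id_left[OF d(1)] id_right[OF d(1)] id_left[OF zero_hom[OF ZO O]] id_right[OF zero_hom[OF O ZO]] id_hom
  have c: "cpl V" "cpl W" using Z cpl_P[OF X] d z by (auto simp: is_complex_def V_def W_def)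
  have m: "chain_map C V X k" "chain_map C X W p" using z d by (auto simp: chain_map_def V_def W_def k_def p_def)
  have "biproduct C (cob W i) (cob V i) (cob X i) (j i) (k i) (p i) (q i)" for i
    using biproduct_zero_left[OF Z(2) O] biproduct_zero_right[OF Z(2) O] by (simp add: V_def W_def j_def k_def p_def q_def)
  then obtain h where "(cl V X (gm V X k), cl X W (gm X W p), h) : Tri K" using split_triangle_chain[OF c(1) X c(2) m] by blast
  moreover have "supp V {n..}" "supp W {..<n}" "\<forall>i\<ge>n. cob V i = cob X i" "\<forall>i<n. cob W i = cob X i" "\<forall>i. i + 1 < n \<longrightarrow> cdiff W i = cdiff X i"
    using Z(2) by (simp_all add: supp_def V_def W_def)
  ultimately show ?thesis using c chain_map_arr[OF c(1) X m(1)] chain_map_arr[OF X c(2) m(2)] by blast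
qed

lemma extension_components:
  assumes r: "rcone (unshift_cpx C Z) X a Y j k p q" and Z: "cpl Z"
  obtains j' k' p' q' where "\<forall>i. biproduct C (cob Z i) (cob X i) (cob Y i) (j' i) (k' i) (p' i) (q' i)"
    "chain_map C X Y k'" "chain_map C Y Z p'"
proof -
  have b: "bip (cob Z) (cob X) (cob Y) j k p q" using rconeD(5)[OF r] shift_unshift[OF Z] by simp
  have m: "k : chm X Y" "p : chm Y Z" using rconeD(6,7)[OF r] shift_unshift[OF Z] by simp_all
  show thesis
  proof (rule bipE[OF b])
    fix j' k' p' q'
    assume h: "\<And>i. biproduct C (cob Z i) (cob X i) (cob Y i) (j' i) (k' i) (p' i) (q' i)"
      and f: "fm X Y k'" "fm Y Z p'" "k = gm X Y k'" "p = gm Y Z p'"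
    have "chain_map C X Y k'" "chain_map C Y Z p'"
      using chm_iff[OF rconeD(2,3)[OF r]] chm_iff[OF rconeD(3)[OF r] Z] f m by simp_all
    then show thesis using that h by blast
  qed
qed

end

context additive_category
begin

lemma biproduct_zero_iso:
  assumes b: "biproduct C A B W i j p q"
  shows "zero_object C B ==> i ** p = Ident C W" "zero_object C A ==> j ** q = Ident C W"
proof -
  note h = biproductD(1-4,9)[OF b]
  have W: "W : Ob C" using hom_Ob2[OF h(1)] .
  show "i ** p = Ident C W" if "zero_object C B"
    using h(5) zero_object_hom[OF that h(2)] zero_left[OF h(4) W] Add_Zero[OF comp[OF h(3,1)]] by simp
  show "j ** q = Ident C W" if "zero_object C A"
    using h(5) zero_object_hom[OF that h(1)] zero_left[OF h(3) W] Zero_Add[OF comp[OF h(4,2)]] by simp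
qed

end

section \<open>Closure of the subcategories under shifts and extensions\<close>

context exact_category
begin

definition eventually_acyclic :: "('o, 'm) cpx set" where
  "eventually_acyclic = {X. (\<exists>n. right_bounded_at C X n) \<and> (\<exists>m Y a b. acyclic_below C E X m Y a b)}"

abbreviation "Kbd \<equiv> isoc {X. bounded_cpx C X}"
abbreviation "Kmb \<equiv> isoc eventually_acyclic"

lemma eventually_acyclicI: "right_bounded_at C X n ==> acyclic_below C E X m Y a b ==> X : eventually_acyclic"
  unfolding eventually_acyclic_def by blast

lemma bounded_eventually_acyclic:
  assumes "cpl X" "bounded_cpx C X" shows "X : eventually_acyclic"
proof -
  obtain l n where s: "supp X {l..n}" using assms(2) bounded_iff by blast
  have "\<exists>Y a b. acyclic_below C E X (l - 1) Y a b" by (rule acyclic_zero[OF assms(1)]) (use s in \<open>simp add: supp_def\<close>)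
  moreover have "right_bounded_at C X n" using s by (simp add: supp_def right_bounded_at_def)
  ultimately show ?thesis using eventually_acyclicI by blast
qed

lemma right_bounded_mono: "right_bounded_at C X n ==> n \<le> n' ==> right_bounded_at C X n'"
  by (auto simp: right_bounded_at_def)

lemma right_bounded_supp: "right_bounded_at C X n \<longleftrightarrow> supp X {..n}"
  by (auto simp: right_bounded_at_def supp_def)

lemma right_bounded_extension:
  assumes r: "rcone (unshift_cpx C Z) X a Y j k p q" and Z: "cpl Z"
    and n: "right_bounded_at C X n" "right_bounded_at C Z n'"
  shows "right_bounded_at C Y (max n n')"
  using supp_extension[OF r Z, of "{..max n n'}"] right_bounded_mono[OF n(1)] right_bounded_mono[OF n(2)]
  unfolding right_bounded_supp by simp

text \<open>Below the support of \<open>X\<close> the projection to \<open>Z\<close> is an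
  isomorphism in each degree, and the conflations of \<open>Z\<close> are carried over along
  it.\<close>

lemma eventually_acyclic_extension_left:
  assumes r: "rcone (unshift_cpx C Z) X a Y j k p q" and Z: "cpl Z" "Z : eventually_acyclic" and X: "bounded_cpx C X"
  shows "Y : eventually_acyclic"
proof -
  obtain l n where s: "supp X {l..n}" using X bounded_iff by blast
  obtain n' m V c d where n': "right_bounded_at C Z n'" and m: "acyclic_below C E Z m V c d"
    using Z(2) unfolding eventually_acyclic_def by blast
  have "right_bounded_at C X n" using s by (simp add: supp_def right_bounded_at_def)
  then have rb: "right_bounded_at C Y (max n n')" using right_bounded_extension[OF r Z(1)] n' by blast
  have cX: "cpl X" "cpl Y" using rconeD[OF r] by auto
  obtain j' k' p' q' where b: "\<forall>i. biproduct C (cob Z i) (cob X i) (cob Y i) (j' i) (k' i) (p' i) (q' i)" and p: "chain_map C Y Z p'"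
    by (rule extension_components[OF r Z(1)])
  define m' where "m' = min m (l - 1)"
  have ac: "acyclic_below C E Z m' V c d" using acyclic_mono[OF m] by (simp add: m'_def)
  have z: "zero_object C (cob X i)" if "i \<le> m'" for i using that s by (simp add: m'_def supp_def)
  have h: "j' i : hom C (cob Z i) (cob Y i)" "p' i : hom C (cob Y i) (cob Z i)" "p' i ** j' i = Ident C (cob Z i)" for i
    using b by (simp_all add: biproduct_def)
  have i: "j' i ** p' i = Ident C (cob Y i)" if "i \<le> m'" for i using biproduct_zero_iso(1)[OF b[rule_format, of i] z[OF that]] .
  \<comment> \<open>Only the projection \<open>p'\<close> is known to be a chain map;
    \<open>j'\<close> commutes with the differentials in the range where it is inverse to
    \<open>p'\<close>.\<close>
  have "j' (i + 1) ** cdiff Z i = cdiff Y i ** j' i" if "i < m'" for i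
  proof -
    have "p' (i + 1) ** cdiff Y i = cdiff Z i ** p' i" using p by (simp add: chain_map_def)
    then show ?thesis
      using iso_square[OF cplD(1)[OF cX(2), of i] cplD(1)[OF Z(1), of i] h(2) h(2) _ h(1) h(1) i h(3)] that by simp
  qed
  then have "acyclic_below C E Y m' V (\<lambda>i. j' (i + 1) ** c i) (\<lambda>i. d i ** p' i)"
    by (intro acyclic_transfer[OF Z(1) cX(2) ac]) (use h i in auto)
  then show ?thesis using eventually_acyclicI[OF rb] by blast
qed

lemma eventually_acyclic_extension_right:
  assumes r: "rcone (unshift_cpx C Z) X a Y j k p q" and Z: "cpl Z" "bounded_cpx C Z" and X: "X : eventually_acyclic"
  shows "Y : eventually_acyclic"
proof -
  obtain l n where s: "supp Z {l..n}" using Z(2) bounded_iff by blast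
  obtain n' m V c d where n': "right_bounded_at C X n'" and m: "acyclic_below C E X m V c d"
    using X unfolding eventually_acyclic_def by blast
  have "right_bounded_at C Z n" using s by (simp add: supp_def right_bounded_at_def)
  then have rb: "right_bounded_at C Y (max n' n)" using right_bounded_extension[OF r Z(1)] n' by blast
  have cX: "cpl X" "cpl Y" using rconeD[OF r] by auto
  obtain j' k' p' q' where b: "\<forall>i. biproduct C (cob Z i) (cob X i) (cob Y i) (j' i) (k' i) (p' i) (q' i)" and k: "chain_map C X Y k'"
    by (rule extension_components[OF r Z(1)])
  define m' where "m' = min m (l - 1)"
  have ac: "acyclic_below C E X m' V c d" using acyclic_mono[OF m] by (simp add: m'_def)
  have z: "zero_object C (cob Z i)" if "i \<le> m'" for i using that s by (simp add: m'_def supp_def)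
  have h: "k' i : hom C (cob X i) (cob Y i)" "q' i : hom C (cob Y i) (cob X i)" "q' i ** k' i = Ident C (cob X i)" for i
    using b by (simp_all add: biproduct_def)
  have i: "k' i ** q' i = Ident C (cob Y i)" if "i \<le> m'" for i using biproduct_zero_iso(2)[OF b[rule_format, of i] z[OF that]] .
  have "acyclic_below C E Y m' V (\<lambda>i. k' (i + 1) ** c i) (\<lambda>i. d i ** q' i)"
    by (rule acyclic_transfer[OF cX ac]) (use h i k in \<open>auto simp: chain_map_def\<close>)
  then show ?thesis using eventually_acyclicI[OF rb] by blast
qed

lemma eventually_acyclic_shift:
  assumes "cpl X" "X : eventually_acyclic" shows "sh X : eventually_acyclic"
proof -
  obtain n m Y a b where n: "right_bounded_at C X n" and m: "acyclic_below C E X m Y a b"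
    using assms(2) unfolding eventually_acyclic_def by blast
  have "right_bounded_at C (sh X) (n - 1)" using n by (simp add: right_bounded_at_def cob_shift)
  then show ?thesis using eventually_acyclicI acyclic_shift[OF assms(1) m] by blast
qed

definition negs :: "('o, 'm) cpx set" where "negs = {X. bounded_cpx C X \<and> supp X {..<0}}"
definition poss :: "('o, 'm) cpx set" where "poss = {X. bounded_cpx C X \<and> supp X {0<..}}"
definition resolutions :: "('o, 'm) cpx set" where
  "resolutions = {X. right_bounded_at C X 0 \<and> (\<exists>Y a b. acyclic_below C E X 0 Y a b)}"

text \<open>Right boundedness persists for larger bounds and acyclicity for smaller ones. So both
  bounds in \<open>KF\<close> may be taken to be 0, which is the form of
  \<open>resolutions\<close>.\<close>

lemma subcategories:
  "KP C E = K" "Kminusb C E = Kmb" "Kb C E = Kbd"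
  "Kneg C E = isoc negs" "Kpos C E = isoc poss" "KF C E = isoc resolutions"
proof -
  show K: "KP C E = K" by (simp add: KP_def)
  show "Kminusb C E = Kmb" "Kb C E = Kbd"
    "Kneg C E = isoc negs" "Kpos C E = isoc poss"
    unfolding Kminusb_def Kb_def Kneg_def Kpos_def K isoc_def
    by (rule arg_cong[of _ _ "iso_closure K"]; auto simp: eventually_acyclic_def negs_def poss_def supp_def not_le not_less)+
  show "KF C E = isoc resolutions"
    unfolding KF_def K isoc_def resolutions_def
    using right_bounded_mono[of _ _ 0] acyclic_mono[of _ _ _ _ _ 0]
    by (intro arg_cong[of _ _ "iso_closure K"]) (auto simp del: add_uminus_conv_diff; blast)
qed

lemma bounded_extension:
  assumes r: "rcone (unshift_cpx C Z) X a Y j k p q" and Z: "cpl Z" "bounded_cpx C Z" and X: "bounded_cpx C X"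
  shows "bounded_cpx C Y"
proof -
  obtain l n l' n' where s: "supp X {l..n}" "supp Z {l'..n'}" using X Z(2) unfolding bounded_iff by blast
  have "supp Y {min l l'..max n n'}"
    by (rule supp_extension[OF r Z(1) supp_mono[OF s(1)] supp_mono[OF s(2)]]) auto
  then show ?thesis unfolding bounded_iff by blast
qed

lemma bounded_shift: "bounded_cpx C X ==> bounded_cpx C (sh X)"
  and bounded_unshift: "bounded_cpx C X ==> bounded_cpx C (unshift_cpx C X)"
proof -
  assume "bounded_cpx C X"
  then obtain l n where s: "supp X {l..n}" unfolding bounded_iff by blast
  have "supp (sh X) {l - 1..n - 1}" "supp (unshift_cpx C X) {l + 1..n + 1}"
    using supp_mono[OF supp_shift[OF s], of "{l - 1..n - 1}"] supp_mono[OF supp_unshift[OF s], of "{l + 1..n + 1}"] by (auto simp: subset_iff)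
  then show "bounded_cpx C (sh X)" "bounded_cpx C (unshift_cpx C X)" unfolding bounded_iff by blast+
qed

lemma isoc_zero_object:
  assumes z: "zero_object K X" and A: "\<And>Z. cpl Z ==> (\<And>i. zero_object C (cob Z i)) ==> Z : A" shows "X : isoc A"
proof -
  obtain Z where Z: "cpl Z" "\<And>i. zero_object C (cob Z i)" by (rule zero_cpl) blast
  have "hom K Z Z = {Zero K Z Z}" by (rule hom_disjoint_supp[OF Z(1) Z(1), of "{}" "{}"]) (use Z(2) in \<open>auto simp: supp_def\<close>)
  then have "zero_object K Z" using K.zero_objectI[of Z] K.id_hom[of Z] Z(1) by auto
  then have "isomorphic K X Z" using K.zero_object_isomorphic z by blast
  then show ?thesis using A[OF Z] Z(1) isoc_iff by blast
qed

sublocale V: verdier_setting K std "Kmb" "Kbd"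
proof
  show "Kbd \<subseteq> Kmb"
    unfolding isoc_iff subset_iff using bounded_eventually_acyclic by blast
  show "Kmb \<subseteq> Ob K" using isoc_cpl by auto
  show "ShOb K X : Kmb" if "X : Kmb" for X
    using isoc_shift[OF that] eventually_acyclic_shift by simp
  show "X : Kbd" if "isomorphic K X Y" "Y : Kbd" for X Y
    using isoc_closed that by blast
  show "X : Kbd" if "zero_object K X" for X
    by (rule isoc_zero_object[OF that]) (simp add: bounded_cpx_def)
  show "ShOb K X : Kbd" if "X : Kbd" for X
    using isoc_shift[OF that] bounded_shift by simp
  show "X : Kbd" if "X : Ob K" "ShOb K X : Kbd" for X
    using isoc_unshift[of X "Collect (bounded_cpx C)" "Collect (bounded_cpx C)"] that bounded_unshift by simp
  show "Cod K f : Kbd"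
    if "(f, g, h) : Tri K" "Dom K f : Kbd" "Cod K g : Kbd" for f g h
    by (rule isoc_extension[OF that]) (use bounded_extension in \<open>simp\<close>)
  show "Cod K f : Kmb"
    if "(f, g, h) : Tri K" "Dom K f : Kbd" "Cod K g : Kmb" for f g h
    by (rule isoc_extension[OF that]) (use eventually_acyclic_extension_left in \<open>simp\<close>)
qed

end

section \<open>Orthogonality and the triangles of the decomposition\<close>

context frobenius_category
begin

text \<open>An arrow on \<open>cob X l\<close> that kills the incoming differential factors through
  the deflation \<open>b l\<close>. As \<open>cob N l\<close> is injective, the factor extends along
  the inflation \<open>a l\<close>, available since \<open>l < m\<close>; the extension is a null
  homotopy.\<close>

lemma hom_acyclic_degree:
  assumes X: "cpl X" "acyclic_below C E X m Y a b" and N: "cpl N" "supp N {l}" and l: "l < m"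
  shows "hom K X N = {Zero K X N}"
proof -
  note D = acyclicD[OF X(2)]
  note c = X(1) N(1)
  have m: "meets X N l" using N(2) by (simp add: meets_def supp_def)
  have lm: "l \<le> m" "l - 1 < m" "l - 1 \<le> m" using l by auto
  have b1: "b (l - 1) : hom C (cob X (l - 1)) (Y (l - 1))" "a (l - 1) : hom C (Y (l - 1)) (cob X l)" using D(3)[OF lm(3)] D(2)[OF lm(1)] .
  note Nl = cpl_Ob[OF N(1), of l]
  have "f = Zero K X N" if f: "f : hom K X N" for f
  proof -
    obtain u where u: "cocycle X N l u" "f = carr X N l u" using conc_ex[OF c m f] by blast
    have uh: "u : hom C (cob X l) (cob N l)" and ud: "u ** cdiff X (l - 1) = Zero C (cob X (l - 1)) (cob N l)" using u(1) by (auto simp: cocycle_def)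
    have "(u ** a (l - 1)) ** b (l - 1) = Zero C (Y (l - 1)) (cob N l) ** b (l - 1)"
      using assoc[OF b1 uh] ud D(4)[OF lm(2)] zero_left[OF b1(1) Nl] by simp
    then have "u ** a (l - 1) = Zero C (Y (l - 1)) (cob N l)"
      by (rule deflation_epi[OF D(1)[OF lm(3)] b1(1) comp[OF b1(2) uh] zero_hom[OF hom_Ob2[OF b1(1)] Nl]])
    then obtain g where g: "g : hom C (Y l) (cob N l)" "g ** b l = u"
      using conflation_cokernel[OF D(1)[OF lm(1)] b1(2) D(3)[OF lm(1)] uh] by blast
    have "cob N l : Inj C E" using cpl_P[OF N(1)] Proj_eq_Inj by blast
    then obtain t where t: "t : hom C (cob X (l + 1)) (cob N l)" "t ** a l = g"
      using Inj_extend[OF _ D(5)[OF l] D(6)[OF l] g(1)] by blast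
    have td: "t ** cdiff X l = u" using D(4)[OF l] assoc[OF D(3)[OF lm(1)] D(6)[OF l] t(1)] g t by simp
    have z: "Zero C (cob X l) (cob N (l - 1)) : hom C (cob X l) (cob N (l - 1))" using zero_hom cpl_Ob c by blast
    have "cdiff N (l - 1) ** Zero C (cob X l) (cob N (l - 1)) = Zero C (cob X l) (cob N l)"
      using zero_right[OF cplD(1)[OF N(1), of "l - 1"] cpl_Ob[OF X(1)]] by simp
    then have "u = Zero C (cob X l) (cob N l) \<oplus> ((cdiff N (l - 1) ** Zero C (cob X l) (cob N (l - 1))) \<oplus> (t ** cdiff X l))"
      using td Zero_Add[OF uh] by simp
    then show ?thesis using conc_eq_iff[OF c m zero_cocycle[OF c] u(1)] conc_zero[OF c] u(2) z t(1) by metis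
  qed
  moreover have "Zero K X N : hom K X N" using K.zero_hom X(1) N(1) by simp
  ultimately show ?thesis by blast
qed

text \<open>Induction on the width \<open>k\<close> of the support of \<open>N\<close>: truncation
  at \<open>l + 1\<close> splits off the lowest degree, and there are no nonzero maps into either
  piece.\<close>

lemma hom_acyclic_zero:
  assumes X: "cpl X" "acyclic_below C E X m Y a b" and N: "cpl N" "supp N {l..<l + int k}" and l: "l + int k \<le> m"
  shows "hom K X N = {Zero K X N}"
  using N l
proof (induction k arbitrary: l N)
  case 0
  then show ?case using hom_disjoint_supp[OF X(1) 0(1), of UNIV "{}"] by (simp add: supp_def)
next
  case (Suc k)
  obtain V W i p h where t: "cpl V" "cpl W" "supp V {l + 1..}" "supp W {..<l + 1}" "\<forall>i\<ge>l + 1. cob V i = cob N i" "\<forall>i<l + 1. cob W i = cob N i"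
    "i : hom K V N" "p : hom K N W" "(i, p, h) : Tri K"
    using truncation_triangle[OF Suc(2), of "l + 1"] by blast
  have "supp V {l + 1..<l + 1 + int k}"
    unfolding supp_def
  proof (intro allI impI)
    fix n assume n: "n \<notin> {l + 1..<l + 1 + int k}"
    show "zero_object C (cob V n)"
      using t(3,5) Suc(3) n unfolding supp_def by (cases "n \<ge> l + 1") auto
  qed
  moreover have "supp W {l}"
    unfolding supp_def
  proof (intro allI impI)
    fix n assume n: "n \<notin> {l}"
    show "zero_object C (cob W n)"
      using t(4,6) Suc(3) n unfolding supp_def by (cases "n < l + 1") auto
  qed
  ultimately show ?case
    using K.hom_zero_middle[OF t(9,7,8)] Suc.IH[OF t(1)] hom_acyclic_degree[OF X t(2)] Suc(4) X(1) by simp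
qed

lemma hom_resolution_neg: "X : isoc resolutions ==> N : isoc negs ==> hom K X N = {Zero K X N}"
proof (erule isoc_hom_zero, assumption)
  fix X N assume X: "X : resolutions" "cpl X" and N: "N : negs" "cpl N"
  obtain Y a b where ac: "acyclic_below C E X 0 Y a b" using X by (auto simp: resolutions_def)
  obtain l n where s: "supp N {l..n}" "supp N {..<0}" using N by (auto simp: negs_def bounded_iff)
  \<comment> \<open>The interval runs from \<open>min l 0\<close> up to but excluding 0; the minimum
    keeps its width nonnegative also when \<open>l\<close> is positive.\<close>
  have "supp N {min l 0..<min l 0 + int (nat (- min l 0))}"
    using s by (auto simp: supp_def not_le)
  then show "hom K X N = {Zero K X N}" by (rule hom_acyclic_zero[OF X(2) ac N(2)]) simp
qed

lemma hom_pos_resolution: "X : isoc poss ==> N : isoc resolutions ==> hom K X N = {Zero K X N}"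
proof (erule isoc_hom_zero, assumption)
  fix X N assume X: "X : poss" "cpl X" and N: "N : resolutions" "cpl N"
  show "hom K X N = {Zero K X N}"
    by (rule hom_disjoint_supp[OF X(2) N(2), of "{0<..}" "{..0}"]) (use X N in \<open>auto simp: poss_def resolutions_def right_bounded_supp\<close>)
qed

lemma hom_pos_neg: "X : isoc poss ==> N : isoc negs ==> hom K X N = {Zero K X N}"
proof (erule isoc_hom_zero, assumption)
  fix X N assume X: "X : poss" "cpl X" and N: "N : negs" "cpl N"
  show "hom K X N = {Zero K X N}"
    by (rule hom_disjoint_supp[OF X(2) N(2), of "{0<..}" "{..<0}"]) (use X N in \<open>auto simp: poss_def negs_def\<close>)
qed

lemma K_star: "X : star K A B \<longleftrightarrow> (\<exists>U W f g h. (f, g, h) : Tri K \<and> f : hom K U X \<and> g : hom K X W \<and> U : A \<and> W : B)"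
proof
  assume "X : star K A B"
  then obtain f g h where t: "(f, g, h) : Tri K" "Dom K f : A" "Cod K f = X" "Cod K g : B" unfolding star_def by blast
  show "\<exists>U W f g h. (f, g, h) : Tri K \<and> f : hom K U X \<and> g : hom K X W \<and> U : A \<and> W : B"
    using K.Tri_hom(1,2)[OF t(1)] t unfolding t(3) by blast
next
  assume "\<exists>U W f g h. (f, g, h) : Tri K \<and> f : hom K U X \<and> g : hom K X W \<and> U : A \<and> W : B"
  then obtain U W f g h where t: "(f, g, h) : Tri K" "f : hom K U X" "g : hom K X W" "U : A" "W : B" by blast
  have "Dom K f = U" "Cod K f = X" "Cod K g = W" using t by (simp_all add: hom_def)
  then show "X : star K A B" unfolding star_def using t K.hom_Ob2[OF t(2)] by blast
qed

abbreviation nonneg :: "('o, 'm) cpx set" where "nonneg \<equiv> star K (isoc poss) (isoc resolutions)"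

lemma negs_extension:
  assumes "(f, g, h) : Tri K" "Dom K f : isoc negs" "Cod K g : isoc negs" shows "Cod K f : isoc negs"
proof (rule isoc_extension[OF assms])
  fix X Z a Y j k p q assume "X : negs" "Z : negs" "cpl Z" "rcone (unshift_cpx C Z) X a Y j k p q"
  then show "Y : negs" using bounded_extension[of Z X a Y j k p q] supp_extension[of Z X a Y j k p q] by (simp add: negs_def)
qed

lemma negs_bounded: "isoc negs \<subseteq> Kbd" and poss_bounded: "isoc poss \<subseteq> Kbd"
  and resolutions_eventually_acyclic: "isoc resolutions \<subseteq> Kmb"
  by (rule isoc_mono; auto simp: negs_def poss_def resolutions_def eventually_acyclic_def)+

lemma nonneg_resolution:
  assumes X: "cpl X" "right_bounded_at C X n" "acyclic_below C E X m Y a b" and m: "0 \<le> m"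
  shows "X : nonneg"
proof -
  \<comment> \<open>Truncating at 1 keeps degree 0 in the quotient \<open>W\<close>, together with
    all differentials out of negative degrees; these are the ones that acyclicity up to 0 speaks
    of.\<close>
  obtain V W k p h where t: "cpl V" "cpl W" "supp V {1..}" "supp W {..<1}" "\<forall>i\<ge>1. cob V i = cob X i" "\<forall>i<1. cob W i = cob X i"
    "\<forall>i. i + 1 < 1 \<longrightarrow> cdiff W i = cdiff X i" "k : hom K V X" "p : hom K X W" "(k, p, h) : Tri K"
    using truncation_triangle[OF X(1), of 1] by blast
  have "supp V {1..n}"
    unfolding supp_def
  proof (intro allI impI)
    fix i assume n: "i \<notin> {1..n}"
    show "zero_object C (cob V i)"
      using t(3,5) X(2) n unfolding supp_def right_bounded_at_def by (cases "i \<ge> 1") auto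
  qed
  moreover have "supp V {0<..}" by (rule supp_mono[OF t(3)]) auto
  ultimately have "V : poss" unfolding poss_def bounded_iff by blast
  then have V: "V : isoc poss" using isoc_base[OF t(1)] by blast
  have "acyclic_below C E W 0 Y a b"
    using acyclic_mono[OF X(3) m] t(6,7) unfolding acyclic_below_def by simp
  moreover have "right_bounded_at C W 0" using t(4) by (simp add: supp_def right_bounded_at_def)
  ultimately have "W : resolutions" unfolding resolutions_def by blast
  then have "W : isoc resolutions" using isoc_base[OF t(2)] by blast
  then show ?thesis unfolding K_star using V t(8-10) by blast
qed

text \<open>
  Adding an injective hull of \<open>Y m\<close> in degree \<open>m + 1\<close> makes the complex acyclic in one more degree,
  and changes it only by an object of \<open>Kneg\<close>.
\<close>

lemma acyclic_step:
  assumes X: "cpl X" "right_bounded_at C X n" "acyclic_below C E X m Y a b" and m: "m < 0"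
  shows "\<exists>X' n' Y' a' b' f g h. cpl X' \<and> right_bounded_at C X' n' \<and> acyclic_below C E X' (m + 1) Y' a' b' \<and>
    (f, g, h) : Tri K \<and> f : hom K X' X \<and> Cod K g : isoc negs"
proof -
  note D = acyclicD[OF X(3)]
  note bm = D(3)[of m, OF order_refl] and am = D(2)[of m, OF order_refl] and d = cplD[OF X(1)]
  have m1: "m - 1 < m" "m - 1 \<le> m" by auto
  have b1: "b (m - 1) : hom C (cob X (m - 1)) (Y (m - 1))" using D(3)[OF m1(2)] .
  have Ym: "Y m : Ob C" "Y (m - 1) : Ob C" "cob X (m + 1) : Ob C" using hom_Ob2[OF bm] hom_Ob1[OF am] cpl_Ob[OF X(1)] by auto
  have "(cdiff X m ** a (m - 1)) ** b (m - 1) = cdiff X m ** cdiff X (m - 1)"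
    using assoc[OF b1 am d(1)] D(4)[OF m1(1)] by simp
  also have "\<dots> = Zero C (Y (m - 1)) (cob X (m + 1)) ** b (m - 1)"
    using d(2)[of "m - 1"] zero_left[OF b1 Ym(3)] by (simp add: algebra_simps)
  finally have "cdiff X m ** a (m - 1) = Zero C (Y (m - 1)) (cob X (m + 1))"
    by (rule deflation_epi[OF D(1)[OF m1(2)] b1 comp[OF am d(1)] zero_hom[OF Ym(2,3)]])
  \<comment> \<open>In degree \<open>m\<close> acyclicity provides only the deflation
    \<open>b m\<close>. The differential factors through it as \<open>c\<close>, which need not be
    an inflation; pairing \<open>c\<close> with \<open>\<iota>\<close> makes it one.\<close>
  then obtain c where c: "c : hom C (Y m) (cob X (m + 1))" "c ** b m = cdiff X m"
    using conflation_cokernel[OF D(1)[OF order_refl] am bm d(1)] by blast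
  obtain \<iota> where \<iota>0: "inflation E \<iota>" "Dom C \<iota> = Y m" "Cod C \<iota> : Inj C E" using enough_injectives[OF Ym(1)] by blast
  define I where "I = Cod C \<iota>"
  have I: "I : Proj C E" "I : Ob C" using \<iota>0(3) Proj_eq_Inj Proj_Ob by (auto simp: I_def)
  have \<iota>: "\<iota> : hom C (Y m) I" using \<iota>0 conflationD(1)[of \<iota>] by (auto simp: inflation_def I_def)
  obtain W j k p q where b: "biproduct C (cob X (m + 1)) I W j k p q" using ex_biproduct[OF Ym(3) I(2)] by blast
  note h = biproductD[OF b]
  have W: "W : Proj C E" using Proj_biproduct[OF cpl_P[OF X(1)] I(1) b] .
  obtain p' where p': "((j ** c) \<oplus> (k ** \<iota>), p') : E" using inflation_pair[OF \<iota>0(1) \<iota> c(1) b] by (auto simp: inflation_def)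
  let ?a = "(j ** c) \<oplus> (k ** \<iota>)"
  note pr = biproduct_pair[OF b c(1) \<iota>]
  have p'h: "p' : hom C W (Cod C p')" using conflationD(2)[OF p'] hom_Cod[OF pr(1)] by simp
  define J where "J = stalk I (m + 1)"
  \<comment> \<open>Degree \<open>m + 1\<close> is enlarged by \<open>I\<close>. The new
    differential into it has components \<open>c\<close> and \<open>\<iota>\<close> on
    \<open>Y m\<close>, and the one out of it ignores \<open>I\<close>.\<close>
  define X' where "X' = \<lparr>cob = (\<lambda>i. if i = m + 1 then W else cob X i),
    cdiff = (\<lambda>i. if i = m + 1 then cdiff X i ** p else if i = m then ?a ** b m else cdiff X i)\<rparr>"
  have ab: "?a ** b m : hom C (cob X m) W" using comp[OF bm pr(1)] .
  have pab: "p ** (?a ** b m) = cdiff X m" using assoc[OF bm pr(1) h(3)] pr(2) c(2) by simp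
  have dp: "cdiff X (m + 1) ** p : hom C W (cob X (m + 2))" using comp[OF h(3) d(1)[of "m + 1"]] by (simp add: add.assoc)
  define \<pi> where "\<pi> i = (if i = m + 1 then p else Ident C (cob X i))" for i
  define \<kappa> where "\<kappa> i = (if i = m + 1 then k else Zero C zob (cob X i))" for i
  define \<pi>' where "\<pi>' i = (if i = m + 1 then j else Ident C (cob X i))" for i
  define \<kappa>' where "\<kappa>' i = (if i = m + 1 then q else Zero C (cob X i) zob)" for i
  have bX: "biproduct C (cob X i) (cob J i) (cob X' i) (\<pi>' i) (\<kappa> i) (\<pi> i) (\<kappa>' i)" for i
    using b biproduct_zero_right[OF zob(1) cpl_Ob[OF X(1)]] by (simp add: X'_def J_def cob_stalk \<pi>'_def \<pi>_def \<kappa>_def \<kappa>'_def)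
  have dX': "cdiff X' i : hom C (cob X' i) (cob X' (i + 1))" for i
    using ab dp d(1)[of i] by (auto simp: X'_def add.assoc)
  have \<pi>d: "\<pi> (i + 1) ** cdiff X' i = cdiff X i ** \<pi> i" for i
  proof -
    consider "i = m" | "i = m + 1" | "i \<noteq> m" "i \<noteq> m + 1" by blast
    then show ?thesis
    proof cases
      case 1
      then show ?thesis using pab id_right[OF d(1)[of m]] by (simp add: X'_def \<pi>_def)
    next
      case 2
      then show ?thesis using id_left[OF dp] by (simp add: X'_def \<pi>_def add.assoc)
    next
      case 3
      then show ?thesis using id_left[OF d(1)[of i]] id_right[OF d(1)[of i]] by (simp add: X'_def \<pi>_def)
    qed
  qed
  have cX': "cpl X'"
    unfolding is_complex_def
  proof (intro allI conjI)
    fix i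
    show "cob X' i : Proj C E" using W cpl_P[OF X(1)] by (simp add: X'_def)
    show "cdiff X' i : hom C (cob X' i) (cob X' (i + 1))" using dX' .
    show "cdiff X' (i + 1) ** cdiff X' i = Zero C (cob X' i) (cob X' (i + 2))"
    \<comment> \<open>The composite is tested after the projection \<open>\<pi>\<close>, which is an
      identity except in degree \<open>m + 1\<close>. A composite landing in that degree is the
      exceptional case.\<close>
    proof (cases "i + 1 = m")
      case True
      have "b m ** cdiff X i = Zero C (cob X i) (Y m)"
      proof -
        have i: "i = m - 1" using True by simp
        have "b m ** (a (m - 1) ** b (m - 1)) = Zero C (cob X (m - 1)) (Y m)"
          using assoc[OF b1 am bm] conflationD(3)[OF D(1)[of m, OF order_refl]] hom_Dom[OF am] hom_Cod[OF bm] zero_left[OF b1 Ym(1)] by simp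
        then show ?thesis using D(4)[OF m1(1)] i by simp
      qed
      then show ?thesis
        using True assoc[OF d(1)[of i, unfolded True] bm pr(1)] zero_right[OF pr(1) cpl_Ob[OF X(1), of i]] by (auto simp: X'_def)
    next
      case False
      have e: "\<pi> (i + 2) ** (cdiff X' (i + 1) ** cdiff X' i) = Zero C (cob X' i) (cob X (i + 2))"
      proof -
        note hh = dX'[of i] dX'[of "i + 1", unfolded add.assoc one_add_one]
        have ph: "\<pi> i : hom C (cob X' i) (cob X i)" for i using biproductD(3)[OF bX] .
        have "\<pi> (i + 2) ** (cdiff X' (i + 1) ** cdiff X' i) = (\<pi> (i + 2) ** cdiff X' (i + 1)) ** cdiff X' i"
          using assoc[OF hh ph] by simp
        also have "\<dots> = cdiff X (i + 1) ** (cdiff X i ** \<pi> i)"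
          using \<pi>d[of "i + 1"] \<pi>d[of i] assoc[OF hh(1) ph d(1)[of "i + 1"]] by (simp add: add.assoc)
        also have "\<dots> = Zero C (cob X' i) (cob X (i + 2))"
          using assoc[OF ph[of i] d(1)[of i] d(1)[of "i + 1"]] d(2)[of i] zero_left[OF ph[of i] cpl_Ob[OF X(1)]] by simp
        finally show ?thesis .
      qed
      have "\<pi> (i + 2) = Ident C (cob X' (i + 2))" "cob X (i + 2) = cob X' (i + 2)" using False by (simp_all add: \<pi>_def X'_def)
      then show ?thesis using e id_left[OF comp[OF dX'[of i] dX'[of "i + 1", unfolded add.assoc one_add_one]]] by simp
    qed
  qed
  have cJ: "cpl J" unfolding J_def by (rule stalk_cpl(2)[OF I(1)])
  have k: "chain_map C J X' \<kappa>"
    unfolding chain_map_def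
  proof (intro allI conjI)
    fix i
    show kh: "\<kappa> i : hom C (cob J i) (cob X' i)" using biproductD(2)[OF bX] .
    show "\<kappa> (i + 1) ** cdiff J i = cdiff X' i ** \<kappa> i"
    proof (cases "i = m + 1")
      case True
      have "(cdiff X i ** p) ** k = Zero C I (cob X (i + 1))"
        using assoc[OF h(2,3) d(1)[of "m + 1"]] h(7) zero_right[OF d(1)[of "m + 1"] I(2)] True by simp
      then show ?thesis using True zero_left[OF zero_hom[OF I(2) zob(2)] cpl_Ob[OF X(1)]] by (simp add: J_def cob_stalk cdiff_stalk X'_def \<kappa>_def)
    next
      case False
      then have "zero_object C (cob J i)" using zob by (simp add: J_def cob_stalk)
      then show ?thesis
        using zero_object_hom[OF _ comp[OF kh dX']] zero_object_hom[OF _ comp[OF cplD(1)[OF cJ, of i] biproductD(2)[OF bX[of "i + 1"]]]] by simp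
    qed
  qed
  have \<pi>: "chain_map C X' X \<pi>" unfolding chain_map_def using biproductD(3)[OF bX] \<pi>d by blast
  obtain t where t: "(cl J X' (gm J X' \<kappa>), cl X' X (gm X' X \<pi>), t) : Tri K"
    using split_triangle_chain[OF cJ cX' X(1) k \<pi> bX] by blast
  note r = K.Tri_rotate[OF t]
  have "t : hom K X (sh J)" using K.Tri_hom(3)[OF t] by simp
  then have tc: "Cod K t = sh J" by (simp add: hom_def)
  \<comment> \<open>\<open>J\<close> sits in degree \<open>m + 1\<close>, so its shift, the cone of
    the projection, sits in degree \<open>m\<close>, which is negative.\<close>
  have "supp J {m + 1}" using zob by (simp add: supp_def J_def cob_stalk)
  then have sJ: "supp (sh J) {m}" using supp_mono[OF supp_shift, of J "{m + 1}" "{m}"] by auto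
  have "supp (sh J) {m..m}" "supp (sh J) {..<0}" using sJ supp_mono[OF sJ, of "{..<0}"] m by simp_all
  then have "sh J : negs" unfolding negs_def bounded_iff by blast
  then have N: "Cod K t : isoc negs" using isoc_base[OF cpl_shift[OF cJ]] tc by simp
  have f: "cl X' X (gm X' X \<pi>) : hom K X' X" using K_homI[OF cX' X(1)] chm_iff[OF cX' X(1)] \<pi> by blast
  have rb: "right_bounded_at C X' (max n (m + 1))" using X(2) by (simp add: right_bounded_at_def X'_def)
  have "acyclic_below C E X' (m + 1) (Y(m + 1 := Cod C p')) (a(m := ?a)) (b(m + 1 := p'))"
    unfolding acyclic_below_def
  proof (intro allI impI conjI)
    fix i assume "i \<le> m + 1"
    then consider "i = m + 1" | "i \<le> m" "i \<noteq> m + 1" "i - 1 \<noteq> m" "i - 1 \<noteq> m + 1" by linarith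
    then show "((a(m := ?a)) (i - 1), (b(m + 1 := p')) i) : E"
      "(a(m := ?a)) (i - 1) : hom C ((Y(m + 1 := Cod C p')) (i - 1)) (cob X' i)"
      "(b(m + 1 := p')) i : hom C (cob X' i) ((Y(m + 1 := Cod C p')) i)"
      by (cases; use p' pr(1) p'h D(1-3)[of i] in \<open>simp add: X'_def\<close>)+
  next
    fix i assume "i < m + 1"
    then consider "i = m" | "i < m" by linarith
    then show "cdiff X' i = (a(m := ?a)) i ** (b(m + 1 := p')) i"
      by cases (use D(4)[of i] in \<open>simp_all add: X'_def\<close>)
  qed
  then show ?thesis using cX' rb r f N by blast
qed

text \<open>Induction on a bound \<open>l\<close> for the number of steps until the range of
  acyclicity reaches 0. By the octahedron the cone of the composite is an extension of two objects
  of \<open>isoc negs\<close>.\<close>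

lemma decomposition_exists:
  assumes "cpl X" "right_bounded_at C X n" "acyclic_below C E X m Y a b" "- int l \<le> m"
  shows "\<exists>V f g h. (f, g, h) : Tri K \<and> f : hom K V X \<and> V : nonneg \<and> Cod K g : isoc negs"
  using assms
proof (induction l arbitrary: X n m Y a b)
  case 0
  have X: "X : nonneg" using nonneg_resolution[OF 0(1-3)] 0(4) by simp
  have I: "Ident K X : hom K X X" using K.id_hom 0(1) by simp
  obtain g h where t: "(Ident K X, g, h) : Tri K" using K.cone_exists[OF I] by blast
  have "Cod K g : isoc negs"
    by (rule isoc_zero_object[OF V.cone_Ident[OF t]]) (use 0(1) in \<open>auto simp: negs_def supp_def bounded_cpx_def\<close>)
  then show ?case using t I X by blast
next
  case (Suc l)
  show ?case
  proof (cases "- int l \<le> m")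
    case True
    show ?thesis by (rule Suc.IH[OF Suc.prems(1-3) True])
  next
    case False
    then have m: "m < 0" "- int l \<le> m + 1" using Suc.prems(4) by auto
    obtain X' n' Y' a' b' f g h where s: "cpl X'" "right_bounded_at C X' n'" "acyclic_below C E X' (m + 1) Y' a' b'"
      and t: "(f, g, h) : Tri K" "f : hom K X' X" "Cod K g : isoc negs"
      using acyclic_step[OF Suc.prems(1-3) m(1)] by blast
    obtain V f1 g1 h1 where v: "(f1, g1, h1) : Tri K" "f1 : hom K V X'" "V : nonneg" "Cod K g1 : isoc negs"
      using Suc.IH[OF s m(2)] by blast
    have ff: "f **\<^sub>K f1 : hom K V X" using K.comp[OF v(2) t(2)] .
    obtain Z g2 h2 where w: "(f **\<^sub>K f1, g2, h2) : Tri K" using K.cone_exists[OF ff] by blast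
    have cd: "Cod K f1 = Dom K f" using v(2) t(2) by (simp add: hom_def)
    obtain u v' w' where o: "(u, v', w') : Tri K" "isomorphic K (Cod K g1) (Dom K u)" "isomorphic K (Cod K g2) (Cod K u)" "isomorphic K (Cod K g) (Cod K v')"
      using K.octahedron_objects[OF v(1) t(1) w cd] by blast
    have "Cod K u : isoc negs"
      using negs_extension[OF o(1)] isoc_closed[OF v(4) K.isomorphic_sym[OF o(2)]] isoc_closed[OF t(3) K.isomorphic_sym[OF o(4)]] by blast
    then have "Cod K g2 : isoc negs" using isoc_closed o(3) by blast
    then show ?thesis using w ff v(3) by blast
  qed
qed

lemma star_closed:
  assumes "X : star K A B" "isomorphic K X' X" shows "X' : star K A B"
proof -
  obtain U W f g h where t: "(f, g, h) : Tri K" "f : hom K U X" "g : hom K X W" "U : A" "W : B" using assms(1) unfolding K_star by blast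
  obtain s where s: "s : hom K X' X" "iso K s" using assms(2) by (auto simp: isomorphic_def)
  obtain s' where s': "s' : hom K X X'" "s' **\<^sub>K s = Ident K X'" "s **\<^sub>K s' = Ident K X" by (rule K.isoE[OF s(2,1)])
  have ob: "U : Ob K" "W : Ob K" using K.hom_Ob1[OF t(2)] K.hom_Ob2[OF t(3)] by auto
  have h: "h : hom K W (sh U)" using K.Tri_hom(3)[OF t(1)] t(2,3) by (simp add: hom_def)
  have f': "s' **\<^sub>K f : hom K U X'" and g': "g **\<^sub>K s : hom K X' W" using K.comp t s s' by blast+
  have "triangle_iso K (s' **\<^sub>K f, g **\<^sub>K s, h) (f, g, h)"
    by (rule triangle_isoI[OF f' g' _ t(2,3) _ K.id_hom[OF ob(1)] s(1) K.id_hom[OF ob(2)] K.iso_Ident[OF ob(1)] s(2) K.iso_Ident[OF ob(2)]])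
      (use h K.assoc[OF t(2) s'(1) s(1)] s'(3) K.id_left[OF t(2)] K.id_right[OF t(2)] K.id_left[OF g']
        K.ShArr_Ident[OF ob(1)] K.id_left[OF h] K.id_right[OF h] in simp_all)
  then have "(s' **\<^sub>K f, g **\<^sub>K s, h) : Tri K" using K.Tri_iso[OF t(1)] by blast
  then show ?thesis unfolding K_star using f' g' t(4,5) by blast
qed

lemma nonneg_eventually_acyclic: "nonneg \<subseteq> Kmb"
proof
  fix X assume "X : nonneg"
  then obtain U W f g h where t: "(f, g, h) : Tri K" "f : hom K U X" "g : hom K X W" "U : isoc poss" "W : isoc resolutions" unfolding K_star by blast
  have "Dom K f : Kbd" "Cod K g : Kmb" "Cod K f = X"
    using t(2-5) poss_bounded resolutions_eventually_acyclic by (auto simp: hom_def)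
  then show "X : Kmb" using V.U_ext[OF t(1)] by simp
qed

lemma eventually_acyclic_star: "Kmb = star K nonneg (isoc negs)"
proof (intro set_eqI iffI)
  fix X assume "X : Kmb"
  then obtain X' where X': "isomorphic K X X'" "cpl X'" "X' : eventually_acyclic" unfolding isoc_iff by blast
  obtain n m Y a b where h: "right_bounded_at C X' n" "acyclic_below C E X' m Y a b" using X'(3) unfolding eventually_acyclic_def by blast
  \<comment> \<open>The range starts at \<open>m\<close>, so \<open>- m\<close> steps suffice, and
    none if \<open>m\<close> is already nonnegative.\<close>
  have "- int (nat (- m)) \<le> m" by simp
  then obtain V f g h where "(f, g, h) : Tri K" "f : hom K V X'" "V : nonneg" "Cod K g : isoc negs"
    using decomposition_exists[OF X'(2) h] by blast
  moreover have "g : hom K X' (Cod K g)" using K.Tri_hom(2)[OF calculation(1)] calculation(2) by (simp add: hom_def)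
  ultimately have "X' : star K nonneg (isoc negs)" unfolding K_star[of X'] by blast
  then show "X : star K nonneg (isoc negs)" by (rule star_closed[OF _ X'(1)])
next
  fix X assume "X : star K nonneg (isoc negs)"
  then obtain U W f g h where t: "(f, g, h) : Tri K" "f : hom K U X" "g : hom K X W" "U : nonneg" "W : isoc negs" unfolding K_star[of X] by blast
  have d: "Dom K f : Kmb" "Cod K g : Kbd" "Cod K f = X"
    using t(2-5) negs_bounded nonneg_eventually_acyclic by (auto simp: hom_def)
  have "Cod K f : Kmb"
    by (rule isoc_extension[OF t(1) d(1,2)]) (use eventually_acyclic_extension_right in \<open>simp\<close>)
  then show "X : Kmb" using d(3) by simp
qed

theorem decomposition: "\<exists>V. is_perp (KP C E) V (Kpos C E) (KF C E) \<and> is_perp (KP C E) (Kminusb C E) V (Kneg C E)"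
proof (intro exI conjI)
  show "is_perp (KP C E) nonneg (Kpos C E) (KF C E)" unfolding is_perp_def subcategories using hom_pos_resolution by simp
  have "hom K X N = {Zero K X N}" if X: "X : nonneg" and N: "N : isoc negs" for X N
  proof -
    obtain U W f g h where t: "(f, g, h) : Tri K" "f : hom K U X" "g : hom K X W" "U : isoc poss" "W : isoc resolutions" using X unfolding K_star by blast
    show ?thesis
      by (rule K.hom_zero_middle'[OF t(1-3) _ hom_pos_neg[OF t(4) N] hom_resolution_neg[OF t(5) N]]) (use isoc_cpl[OF N] in simp)
  qed
  then show "is_perp (KP C E) (Kminusb C E) nonneg (Kneg C E)" unfolding is_perp_def subcategories eventually_acyclic_star[symmetric] by simp
qed

end

section \<open>Projective resolutions in the Verdier quotient\<close>

context verdier_setting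
begin

text \<open>\<open>s\<close> is the fibre of \<open>x\<close>, so its cone is \<open>Z\<close>, an
  object of \<open>N\<close>. This is how arrows that factor through \<open>N\<close> become zero in
  the quotient.\<close>

lemma S_annihilates:
  assumes x: "x : hom T X Z" "X : U" "Z : N"
  shows "\<exists>W s. s : hom T' W X \<and> s : cone_in T' N \<and> x ** s = Zero T W Z"
proof -
  obtain B where B: "B : Ob T" "ShOb T B = Z" using ShOb_surj[OF hom_Ob2[OF x(1)]] by blast
  have x': "x : hom T X (ShOb T B)" using x B by simp
  obtain W y s where t: "(y, s, x) : Tri T" "y : hom T B W" "s : hom T W X" using Tri_third[OF B(1) x'] by blast
  have BN: "B : N" using N_unshift B x(3) by simp
  have "s : cone_in T' N" by (rule S_of_third[OF t(1)]) (use t BN x in \<open>simp_all add: hom_def\<close>)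
  moreover have "x ** s = Zero T W Z" using Tri_zero'[OF Tri_rotate[OF t(1)] t(3) x(1)] .
  ultimately show ?thesis using t(3) S_U sub_hom by blast
qed

end

context exact_category
begin

text \<open>\<open>e\<close> is a cokernel of the inflation \<open>a (- 1)\<close>, and the
  deflation \<open>b (- 1)\<close> is epic, so an arrow that kills the differential also kills
  \<open>a (- 1)\<close>.\<close>

lemma resolution_cokernel:
  assumes r: "projective_resolution C E A (X, e)"
  shows "u : hom C (cob X 0) B ==> u ** cdiff X (- 1) = Zero C (cob X (- 1)) B ==> \<exists>w\<in>hom C A B. w ** e = u"
    "w : hom C A B ==> w' : hom C A B ==> w ** e = w' ** e ==> w = w'"
proof -
  from r obtain Y a b where ac: "acyclic_below C E X 0 Y a b" and Y: "Y 0 = A" "b 0 = e"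
    unfolding projective_resolution_def by auto
  note D = acyclicD[OF ac]
  have a: "a (- 1) : hom C (Y (- 1)) (cob X 0)" "b (- 1) : hom C (cob X (- 1)) (Y (- 1))" "(a (- 1), e) : E" "e : hom C (cob X 0) A"
    "(a (- 2), b (- 1)) : E" "cdiff X (- 1) = a (- 1) ** b (- 1)"
    using D(2)[of 0] D(3)[of "- 1"] D(1)[of 0] D(3)[of 0] D(1)[of "- 1"] D(4)[of "- 1"] Y by simp_all
  show "w : hom C A B ==> w' : hom C A B ==> w ** e = w' ** e ==> w = w'" using deflation_epi[OF a(3,4)] .
  show "\<exists>w\<in>hom C A B. w ** e = u" if u: "u : hom C (cob X 0) B" "u ** cdiff X (- 1) = Zero C (cob X (- 1)) B"
  proof -
    have B: "B : Ob C" "Y (- 1) : Ob C" using hom_Ob2[OF u(1)] hom_Ob1[OF a(1)] by auto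
    have "(u ** a (- 1)) ** b (- 1) = Zero C (Y (- 1)) B ** b (- 1)"
      using assoc[OF a(2,1) u(1)] u(2) a(6) zero_left[OF a(2) B(1)] by simp
    then have "u ** a (- 1) = Zero C (Y (- 1)) B"
      by (rule deflation_epi[OF a(5,2) comp[OF a(1) u(1)] zero_hom[OF B(2,1)]])
    then show ?thesis using conflation_cokernel[OF a(3,1,4) u(1)] by blast
  qed
qed

lemma pres_stalk:
  assumes I: "I : Proj C E" shows "pres (stalk I 0) (Ident B.K (stalk I 0)) I"
proof -
  note O = Proj_Ob[OF I] and S = stalk_cpl(1)[OF Proj_Ob[OF I], of 0]
  have "Ident B.K (stalk I 0) : hom B.K (stalk I 0) (stalk I 0)" using B.K.id_hom S by simp
  then show ?thesis
    unfolding pres_def using stalk_cpl(2)[OF I] right_bounded_stalk O B.K.id_left sarr_hom by metis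
qed

end

context frobenius_category
begin

text \<open>The factor \<open>M\<close> is the brutal truncation of \<open>N\<close>: there are no maps from \<open>X\<close> to its negative part.\<close>

lemma factor_nonneg:
  assumes X: "X : isoc resolutions" and N: "N : Kbd" and x: "x : hom K X N"
  shows "\<exists>M x' y. cpl M \<and> supp M {0..} \<and> bounded_cpx C M \<and> x' : hom K X M \<and> y : hom K M N \<and> x = y **\<^sub>K x'"
proof -
  obtain N0 where N0: "isomorphic K N N0" "cpl N0" "bounded_cpx C N0" using N by (auto simp: isoc_iff)
  obtain n where n: "n : hom K N N0" "iso K n" using N0(1) by (auto simp: isomorphic_def)
  obtain n' where n': "n' : hom K N0 N" "n' **\<^sub>K n = Ident K N" by (rule K.isoE[OF n(2,1)])
  obtain l k where lk: "supp N0 {l..k}" using N0(3) bounded_iff by blast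
  obtain M W i p h where t: "cpl M" "cpl W" "supp M {0..}" "supp W {..<0}" "\<forall>i\<ge>0. cob M i = cob N0 i" "\<forall>i<0. cob W i = cob N0 i"
    "i : hom K M N0" "p : hom K N0 W" "(i, p, h) : Tri K"
    using truncation_triangle[OF N0(2), of 0] by blast
  have "supp M {l..k}" "supp W {l..k}"
    unfolding supp_def
  proof (intro allI impI)
    fix i assume n: "i \<notin> {l..k}"
    show "zero_object C (cob M i)" using t(3,5) lk n unfolding supp_def by (cases "i \<ge> 0") auto
  next
    show "\<forall>i. i \<notin> {l..k} \<longrightarrow> zero_object C (cob W i)"
    proof (intro allI impI)
      fix i assume n: "i \<notin> {l..k}"
      show "zero_object C (cob W i)" using t(4,6) lk n unfolding supp_def by (cases "i < 0") auto
    qed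
  qed
  then have M: "bounded_cpx C M" and "W : negs" using t(4) unfolding negs_def bounded_iff by blast+
  then have W: "W : isoc negs" using isoc_base[OF t(2)] by blast
  have nx: "n **\<^sub>K x : hom K X N0" using K.comp[OF x n(1)] .
  have "p **\<^sub>K (n **\<^sub>K x) = Zero K X W" using K.comp[OF nx t(8)] hom_resolution_neg[OF X W] by blast
  then obtain x' where x': "x' : hom K X M" "n **\<^sub>K x = i **\<^sub>K x'" using K.Tri_kernel[OF t(9,7,8) nx] by blast
  have "x = n' **\<^sub>K (n **\<^sub>K x)" using K.assoc[OF x n(1) n'(1)] n'(2) K.id_left[OF x] by simp
  also have "\<dots> = (n' **\<^sub>K i) **\<^sub>K x'" unfolding x'(2) using K.assoc[OF x'(1) t(7) n'(1)] by simp
  finally show ?thesis using t(1,3) M x'(1) K.comp[OF t(7) n'(1)] by blast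
qed

end

section \<open>The functor sending an object to its chosen resolution: full, faithful up to
  projectives, and dense\<close>

locale resolution_functor = frobenius_category C E for C :: "('o, 'm, 'x) addcat_scheme" (structure) and E +
  fixes \<rho> :: "'o => ('o, 'm) cpx \<times> 'm"
  assumes choice: "resolution_choice C E \<rho>"
begin

notation V.F.D_Cmp_infix (infixl "**\<^sub>D" 70)

abbreviation "R \<equiv> resolution_ob \<rho>"
abbreviation "e A \<equiv> snd (\<rho> A)"
abbreviation "Ra f \<equiv> resolution_arr C \<rho> f"
abbreviation "\<epsilon> A \<equiv> B.carr (R A) (stalk A 0) 0 (e A)"

lemma R_resolution: "A : Ob C ==> projective_resolution C E A (R A, e A)"
  using choice by (simp add: resolution_choice_def resolution_ob_def)

lemma R_pres: "A : Ob C ==> pres (R A) (\<epsilon> A) A" and e_cocycle: "A : Ob C ==> B.cocycle (R A) (stalk A 0) 0 (e A)"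
  using resolution_pres R_resolution by blast+

lemma R_cpl: "A : Ob C ==> cpl (R A)" and R_bound: "A : Ob C ==> right_bounded_at C (R A) 0"
  using presD(1,2) R_pres by blast+

lemma e_hom: "A : Ob C ==> e A : hom C (cob (R A) 0) A"
  using e_cocycle by (simp add: B.cocycle_def cob_stalk)

lemma R_resolutions: "A : Ob C ==> R A : isoc resolutions"
  by (rule isoc_base[OF R_cpl]) (use R_resolution[of A] in \<open>auto simp: projective_resolution_def resolutions_def\<close>)

lemma R_Ob: "A : Ob C ==> R A : Kmb"
  using R_resolutions resolutions_eventually_acyclic by blast

lemma augmented_eq:
  assumes A: "A : Ob C" "B : Ob C" and u: "B.cocycle (R A) (stalk B 0) 0 u" "B.cocycle (R A) (stalk B 0) 0 v"
  shows "B.carr (R A) (stalk B 0) 0 u = B.carr (R A) (stalk B 0) 0 v \<longleftrightarrow> u = v"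
  using carr_to_stalk_inj[OF B_cpl[OF R_cpl[OF A(1)]] _ A(2) u] R_bound[OF A(1)] by (auto simp: right_bounded_at_def)

lemma augmented_comp:
  assumes A: "A : Ob C" and X: "cpl X" and w: "B.cocycle X (stalk A 0) 0 w" and \<psi>: "chain_map C Y X \<psi>" "cpl Y"
  shows "B.cocycle Y (stalk A 0) 0 (w ** \<psi> 0)" "B.carr X (stalk A 0) 0 w **\<^sub>B cl Y X (gm Y X \<psi>) = B.carr Y (stalk A 0) 0 (w ** \<psi> 0)"
proof -
  note c = B_cpl[OF \<psi>(2)] B_cpl[OF X] stalk_cpl(1)[OF A, of 0]
  have e: "w ** cdiff X (- 1) = Zero C (cob X (- 1)) A" "w : hom C (cob X 0) A" using w cocycle_stalk(1)[OF c(2) A] by auto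
  note h = chain_map_hom[OF \<psi>(1)] and d = cplD(1)[OF X, of "- 1", simplified] and d' = cplD(1)[OF \<psi>(2), of "- 1", simplified]
  have "(w ** \<psi> 0) ** cdiff Y (- 1) = Zero C (cob Y (- 1)) A"
    using assoc[OF d' h e(2)] assoc[OF h d e(2)] \<psi>(1)[unfolded chain_map_def, rule_format, of "- 1"] e(1) zero_left[OF h A] by simp
  then show "B.cocycle Y (stalk A 0) 0 (w ** \<psi> 0)" using cocycle_stalk(1)[OF c(1) A] comp[OF h e(2)] by simp
  show "B.carr X (stalk A 0) 0 w **\<^sub>B cl Y X (gm Y X \<psi>) = B.carr Y (stalk A 0) 0 (w ** \<psi> 0)" using B.conc_right[OF c w \<psi>(1)] .
qed

lemma cocycle_post:
  assumes A: "A : Ob C" and f: "f : hom C A B" shows "B.cocycle (R A) (stalk B 0) 0 (f ** e A)"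
proof -
  note c = B_cpl[OF R_cpl[OF A]]
  have e: "e A ** cdiff (R A) (- 1) = Zero C (cob (R A) (- 1)) A" using e_cocycle[OF A] cocycle_stalk(1)[OF c A] by auto
  have "(f ** e A) ** cdiff (R A) (- 1) = Zero C (cob (R A) (- 1)) B"
    using assoc[OF cplD(1)[OF R_cpl[OF A], of "- 1", simplified] e_hom[OF A] f] e zero_right[OF f cpl_Ob[OF R_cpl[OF A]]] by simp
  then show ?thesis using cocycle_stalk(1)[OF c hom_Ob2[OF f]] comp[OF e_hom[OF A] f] by simp
qed

text \<open>\<open>resolution_arr\<close> is the set of all lifts of \<open>f\<close>. A chain map
  is a lift iff its class has the prescribed composite with the augmentation, and by
  \<open>comparison\<close> there is exactly one such class; so the set is a single homotopy
  class.\<close>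

lemma Ra:
  assumes f: "f : hom C A B" shows "Ra f : hom K (R A) (R B)" "\<epsilon> B **\<^sub>B Ra f = sarr A B f **\<^sub>B \<epsilon> A"
proof -
  have ob: "A : Ob C" "B : Ob C" using hom_Ob1[OF f] hom_Ob2[OF f] .
  note c = R_cpl[OF ob(1)] R_cpl[OF ob(2)] and p = R_pres[OF ob(1)] R_pres[OF ob(2)]
  note cB = B_cpl[OF c(1)] B_cpl[OF c(2)]
  obtain x where x: "x : hom B.K (R A) (R B)" "\<epsilon> B **\<^sub>B x = sarr A B f **\<^sub>B \<epsilon> A"
    using comparison(1)[OF p(2) c(1) R_bound[OF ob(1)] B.K.comp[OF presD(4)[OF p(1)] sarr_hom[OF f]]] by blast
  obtain \<phi> where \<phi>: "chain_map C (R A) (R B) \<phi>" "x = cl (R A) (R B) (gm (R A) (R B) \<phi>)" by (rule B.chain_map_arrE[OF x(1)])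
  have "e B ** \<psi> 0 = f ** e A \<longleftrightarrow> homotopic C (R A) (R B) \<phi> \<psi>" if \<psi>: "chain_map C (R A) (R B) \<psi>" for \<psi>
  proof -
    note a = augmented_comp[OF ob(2) c(2) e_cocycle[OF ob(2)] \<psi> c(1)]
    have "e B ** \<psi> 0 = f ** e A \<longleftrightarrow> \<epsilon> B **\<^sub>B cl (R A) (R B) (gm (R A) (R B) \<psi>) = \<epsilon> B **\<^sub>B x"
      unfolding x(2) a(2) sarr_comp[OF cB(1) e_cocycle[OF ob(1)] f] using augmented_eq[OF ob a(1) cocycle_post[OF ob(1) f]] by blast
    also have "\<dots> \<longleftrightarrow> x = cl (R A) (R B) (gm (R A) (R B) \<psi>)"
      using comparison(2)[OF p(2) c(1) R_bound[OF ob(1)] x(1) B.chain_map_arr[OF cB \<psi>]] by auto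
    finally show ?thesis unfolding \<phi>(2) using homotopic_cl[OF c \<phi>(1) \<psi>] by blast
  qed
  then have "Ra f = htpy C (R A) (R B) \<phi>"
    using hom_Dom[OF f] hom_Cod[OF f] by (auto simp: resolution_arr_def htpy_def resolution_ob_def split_beta homotopic_def)
  then have "Ra f = x" using htpy_cl[OF c] chm_iff[OF c] \<phi> by simp
  then show "Ra f : hom K (R A) (R B)" "\<epsilon> B **\<^sub>B Ra f = sarr A B f **\<^sub>B \<epsilon> A" using x B_hom[OF c] by auto
qed

lemmas Ra_hom = Ra(1)

text \<open>Lifts are unique by \<open>comparison\<close>. Functoriality and additivity thereby
  reduce to computations with augmentations.\<close>

lemma Ra_eqI:
  assumes f: "f : hom C A B" and x: "x : hom K (R A) (R B)" "\<epsilon> B **\<^sub>B x = sarr A B f **\<^sub>B \<epsilon> A" shows "Ra f = x"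
proof -
  have ob: "A : Ob C" "B : Ob C" using hom_Ob1[OF f] hom_Ob2[OF f] .
  show ?thesis using comparison(2)[OF R_pres[OF ob(2)] R_cpl[OF ob(1)] R_bound[OF ob(1)]] Ra[OF f] x B_hom[OF R_cpl[OF ob(1)] R_cpl[OF ob(2)]] by simp
qed

lemma Ra_sub_hom: "f : hom C A B ==> Ra f : hom V.T' (R A) (R B)"
  unfolding V.sub_hom using Ra_hom R_Ob hom_Ob1 hom_Ob2 by blast

lemma Ra_Cmp:
  assumes f: "f : hom C A B" and g: "g : hom C B D" shows "Ra (g ** f) = Ra g **\<^sub>K Ra f"
proof (rule Ra_eqI[OF comp[OF f g] K.comp[OF Ra_hom[OF f] Ra_hom[OF g]]])
  have ob: "A : Ob C" "B : Ob C" "D : Ob C" using hom_Ob1 hom_Ob2 f g by blast+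
  note c = R_cpl[OF ob(1)] R_cpl[OF ob(2)] R_cpl[OF ob(3)] and p = presD(4)[OF R_pres[OF ob(1)]] presD(4)[OF R_pres[OF ob(2)]] presD(4)[OF R_pres[OF ob(3)]]
  have h: "Ra f : hom B.K (R A) (R B)" "Ra g : hom B.K (R B) (R D)" using Ra_hom[OF f] Ra_hom[OF g] B_hom[OF c(1,2)] B_hom[OF c(2,3)] by auto
  show "\<epsilon> D **\<^sub>B (Ra g **\<^sub>K Ra f) = sarr A D (g ** f) **\<^sub>B \<epsilon> A"
    unfolding B_ops sarr_Cmp[OF f g, symmetric] using B.K.assoc[OF h p(3)] Ra(2)[OF g] B.K.assoc[OF h(1) p(2) sarr_hom[OF g]] Ra(2)[OF f]
      B.K.assoc[OF p(1) sarr_hom[OF f] sarr_hom[OF g]] by simp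
qed

lemma Ra_Add:
  assumes f: "f : hom C A B" and g: "g : hom C A B" shows "Ra (f \<oplus> g) = Ra f \<oplus>\<^bsub>K\<^esub> Ra g"
proof (rule Ra_eqI[OF add_hom[OF f g] K.add_hom[OF Ra_hom[OF f] Ra_hom[OF g]]])
  have ob: "A : Ob C" "B : Ob C" using hom_Ob1 hom_Ob2 f by blast+
  note c = R_cpl[OF ob(1)] R_cpl[OF ob(2)] and p = presD(4)[OF R_pres[OF ob(1)]] presD(4)[OF R_pres[OF ob(2)]]
  have h: "Ra f : hom B.K (R A) (R B)" "Ra g : hom B.K (R A) (R B)" using Ra_hom[OF f] Ra_hom[OF g] B_hom[OF c] by auto
  show "\<epsilon> B **\<^sub>B (Ra f \<oplus>\<^bsub>K\<^esub> Ra g) = sarr A B (f \<oplus> g) **\<^sub>B \<epsilon> A"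
    unfolding B_ops sarr_Add[OF f g] using B.K.add_right[OF h p(2)] B.K.add_left[OF p(1) sarr_hom[OF f] sarr_hom[OF g]] Ra(2)[OF f] Ra(2)[OF g] by simp
qed

lemma Ra_Neg:
  assumes f: "f : hom C A B" shows "Ra (Neg C f) = Neg K (Ra f)"
proof -
  note n = neg_hom[OF f]
  have z: "Zero C A B : hom C A B" using zero_hom hom_Ob1[OF f] hom_Ob2[OF f] .
  have "Ra (Zero C A B) \<oplus>\<^bsub>K\<^esub> Ra (Zero C A B) = Ra (Zero C A B) \<oplus>\<^bsub>K\<^esub> Zero K (R A) (R B)"
    using Ra_Add[OF z z] Add_Zero[OF z] K.Add_Zero[OF Ra_hom[OF z]] by simp
  then have "Ra (Zero C A B) = Zero K (R A) (R B)"
    using K.Add_cancel[OF Ra_hom[OF z] _ Ra_hom[OF z]] K.zero_hom[OF K.hom_Ob1[OF Ra_hom[OF z]] K.hom_Ob2[OF Ra_hom[OF z]]] by blast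
  then have "Ra f \<oplus>\<^bsub>K\<^esub> Ra (Neg C f) = Zero K (R A) (R B)" using Ra_Add[OF f n] Add_Neg[OF f] by simp
  then show ?thesis using K.Neg_unique[OF Ra_hom[OF f] Ra_hom[OF n]] by simp
qed

lemma Ra_Ident:
  assumes A: "A : Ob C" shows "Ra (Ident C A) = Ident K (R A)"
proof (rule Ra_eqI[OF id_hom[OF A] K.id_hom])
  note c = R_cpl[OF A] and p = presD(4)[OF R_pres[OF A]]
  show "R A : Ob K" using c by simp
  show "\<epsilon> A **\<^sub>B Ident K (R A) = sarr A A (Ident C A) **\<^sub>B \<epsilon> A"
    unfolding B_ops sarr_comp[OF B_cpl[OF c] e_cocycle[OF A] id_hom[OF A]] using B.K.id_right[OF p] id_left[OF e_hom[OF A]] by simp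
qed

text \<open>Composed with the augmentation of \<open>B\<close>, \<open>g\<close> becomes an arrow on
  \<open>cob (R A) 0\<close> that kills the differential, and such an arrow descends along the
  cokernel \<open>e A\<close>.\<close>

lemma Ra_full:
  assumes A: "A : Ob C" and B: "B : Ob C" and g: "g : hom K (R A) (R B)"
  shows "\<exists>f\<in>hom C A B. g = Ra f"
proof -
  note c = B_cpl[OF R_cpl[OF A]]
  have "g : hom B.K (R A) (R B)" using g B_hom[OF R_cpl[OF A] R_cpl[OF B]] by simp
  then obtain u where u: "B.cocycle (R A) (stalk B 0) 0 u" "\<epsilon> B **\<^sub>B g = B.carr (R A) (stalk B 0) 0 u"
    using B.conc_ex[OF c stalk_cpl(1)[OF B] meets_stalk(1) B.K.comp[OF _ presD(4)[OF R_pres[OF B]]]] by blast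
  obtain f where f: "f : hom C A B" "f ** e A = u"
    using resolution_cokernel(1)[OF R_resolution[OF A], of u B] u(1) cocycle_stalk(1)[OF c B] by auto
  then have "Ra f = g" using Ra_eqI[OF f(1) g] u(2) sarr_comp[OF c e_cocycle[OF A] f(1)] by simp
  then show ?thesis using f(1) by blast
qed

text \<open>The stalk of a projective resolves it, and resolutions of the same object are isomorphic
  in \<open>K\<close>.\<close>

lemma R_projective:
  assumes I: "I : Proj C E" shows "R I : Kbd"
proof -
  have "isomorphic K (R I) (stalk I 0)" using pres_isomorphic[OF R_pres[OF Proj_Ob[OF I]] pres_stalk[OF I]] .
  moreover have "bounded_cpx C (stalk I 0)" unfolding bounded_cpx_def using zob by (intro exI[of _ 0]) (auto simp: cob_stalk)
  ultimately show ?thesis using stalk_cpl(2)[OF I] by (auto simp: isoc_iff)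
qed

text \<open>The lift of \<open>u\<close> ends in an object of \<open>Kbd\<close>, so some
  denominator annihilates it, and with it the lift of \<open>v ** u\<close>.\<close>

lemma Q_Ra_projective:
  assumes f: "f : hom C A B" and u: "u : hom C A I" and v: "v : hom C I B" and I: "I : Proj C E"
  shows "V.F.Q (Ra (f \<oplus> (v ** u))) = V.F.Q (Ra f)"
proof -
  have ob: "A : Ob C" "B : Ob C" "I : Ob C" using hom_Ob1 hom_Ob2 u v by blast+
  obtain W s where s: "s : hom V.T' W (R A)" "s : V.F.S" "Ra u **\<^sub>K s = Zero K W (R I)"
    using V.S_annihilates[OF Ra_hom[OF u] R_Ob[OF ob(1)] R_projective[OF I]] by blast
  have sK: "s : hom K W (R A)" using s(1) V.sub_hom by blast
  have vu: "v ** u : hom C A B" using comp[OF u v] .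
  have W: "W : Ob K" using K.hom_Ob1[OF sK] .
  have "Ra (v ** u) **\<^sub>K s = Zero K W (R B)"
    unfolding Ra_Cmp[OF u v] using K.assoc[OF sK Ra_hom[OF u] Ra_hom[OF v]] s(3) K.zero_right[OF Ra_hom[OF v] W] by simp
  then have "Ra (f \<oplus> (v ** u)) **\<^sub>K s = Ra f **\<^sub>K s"
    unfolding Ra_Add[OF f vu] using K.add_left[OF sK Ra_hom[OF f] Ra_hom[OF vu]] K.Add_Zero[OF K.comp[OF sK Ra_hom[OF f]]] by simp
  then show ?thesis
    using V.F.Q_eqI[OF Ra_sub_hom[OF add_hom[OF f vu]] Ra_sub_hom[OF f] s(1,2)] by simp
qed

text \<open>Equality in the quotient holds already after a denominator \<open>s\<close>. So the lift
  of the difference \<open>h\<close> factors through the cone of \<open>s\<close>, and then through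
  a bounded complex \<open>M\<close> in degrees at least 0. The term of \<open>M\<close> in degree 0
  is the projective through which \<open>h\<close> factors.\<close>

lemma Q_Ra_faithful:
  assumes f: "f : hom C A B" and g: "g : hom C A B" and q: "V.F.Q (Ra f) = V.F.Q (Ra g)"
  shows "\<exists>I\<in>Proj C E. \<exists>u\<in>hom C A I. \<exists>v\<in>hom C I B. g = f \<oplus> (v ** u)"
proof -
  have ob: "A : Ob C" "B : Ob C" using hom_Ob1 hom_Ob2 f by blast+
  define h where "h = Neg C f \<oplus> g"
  have h: "h : hom C A B" unfolding h_def using add_hom neg_hom f g by blast
  have fh: "f \<oplus> h = g"
    unfolding h_def using Add_assoc[OF f neg_hom[OF f] g] Add_Neg[OF f] Zero_Add[OF g] by simp
  obtain W s where s: "s : hom V.T' W (R A)" "s : V.F.S" "Ra f **\<^sub>K s = Ra g **\<^sub>K s"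
    using V.F.Q_eqD[OF Ra_sub_hom[OF f] Ra_sub_hom[OF g] q] by auto
  have sK: "s : hom K W (R A)" using s(1) V.sub_hom by blast
  have hs0: "Ra h **\<^sub>K s = Zero K W (R B)"
  proof -
    have "Ra h **\<^sub>K s = Neg K (Ra f **\<^sub>K s) \<oplus>\<^bsub>K\<^esub> (Ra g **\<^sub>K s)"
      unfolding h_def Ra_Add[OF neg_hom[OF f] g] Ra_Neg[OF f]
      using K.add_left[OF sK K.neg_hom[OF Ra_hom[OF f]] Ra_hom[OF g]] K.neg_left[OF sK Ra_hom[OF f]] by simp
    then show ?thesis
      using s(3) K.Add_Neg[OF K.comp[OF sK Ra_hom[OF f]]] K.Add_commute[OF K.neg_hom K.comp] K.comp[OF sK Ra_hom[OF f]]
        K.Add_commute[OF K.comp[OF sK Ra_hom[OF f]] K.neg_hom[OF K.comp[OF sK Ra_hom[OF f]]]] by simp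
  qed
  obtain g1 h1 where t: "(s, g1, h1) : Tri K" "Cod K g1 : Kbd" using s(2) V.S_iff by blast
  have g1: "g1 : hom K (R A) (Cod K g1)" using K.Tri_hom(2)[OF t(1)] sK by (simp add: hom_def)
  obtain y where y: "y : hom K (Cod K g1) (R B)" "Ra h = y **\<^sub>K g1" using K.Tri_cokernel[OF t(1) sK g1 Ra_hom[OF h] hs0] by blast
  obtain M x' z where M: "cpl M" "supp M {0..}" "bounded_cpx C M" "x' : hom K (R A) M" "z : hom K M (Cod K g1)" "g1 = z **\<^sub>K x'"
    using factor_nonneg[OF R_resolutions[OF ob(1)] t(2) g1] by blast
  have yz: "y **\<^sub>K z : hom K M (R B)" using K.comp[OF M(5) y(1)] .
  have hx: "Ra h = (y **\<^sub>K z) **\<^sub>K x'" using y(2) M(6) K.assoc[OF M(4,5) y(1)] by simp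
  note cA = R_cpl[OF ob(1)] and cB = R_cpl[OF ob(2)]
  note cA' = B_cpl[OF cA] and cM' = B_cpl[OF M(1)]
  have yzB: "y **\<^sub>K z : hom B.K M (R B)" and xB: "x' : hom B.K (R A) M" using yz M(4) B_hom[OF M(1) cB] B_hom[OF cA M(1)] by auto
  obtain w0 where w0: "B.cocycle M (stalk B 0) 0 w0" "\<epsilon> B **\<^sub>B (y **\<^sub>K z) = B.carr M (stalk B 0) 0 w0"
    using B.conc_ex[OF cM' stalk_cpl(1)[OF ob(2)] meets_stalk(1) B.K.comp[OF yzB presD(4)[OF R_pres[OF ob(2)]]]] by blast
  obtain \<gamma> where \<gamma>: "chain_map C (R A) M \<gamma>" "x' = cl (R A) M (gm (R A) M \<gamma>)" by (rule B.chain_map_arrE[OF xB])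
  note a = augmented_comp[OF ob(2) M(1) w0(1) \<gamma>(1) cA] and \<gamma>i = chain_map_hom[OF \<gamma>(1)]
  have "\<epsilon> B **\<^sub>B Ra h = B.carr (R A) (stalk B 0) 0 (w0 ** \<gamma> 0)"
    using hx B.K.assoc[OF xB yzB presD(4)[OF R_pres[OF ob(2)]]] w0(2) a(2) \<gamma>(2) unfolding B_ops by simp
  then have "B.carr (R A) (stalk B 0) 0 (h ** e A) = B.carr (R A) (stalk B 0) 0 (w0 ** \<gamma> 0)"
    using Ra(2)[OF h] sarr_comp[OF cA' e_cocycle[OF ob(1)] h] by simp
  then have e0: "h ** e A = w0 ** \<gamma> 0" using augmented_eq[OF ob cocycle_post[OF ob(1) h] a(1)] by blast
  \<comment> \<open>As \<open>M\<close> vanishes in degree -1, \<open>\<gamma> 0\<close> kills the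
    differential of \<open>R A\<close> and descends along \<open>e A\<close>.\<close>
  have zM: "zero_object C (cob M (- 1))" using M(2) by (simp add: supp_def)
  have dM: "cdiff M (- 1) : hom C (cob M (- 1)) (cob M 0)" using cplD(1)[OF M(1), of "- 1"] by simp
  have "\<gamma> 0 ** cdiff (R A) (- 1) = cdiff M (- 1) ** \<gamma> (- 1)" using \<gamma>(1)[unfolded chain_map_def, rule_format, of "- 1"] by simp
  also have "\<dots> = Zero C (cob (R A) (- 1)) (cob M 0)"
    using zero_object_hom[OF zM dM] zero_left[OF \<gamma>i[of "- 1"] cpl_Ob[OF M(1)]] by simp
  finally obtain w where w: "w : hom C A (cob M 0)" "w ** e A = \<gamma> 0"
    using resolution_cokernel(1)[OF R_resolution[OF ob(1)] \<gamma>i] by blast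
  have w0h: "w0 : hom C (cob M 0) B" using w0(1) cocycle_stalk(1)[OF cM' ob(2)] by blast
  have "h ** e A = (w0 ** w) ** e A" using e0 assoc[OF e_hom[OF ob(1)] w(1) w0h] w(2) by simp
  then have "h = w0 ** w" using resolution_cokernel(2)[OF R_resolution[OF ob(1)] h comp[OF w(1) w0h]] by blast
  then show ?thesis using fh cpl_P[OF M(1)] w(1) w0h by blast
qed

text \<open>The denominator \<open>s\<close> is refined to \<open>s'\<close>, the fibre of a map to
  a bounded complex in degrees at least 0. The object \<open>N\<close> preceding \<open>s'\<close>
  in its triangle lives in positive degrees and has no maps to \<open>R B\<close>, so the numerator
  extends along \<open>s'\<close> to an arrow out of \<open>R A\<close>.\<close>

lemma Q_Ra_full:
  assumes A: "A : Ob C" and B: "B : Ob C" and \<alpha>: "\<alpha> : hom V.F.D (R A) (R B)"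
  shows "\<exists>f\<in>hom C A B. \<alpha> = V.F.Q (Ra f)"
proof -
  obtain Z s \<phi> where s: "s : hom V.T' Z (R A)" "s : V.F.S" and \<phi>: "\<phi> : hom V.T' Z (R B)"
    and \<alpha>f: "\<alpha> = fraction V.T' (Kbd) (R A) (R B) (s, \<phi>)"
    using V.F.D_homE[OF \<alpha>] by blast
  have sK: "s : hom K Z (R A)" and \<phi>K: "\<phi> : hom K Z (R B)" using s(1) \<phi> V.sub_hom by blast+
  obtain g1 h1 where t: "(s, g1, h1) : Tri K" "Cod K g1 : Kbd" using s(2) V.S_iff by blast
  have g1: "g1 : hom K (R A) (Cod K g1)" using K.Tri_hom(2)[OF t(1)] sK by (simp add: hom_def)
  obtain M x' z where M: "cpl M" "supp M {0..}" "bounded_cpx C M" "x' : hom K (R A) M" "z : hom K M (Cod K g1)" "g1 = z **\<^sub>K x'"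
    using factor_nonneg[OF R_resolutions[OF A] t(2) g1] by blast
  define N where "N = unshift_cpx C M"
  have N: "cpl N" "sh N = M" unfolding N_def using cpl_unshift shift_unshift M(1) by auto
  have "supp N {0<..}" unfolding N_def by (rule supp_mono[OF supp_unshift[OF M(2)]]) auto
  then have "N : poss" using bounded_unshift[OF M(3)] by (simp add: poss_def N_def)
  then have Np: "N : isoc poss" using isoc_base[OF N(1)] by blast
  have x'': "x' : hom K (R A) (ShOb K N)" using M(4) N by simp
  obtain Z' b s' where t': "(b, s', x') : Tri K" "b : hom K N Z'" "s' : hom K Z' (R A)" using K.Tri_third[OF _ x''] N(1) by auto
  have s'S: "s' : V.F.S"
    by (rule V.S_of_third[OF t'(1)]) (use t' Np poss_bounded R_Ob[OF A] in \<open>auto simp: hom_def\<close>)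
  then have s'h: "s' : hom V.T' Z' (R A)" using t'(3) V.S_U[OF s'S t'(3)] V.sub_hom by blast
  have Z': "Z' : Ob K" using K.hom_Ob1[OF t'(3)] .
  have "x' **\<^sub>K s' = Zero K Z' M" using K.Tri_zero'[OF K.Tri_rotate[OF t'(1)] t'(3) M(4)] .
  then have "g1 **\<^sub>K s' = Zero K Z' (Cod K g1)" using M(6) K.assoc[OF t'(3) M(4,5)] K.zero_right[OF M(5) Z'] by simp
  then obtain r where r: "r : hom K Z' Z" "s' = s **\<^sub>K r" using K.Tri_kernel[OF t(1) sK g1 t'(3)] by blast
  have rh: "r : hom V.T' Z' Z" using r(1) s(1) s'h V.sub_hom by blast
  have "\<phi> **\<^sub>K r : hom K Z' (R B)" using K.comp[OF r(1) \<phi>K] .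
  moreover from this have "(\<phi> **\<^sub>K r) **\<^sub>K b = Zero K N (R B)"
    using K.comp[OF t'(2)] hom_pos_resolution[OF Np R_resolutions[OF B]] by blast
  ultimately obtain \<psi> where \<psi>: "\<psi> : hom K (R A) (R B)" "\<phi> **\<^sub>K r = \<psi> **\<^sub>K s'"
    using K.Tri_cokernel[OF t'(1-3)] by blast
  obtain f where f: "f : hom C A B" "\<psi> = Ra f" using Ra_full[OF A B \<psi>(1)] by blast
  have I: "Ident K (R A) : hom V.T' (R A) (R A)" "Ident K (R A) : V.F.S"
    using V.F.id_hom[of "R A"] V.F.frac_Ident[of "R A"] R_Ob[OF A] by simp_all
  have "roof_eq V.T' (Kbd) (R A) (R B) (s, \<phi>) (Ident K (R A), \<psi>)"
    by (rule V.F.roof_eqI[OF s \<phi> I _ rh s'h])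
      (use Ra_sub_hom[OF f(1)] f(2) r(2) s'S \<psi>(2) K.id_left[OF t'(3)] in simp_all)
  then have "\<alpha> = fraction V.T' (Kbd) (R A) (R B) (Ident K (R A), \<psi>)"
    unfolding \<alpha>f by (rule V.F.fraction_eqI)
  then have "\<alpha> = V.F.Q \<psi>" using V.F.Q_def[OF Ra_sub_hom[OF f(1)]] f(2) by simp
  then show ?thesis using f by blast
qed

lemma Q_isomorphic:
  assumes "isomorphic K X Y" "X : Kmb" "Y : Kmb" shows "isomorphic V.F.D X Y"
proof -
  obtain s where s: "s : hom K X Y" "iso K s" using assms(1) by (auto simp: isomorphic_def)
  obtain s' where s': "s' : hom K Y X" "s' **\<^sub>K s = Ident K X" "s **\<^sub>K s' = Ident K Y" by (rule K.isoE[OF s(2,1)])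
  have h: "s : hom V.T' X Y" "s' : hom V.T' Y X" using s s' assms V.sub_hom by blast+
  have "iso V.F.D (V.F.Q s)"
    by (rule V.F.D.isoI[OF V.F.Q_hom[OF h(1)] V.F.Q_hom[OF h(2)]])
      (use V.F.Q_Cmp[OF h] V.F.Q_Cmp[OF h(2,1)] s' in simp_all)
  then show ?thesis using V.F.Q_hom[OF h(1)] unfolding isomorphic_def by blast
qed

text \<open>The two triangles of the decomposition give a roof from \<open>X\<close> over
  \<open>Y\<close> to \<open>W\<close>, and both of its legs have cones in
  \<open>Kbd\<close>.\<close>

lemma Q_Ra_dense:
  assumes X: "X : Kmb" shows "\<exists>A\<in>Ob C. isomorphic V.F.D X (R A)"
proof -
  obtain Y N f g h where t: "(f, g, h) : Tri K" "f : hom K Y X" "g : hom K X N" "Y : nonneg" "N : isoc negs"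
    using X unfolding eventually_acyclic_star K_star[of X] by blast
  obtain M W i p q where r: "(i, p, q) : Tri K" "i : hom K M Y" "p : hom K Y W" "M : isoc poss" "W : isoc resolutions"
    using t(4) unfolding K_star[of Y] by blast
  have Y: "Y : Kmb" using t(4) nonneg_eventually_acyclic by blast
  have W: "W : Kmb" using r(5) resolutions_eventually_acyclic by blast
  have fS: "f : V.F.S"
    by (rule V.S_I[OF t(1)]) (use t negs_bounded X Y in \<open>auto simp: hom_def\<close>)
  have pS: "p : V.F.S"
    by (rule V.S_of_third[OF r(1)]) (use r poss_bounded W in \<open>auto simp: hom_def\<close>)
  have "f : hom V.T' Y X" "p : hom V.T' Y W" using t(2) r(3) X Y W V.sub_hom by blast+
  then have i1: "isomorphic V.F.D Y X" "isomorphic V.F.D Y W"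
    using V.F.Q_iso(4) V.F.Q_hom fS pS unfolding isomorphic_def by blast+
  obtain F where F: "isomorphic K W F" "cpl F" "F : resolutions" using r(5) isoc_iff by blast
  obtain Z a b where ac: "right_bounded_at C F 0" "acyclic_below C E F 0 Z a b" using F(3) unfolding resolutions_def by blast
  have Z: "Z 0 : Ob C" using hom_Ob2[OF acyclicD(3)[OF ac(2)]] by simp
  have "isomorphic K F (R (Z 0))" using pres_isomorphic[OF resolution_pres(2)[OF acyclic_below_0_resolution[OF F(2) ac]] R_pres[OF Z]] .
  then have "isomorphic K W (R (Z 0))" using K.isomorphic_trans F(1) by blast
  then have "isomorphic V.F.D W (R (Z 0))" using Q_isomorphic W R_Ob[OF Z] by blast
  then show ?thesis using i1 V.F.D.isomorphic_trans V.F.D.isomorphic_sym Z by blast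
qed

end

section \<open>Equivalences of categories\<close>

context
  fixes A :: "('o, 'm, 'x) addcat_scheme" and B :: "('p, 'n, 'y) addcat_scheme"
begin

abbreviation A_Cmp_infix (infixl "**\<^sub>A" 70) where "g **\<^sub>A f \<equiv> Cmp A g f"
abbreviation B_Cmp_infix (infixl "**\<^sub>B" 70) where "g **\<^sub>B f \<equiv> Cmp B g f"

lemma equivalenceI:
  assumes A: "category A" and B: "category B" and F: "is_functor A B Fo Fa"
    and full: "\<And>X Y h. X : Ob A ==> Y : Ob A ==> h : hom B (Fo X) (Fo Y) ==> \<exists>f\<in>hom A X Y. Fa f = h"
    and faithful: "\<And>X Y f g. f : hom A X Y ==> g : hom A X Y ==> Fa f = Fa g ==> f = g"
    and dense: "\<And>Y. Y : Ob B ==> \<exists>X\<in>Ob A. isomorphic B Y (Fo X)"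
  shows "is_equivalence A B Fo Fa"
proof -
  interpret A: category A by (rule A)
  interpret B: category B by (rule B)
  have Fo: "X : Ob A ==> Fo X : Ob B" for X using F by (simp add: is_functor_def)
  have Fh: "Fa f : hom B (Fo X) (Fo Y)" if "f : hom A X Y" for f X Y
    using F that by (auto simp: is_functor_def hom_def)
  have FI: "Fa (Ident A X) = Ident B (Fo X)" if "X : Ob A" for X using F that by (simp add: is_functor_def)
  have FC: "Fa (g **\<^sub>A f) = Fa g **\<^sub>B Fa f" if "f : hom A X Y" "g : hom A Y Z" for f g X Y Z
    using F that by (auto simp: is_functor_def hom_def)
  have "\<forall>Y\<in>Ob B. \<exists>X. X : Ob A \<and> isomorphic B Y (Fo X)" using dense by blast
  then obtain Go where Go: "\<forall>Y\<in>Ob B. Go Y : Ob A \<and> isomorphic B Y (Fo (Go Y))" by (rule bchoice[THEN exE])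
  then have "\<forall>Y\<in>Ob B. \<exists>s. s : hom B Y (Fo (Go Y)) \<and> iso B s" unfolding isomorphic_def by blast
  then obtain v where v': "\<forall>Y\<in>Ob B. v Y : hom B Y (Fo (Go Y)) \<and> iso B (v Y)" by (rule bchoice[THEN exE])
  then have "\<forall>Y\<in>Ob B. \<exists>s. s : hom B (Fo (Go Y)) Y \<and> s **\<^sub>B v Y = Ident B Y \<and> v Y **\<^sub>B s = Ident B (Fo (Go Y))" using B.isoE by metis
  then obtain u where u': "\<forall>Y\<in>Ob B. u Y : hom B (Fo (Go Y)) Y \<and> u Y **\<^sub>B v Y = Ident B Y \<and> v Y **\<^sub>B u Y = Ident B (Fo (Go Y))"
    by (rule bchoice[THEN exE])
  have G: "Go Y : Ob A" and u: "u Y : hom B (Fo (Go Y)) Y" and v: "v Y : hom B Y (Fo (Go Y))"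
    and vu: "v Y **\<^sub>B u Y = Ident B (Fo (Go Y))" and uv: "u Y **\<^sub>B v Y = Ident B Y" if "Y : Ob B" for Y
    using Go v' u' that by blast+
  define Ga where "Ga h = (SOME f. f : hom A (Go (Dom B h)) (Go (Cod B h)) \<and> Fa f = (v (Cod B h) **\<^sub>B h) **\<^sub>B u (Dom B h))" for h
  have Ga: "Ga h : hom A (Go X) (Go Y)" "Fa (Ga h) = (v Y **\<^sub>B h) **\<^sub>B u X" if h: "h : hom B X Y" for h X Y
  proof -
    have ob: "X : Ob B" "Y : Ob B" using B.hom_Ob1[OF h] B.hom_Ob2[OF h] .
    have "(v Y **\<^sub>B h) **\<^sub>B u X : hom B (Fo (Go X)) (Fo (Go Y))" using B.comp[OF u[OF ob(1)] B.comp[OF h v[OF ob(2)]]] .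
    then obtain f where "f : hom A (Go X) (Go Y) \<and> Fa f = (v Y **\<^sub>B h) **\<^sub>B u X" using full[OF G[OF ob(1)] G[OF ob(2)]] by blast
    then have "Ga h : hom A (Go X) (Go Y) \<and> Fa (Ga h) = (v Y **\<^sub>B h) **\<^sub>B u X"
      unfolding Ga_def hom_Dom[OF h] hom_Cod[OF h] by (rule someI)
    then show "Ga h : hom A (Go X) (Go Y)" "Fa (Ga h) = (v Y **\<^sub>B h) **\<^sub>B u X" by auto
  qed
  have uGa: "u Y **\<^sub>B Fa (Ga h) = h **\<^sub>B u X" if h: "h : hom B X Y" for h X Y
  proof -
    have ob: "X : Ob B" "Y : Ob B" using B.hom_Ob1[OF h] B.hom_Ob2[OF h] .
    note vh = B.comp[OF h v[OF ob(2)]]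
    have "u Y **\<^sub>B ((v Y **\<^sub>B h) **\<^sub>B u X) = (u Y **\<^sub>B (v Y **\<^sub>B h)) **\<^sub>B u X" using B.assoc[OF u[OF ob(1)] vh u[OF ob(2)]] by simp
    also have "u Y **\<^sub>B (v Y **\<^sub>B h) = h" using B.assoc[OF h v[OF ob(2)] u[OF ob(2)]] uv[OF ob(2)] B.id_left[OF h] by simp
    finally show ?thesis using Ga(2)[OF h] by simp
  qed
  \<comment> \<open>Arrows into \<open>Go Y\<close> are compared in \<open>B\<close> after the
    isomorphism \<open>u Y\<close>; with \<open>uGa\<close> this yields the functoriality of
    \<open>Ga\<close>.\<close>
  have u_cancel: "f = g" if "f : hom A X (Go Y)" "g : hom A X (Go Y)" "Y : Ob B" "u Y **\<^sub>B Fa f = u Y **\<^sub>B Fa g" for f g X Y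
  proof -
    have "Fa f = v Y **\<^sub>B (u Y **\<^sub>B Fa f)" "Fa g = v Y **\<^sub>B (u Y **\<^sub>B Fa g)"
      using B.assoc[OF Fh[OF that(1)] u[OF that(3)] v[OF that(3)]] B.assoc[OF Fh[OF that(2)] u[OF that(3)] v[OF that(3)]] vu[OF that(3)]
        B.id_left[OF Fh[OF that(1)]] B.id_left[OF Fh[OF that(2)]] by simp_all
    then show ?thesis using faithful[OF that(1,2)] that(4) by simp
  qed
  have "is_functor B A Go Ga"
    unfolding is_functor_def
  proof (intro conjI ballI impI)
    show "Go X : Ob A" if "X : Ob B" for X using G[OF that] .
    show "Ga f : hom A (Go (Dom B f)) (Go (Cod B f))" if "f : Arr B" for f using Ga(1)[OF Arr_hom[OF that]] .
    show "Ga (Ident B X) = Ident A (Go X)" if X: "X : Ob B" for X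
    proof (rule u_cancel[OF Ga(1)[OF B.id_hom[OF X]] A.id_hom[OF G[OF X]] X])
      show "u X **\<^sub>B Fa (Ga (Ident B X)) = u X **\<^sub>B Fa (Ident A (Go X))"
        unfolding uGa[OF B.id_hom[OF X]] FI[OF G[OF X]] using B.id_left[OF u[OF X]] B.id_right[OF u[OF X]] by simp
    qed
    show "Ga (g **\<^sub>B f) = Ga g **\<^sub>A Ga f" if fg: "f : Arr B" "g : Arr B" "Cod B f = Dom B g" for f g
    proof -
      have f: "f : hom B (Dom B f) (Dom B g)" and g: "g : hom B (Dom B g) (Cod B g)" using fg by (auto simp: hom_def)
      have ob: "Dom B f : Ob B" "Cod B g : Ob B" "Dom B g : Ob B" using B.hom_Ob1 B.hom_Ob2 f g by blast+
      show ?thesis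
      proof (rule u_cancel[OF Ga(1)[OF B.comp[OF f g]] A.comp[OF Ga(1)[OF f] Ga(1)[OF g]] ob(2)])
        note Ff = Fh[OF Ga(1)[OF f]] and Fg = Fh[OF Ga(1)[OF g]]
        have "u (Cod B g) **\<^sub>B Fa (Ga g **\<^sub>A Ga f) = (u (Cod B g) **\<^sub>B Fa (Ga g)) **\<^sub>B Fa (Ga f)"
          unfolding FC[OF Ga(1)[OF f] Ga(1)[OF g]] using B.assoc[OF Ff Fg u[OF ob(2)]] by simp
        also have "\<dots> = g **\<^sub>B (u (Dom B g) **\<^sub>B Fa (Ga f))" unfolding uGa[OF g] using B.assoc[OF Ff u[OF ob(3)] g] .
        also have "\<dots> = (g **\<^sub>B f) **\<^sub>B u (Dom B f)" unfolding uGa[OF f] using B.assoc[OF u[OF ob(1)] f g] by simp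
        finally show "u (Cod B g) **\<^sub>B Fa (Ga (g **\<^sub>B f)) = u (Cod B g) **\<^sub>B Fa (Ga g **\<^sub>A Ga f)"
          unfolding uGa[OF B.comp[OF f g]] by simp
      qed
    qed
  qed
  moreover have "natural_iso B B (Fo \<circ> Go) (Fa \<circ> Ga) (\<lambda>X. X) (\<lambda>f. f) u"
    unfolding natural_iso_def using u B.isoI[OF u v vu uv] uGa[OF Arr_hom] by simp
  moreover have "\<exists>\<eta>. natural_iso A A (\<lambda>X. X) (\<lambda>f. f) (Go \<circ> Fo) (Ga \<circ> Fa) \<eta>"
  proof -
    define \<eta> where "\<eta> X = (SOME f. f : hom A X (Go (Fo X)) \<and> Fa f = v (Fo X))" for X
    have \<eta>: "\<eta> X : hom A X (Go (Fo X))" "Fa (\<eta> X) = v (Fo X)" if X: "X : Ob A" for X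
    proof -
      obtain f where "f : hom A X (Go (Fo X)) \<and> Fa f = v (Fo X)" using full[OF X G[OF Fo[OF X]] v[OF Fo[OF X]]] by blast
      then have "\<eta> X : hom A X (Go (Fo X)) \<and> Fa (\<eta> X) = v (Fo X)" unfolding \<eta>_def by (rule someI)
      then show "\<eta> X : hom A X (Go (Fo X))" "Fa (\<eta> X) = v (Fo X)" by auto
    qed
    have "iso A (\<eta> X)" if X: "X : Ob A" for X
    proof -
      note X' = Fo[OF X] and GX = G[OF Fo[OF X]]
      obtain f where f: "f : hom A (Go (Fo X)) X" "Fa f = u (Fo X)" using full[OF GX X u[OF X']] by blast
      show ?thesis
      proof (rule A.isoI[OF \<eta>(1)[OF X] f(1)])
        show "f **\<^sub>A \<eta> X = Ident A X"
          by (rule faithful[OF A.comp[OF \<eta>(1)[OF X] f(1)] A.id_hom[OF X]])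
            (use FC[OF \<eta>(1)[OF X] f(1)] f(2) \<eta>(2)[OF X] uv[OF X'] FI[OF X] in simp)
        show "\<eta> X **\<^sub>A f = Ident A (Go (Fo X))"
          by (rule faithful[OF A.comp[OF f(1) \<eta>(1)[OF X]] A.id_hom[OF GX]])
            (use FC[OF f(1) \<eta>(1)[OF X]] f(2) \<eta>(2)[OF X] vu[OF X'] FI[OF GX] in simp)
      qed
    qed
    moreover have "\<eta> (Cod A f) **\<^sub>A f = Ga (Fa f) **\<^sub>A \<eta> (Dom A f)" if "f : Arr A" for f
    proof -
      have f: "f : hom A (Dom A f) (Cod A f)" using Arr_hom[OF that] .
      have ob: "Dom A f : Ob A" "Cod A f : Ob A" using A.hom_Ob1[OF f] A.hom_Ob2[OF f] .
      note Ff = Fh[OF f] and e = \<eta>[OF ob(1)] and e' = \<eta>[OF ob(2)] and o = Fo[OF ob(1)] Fo[OF ob(2)]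
      show ?thesis
      proof (rule faithful[OF A.comp[OF f e'(1)] A.comp[OF e(1) Ga(1)[OF Ff]]])
        note vF = B.comp[OF Ff v[OF o(2)]]
        have "Fa (Ga (Fa f) **\<^sub>A \<eta> (Dom A f)) = ((v (Fo (Cod A f)) **\<^sub>B Fa f) **\<^sub>B u (Fo (Dom A f))) **\<^sub>B v (Fo (Dom A f))"
          unfolding FC[OF e(1) Ga(1)[OF Ff]] Ga(2)[OF Ff] e(2) ..
        also have "\<dots> = v (Fo (Cod A f)) **\<^sub>B Fa f"
          using B.assoc[OF v[OF o(1)] u[OF o(1)] vF] uv[OF o(1)] B.id_right[OF vF] by simp
        finally show "Fa (\<eta> (Cod A f) **\<^sub>A f) = Fa (Ga (Fa f) **\<^sub>A \<eta> (Dom A f))"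
          unfolding FC[OF f e'(1)] e'(2) by simp
      qed
    qed
    ultimately show ?thesis unfolding natural_iso_def using \<eta>(1) by (intro exI[of _ \<eta>]) simp
  qed
  ultimately show ?thesis unfolding is_equivalence_def using F by blast
qed

end

section \<open>The stable category\<close>

context resolution_functor
begin

abbreviation "G f \<equiv> V.F.Q (Ra f)"

lemma G_hom: "f : hom C A B ==> G f : hom V.F.D (R A) (R B)"
  using V.F.Q_hom[OF Ra_sub_hom] .

lemma G_Cmp: "f : hom C A B ==> g : hom C B D ==> G (g ** f) = G g **\<^sub>D G f"
  using V.F.Q_Cmp[OF Ra_sub_hom Ra_sub_hom] Ra_Cmp by simp

lemma G_Add: "f : hom C A B ==> g : hom C A B ==> G (f \<oplus> g) = G f \<oplus>\<^bsub>V.F.D\<^esub> G g"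
  using V.Q_Add[OF Ra_sub_hom Ra_sub_hom] Ra_Add by simp

lemma G_Ident: "A : Ob C ==> G (Ident C A) = Ident V.F.D (R A)"
  using Ra_Ident by simp

text \<open>\<open>Q_Ra_projective\<close> and \<open>Q_Ra_faithful\<close> identify the ideal
  relation with equality after \<open>G\<close>. Operations on stable classes are then well defined
  because \<open>G\<close> is additive and functorial.\<close>

lemma stab_eq_iff:
  assumes f: "f : hom C A B" shows "stab_eq C E f g \<longleftrightarrow> g : hom C A B \<and> G f = G g"
proof
  assume s: "stab_eq C E f g"
  then have g: "g : hom C A B" using f by (auto simp: stab_eq_def hom_def)
  obtain I u v where "I : Proj C E" "u : hom C A I" "v : hom C I B" "g = f \<oplus> (v ** u)"
    using s f by (auto simp: stab_eq_def hom_def)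
  then show "g : hom C A B \<and> G f = G g" using g Q_Ra_projective[OF f] by metis
next
  assume s: "g : hom C A B \<and> G f = G g"
  then obtain I u v where "I : Proj C E" "u : hom C A I" "v : hom C I B" "g = f \<oplus> (v ** u)"
    using Q_Ra_faithful[OF f] by blast
  then have "\<exists>Q\<in>Proj C E. \<exists>u\<in>hom C (Dom C f) Q. \<exists>v\<in>hom C Q (Cod C f). g = f \<oplus> (v ** u)"
    using hom_Dom[OF f] hom_Cod[OF f] by blast
  then show "stab_eq C E f g" unfolding stab_eq_def using f s by (simp add: hom_def)
qed

lemma stab_eq: "f : hom C A B ==> stab C E f = (A, B, {g. g : hom C A B \<and> G f = G g})"
  by (auto simp: stab_def stab_eq_iff hom_Dom[of f C A B] hom_Cod[of f C A B])

lemma stab_inj: "f : hom C A B ==> g : hom C A B ==> stab C E f = stab C E g \<longleftrightarrow> G f = G g"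
  by (auto simp: stab_eq)

end

section \<open>The stable category and its equivalence with the quotient\<close>

locale happel = resolution_functor C E \<rho> for C :: "('o, 'm, 'x) addcat_scheme" (structure) and E and \<rho> +
  fixes \<sigma> :: "'o => 'm \<times> 'm"
  assumes cosyzygy: "cosyzygy_choice C E \<sigma>"
begin

abbreviation "SC \<equiv> stable_cat C E \<sigma>"
abbreviation SC_Cmp_infix (infixl "**\<^sub>S" 70) where "g **\<^sub>S f \<equiv> Cmp SC g f"
abbreviation "ci A \<equiv> fst (\<sigma> A)"
abbreviation "cp A \<equiv> snd (\<sigma> A)"
abbreviation "cI A \<equiv> Cod C (fst (\<sigma> A))"
abbreviation "Sy A \<equiv> Cod C (snd (\<sigma> A))"

lemma SC_simps [simp]:
  "Ob SC = Ob C" "Arr SC = stab C E ` Arr C" "Dom SC = fst" "Cod SC = (\<lambda>f. fst (snd f))"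
  "Ident SC X = stab C E (Ident C X)" "ShOb SC X = Sy X"
  by (auto simp: stable_cat_def fun_eq_iff)

lemma stab_Dom_Cod [simp]: "fst (stab C E f) = Dom C f" "fst (snd (stab C E f)) = Cod C f"
  by (simp_all add: stab_def)

lemma SC_hom: "hom SC A B = stab C E ` hom C A B"
  by (auto simp: hom_def)

lemma SC_Cmp:
  assumes f: "f : hom C A B" and g: "g : hom C B D" shows "stab C E g **\<^sub>S stab C E f = stab C E (g ** f)"
proof -
  have "(\<exists>\<psi>\<in>{k. k : hom C B D \<and> G g = G k}. \<exists>\<phi>\<in>{k. k : hom C A B \<and> G f = G k}. stab_eq C E (\<psi> ** \<phi>) \<chi>) \<longleftrightarrow>
      \<chi> : hom C A D \<and> G (g ** f) = G \<chi>" for \<chi>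
  proof
    assume "\<exists>\<psi>\<in>{k. k : hom C B D \<and> G g = G k}. \<exists>\<phi>\<in>{k. k : hom C A B \<and> G f = G k}. stab_eq C E (\<psi> ** \<phi>) \<chi>"
    then obtain \<psi> \<phi> where h: "\<psi> : hom C B D" "G g = G \<psi>" "\<phi> : hom C A B" "G f = G \<phi>" "stab_eq C E (\<psi> ** \<phi>) \<chi>" by blast
    then show "\<chi> : hom C A D \<and> G (g ** f) = G \<chi>"
      using stab_eq_iff[OF comp[OF h(3,1)]] G_Cmp[OF f g] G_Cmp[OF h(3,1)] by simp
  next
    assume "\<chi> : hom C A D \<and> G (g ** f) = G \<chi>"
    then have "stab_eq C E (g ** f) \<chi>" using stab_eq_iff[OF comp[OF f g]] by blast
    then show "\<exists>\<psi>\<in>{k. k : hom C B D \<and> G g = G k}. \<exists>\<phi>\<in>{k. k : hom C A B \<and> G f = G k}. stab_eq C E (\<psi> ** \<phi>) \<chi>" using f g by blast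
  qed
  then show ?thesis unfolding stab_eq[OF f] stab_eq[OF g] stab_eq[OF comp[OF f g]] by (simp add: stable_cat_def)
qed

lemma SC_Add:
  assumes f: "f : hom C A B" and g: "g : hom C A B" shows "stab C E f \<oplus>\<^bsub>SC\<^esub> stab C E g = stab C E (f \<oplus> g)"
proof -
  have "(\<exists>\<phi>\<in>{k. k : hom C A B \<and> G f = G k}. \<exists>\<psi>\<in>{k. k : hom C A B \<and> G g = G k}. stab_eq C E (\<phi> \<oplus> \<psi>) \<chi>) \<longleftrightarrow>
      \<chi> : hom C A B \<and> G (f \<oplus> g) = G \<chi>" for \<chi>
  proof
    assume "\<exists>\<phi>\<in>{k. k : hom C A B \<and> G f = G k}. \<exists>\<psi>\<in>{k. k : hom C A B \<and> G g = G k}. stab_eq C E (\<phi> \<oplus> \<psi>) \<chi>"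
    then obtain \<psi> \<phi> where h: "\<psi> : hom C A B" "G g = G \<psi>" "\<phi> : hom C A B" "G f = G \<phi>" "stab_eq C E (\<phi> \<oplus> \<psi>) \<chi>" by blast
    then show "\<chi> : hom C A B \<and> G (f \<oplus> g) = G \<chi>"
      using stab_eq_iff[OF add_hom[OF h(3,1)]] G_Add[OF f g] G_Add[OF h(3,1)] by simp
  next
    assume "\<chi> : hom C A B \<and> G (f \<oplus> g) = G \<chi>"
    then have "stab_eq C E (f \<oplus> g) \<chi>" using stab_eq_iff[OF add_hom[OF f g]] by blast
    then show "\<exists>\<phi>\<in>{k. k : hom C A B \<and> G f = G k}. \<exists>\<psi>\<in>{k. k : hom C A B \<and> G g = G k}. stab_eq C E (\<phi> \<oplus> \<psi>) \<chi>" using f g by blast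
  qed
  then show ?thesis unfolding stab_eq[OF f] stab_eq[OF g] stab_eq[OF add_hom[OF f g]] by (simp add: stable_cat_def)
qed

lemma SC_category: "category SC"
proof
  fix f assume "f : Arr SC"
  then obtain g where g: "g : Arr C" "f = stab C E g" by auto
  then show "Dom SC f : Ob SC" "Cod SC f : Ob SC" using Dom_in_Ob Cod_in_Ob by simp_all
next
  fix X assume "X : Ob SC"
  then show "Ident SC X : hom SC X X" unfolding SC_hom using id_hom by simp
next
  fix f X Y g Z assume "f : hom SC X Y" "g : hom SC Y Z"
  then obtain f' g' where h: "f' : hom C X Y" "f = stab C E f'" "g' : hom C Y Z" "g = stab C E g'" unfolding SC_hom by blast
  then show "g **\<^sub>S f : hom SC X Z" unfolding SC_hom using SC_Cmp[OF h(1,3)] comp[OF h(1,3)] by simp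
next
  fix f W X g Y h Z assume "f : hom SC W X" "g : hom SC X Y" "h : hom SC Y Z"
  then obtain f' g' h' where h: "f' : hom C W X" "f = stab C E f'" "g' : hom C X Y" "g = stab C E g'" "h' : hom C Y Z" "h = stab C E h'"
    unfolding SC_hom by blast
  show "(h **\<^sub>S g) **\<^sub>S f = h **\<^sub>S (g **\<^sub>S f)"
    unfolding h(2,4,6) SC_Cmp[OF h(1,3)] SC_Cmp[OF h(3,5)] SC_Cmp[OF h(1) comp[OF h(3,5)]] SC_Cmp[OF comp[OF h(1,3)] h(5)]
    using assoc[OF h(1,3,5)] by simp
next
  fix f X Y assume "f : hom SC X Y"
  then obtain f' where h: "f' : hom C X Y" "f = stab C E f'" unfolding SC_hom by blast
  show "Ident SC Y **\<^sub>S f = f" "f **\<^sub>S Ident SC X = f"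
    using SC_Cmp[OF h(1) id_hom[OF hom_Ob2[OF h(1)]]] SC_Cmp[OF id_hom[OF hom_Ob1[OF h(1)]] h(1)] h
      id_left[OF h(1)] id_right[OF h(1)] by simp_all
qed

text \<open>A representative of the class is picked by choice; by \<open>Ga_stab\<close> the value
  does not depend on it.\<close>

definition "Ga \<Phi> = G (SOME f. f : Arr C \<and> stab C E f = \<Phi>)"

lemma Ga_stab:
  assumes f: "f : hom C A B" shows "Ga (stab C E f) = G f"
proof -
  let ?g = "SOME g. g : Arr C \<and> stab C E g = stab C E f"
  have "?g : Arr C \<and> stab C E ?g = stab C E f" by (rule someI[of _ f]) (use f in \<open>simp add: hom_def\<close>)
  then have g: "?g : Arr C" "stab C E ?g = stab C E f" by auto
  then have "?g : hom C A B" using f stab_Dom_Cod(1)[of ?g] stab_Dom_Cod(2)[of ?g] by (simp add: hom_def)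
  then have "G ?g = G f" using stab_inj[OF _ f] g(2) by blast
  then show ?thesis by (simp add: Ga_def)
qed

lemma G_functor: "is_additive_functor SC V.F.D R Ga"
  unfolding is_additive_functor_def is_functor_def
proof (intro conjI ballI impI)
  show "R X : Ob V.F.D" if "X : Ob SC" for X using that R_Ob by simp
  show "Ga f : hom V.F.D (R (Dom SC f)) (R (Cod SC f))" if "f : Arr SC" for f
    using that Ga_stab[OF Arr_hom] G_hom[OF Arr_hom] by auto
  show "Ga (Ident SC X) = Ident V.F.D (R X)" if "X : Ob SC" for X
    using that Ga_stab[OF id_hom] G_Ident by simp
  fix f g assume "f : Arr SC" "g : Arr SC"
  then obtain f' g' where h: "f' : Arr C" "f = stab C E f'" "g' : Arr C" "g = stab C E g'" by auto
  note f' = Arr_hom[OF h(1)] and g' = Arr_hom[OF h(3)]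
  show "Ga (g **\<^sub>S f) = Ga g **\<^sub>D Ga f" if "Cod SC f = Dom SC g"
  proof -
    have g'': "g' : hom C (Cod C f') (Cod C g')" using that g' h by simp
    show ?thesis unfolding h SC_Cmp[OF f' g''] Ga_stab[OF f'] Ga_stab[OF g''] Ga_stab[OF comp[OF f' g'']] by (rule G_Cmp[OF f' g''])
  qed
  show "Ga (f \<oplus>\<^bsub>SC\<^esub> g) = Ga f \<oplus>\<^bsub>V.F.D\<^esub> Ga g" if "Dom SC f = Dom SC g" "Cod SC f = Cod SC g"
  proof -
    have g'': "g' : hom C (Dom C f') (Cod C f')" using that g' h by simp
    show ?thesis unfolding h SC_Add[OF f' g''] Ga_stab[OF f'] Ga_stab[OF g''] Ga_stab[OF add_hom[OF f' g'']] by (rule G_Add[OF f' g''])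
  qed
qed

lemma G_equivalence: "is_equivalence SC V.F.D R Ga"
proof (rule equivalenceI[OF SC_category V.F.D.category_axioms])
  show "is_functor SC V.F.D R Ga" using G_functor by (simp add: is_additive_functor_def)
  show "\<exists>f\<in>hom SC X Y. Ga f = h" if h: "X : Ob SC" "Y : Ob SC" "h : hom V.F.D (R X) (R Y)" for X Y h
  proof -
    obtain f where "f : hom C X Y" "h = G f" using Q_Ra_full[of X Y h] h by auto
    then show ?thesis unfolding SC_hom using Ga_stab by blast
  qed
  show "f = g" if fg: "f : hom SC X Y" "g : hom SC X Y" "Ga f = Ga g" for X Y f g
  proof -
    obtain f' g' where h: "f' : hom C X Y" "f = stab C E f'" "g' : hom C X Y" "g = stab C E g'" using fg unfolding SC_hom by blast
    then show ?thesis using fg(3) Ga_stab stab_inj[OF h(1,3)] by simp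
  qed
  show "\<exists>X\<in>Ob SC. isomorphic V.F.D Y (R X)" if "Y : Ob V.F.D" for Y using that Q_Ra_dense by simp
qed

end

section \<open>The triangle functor\<close>

context resolution_functor
begin

lemma connecting_ex:
  assumes E: "(i, p) : E" and i: "i : hom C A B" and p: "p : hom C B D"
  shows "\<exists>d\<in>hom K (R D) (sh (R A)). (Ra i, Ra p, d) : Tri K"
proof -
  have ob: "A : Ob C" "B : Ob C" "D : Ob C" using hom_Ob1 hom_Ob2 i p by blast+
  show ?thesis by (rule conflation_triangle[OF R_pres[OF ob(1)] R_pres[OF ob(2)] R_pres[OF ob(3)] E i p Ra[OF i] Ra[OF p]])
qed

text \<open>The morphism axiom yields some third map \<open>x\<close> compatible with the connecting
  arrows. It agrees with \<open>Ra g\<close> on \<open>Ra p\<close>, so their difference factors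
  through \<open>d\<close> by a map from the shift of \<open>R A\<close> to \<open>R D'\<close>, and
  such maps vanish by \<open>hom_shift_zero\<close>.\<close>

lemma connecting_map:
  assumes t: "(Ra i, Ra p, d) : Tri K" "i : hom C A B" "p : hom C B D" "d : hom K (R D) (sh (R A))"
    and t': "(Ra i', Ra p', d') : Tri K" "i' : hom C A' B'" "p' : hom C B' D'" "d' : hom K (R D') (sh (R A'))"
    and f: "f : hom C A A'" and k: "k : hom C B B'" and g: "g : hom C D D'" and e: "k ** i = i' ** f" "g ** p = p' ** k"
  shows "ShArr K (Ra f) **\<^sub>K d = d' **\<^sub>K Ra g"
proof -
  have ob: "A : Ob C" "D : Ob C" "D' : Ob C" using hom_Ob1 hom_Ob2 t(2,3) t'(3) by blast+
  note ip = Ra_hom[OF t(2)] Ra_hom[OF t(3)] Ra_hom[OF t'(2)] Ra_hom[OF t'(3)]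
  have "Ra k **\<^sub>K Ra i = Ra i' **\<^sub>K Ra f" using Ra_Cmp[OF t(2) k] Ra_Cmp[OF f t'(2)] e(1) by simp
  then obtain x where x: "x : hom K (R D) (R D')" "x **\<^sub>K Ra p = Ra p' **\<^sub>K Ra k" "ShArr K (Ra f) **\<^sub>K d = d' **\<^sub>K x"
    using K.Tri_morphism[OF t(1) t'(1), of "Ra f" "Ra k"] Ra_hom[OF f] Ra_hom[OF k] hom_Dom[OF ip(1)] hom_Dom[OF ip(2)] hom_Dom[OF ip(3)]
      hom_Dom[OF ip(4)] hom_Cod[OF ip(2)] hom_Cod[OF ip(4)] by auto
  note g' = Ra_hom[OF g]
  let ?d = "x \<oplus>\<^bsub>K\<^esub> Neg K (Ra g)"
  have d: "?d : hom K (R D) (R D')" using K.add_hom[OF x(1) K.neg_hom[OF g']] .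
  have "?d **\<^sub>K Ra p = Zero K (R B) (R D')"
    using K.Cmp_diff(2)[OF x(1) g' K.id_hom[OF K.hom_Ob2[OF g']] ip(2)] x(2) Ra_Cmp[OF t(3) g] Ra_Cmp[OF k t'(3)] e(2)
      K.Add_Neg[OF K.comp[OF ip(2) g']] by simp
  then obtain y where y: "y : hom K (sh (R A)) (R D')" "?d = y **\<^sub>K d"
    using K.Tri_cokernel[OF K.Tri_rotate[OF t(1)] ip(2) t(4) d] by blast
  have "y = Zero K (sh (R A)) (R D')" using y(1) hom_shift_zero[OF R_cpl[OF ob(1)] R_bound[OF ob(1)] R_pres[OF ob(3)]] by blast
  then have "?d = Zero K (R D) (R D')" using y(2) K.zero_left[OF t(4)] R_cpl[OF ob(3)] by simp
  then have "x = Ra g" using K.diff_Zero[OF x(1) g'] by blast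
  then show ?thesis using x(3) by simp
qed

end

context happel
begin

lemma cosD:
  assumes A: "A : Ob C"
  shows "(ci A, cp A) : E" "ci A : hom C A (cI A)" "cp A : hom C (cI A) (Sy A)" "cI A : Proj C E"
proof -
  have h: "\<sigma> A : E" "Dom C (ci A) = A" "cI A : Inj C E" using cosyzygy A by (auto simp: cosyzygy_choice_def)
  show e: "(ci A, cp A) : E" using h(1) by simp
  show "ci A : hom C A (cI A)" "cp A : hom C (cI A) (Sy A)" using conflationD(1,2)[OF e] h(2) by auto
  show "cI A : Proj C E" using h(3) Proj_eq_Inj by simp
qed

lemma Sy_Ob: "A : Ob C ==> Sy A : Ob C"
  using hom_Ob2[OF cosD(3)] .

definition "\<delta> A = (SOME d. d : hom K (R (Sy A)) (sh (R A)) \<and> (Ra (ci A), Ra (cp A), d) : Tri K)"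

lemma \<delta>:
  assumes A: "A : Ob C" shows "\<delta> A : hom K (R (Sy A)) (sh (R A))" "(Ra (ci A), Ra (cp A), \<delta> A) : Tri K"
proof -
  have "\<exists>d. d : hom K (R (Sy A)) (sh (R A)) \<and> (Ra (ci A), Ra (cp A), d) : Tri K"
    using connecting_ex[OF cosD(1-3)[OF A]] by blast
  from someI_ex[OF this] show "\<delta> A : hom K (R (Sy A)) (sh (R A))" "(Ra (ci A), Ra (cp A), \<delta> A) : Tri K"
    unfolding \<delta>_def by auto
qed

definition "\<eta> A = V.F.Q (Neg K (\<delta> A))"

lemma R_shift_Ob: "A : Ob C ==> sh (R A) : Kmb"
  using V.U_shift[OF R_Ob] by simp

lemma \<delta>_sub: "A : Ob C ==> \<delta> A : hom V.T' (R (Sy A)) (sh (R A))"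
  "A : Ob C ==> Neg K (\<delta> A) : hom V.T' (R (Sy A)) (sh (R A))"
  unfolding V.sub_hom using \<delta>(1) K.neg_hom[OF \<delta>(1)] R_Ob[OF Sy_Ob] R_shift_Ob by blast+

text \<open>The quotient inverts \<open>\<delta> A\<close> because the resolution of
  \<open>cI A\<close> lies in \<open>Kbd\<close>; the sign is an isomorphism of its own.\<close>

lemma \<eta>:
  assumes A: "A : Ob C"
  shows "\<eta> A : hom V.F.D (R (Sy A)) (sh (R A))" "iso V.F.D (\<eta> A)"
proof -
  let ?X = "R (Sy A)" and ?Y = "sh (R A)"
  note d = \<delta>[OF A]
  show "\<eta> A : hom V.F.D ?X ?Y" unfolding \<eta>_def by (rule V.F.Q_hom[OF \<delta>_sub(2)[OF A]])
  have r: "(Ra (cp A), \<delta> A, Neg K (ShArr K (Ra (ci A)))) : Tri K" using K.Tri_rotate[OF d(2)] .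
  have "\<delta> A : V.F.S"
    by (rule V.S_of_third[OF r])
      (use hom_Dom[OF Ra_hom[OF cosD(3)[OF A]]] hom_Cod[OF d(1)] R_projective[OF cosD(4)[OF A]] R_shift_Ob[OF A] in simp_all)
  then have iso\<delta>: "iso V.F.D (V.F.Q (\<delta> A))" using V.F.Q_iso(4)[OF \<delta>_sub(1)[OF A]] by blast
  have X: "?X : Ob K" "?X : Kmb" using R_cpl[OF Sy_Ob[OF A]] R_Ob[OF Sy_Ob[OF A]] by auto
  let ?n = "Neg K (Ident K ?X)"
  note I = K.id_hom[OF X(1)]
  have n: "?n : hom V.T' ?X ?X" unfolding V.sub_hom using X(2) K.neg_hom[OF I] by blast
  have nn: "?n **\<^sub>K ?n = Ident K ?X" using K.Cmp_Neg_Neg[OF I I] K.Ident_pair[OF X(1)] by simp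
  have "iso V.F.D (V.F.Q ?n)"
    by (rule V.F.D.isoI[OF V.F.Q_hom[OF n] V.F.Q_hom[OF n]]) (use V.F.Q_Cmp[OF n n] nn in simp_all)
  moreover have "\<eta> A = V.F.Q (\<delta> A) **\<^sub>D V.F.Q ?n"
    unfolding \<eta>_def using V.F.Q_Cmp[OF n \<delta>_sub(1)[OF A]] K.neg_right[OF I d(1)] K.id_right[OF d(1)] by simp
  ultimately show "iso V.F.D (\<eta> A)"
    using V.F.D.iso_Cmp[OF _ iso\<delta> V.F.Q_hom[OF n] V.F.Q_hom[OF \<delta>_sub(1)[OF A]]] by simp
qed

lemma \<eta>_natural:
  assumes f: "f : hom C A B" and g: "cosyzygy_map C \<sigma> f g"
  shows "g : hom C (Sy A) (Sy B)" "\<eta> B **\<^sub>D G g = ShArr V.F.D (G f) **\<^sub>D \<eta> A"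
proof -
  have ob: "A : Ob C" "B : Ob C" using hom_Ob1[OF f] hom_Ob2[OF f] .
  obtain k where gh: "g : hom C (Sy A) (Sy B)" and k: "k : hom C (cI A) (cI B)" "k ** ci A = ci B ** f" "g ** cp A = cp B ** k"
    using g hom_Dom[OF f] hom_Cod[OF f] by (auto simp: cosyzygy_map_def Let_def)
  show "g : hom C (Sy A) (Sy B)" using gh .
  note d = \<delta>[OF ob(1)] and d' = \<delta>[OF ob(2)]
  have e: "ShArr K (Ra f) **\<^sub>K \<delta> A = \<delta> B **\<^sub>K Ra g"
    by (rule connecting_map[OF d(2) cosD(2,3)[OF ob(1)] d(1) d'(2) cosD(2,3)[OF ob(2)] d'(1) f k(1) gh k(2,3)])
  have Sf: "ShArr K (Ra f) : hom K (sh (R A)) (sh (R B))" using K.ShArr_hom[OF Ra_hom[OF f]] by simp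
  have Sf': "ShArr K (Ra f) : hom V.T' (sh (R A)) (sh (R B))" using Sf R_shift_Ob ob V.sub_hom by blast
  have "Neg K (\<delta> B) **\<^sub>K Ra g = ShArr K (Ra f) **\<^sub>K Neg K (\<delta> A)"
    using e K.neg_left[OF Ra_hom[OF gh] d'(1)] K.neg_right[OF d(1) Sf] by simp
  then show "\<eta> B **\<^sub>D G g = ShArr V.F.D (G f) **\<^sub>D \<eta> A"
    unfolding \<eta>_def V.Q_ShArr[OF Ra_sub_hom[OF f]]
    using V.F.Q_Cmp[OF Ra_sub_hom[OF gh] \<delta>_sub(2)[OF ob(2)]] V.F.Q_Cmp[OF \<delta>_sub(2)[OF ob(1)] Sf'] by simp
qed

lemma cosyzygy_map_ex:
  assumes f: "f : hom C A B" shows "\<exists>g. cosyzygy_map C \<sigma> f g"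
proof -
  have ob: "A : Ob C" "B : Ob C" using hom_Ob1[OF f] hom_Ob2[OF f] .
  note a = cosD[OF ob(1)] and b = cosD[OF ob(2)]
  have cif: "ci B ** f : hom C A (cI B)" using comp[OF f b(2)] .
  have "cI B : Inj C E" using b(4) Proj_eq_Inj by simp
  then obtain k where k: "k : hom C (cI A) (cI B)" "k ** ci A = ci B ** f" using Inj_extend[OF _ a(1,2) cif] by blast
  have pk: "cp B ** k : hom C (cI A) (Sy B)" using comp[OF k(1) b(3)] .
  have "cp B ** ci B = Zero C B (Sy B)" using conflationD(3)[OF b(1)] hom_Dom[OF b(2)] by simp
  then have "(cp B ** k) ** ci A = Zero C A (Sy B)"
    using assoc[OF a(2) k(1) b(3)] k(2) assoc[OF f b(2,3)] zero_left[OF f Sy_Ob[OF ob(2)]] by simp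
  then obtain g where g: "g : hom C (Sy A) (Sy B)" "g ** cp A = cp B ** k" using conflation_cokernel[OF a(1,2,3) pk] by blast
  have "cosyzygy_map C \<sigma> f g"
    unfolding cosyzygy_map_def Let_def hom_Dom[OF f] hom_Cod[OF f] using g k by blast
  then show ?thesis by blast
qed

lemma SC_ShArr:
  assumes f: "f : hom C A B" and g: "cosyzygy_map C \<sigma> f g" shows "ShArr SC (stab C E f) = stab C E g"
proof -
  have ob: "A : Ob C" "B : Ob C" using hom_Ob1[OF f] hom_Ob2[OF f] .
  note n = \<eta>_natural[OF f g]
  have "(\<exists>\<phi>\<in>{k. k : hom C A B \<and> G f = G k}. \<exists>\<psi>. cosyzygy_map C \<sigma> \<phi> \<psi> \<and> stab_eq C E \<psi> \<chi>) \<longleftrightarrow> \<chi> : hom C (Sy A) (Sy B) \<and> G g = G \<chi>" for \<chi>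
  proof
    assume "\<exists>\<phi>\<in>{k. k : hom C A B \<and> G f = G k}. \<exists>\<psi>. cosyzygy_map C \<sigma> \<phi> \<psi> \<and> stab_eq C E \<psi> \<chi>"
    then obtain \<phi> \<psi> where h: "\<phi> : hom C A B" "G f = G \<phi>" "cosyzygy_map C \<sigma> \<phi> \<psi>" "stab_eq C E \<psi> \<chi>" by blast
    note n' = \<eta>_natural[OF h(1,3)]
    \<comment> \<open>As \<open>\<eta> B\<close> is invertible, naturality determines
      \<open>G \<psi>\<close> from \<open>G \<phi>\<close>, so the choice of extension and of
      representative does not matter.\<close>
    obtain \<eta>' where \<eta>': "\<eta>' : hom V.F.D (sh (R B)) (R (Sy B))" "\<eta>' **\<^sub>D \<eta> B = Ident V.F.D (R (Sy B))"
      by (rule V.F.D.isoE[OF \<eta>(2,1)[OF ob(2)]])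
    have c: "\<eta>' **\<^sub>D (\<eta> B **\<^sub>D G x) = G x" if x: "x : hom C (Sy A) (Sy B)" for x
      using V.F.D.assoc[OF G_hom[OF x] \<eta>(1)[OF ob(2)] \<eta>'(1)] \<eta>'(2) V.F.D.id_left[OF G_hom[OF x]] by simp
    have "\<eta> B **\<^sub>D G g = \<eta> B **\<^sub>D G \<psi>" using n(2) n'(2) h(2) by simp
    then have "G g = G \<psi>" using arg_cong[of _ _ "\<lambda>z. \<eta>' **\<^sub>D z"] c[OF n(1)] c[OF n'(1)] by metis
    moreover have "\<chi> : hom C (Sy A) (Sy B)" "G \<psi> = G \<chi>" using stab_eq_iff[OF n'(1)] h(4) by blast+
    ultimately show "\<chi> : hom C (Sy A) (Sy B) \<and> G g = G \<chi>" by simp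
  next
    assume "\<chi> : hom C (Sy A) (Sy B) \<and> G g = G \<chi>"
    then have "stab_eq C E g \<chi>" using stab_eq_iff[OF n(1)] by blast
    then show "\<exists>\<phi>\<in>{k. k : hom C A B \<and> G f = G k}. \<exists>\<psi>. cosyzygy_map C \<sigma> \<phi> \<psi> \<and> stab_eq C E \<psi> \<chi>" using f g by blast
  qed
  then show ?thesis unfolding stab_eq[OF f] stab_eq[OF n(1)] by (simp add: stable_cat_def)
qed

lemma Ga_ShArr:
  assumes f: "f : hom C A B"
  shows "\<exists>g\<in>hom C (Sy A) (Sy B). ShArr SC (stab C E f) = stab C E g \<and> \<eta> B **\<^sub>D G g = ShArr V.F.D (G f) **\<^sub>D \<eta> A"
  using cosyzygy_map_ex[OF f] SC_ShArr[OF f] \<eta>_natural[OF f] by metis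

lemma \<eta>_natural_iso: "natural_iso SC V.F.D (R \<circ> ShOb SC) (Ga \<circ> ShArr SC) (ShOb V.F.D \<circ> R) (ShArr V.F.D \<circ> Ga) \<eta>"
  unfolding natural_iso_def
proof (intro conjI ballI)
  show "\<eta> X : hom V.F.D ((R \<circ> ShOb SC) X) ((ShOb V.F.D \<circ> R) X)" "iso V.F.D (\<eta> X)" if "X : Ob SC" for X
    using \<eta> that by simp_all
  fix f assume "f : Arr SC"
  then obtain f' where f': "f' : hom C (Dom C f') (Cod C f')" "f = stab C E f'" using Arr_hom by fastforce
  obtain g where g: "g : hom C (Sy (Dom C f')) (Sy (Cod C f'))" "ShArr SC (stab C E f') = stab C E g"
    "\<eta> (Cod C f') **\<^sub>D G g = ShArr V.F.D (G f') **\<^sub>D \<eta> (Dom C f')" using Ga_ShArr[OF f'(1)] by blast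
  then show "\<eta> (Cod SC f) **\<^sub>D (Ga \<circ> ShArr SC) f = (ShArr V.F.D \<circ> Ga) f **\<^sub>D \<eta> (Dom SC f)"
    unfolding f'(2) using Ga_stab[OF f'(1)] Ga_stab[OF g(1)] by simp
qed

text \<open>
  The standard triangle \<open>A \<rightarrow> B \<rightarrow> D \<rightarrow> S\<close> comes from the conflation \<open>A \<rightarrow> B \<oplus> I \<rightarrow> D\<close> with components
  \<open>(f, i)\<close> and \<open>(c, - j)\<close>; its map to \<open>A \<rightarrow> I \<rightarrow> S\<close> is \<open>- w\<close> on \<open>D\<close>, whence the sign in \<open>\<eta>\<close>.
\<close>

lemma happel_conflation:
  assumes f: "f : hom C A B" and h: "happel_standard C \<sigma> f c w"
  obtains D W ib pb u v d where "c : hom C B D" "w : hom C D (Sy A)" "ib : hom C B W" "pb : hom C W B"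
    "u : hom C A W" "v : hom C W D" "pb ** ib = Ident C B" "G (ib ** pb) = Ident V.F.D (R W)" "G (ib ** f) = G u" "v ** ib = c"
    "d : hom K (R D) (sh (R A))" "(Ra u, Ra v, d) : Tri K" "V.F.Q d = \<eta> A **\<^sub>D G w"
proof -
  have A: "A : Ob C" "B : Ob C" using hom_Ob1[OF f] hom_Ob2[OF f] .
  note s = cosD[OF A(1)]
  have I: "cI A : Ob C" "cI A : Proj C E" using s(4) Proj_Ob by auto
  obtain j where po: "is_pushout C (ci A) f c j" and w: "w : hom C (Cod C c) (Sy A)" "w ** c = Zero C (Dom C c) (Sy A)" "w ** j = cp A"
    using h hom_Dom[OF f] by (auto simp: happel_standard_def Let_def)
  obtain D where D: "c : hom C B D" "j : hom C (cI A) D" "j ** ci A = c ** f"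
    and un: "\<forall>V. \<forall>u\<in>hom C (cI A) V. \<forall>v\<in>hom C B V. u ** ci A = v ** f \<longrightarrow> (\<exists>!w. w : hom C D V \<and> w ** j = u \<and> w ** c = v)"
    by (rule pushoutD[OF po s(2) f])
  have w: "w : hom C D (Sy A)" "w ** c = Zero C B (Sy A)" "w ** j = cp A" using w hom_Dom[OF D(1)] hom_Cod[OF D(1)] by simp_all
  have DO: "D : Ob C" using hom_Ob2[OF D(1)] .
  obtain W ib ji pb qi where b: "biproduct C B (cI A) W ib ji pb qi" using ex_biproduct[OF A(2) I(1)] by blast
  note bh = biproductD[OF b]
  note nj = neg_hom[OF D(2)]
  let ?u = "(ib ** f) \<oplus> (ji ** ci A)" and ?v = "(c ** pb) \<oplus> (Neg C j ** qi)"
  note u = biproduct_pair[OF b f s(2)] and v = biproduct_copair[OF b D(1) nj]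
  have cf: "c ** f : hom C A D" using comp[OF f D(1)] .
  have vu: "?v ** ?u = Zero C A D"
    using add_right[OF comp[OF f bh(1)] comp[OF s(2) bh(2)] v(1)] assoc[OF f bh(1) v(1)] assoc[OF s(2) bh(2) v(1)] v(2,3)
      neg_left[OF s(2) D(2)] D(3) Add_Neg[OF cf] by simp
  have "inflation E (ci A)" using s(1) unfolding inflation_def by blast
  then have infl: "inflation E ?u" using inflation_pair[OF _ s(2) f b] by blast
  have uv: "(?u, ?v) : E"
  proof (rule inflation_cokernel[OF infl u(1) v(1) vu])
    fix V g assume g: "g : hom C W V" and gu: "g ** ?u = Zero C A V"
    note gb = comp[OF bh(1) g] and gj = comp[OF bh(2) g]
    have V: "V : Ob C" using hom_Ob2[OF g] .
    have "((g ** ib) ** f) \<oplus> ((g ** ji) ** ci A) = Zero C A V"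
      using gu add_right[OF comp[OF f bh(1)] comp[OF s(2) bh(2)] g] assoc[OF f bh(1) g] assoc[OF s(2) bh(2) g] by simp
    then have "((g ** ji) ** ci A) \<oplus> ((g ** ib) ** f) = Zero C A V"
      using Add_commute[OF comp[OF s(2) gj] comp[OF f gb]] by simp
    then have "Neg C ((g ** ji) ** ci A) = (g ** ib) ** f" using Neg_unique[OF comp[OF s(2) gj] comp[OF f gb]] by blast
    then have "Neg C (g ** ji) ** ci A = (g ** ib) ** f" using neg_left[OF s(2) gj] by simp
    then obtain x where x: "x : hom C D V" "x ** j = Neg C (g ** ji)" "x ** c = g ** ib" using un neg_hom[OF gj] gb by blast
    have "x ** ?v = g"
    proof (rule biproduct_coext[OF b comp[OF v(1) x(1)] g])
      show "(x ** ?v) ** ib = g ** ib" using assoc[OF bh(1) v(1) x(1)] v(2) x(3) by simp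
      show "(x ** ?v) ** ji = g ** ji" using assoc[OF bh(2) v(1) x(1)] v(3) neg_right[OF D(2) x(1)] x(2) Neg_Neg[OF gj] by simp
    qed
    then show "\<exists>x\<in>hom C D V. x ** ?v = g" using x(1) by blast
  next
    fix V x y assume x: "x : hom C D V" and y: "y : hom C D V" and e: "x ** ?v = y ** ?v"
    have "(x ** ?v) ** ib = (y ** ?v) ** ib" "(x ** ?v) ** ji = (y ** ?v) ** ji" using e by simp_all
    then have e1: "x ** c = y ** c" and "Neg C (x ** j) = Neg C (y ** j)"
      using assoc[OF bh(1) v(1) x] assoc[OF bh(1) v(1) y] assoc[OF bh(2) v(1) x] assoc[OF bh(2) v(1) y] v(2,3)
        neg_right[OF D(2) x] neg_right[OF D(2) y] by simp_all
    then have e2: "x ** j = y ** j" using Neg_Neg[OF comp[OF D(2) x]] Neg_Neg[OF comp[OF D(2) y]] by metis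
    have "(y ** j) ** ci A = (y ** c) ** f" using assoc[OF s(2) D(2) y] assoc[OF f D(1) y] D(3) by simp
    then have "\<exists>!w. w : hom C D V \<and> w ** j = y ** j \<and> w ** c = y ** c" using un comp[OF D(2) y] comp[OF D(1) y] by blast
    then show "x = y" using x y e1 e2 by blast
  qed
  have WO: "W : Ob C" using hom_Ob2[OF bh(1)] .
  note ibpb = comp[OF bh(3,1)]
  \<comment> \<open>The complementary idempotent factors through the projective \<open>cI A\<close>,
    so \<open>B\<close> and \<open>W\<close> become isomorphic in the quotient.\<close>
  have "G (ib ** pb) = G ((ib ** pb) \<oplus> (ji ** qi))" using Q_Ra_projective[OF ibpb bh(4,2) I(2)] by simp
  then have g1: "G (ib ** pb) = Ident V.F.D (R W)" using bh(9) G_Ident[OF WO] by simp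
  have g2: "G (ib ** f) = G ?u" using Q_Ra_projective[OF comp[OF f bh(1)] s(2) bh(2) I(2)] by simp
  obtain d where d: "d : hom K (R D) (sh (R A))" "(Ra ?u, Ra ?v, d) : Tri K" using connecting_ex[OF uv u(1) v(1)] by blast
  note \<delta>A = \<delta>[OF A(1)]
  note IA = id_hom[OF A(1)]
  have "Neg C w ** ?v = cp A ** qi"
  proof (rule biproduct_coext[OF b comp[OF v(1) neg_hom[OF w(1)]] comp[OF bh(4) s(3)]])
    show "(Neg C w ** ?v) ** ib = (cp A ** qi) ** ib"
      using assoc[OF bh(1) v(1) neg_hom[OF w(1)]] v(2) neg_left[OF D(1) w(1)] w(2) Neg_Zero[OF A(2) Sy_Ob[OF A(1)]]
        assoc[OF bh(1,4) s(3)] bh(8) zero_right[OF s(3) A(2)] by simp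
    show "(Neg C w ** ?v) ** ji = (cp A ** qi) ** ji"
      using assoc[OF bh(2) v(1) neg_hom[OF w(1)]] v(3) Cmp_Neg_Neg[OF D(2) w(1)] w(3)
        assoc[OF bh(2,4) s(3)] bh(6) id_right[OF s(3)] by simp
  qed
  then have "ShArr K (Ra (Ident C A)) **\<^sub>K d = \<delta> A **\<^sub>K Ra (Neg C w)"
    using connecting_map[OF d(2) u(1) v(1) d(1) \<delta>A(2) s(2,3) \<delta>A(1) IA bh(4) neg_hom[OF w(1)]] u(3) id_right[OF s(2)] by simp
  then have "d = Neg K (\<delta> A) **\<^sub>K Ra w"
    using Ra_Ident[OF A(1)] K.ShArr_Ident[of "R A"] R_cpl[OF A(1)] K.id_left[OF d(1)] Ra_Neg[OF w(1)]
      K.neg_right[OF Ra_hom[OF w(1)] \<delta>A(1)] K.neg_left[OF Ra_hom[OF w(1)] \<delta>A(1)] by simp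
  then have "V.F.Q d = \<eta> A **\<^sub>D G w" unfolding \<eta>_def using V.F.Q_Cmp[OF Ra_sub_hom[OF w(1)] \<delta>_sub(2)[OF A(1)]] by simp
  then show thesis using that[OF D(1) w(1) bh(1,3) u(1) v(1) bh(5) g1 g2 v(2) d] by blast
qed

lemma Tri_SC: "Tri SC = {t. \<exists>f c w. f : Arr C \<and> happel_standard C \<sigma> f c w \<and> triangle_iso SC t (stab C E f, stab C E c, stab C E w)}"
proof -
  obtain T where T: "SC = saturate T" "Tri T = {(stab C E f, stab C E c, stab C E w) | f c w. f : Arr C \<and> happel_standard C \<sigma> f c w}"
    unfolding stable_cat_def by simp
  then have "Tri SC = {t. \<exists>t'\<in>Tri T. triangle_iso SC t t'}" by (simp only: Tri_saturate triangle_iso_saturate)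
  then show ?thesis unfolding T(2) by blast
qed

lemma Ga_iso:
  assumes "iso SC (stab C E f)" "f : hom C A B" shows "iso V.F.D (G f)"
proof -
  interpret SC: category SC by (rule SC_category)
  have "stab C E f : hom SC A B" using assms(2) SC_hom by blast
  then obtain g' where g': "g' : hom SC B A" "g' **\<^sub>S stab C E f = Ident SC A" "stab C E f **\<^sub>S g' = Ident SC B"
    by (rule SC.isoE[OF assms(1)])
  obtain g where g: "g : hom C B A" "g' = stab C E g" using g'(1) SC_hom by blast
  have ob: "A : Ob C" "B : Ob C" using hom_Ob1[OF assms(2)] hom_Ob2[OF assms(2)] .
  have "G (g ** f) = G (Ident C A)" "G (f ** g) = G (Ident C B)"
    using g' SC_Cmp[OF assms(2) g(1)] SC_Cmp[OF g(1) assms(2)] g(2) stab_inj[OF comp[OF assms(2) g(1)] id_hom[OF ob(1)]]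
      stab_inj[OF comp[OF g(1) assms(2)] id_hom[OF ob(2)]] by simp_all
  then show ?thesis
    using V.F.D.isoI[OF G_hom[OF assms(2)] G_hom[OF g(1)]] G_Cmp[OF assms(2) g(1)] G_Cmp[OF g(1) assms(2)] G_Ident ob by simp
qed

text \<open>The given triangle is compared with the image of the triangle that
  \<open>happel_conflation\<close> supplies. The comparison of the middle objects passes through
  \<open>ib\<close>, which becomes invertible because its complement is projective.\<close>

lemma Ga_triangle:
  assumes t: "(\<Phi>, \<Psi>, \<Xi>) : Tri SC" shows "(Ga \<Phi>, Ga \<Psi>, \<eta> (Dom SC \<Phi>) **\<^sub>D Ga \<Xi>) : Tri V.F.D"
proof -
  interpret SC: category SC by (rule SC_category)
  obtain f c w where f: "f : Arr C" and hs: "happel_standard C \<sigma> f c w" and ti: "triangle_iso SC (\<Phi>, \<Psi>, \<Xi>) (stab C E f, stab C E c, stab C E w)"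
    using t unfolding Tri_SC by blast
  obtain \<alpha> \<beta> \<gamma> where m: "tri_map SC (\<Phi>, \<Psi>, \<Xi>) (stab C E f, stab C E c, stab C E w) \<alpha> \<beta> \<gamma>" and i: "iso SC \<alpha>" "iso SC \<beta>" "iso SC \<gamma>"
    using ti unfolding triangle_iso_iff by blast
  obtain X Y Z X' Y' Z' where h: "\<Phi> : hom SC X Y" "\<Psi> : hom SC Y Z" "\<Xi> : hom SC Z (ShOb SC X)"
    "stab C E f : hom SC X' Y'" "stab C E c : hom SC Y' Z'" "stab C E w : hom SC Z' (ShOb SC X')"
    "\<alpha> : hom SC X X'" "\<beta> : hom SC Y Y'" "\<gamma> : hom SC Z Z'"
    and e: "\<beta> **\<^sub>S \<Phi> = stab C E f **\<^sub>S \<alpha>" "\<gamma> **\<^sub>S \<Psi> = stab C E c **\<^sub>S \<beta>" "ShArr SC \<alpha> **\<^sub>S \<Xi> = stab C E w **\<^sub>S \<gamma>"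
    by (rule tri_mapE[OF m])
  have f: "f : hom C X' Y'" using f h(4) by (simp add: hom_def)
  obtain D W ib pb u v d where c: "c : hom C Y' D" and w: "w : hom C D (Sy X')" and ib: "ib : hom C Y' W" "pb : hom C W Y'"
    and u: "u : hom C X' W" and v: "v : hom C W D" and q: "pb ** ib = Ident C Y'" "G (ib ** pb) = Ident V.F.D (R W)" "G (ib ** f) = G u" "v ** ib = c"
    and d: "d : hom K (R D) (sh (R X'))" "(Ra u, Ra v, d) : Tri K" "V.F.Q d = \<eta> X' **\<^sub>D G w"
    by (rule happel_conflation[OF f hs])
  have DZ: "D = Z'" using c h(5) by (simp add: hom_def)
  note c = c[unfolded DZ] and w = w[unfolded DZ] and v = v[unfolded DZ] and d = d[unfolded DZ]
  obtain x y z where xyz: "x : hom C X Y" "\<Phi> = stab C E x" "y : hom C Y Z" "\<Psi> = stab C E y" "z : hom C Z (Sy X)" "\<Xi> = stab C E z"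
    using h(1-3) unfolding SC_hom by auto
  obtain a b g where abg: "a : hom C X X'" "\<alpha> = stab C E a" "b : hom C Y Y'" "\<beta> = stab C E b" "g : hom C Z Z'" "\<gamma> = stab C E g"
    using h(7-9) unfolding SC_hom by auto
  have ob: "X : Ob C" "X' : Ob C" "Y' : Ob C" "W : Ob C" "Z' : Ob C" using hom_Ob1 hom_Ob2 abg(1) ib(1) c by blast+
  obtain s where s: "s : hom C (Sy X) (Sy X')" "ShArr SC (stab C E a) = stab C E s" "\<eta> X' **\<^sub>D G s = ShArr V.F.D (G a) **\<^sub>D \<eta> X"
    using Ga_ShArr[OF abg(1)] by blast
  have e1: "G b **\<^sub>D G x = G f **\<^sub>D G a"
    using e(1) SC_Cmp[OF xyz(1) abg(3)] SC_Cmp[OF abg(1) f] xyz(2) abg(2,4)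
      stab_inj[OF comp[OF xyz(1) abg(3)] comp[OF abg(1) f]] G_Cmp[OF xyz(1) abg(3)] G_Cmp[OF abg(1) f] by simp
  have e2: "G g **\<^sub>D G y = G c **\<^sub>D G b"
    using e(2) SC_Cmp[OF xyz(3) abg(5)] SC_Cmp[OF abg(3) c] xyz(4) abg(4,6)
      stab_inj[OF comp[OF xyz(3) abg(5)] comp[OF abg(3) c]] G_Cmp[OF xyz(3) abg(5)] G_Cmp[OF abg(3) c] by simp
  have e3: "G s **\<^sub>D G z = G w **\<^sub>D G g"
    using e(3) SC_Cmp[OF xyz(5) s(1)] SC_Cmp[OF abg(5) w] xyz(6) abg(2,6) s(2)
      stab_inj[OF comp[OF xyz(5) s(1)] comp[OF abg(5) w]] G_Cmp[OF xyz(5) s(1)] G_Cmp[OF abg(5) w] by simp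
  note Gx = G_hom[OF xyz(1)] and Gy = G_hom[OF xyz(3)] and Gz = G_hom[OF xyz(5)] and Ga' = G_hom[OF abg(1)] and Gb = G_hom[OF abg(3)] and Gg = G_hom[OF abg(5)]
    and Gi = G_hom[OF ib(1)] and Gp = G_hom[OF ib(2)] and Gu = G_hom[OF u] and Gv = G_hom[OF v] and Gs = G_hom[OF s(1)] and Gw = G_hom[OF w] and Gf = G_hom[OF f] and Gc = G_hom[OF c]
  note \<eta>X = \<eta>(1)[OF ob(1)] and \<eta>X' = \<eta>(1)[OF ob(2)]
  have iso_i: "iso V.F.D (G ib)"
    by (rule V.F.D.isoI[OF Gi Gp]) (use G_Cmp[OF ib] G_Cmp[OF ib(2,1)] q(1,2) G_Ident[OF ob(3)] in simp_all)
  have isos: "iso V.F.D (G a)" "iso V.F.D (G b)" "iso V.F.D (G g)" using Ga_iso i abg by simp_all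
  have dh: "d : hom V.T' (R Z') (sh (R X'))" unfolding V.sub_hom using d(1) R_Ob[OF ob(5)] R_shift_Ob[OF ob(2)] by blast
  have tT: "(Ra u, Ra v, d) : Tri V.T'"
    unfolding V.sub_Tri using d(2) hom_Dom[OF Ra_hom[OF u]] hom_Dom[OF Ra_hom[OF v]] hom_Dom[OF d(1)] R_Ob ob by simp
  have Qd: "V.F.Q d : hom V.F.D (R Z') (ShOb V.F.D (R X'))" using V.F.Q_hom[OF dh] by simp
  have \<eta>z: "\<eta> X **\<^sub>D G z : hom V.F.D (R Z) (ShOb V.F.D (R X))" using V.F.D.comp[OF Gz \<eta>X] by simp
  have Sa: "ShArr V.F.D (G a) : hom V.F.D (sh (R X)) (sh (R X'))"
    using V.F.Q_hom[OF V.sub_ShArr[OF Ra_sub_hom[OF abg(1)]]] V.Q_ShArr[OF Ra_sub_hom[OF abg(1)]] by simp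
  have "triangle_iso V.F.D (G x, G y, \<eta> X **\<^sub>D G z) (G u, G v, V.F.Q d)"
  proof (rule triangle_isoI[OF Gx Gy \<eta>z Gu Gv Qd Ga' V.F.D.comp[OF Gb Gi] Gg isos(1) V.F.D.iso_Cmp[OF isos(2) iso_i Gb Gi] isos(3)])
    have "(G ib **\<^sub>D G b) **\<^sub>D G x = (G ib **\<^sub>D G f) **\<^sub>D G a"
      using V.F.D.assoc[OF Gx Gb Gi] V.F.D.assoc[OF Ga' Gf Gi] e1 by simp
    then show "(G ib **\<^sub>D G b) **\<^sub>D G x = G u **\<^sub>D G a" using G_Cmp[OF f ib(1)] q(3) by simp
    have "G v **\<^sub>D (G ib **\<^sub>D G b) = G c **\<^sub>D G b"
      using V.F.D.assoc[OF Gb Gi Gv] G_Cmp[OF ib(1) v] q(4) by simp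
    then show "G g **\<^sub>D G y = G v **\<^sub>D (G ib **\<^sub>D G b)" using e2 by simp
    have "ShArr V.F.D (G a) **\<^sub>D (\<eta> X **\<^sub>D G z) = (\<eta> X' **\<^sub>D G s) **\<^sub>D G z"
      using V.F.D.assoc[OF Gz \<eta>X Sa] s(3) by simp
    also have "\<dots> = \<eta> X' **\<^sub>D (G w **\<^sub>D G g)" using V.F.D.assoc[OF Gz Gs \<eta>X'] e3 by simp
    also have "\<dots> = V.F.Q d **\<^sub>D G g" using V.F.D.assoc[OF Gg Gw \<eta>X'] d(3) by simp
    finally show "ShArr V.F.D (G a) **\<^sub>D (\<eta> X **\<^sub>D G z) = V.F.Q d **\<^sub>D G g" .
  qed
  then have "(G x, G y, \<eta> X **\<^sub>D G z) : Tri V.F.D" unfolding V.D_Tri using tT by blast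
  then show ?thesis unfolding xyz(2,4,6) using Ga_stab xyz(1,3,5) hom_Dom[OF xyz(1)] by simp
qed

theorem G_triangle_equivalence: "is_triangle_equivalence SC V.F.D R Ga"
  unfolding is_triangle_equivalence_def is_triangle_functor_def
  using G_functor G_equivalence \<eta>_natural_iso Ga_triangle by blast

end

context frobenius_category
begin

lemma cosyzygy_choice_ex: "\<exists>\<sigma>. cosyzygy_choice C E \<sigma>"
proof -
  have "\<exists>s. s : E \<and> Dom C (fst s) = A \<and> Cod C (fst s) : Inj C E" if A: "A : Ob C" for A
  proof -
    obtain i p where "(i, p) : E" "Dom C i = A" "Cod C i : Inj C E"
      using enough_injectives[OF A] unfolding inflation_def by blast
    then show ?thesis by (intro exI[of _ "(i, p)"]) simp
  qed
  then have "\<forall>A\<in>Ob C. \<exists>s. s : E \<and> Dom C (fst s) = A \<and> Cod C (fst s) : Inj C E" by blast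
  from bchoice[OF this] show ?thesis unfolding cosyzygy_choice_def .
qed

lemma resolution_choice_ex: "\<exists>\<rho>. resolution_choice C E \<rho>"
proof -
  have "\<forall>A\<in>Ob C. \<exists>r. projective_resolution C E A r" using resolution_exists[OF enough_projectives] by blast
  from bchoice[OF this] show ?thesis unfolding resolution_choice_def .
qed

end

theorem corollary2p2:
  fixes C :: "('o, 'm) addcat" and E :: "('m \<times> 'm) set"
  assumes "frobenius_category C E"
    and "weakly_idempotent_complete C"
  shows
    "(\<exists>V. is_perp (KP C E) V (Kpos C E) (KF C E) \<and>
          is_perp (KP C E) (Kminusb C E) V (Kneg C E)) \<and>
     (\<exists>\<sigma>. cosyzygy_choice C E \<sigma>) \<and> (\<exists>\<rho>. resolution_choice C E \<rho>) \<and>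
     (\<forall>\<sigma> \<rho>. cosyzygy_choice C E \<sigma> \<longrightarrow> resolution_choice C E \<rho> \<longrightarrow>
        (\<exists>Go Ga.
           (\<forall>A\<in>Ob C. Go A = resolution_ob \<rho> A) \<and>
           (\<forall>f\<in>Arr C. Ga (stab C E f) =
              verdier_arr (KminusbTri C E) (Kb C E) (resolution_arr C \<rho> f)) \<and>
           is_triangle_equivalence (stable_cat C E \<sigma>) (singularity_cat C E) Go Ga))"
proof (intro conjI allI impI)
  interpret frobenius_category C E by (rule assms(1))
  show "\<exists>V. is_perp (KP C E) V (Kpos C E) (KF C E) \<and> is_perp (KP C E) (Kminusb C E) V (Kneg C E)" by (rule decomposition)
  show "\<exists>\<sigma>. cosyzygy_choice C E \<sigma>" "\<exists>\<rho>. resolution_choice C E \<rho>" by (rule cosyzygy_choice_ex resolution_choice_ex)+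
  fix \<sigma> \<rho> assume "cosyzygy_choice C E \<sigma>" "resolution_choice C E \<rho>"
  then interpret happel C E \<rho> \<sigma>
    by (intro happel.intro resolution_functor.intro resolution_functor_axioms.intro happel_axioms.intro assms(1))
  have "\<forall>f\<in>Arr C. Ga (stab C E f) = verdier_arr (KminusbTri C E) (Kb C E) (resolution_arr C \<rho> f)"
    using Ga_stab[OF Arr_hom] by (simp add: KminusbTri_def subcategories)
  moreover have "is_triangle_equivalence (stable_cat C E \<sigma>) (singularity_cat C E) (resolution_ob \<rho>) Ga"
    using G_triangle_equivalence by (simp add: singularity_cat_def KminusbTri_def subcategories)
  ultimately show "\<exists>Go Ga. (\<forall>A\<in>Ob C. Go A = resolution_ob \<rho> A) \<and>
      (\<forall>f\<in>Arr C. Ga (stab C E f) = verdier_arr (KminusbTri C E) (Kb C E) (resolution_arr C \<rho> f)) \<and>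
      is_triangle_equivalence (stable_cat C E \<sigma>) (singularity_cat C E) Go Ga" by blast
qed

end
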